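(* Let $V_n\supset\dots\supset V_0$, the tower of resolutions $\pi_k$, the point $b_\alpha\in V_0^n$, the functions $t_i^k$, the flag of lattices $L^n\supset\dots\supset L^0$, the toric variety $T_{t^n}$ with normalization $\nu:\hat T_{t^n}\to T_{t^n}$, the sufficiently small polydisk $\hat U\subset\hat T_{t^n}$ centered at the origin, the map $\hat\phi:\hat U\to V_n$, and $U=\nu(\hat U)$, $U^k=\nu(\hat U^k)$ be as described in the context. Then the map $\hat\phi:\hat U\to V_n$ factors through $\nu:\hat U\to U$, i.e. $\hat\phi=\phi\circ\nu$ for a (regular analytic) map $\phi:U\to V_n$. Moreover, for all $k=0,1,\dots,n$ the restriction $\phi|_{U^k}$ is an isomorphism onto its image, which lies inside $V_k$.
   Context: Varieties are complex algebraic or analytic; analytic varieties are assumed to be restrictions of bigger analytic varieties to relatively compact open subsets. $V_n\supset\dots\supset V_0$ is a flag of closed subvarieties, $V_i$ pure of dimension $i$. Branched coverings. A branched covering $f:Y\to X$ of pure-dimensional varieties of equal dimension is a proper surjective map which is a local isomorphism at a generic point; it has degree one if a generic point has one preimage. For a hypersurface $H\subset X$, the generic preimage $H_f\subset Y$ is the union of the irreducible components of $f^{-1}(H)$ on which $f$ restricts to a local isomorphism to $H$ at a generic point. Resolutions of flags. A function is almost monomial in a coordinate neighborhood with coordinates $(x_1,\dots,x_m)$ centered at a point if it equals $x_1^{d_1}\cdots x_m^{d_m}h$ with $d_i\in\mathbb Z$ and $h$ holomorphic and nowhere zero. A resolution of a flag $V_m\supset\dots\supset V_0$ respecting meromorphic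 functions $f_1,\dots,f_r$ is a degree one branched covering $\pi:\overline V_m\to V_m$ with $\overline V_m$ smooth and a finite set $\mathcal D$ of smooth irreducible hypersurfaces with simultaneous normal crossings and union $D$, such that: $\pi$ maps $\overline V_m\setminus D$ isomorphically onto $\mathrm{reg}(V_m)$ minus $V_{m-1}$ and minus the divisors of the $f_i$; the preimages of $V_0,\dots,V_{m-1}$ and of the divisors of the $f_i$ are unions of members of $\mathcal D$; members of $\mathcal D$ that meet have images one contained in the other; if $H_{i_1}\cap\dots\cap H_{i_s}\ne\emptyset$ with $\pi(H_{i_1})\subset\dots\subset\pi(H_{i_s})$ then each irreducible component of this intersection has image $\pi(H_{i_1})$. It comes with the flag $\overline V_m\supset\dots\supset\overline V_0$ where $\overline V_k$ is the generic preimage of $V_k$ under $\pi|_{\overline V_{k+1}}$ (these are smooth). Good coordinates near $b\in\overline V_0$ are coordinates $(x_1,\dots,x_m)$ centered at $b$ on a neighborhood $N$ with $\overline V_j\cap N=\{x_m=\dots=x_{j+1}=0\}$ for all $j$, $D\cap N\subset\{x_1\cdots x_m=0\}$, and all $\pi^*f_i$ almost monomial. Functions $t_k$. Let $\rho_k:\widetilde V_k\to V_k$ be the normalization and $\hat V_{k-1}\subset\widetilde V_k$ the generic preimage of $V_{k-1}$. For $k=1,\dots,n$ let $t_k$ be a meromorphic function on $\widetilde V_k$ (equivalently on $V_k$) with a zero of order $1$ at a generic point of $\hat V_{k-1}$, continued to a meromorphic function on $V_n$, again denoted $t_k$. Tower. There are varieties $V_j^k$ ($0\le j\le n$, $0\le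 k\le n$, $V_j^0=V_j$) with $V_n^k\supset\dots\supset V_0^k$ and maps $\pi_k:V_n^k\to V_n^{k-1}$, obtained by successive applications of resolution of flags, restricting to maps $V_j^k\to V_j^{k-1}$, such that for each $k$ the map $(\pi_1\circ\dots\circ\pi_k)|_{V_k^k}:V_k^k\to V_k$, with the flag $V_k^k\supset\dots\supset V_0^k$, is a resolution of the flag $V_k\supset\dots\supset V_0$ respecting $t_1,\dots,t_k$. Fix $b_\alpha\in V_0^n$ and put $b_\alpha^k=\pi_{k+1}\circ\dots\circ\pi_n(b_\alpha)\in V_0^k$. Choose good coordinates $(x_1,\dots,x_k)$ near $b_\alpha^k$ in $V_k^k$, and write $(\pi_1\circ\dots\circ\pi_k)^*t_i=x_1^{d_{i1}^k}\cdots x_k^{d_{ik}^k}\cdot(\text{nowhere zero holomorphic})$ on $V_k^k$, $i=1,\dots,k$. The matrix $D^k=(d_{ij}^k)$ is lower triangular with nonzero diagonal and $d_{kk}^k=1$; let $C^k=(c_{ij}^k)=(D^k)^{-1}$ and $t_i^k=t_1^{c_{i1}^k}\cdots t_k^{c_{ik}^k}$ for $i=1,\dots,k$. These have no branching near $b_\alpha$; branches are fixed simultaneously for all $k$. $(t_1^k,\dots,t_k^k)$ are coordinates on $V_k^k$ near $b_\alpha^k$. Lattices and toric varieties. $L^k$ is the lattice of monomials (integer exponents) in $t_1^k,\dots,t_k^k$, inside the multiplicative group of monomials in $t_1,\dots,t_n$ with rational exponents; $L^0=\{1\}$. $L^n$ is ordered lexicographically in the basis $(t_1^n,\dots,t_n^n)$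 (first by the exponent of $t_n^n$, then $t_{n-1}^n$, etc.). Then $L^n\supset\dots\supset L^0$ and each $L^k$ is of full rank in the subgroup $\hat L^k$ of $L^n$ generated by $t_1^n,\dots,t_k^n$. Let $L=\{1\}\cup\bigcup_{k=1}^n\{p\in L^k: p>1,\ p\notin\hat L^{k-1}\}$, a semigroup. Let $\hat C$ be the semigroup generated by $t_1^n,\dots,t_n^n$, $\hat T_{t^n}=\operatorname{Spec}\mathbb C[\hat C]\cong\mathbb C^n$ with coordinates $(t_1^n,\dots,t_n^n)$, $T_{t^n}=\operatorname{Spec}\mathbb C[\hat C\cap L]$ (a possibly non-normal affine toric variety), and $\nu:\hat T_{t^n}\to T_{t^n}$ the normalization. The map $\hat\phi$. The functions $(t_1^n,\dots,t_n^n)$ give an isomorphism from a neighborhood $W$ of $b_\alpha$ in $V_n^n$ onto $\hat U\subset\hat T_{t^n}$; $\psi:\hat U\to W$ is its inverse and $\hat\phi=\pi_1\circ\dots\circ\pi_n\circ\psi:\hat U\to V_n$. $\hat U^k$ is the set of points of $\hat U$ where $t_{k+1}^n=\dots=t_n^n=0$ and $t_1^n\cdots t_k^n\ne0$. *)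

theory Defs
  imports "HOL-Analysis.Analysis"
begin

section \<open>Reduced complex analytic spaces\<close>

text \<open>
  The space \<open>C^N\<close> is the set of sequences supported in \<open>{1..N}\<close>, with the product topology;
  this allows \<open>N\<close> to be quantified over.
\<close>

definition Cn :: "nat \<Rightarrow> (nat \<Rightarrow> complex) set" where
  "Cn N = {x. \<forall>i. i \<notin> {1..N} \<longrightarrow> x i = 0}"

definition Cn_top :: "nat \<Rightarrow> (nat \<Rightarrow> complex) topology" where
  "Cn_top N = top_of_set (Cn N)"

text \<open>
  Holomorphic functions of several variables (for \<open>U\<close> open in \<open>Cn N\<close>): continuous and holomorphic
  in each variable separately (Osgood).
\<close>

definition hol_on :: "nat \<Rightarrow> (nat \<Rightarrow> complex) set \<Rightarrow> ((nat \<Rightarrow> complex) \<Rightarrow> complex) \<Rightarrow> bool" where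
  "hol_on N U f \<longleftrightarrow> continuous_on U f \<and>
     (\<forall>x\<in>U. \<forall>i\<in>{1..N}. (\<lambda>z. f (x(i := z))) field_differentiable at (x i))"

text \<open>
  A reduced complex space is a topological space with a sheaf of complex valued functions that is
  locally isomorphic to an analytic subset of an open set in \<open>C^N\<close>.  The sheaf is recorded
  through its stalks: \<open>chol X p f\<close> means that \<open>f\<close> is holomorphic on a neighbourhood of \<open>p\<close>.
  Only the germ of \<open>f\<close> at \<open>p\<close> matters (\<open>germ_closed\<close>).
\<close>

record 'a cspace =
  ctop :: "'a topology"
  chol :: "'a \<Rightarrow> ('a \<Rightarrow> complex) \<Rightarrow> bool"

abbreviation points :: "'a cspace \<Rightarrow> 'a set" where
  "points X \<equiv> topspace (ctop X)"

definition affine_space :: "nat \<Rightarrow> (nat \<Rightarrow> complex) cspace" where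
  "affine_space N = \<lparr> ctop = Cn_top N,
     chol = (\<lambda>p f. \<exists>U. openin (Cn_top N) U \<and> p \<in> U \<and> hol_on N U f) \<rparr>"

text \<open>
  The structure induced on a subset: functions that extend locally to holomorphic functions of
  the ambient space.  It is used for open, closed and locally closed subsets.
\<close>

definition csub :: "'a cspace \<Rightarrow> 'a set \<Rightarrow> 'a cspace" where
  "csub X A = \<lparr> ctop = subtopology (ctop X) A,
     chol = (\<lambda>p f. \<exists>U g. openin (ctop X) U \<and> p \<in> U \<and> chol X p g \<and> (\<forall>q\<in>U \<inter> A. f q = g q)) \<rparr>"

definition morphism :: "'a cspace \<Rightarrow> 'b cspace \<Rightarrow> ('a \<Rightarrow> 'b) \<Rightarrow> bool" where
  "morphism X Y f \<longleftrightarrow> continuous_map (ctop X) (ctop Y) f \<and>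
     (\<forall>p\<in>points X. \<forall>g. chol Y (f p) g \<longrightarrow> chol X p (g \<circ> f))"

definition isomorphism :: "'a cspace \<Rightarrow> 'b cspace \<Rightarrow> ('a \<Rightarrow> 'b) \<Rightarrow> bool" where
  "isomorphism X Y f \<longleftrightarrow> morphism X Y f \<and>
     (\<exists>g. morphism Y X g \<and> (\<forall>x\<in>points X. g (f x) = x) \<and> (\<forall>y\<in>points Y. f (g y) = y))"

definition analytic_in :: "'a cspace \<Rightarrow> 'a set \<Rightarrow> bool" where
  "analytic_in X A \<longleftrightarrow> A \<subseteq> points X \<and>
     (\<forall>p\<in>points X. \<exists>U F. openin (ctop X) U \<and> p \<in> U \<and> finite F \<and>
        (\<forall>f\<in>F. \<forall>q\<in>U. chol X q f) \<and> A \<inter> U = {q\<in>U. \<forall>f\<in>F. f q = 0})"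

definition germ_closed :: "'a cspace \<Rightarrow> bool" where
  "germ_closed X \<longleftrightarrow> (\<forall>p f g U. openin (ctop X) U \<longrightarrow> p \<in> U \<longrightarrow> chol X p f \<longrightarrow>
     (\<forall>q\<in>U. f q = g q) \<longrightarrow> chol X p g)"

definition complex_space :: "'a cspace \<Rightarrow> bool" where
  "complex_space X \<longleftrightarrow> Hausdorff_space (ctop X) \<and> germ_closed X \<and>
     (\<forall>p\<in>points X. \<exists>U N B Z x. openin (ctop X) U \<and> p \<in> U \<and> openin (Cn_top N) B \<and>
        analytic_in (csub (affine_space N) B) Z \<and>
        isomorphism (csub X U) (csub (affine_space N) Z) x)"

text \<open>
  Varieties are restrictions of bigger analytic varieties to relatively compact open subsets.
  Analytifications of algebraic varieties are of this form, by compactification.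
\<close>

definition variety :: "'a cspace \<Rightarrow> bool" where
  "variety X \<longleftrightarrow> complex_space X \<and>
     (\<exists>(X' :: 'a cspace) U x. complex_space X' \<and> openin (ctop X') U \<and>
        compactin (ctop X') (ctop X' closure_of U) \<and> isomorphism X (csub X' U) x)"

text \<open>A coordinate neighbourhood \<open>N\<close> with coordinates \<open>x\<close> centered at \<open>p\<close>.\<close>

definition chart :: "'a cspace \<Rightarrow> nat \<Rightarrow> 'a \<Rightarrow> 'a set \<Rightarrow> ('a \<Rightarrow> nat \<Rightarrow> complex) \<Rightarrow> bool" where
  "chart X m p N x \<longleftrightarrow> openin (ctop X) N \<and> p \<in> N \<and> x p = (\<lambda>_. 0) \<and>
     (\<exists>B. openin (Cn_top m) B \<and> isomorphism (csub X N) (csub (affine_space m) B) x)"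

definition smooth_at :: "'a cspace \<Rightarrow> nat \<Rightarrow> 'a \<Rightarrow> bool" where
  "smooth_at X m p \<longleftrightarrow> (\<exists>N x. chart X m p N x)"

definition smooth_space :: "'a cspace \<Rightarrow> nat \<Rightarrow> bool" where
  "smooth_space X m \<longleftrightarrow> (\<forall>p\<in>points X. smooth_at X m p)"

definition reg_points :: "'a cspace \<Rightarrow> 'a set" where
  "reg_points X = {p\<in>points X. \<exists>m. smooth_at X m p}"

definition pure_dim :: "'a cspace \<Rightarrow> nat \<Rightarrow> bool" where
  "pure_dim X m \<longleftrightarrow> points X \<subseteq> ctop X closure_of {p\<in>points X. smooth_at X m p}"

text \<open>
  A property holds at a generic point if it holds off a nowhere dense (closed) analytic subset.
\<close>

definition nowhere_dense_analytic :: "'a cspace \<Rightarrow> 'a set \<Rightarrow> bool" where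
  "nowhere_dense_analytic X A \<longleftrightarrow> analytic_in X A \<and> ctop X interior_of A = {}"

definition generically :: "'a cspace \<Rightarrow> ('a \<Rightarrow> bool) \<Rightarrow> bool" where
  "generically X P \<longleftrightarrow> (\<exists>A. nowhere_dense_analytic X A \<and> (\<forall>p\<in>points X - A. P p))"

definition irreducible_in :: "'a cspace \<Rightarrow> 'a set \<Rightarrow> bool" where
  "irreducible_in X C \<longleftrightarrow> analytic_in X C \<and> C \<noteq> {} \<and>
     (\<forall>A B. analytic_in X A \<longrightarrow> analytic_in X B \<longrightarrow> C = A \<union> B \<longrightarrow> C = A \<or> C = B)"

definition irreducible_component :: "'a cspace \<Rightarrow> 'a set \<Rightarrow> 'a set \<Rightarrow> bool" where
  "irreducible_component X S C \<longleftrightarrow> irreducible_in X C \<and> C \<subseteq> S \<and>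
     (\<forall>C'. irreducible_in X C' \<longrightarrow> C \<subseteq> C' \<longrightarrow> C' \<subseteq> S \<longrightarrow> C' = C)"

text \<open>A flag \<open>V n \<supseteq> \<dots> \<supseteq> V 0\<close> of closed subvarieties with \<open>V n\<close> the whole of \<open>X\<close>.\<close>

definition variety_flag :: "'a cspace \<Rightarrow> nat \<Rightarrow> (nat \<Rightarrow> 'a set) \<Rightarrow> bool" where
  "variety_flag X n V \<longleftrightarrow> variety X \<and> V n = points X \<and>
     (\<forall>i\<le>n. analytic_in X (V i) \<and> variety (csub X (V i)) \<and> pure_dim (csub X (V i)) i) \<and>
     (\<forall>i<n. V i \<subseteq> V (Suc i))"

section \<open>Branched coverings, meromorphic functions, normalization\<close>

definition local_iso_at :: "'b cspace \<Rightarrow> 'a cspace \<Rightarrow> ('b \<Rightarrow> 'a) \<Rightarrow> 'b \<Rightarrow> bool" where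
  "local_iso_at Y X f p \<longleftrightarrow> (\<exists>U U'. openin (ctop Y) U \<and> p \<in> U \<and> openin (ctop X) U' \<and>
     isomorphism (csub Y U) (csub X U') f)"

definition branched_covering :: "nat \<Rightarrow> 'b cspace \<Rightarrow> 'a cspace \<Rightarrow> ('b \<Rightarrow> 'a) \<Rightarrow> bool" where
  "branched_covering m Y X f \<longleftrightarrow> variety Y \<and> variety X \<and> pure_dim Y m \<and> pure_dim X m \<and>
     morphism Y X f \<and> proper_map (ctop Y) (ctop X) f \<and> f ` points Y = points X \<and>
     generically Y (local_iso_at Y X f)"

definition degree_one :: "'b cspace \<Rightarrow> 'a cspace \<Rightarrow> ('b \<Rightarrow> 'a) \<Rightarrow> bool" where
  "degree_one Y X f \<longleftrightarrow> generically X (\<lambda>x. \<exists>!y. y \<in> points Y \<and> f y = x)"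

definition generic_preimage :: "'b cspace \<Rightarrow> 'a cspace \<Rightarrow> ('b \<Rightarrow> 'a) \<Rightarrow> 'a set \<Rightarrow> 'b set" where
  "generic_preimage Y X f H =
     \<Union>{C. irreducible_component Y {y\<in>points Y. f y \<in> H} C \<and>
            generically (csub Y C) (local_iso_at (csub Y C) (csub X H) f)}"

text \<open>
  A meromorphic function is represented by any function that agrees, near each point, with a
  quotient \<open>g / h\<close> wherever \<open>h \<noteq> 0\<close>; its values elsewhere are irrelevant.
  \<open>meromorphic_along X \<Z> f\<close> says in addition that \<open>f\<close> restricts to a meromorphic
  function on each member \<open>Z\<close> of \<open>\<Z>\<close>, that is, the denominator can be chosen not to
  vanish identically on any nonempty open part of \<open>Z\<close>.
\<close>

definition meromorphic_along :: "'a cspace \<Rightarrow> 'a set set \<Rightarrow> ('a \<Rightarrow> complex) \<Rightarrow> bool" where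
  "meromorphic_along X \<Z> f \<longleftrightarrow>
     (\<forall>p\<in>points X. \<exists>U g h. openin (ctop X) U \<and> p \<in> U \<and> (\<forall>q\<in>U. chol X q g \<and> chol X q h) \<and>
        (\<forall>Z\<in>insert (points X) \<Z>. ctop (csub X Z) interior_of {q\<in>U \<inter> Z. h q = 0} = {}) \<and>
        (\<forall>q\<in>U. h q \<noteq> 0 \<longrightarrow> f q = g q / h q))"

text \<open>
  The support of the divisor of a meromorphic function \<open>f\<close>.  On a space that need not be normal,
  it is the image of the zeros and poles of \<open>f\<close> on the normalization; its complement consists of
  the points at which \<open>f\<close> is a unit of the ring of weakly holomorphic germs, i.e. at which \<open>f\<close> and
  \<open>1 / f\<close> are bounded holomorphic functions off a nowhere dense analytic set.
\<close>

definition divisor_support :: "'a cspace \<Rightarrow> ('a \<Rightarrow> complex) \<Rightarrow> 'a set" where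
  "divisor_support X f = {p\<in>points X. \<not> (\<exists>U a b. openin (ctop X) U \<and> p \<in> U \<and> 0 < a \<and>
     generically (csub X U) (\<lambda>q. chol X q f \<and> a \<le> cmod (f q) \<and> cmod (f q) \<le> b))}"

text \<open>Normal: every weakly holomorphic germ is holomorphic.\<close>

definition normal_space_cx :: "'a cspace \<Rightarrow> bool" where
  "normal_space_cx X \<longleftrightarrow> (\<forall>U p f b. openin (ctop X) U \<longrightarrow> p \<in> U \<longrightarrow>
     generically (csub X U) (\<lambda>q. chol X q f \<and> cmod (f q) \<le> b) \<longrightarrow>
     (\<exists>g U'. openin (ctop X) U' \<and> p \<in> U' \<and> chol X p g \<and>
        generically (csub X U') (\<lambda>q. f q = g q)))"

definition normalization :: "'b cspace \<Rightarrow> 'a cspace \<Rightarrow> ('b \<Rightarrow> 'a) \<Rightarrow> bool" where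
  "normalization Y X \<rho> \<longleftrightarrow> complex_space Y \<and> normal_space_cx Y \<and> morphism Y X \<rho> \<and>
     proper_map (ctop Y) (ctop X) \<rho> \<and> \<rho> ` points Y = points X \<and>
     (\<forall>x\<in>points X. finite {y\<in>points Y. \<rho> y = x}) \<and>
     (\<exists>A. nowhere_dense_analytic X A \<and> nowhere_dense_analytic Y {y\<in>points Y. \<rho> y \<in> A} \<and>
        isomorphism (csub Y {y\<in>points Y. \<rho> y \<notin> A}) (csub X (points X - A)) \<rho>)"

definition almost_monomial ::
  "'a cspace \<Rightarrow> 'a set \<Rightarrow> ('a \<Rightarrow> nat \<Rightarrow> complex) \<Rightarrow> nat \<Rightarrow> (nat \<Rightarrow> int) \<Rightarrow> ('a \<Rightarrow> complex) \<Rightarrow> bool" where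
  "almost_monomial X N x m d f \<longleftrightarrow>
     (\<exists>h. (\<forall>q\<in>N. chol X q h \<and> h q \<noteq> 0) \<and>
        generically (csub X N) (\<lambda>q. f q = (\<Prod>i=1..m. x q i powi d i) * h q))"

text \<open>\<open>f\<close> has order \<open>d\<close> along \<open>Z\<close> at \<open>q\<close>, a point where the space and the hypersurface \<open>Z\<close> are smooth.\<close>

definition order_along :: "'a cspace \<Rightarrow> nat \<Rightarrow> 'a set \<Rightarrow> int \<Rightarrow> ('a \<Rightarrow> complex) \<Rightarrow> 'a \<Rightarrow> bool" where
  "order_along X m Z d f q \<longleftrightarrow> (\<exists>N x. chart X m q N x \<and> Z \<inter> N = {p\<in>N. x p m = 0} \<and>
     almost_monomial X N x m (\<lambda>i. if i = m then d else 0) f)"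

section \<open>Resolutions of flags\<close>

definition simple_normal_crossings :: "'a cspace \<Rightarrow> nat \<Rightarrow> 'a set set \<Rightarrow> bool" where
  "simple_normal_crossings Y m \<D> \<longleftrightarrow> finite \<D> \<and>
     (\<forall>H\<in>\<D>. irreducible_in Y H \<and> smooth_space (csub Y H) (m - 1)) \<and>
     (\<forall>p\<in>points Y. \<exists>N x \<iota>. chart Y m p N x \<and> inj_on \<iota> {H\<in>\<D>. p \<in> H} \<and>
        (\<forall>H\<in>\<D>. p \<in> H \<longrightarrow> \<iota> H \<in> {1..m} \<and> H \<inter> N = {q\<in>N. x q (\<iota> H) = 0}))"

text \<open>
  \<open>\<pi> : Y \<rightarrow> X\<close> with the hypersurfaces \<open>\<D>\<close> is a resolution of the flag \<open>V m \<supseteq> \<dots> \<supseteq> V 0\<close>,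
  \<open>V m = points X\<close>, respecting the functions in \<open>F\<close>.  Since \<open>V (m - 1)\<close> contains the smaller
  members, it is written as \<open>\<Union>j<m. V j\<close>, which is empty for \<open>m = 0\<close>.
\<close>

definition flag_resolution ::
  "'a cspace \<Rightarrow> nat \<Rightarrow> (nat \<Rightarrow> 'a set) \<Rightarrow> ('a \<Rightarrow> complex) set \<Rightarrow>
   'b cspace \<Rightarrow> ('b \<Rightarrow> 'a) \<Rightarrow> 'b set set \<Rightarrow> bool" where
  "flag_resolution X m V F Y \<pi> \<D> \<longleftrightarrow>
     branched_covering m Y X \<pi> \<and> degree_one Y X \<pi> \<and>
     smooth_space Y m \<and> simple_normal_crossings Y m \<D> \<and>
     isomorphism (csub Y (points Y - \<Union>\<D>))
       (csub X (reg_points X - (\<Union>j<m. V j) - (\<Union>f\<in>F. divisor_support X f))) \<pi> \<and>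
     (\<forall>j<m. \<exists>\<S>\<subseteq>\<D>. {y\<in>points Y. \<pi> y \<in> V j} = \<Union>\<S>) \<and>
     (\<forall>f\<in>F. \<exists>\<S>\<subseteq>\<D>. {y\<in>points Y. \<pi> y \<in> divisor_support X f} = \<Union>\<S>) \<and>
     (\<forall>H\<in>\<D>. \<forall>H'\<in>\<D>. H \<inter> H' \<noteq> {} \<longrightarrow> \<pi> ` H \<subseteq> \<pi> ` H' \<or> \<pi> ` H' \<subseteq> \<pi> ` H) \<and>
     (\<forall>\<S>\<subseteq>\<D>. \<forall>H\<in>\<S>. \<Inter>\<S> \<noteq> {} \<longrightarrow> (\<forall>H'\<in>\<S>. \<pi> ` H \<subseteq> \<pi> ` H') \<longrightarrow>
        (\<forall>C. irreducible_component Y (\<Inter>\<S>) C \<longrightarrow> \<pi> ` C = \<pi> ` H))"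

definition resolution_flag ::
  "'a cspace \<Rightarrow> nat \<Rightarrow> (nat \<Rightarrow> 'a set) \<Rightarrow> 'b cspace \<Rightarrow> ('b \<Rightarrow> 'a) \<Rightarrow> (nat \<Rightarrow> 'b set) \<Rightarrow> bool" where
  "resolution_flag X m V Y \<pi> W \<longleftrightarrow> W m = points Y \<and>
     (\<forall>j<m. W j = generic_preimage (csub Y (W (Suc j))) (csub X (V (Suc j))) \<pi> (V j))"

definition good_coordinates ::
  "'b cspace \<Rightarrow> nat \<Rightarrow> (nat \<Rightarrow> 'b set) \<Rightarrow> 'b set set \<Rightarrow> 'b \<Rightarrow> 'b set \<Rightarrow> ('b \<Rightarrow> nat \<Rightarrow> complex) \<Rightarrow> bool" where
  "good_coordinates Y m W \<D> b N x \<longleftrightarrow> chart Y m b N x \<and>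
     (\<forall>j\<le>m. W j \<inter> N = {q\<in>N. \<forall>i\<in>{Suc j..m}. x q i = 0}) \<and>
     \<Union>\<D> \<inter> N \<subseteq> {q\<in>N. (\<Prod>i=1..m. x q i) = 0}"

text \<open>\<open>tower_map \<pi> k d\<close> is the composite of \<open>\<pi> (k + 1), \<dots>, \<pi> (k + d)\<close>, with \<open>\<pi> (k + d)\<close> applied first.\<close>

primrec tower_map :: "(nat \<Rightarrow> 'a \<Rightarrow> 'a) \<Rightarrow> nat \<Rightarrow> nat \<Rightarrow> 'a \<Rightarrow> 'a" where
  "tower_map \<pi> k 0 = id"
| "tower_map \<pi> k (Suc d) = tower_map \<pi> k d \<circ> \<pi> (k + Suc d)"

section \<open>Lattices of monomials and toric varieties\<close>

text \<open>
  A monomial in \<open>t 1, \<dots>, t n\<close> with rational exponents is given by its exponent vector, so that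
  the group of monomials is written additively and the monomial \<open>1\<close> is the zero vector.
\<close>

type_synonym monomial = "nat \<Rightarrow> rat"

definition mutually_inverse :: "nat \<Rightarrow> (nat \<Rightarrow> nat \<Rightarrow> rat) \<Rightarrow> (nat \<Rightarrow> nat \<Rightarrow> int) \<Rightarrow> bool" where
  "mutually_inverse k C D \<longleftrightarrow> (\<forall>i\<in>{1..k}. \<forall>j\<in>{1..k}.
     (\<Sum>l=1..k. C i l * of_int (D l j)) = (if i = j then 1 else 0) \<and>
     (\<Sum>l=1..k. of_int (D i l) * C l j) = (if i = j then 1 else 0))"

text \<open>The monomial \<open>t_i^k\<close>; the family of matrices \<open>C^k\<close> is \<open>c\<close>.\<close>

definition tmon :: "(nat \<Rightarrow> nat \<Rightarrow> nat \<Rightarrow> rat) \<Rightarrow> nat \<Rightarrow> nat \<Rightarrow> monomial" where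
  "tmon c k i = (\<lambda>j. if j \<in> {1..k} then c k i j else 0)"

definition tcomb :: "(nat \<Rightarrow> nat \<Rightarrow> nat \<Rightarrow> rat) \<Rightarrow> nat \<Rightarrow> nat \<Rightarrow> (nat \<Rightarrow> int) \<Rightarrow> monomial" where
  "tcomb c k l a = (\<lambda>j. \<Sum>i=1..l. of_int (a i) * tmon c k i j)"

definition mon_lattice :: "(nat \<Rightarrow> nat \<Rightarrow> nat \<Rightarrow> rat) \<Rightarrow> nat \<Rightarrow> monomial set" where
  "mon_lattice c k = range (tcomb c k k)"

definition mon_lattice_hat :: "(nat \<Rightarrow> nat \<Rightarrow> nat \<Rightarrow> rat) \<Rightarrow> nat \<Rightarrow> nat \<Rightarrow> monomial set" where
  "mon_lattice_hat c n k = range (tcomb c n k)"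

text \<open>\<open>p > 1\<close> in the lexicographic order of \<open>L^n\<close>: the exponent of the last \<open>t_m^n\<close> that occurs is positive.\<close>

definition lex_pos :: "(nat \<Rightarrow> nat \<Rightarrow> nat \<Rightarrow> rat) \<Rightarrow> nat \<Rightarrow> monomial \<Rightarrow> bool" where
  "lex_pos c n p \<longleftrightarrow> (\<exists>a. p = tcomb c n n a \<and>
     (\<exists>m\<in>{1..n}. a m > 0 \<and> (\<forall>i\<in>{Suc m..n}. a i = 0)))"

definition flag_semigroup :: "(nat \<Rightarrow> nat \<Rightarrow> nat \<Rightarrow> rat) \<Rightarrow> nat \<Rightarrow> monomial set" where
  "flag_semigroup c n = {\<lambda>_. 0} \<union>
     (\<Union>k\<in>{1..n}. {p\<in>mon_lattice c k. lex_pos c n p \<and> p \<notin> mon_lattice_hat c n (k - 1)})"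

definition cone_semigroup :: "(nat \<Rightarrow> nat \<Rightarrow> nat \<Rightarrow> rat) \<Rightarrow> nat \<Rightarrow> monomial set" where
  "cone_semigroup c n = {tcomb c n n a | a. \<forall>i\<in>{1..n}. a i \<ge> 0}"

text \<open>
  The complex space of the affine toric variety \<open>Spec C[S]\<close> of a semigroup \<open>S\<close> of monomials.
  Its points, the algebra homomorphisms \<open>C[S] \<rightarrow> C\<close>, are the semigroup homomorphisms from \<open>S\<close> to
  \<open>(C, *)\<close>, here extended by \<open>0\<close> outside \<open>S\<close>.  Holomorphic functions are locally holomorphic
  functions of finitely many elements of \<open>S\<close>.
\<close>

definition toric_points :: "monomial set \<Rightarrow> (monomial \<Rightarrow> complex) set" where
  "toric_points S = {u. u (\<lambda>_. 0) = 1 \<and>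
     (\<forall>s\<in>S. \<forall>s'\<in>S. u (\<lambda>j. s j + s' j) = u s * u s') \<and> (\<forall>s. s \<notin> S \<longrightarrow> u s = 0)}"

definition eval_at :: "nat \<Rightarrow> (nat \<Rightarrow> monomial) \<Rightarrow> (monomial \<Rightarrow> complex) \<Rightarrow> nat \<Rightarrow> complex" where
  "eval_at N s u = (\<lambda>i. if i \<in> {1..N} then u (s i) else 0)"

definition toric_space :: "monomial set \<Rightarrow> (monomial \<Rightarrow> complex) cspace" where
  "toric_space S = \<lparr> ctop = top_of_set (toric_points S),
     chol = (\<lambda>v f. \<exists>N s B g. (\<forall>i\<in>{1..N}. s i \<in> S) \<and> openin (Cn_top N) B \<and> hol_on N B g \<and>
        eval_at N s v \<in> B \<and>
        (\<forall>u\<in>toric_points S. eval_at N s u \<in> B \<longrightarrow> f u = g (eval_at N s u))) \<rparr>"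

definition T_hat :: "(nat \<Rightarrow> nat \<Rightarrow> nat \<Rightarrow> rat) \<Rightarrow> nat \<Rightarrow> (monomial \<Rightarrow> complex) cspace" where
  "T_hat c n = toric_space (cone_semigroup c n)"

definition T_flag :: "(nat \<Rightarrow> nat \<Rightarrow> nat \<Rightarrow> rat) \<Rightarrow> nat \<Rightarrow> (monomial \<Rightarrow> complex) cspace" where
  "T_flag c n = toric_space (cone_semigroup c n \<inter> flag_semigroup c n)"

text \<open>
  The normalization map \<open>T_hat \<rightarrow> T_flag\<close>, induced by the inclusion of semigroups, i.e. restriction
  of homomorphisms.  The coordinate \<open>t_i^n\<close> on \<open>T_hat\<close> is evaluation at \<open>tmon c n i\<close>.
\<close>

definition nu :: "(nat \<Rightarrow> nat \<Rightarrow> nat \<Rightarrow> rat) \<Rightarrow> nat \<Rightarrow> (monomial \<Rightarrow> complex) \<Rightarrow> monomial \<Rightarrow> complex" where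
  "nu c n u = (\<lambda>s. if s \<in> cone_semigroup c n \<inter> flag_semigroup c n then u s else 0)"

definition polydisk ::
  "(nat \<Rightarrow> nat \<Rightarrow> nat \<Rightarrow> rat) \<Rightarrow> nat \<Rightarrow> (nat \<Rightarrow> real) \<Rightarrow> (monomial \<Rightarrow> complex) set" where
  "polydisk c n r = {u\<in>points (T_hat c n). \<forall>i\<in>{1..n}. cmod (u (tmon c n i)) < r i}"

definition stratum ::
  "(nat \<Rightarrow> nat \<Rightarrow> nat \<Rightarrow> rat) \<Rightarrow> nat \<Rightarrow> (nat \<Rightarrow> real) \<Rightarrow> nat \<Rightarrow> (monomial \<Rightarrow> complex) set" where
  "stratum c n r k = {u\<in>polydisk c n r.
     (\<forall>i\<in>{Suc k..n}. u (tmon c n i) = 0) \<and> (\<forall>i\<in>{1..k}. u (tmon c n i) \<noteq> 0)}"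

text \<open>
  \<open>\<tau>\<close> is a branch on \<open>N\<close> of the monomial with exponents \<open>e\<close> in the meromorphic functions
  \<open>f 1, \<dots>, f n\<close>: it is holomorphic and \<open>\<tau>^M = f_1^(M e_1) \<cdots> f_n^(M e_n)\<close> whenever all \<open>M e_j\<close> are integers.
\<close>

definition monomial_branch ::
  "'a cspace \<Rightarrow> 'a set \<Rightarrow> nat \<Rightarrow> (nat \<Rightarrow> 'a \<Rightarrow> complex) \<Rightarrow> monomial \<Rightarrow> ('a \<Rightarrow> complex) \<Rightarrow> bool" where
  "monomial_branch Y N n f e \<tau> \<longleftrightarrow> (\<forall>q\<in>N. chol Y q \<tau>) \<and>
     (\<forall>M>0. (\<forall>j\<in>{1..n}. of_nat M * e j \<in> \<int>) \<longrightarrow>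
        generically (csub Y N) (\<lambda>q. \<tau> q ^ M = (\<Prod>j=1..n. f j q powi \<lfloor>of_nat M * e j\<rfloor>)))"

end

theory Submission
  imports Defs "HOL-Complex_Analysis.Complex_Analysis"
begin

text \<open>
  In suitable coordinates near the base point, each \<open>t\<^sub>i\<close> pulled back to \<open>V\<^sub>k\<^sup>k\<close> is a constant times a
  Laurent monomial.  Comparing these expressions on \<open>V\<^sub>j\<^sup>k\<close> and on \<open>V\<^sub>j\<^sup>j\<close> shows that the map
  \<open>V\<^sub>j\<^sup>k \<rightarrow> V\<^sub>j\<^sup>j\<close> is monomial, whence \<open>L\<^sup>j \<subseteq> L\<^sup>k\<close>, and that the pullback of a holomorphic function of \<open>V\<^sub>n\<close>,
  restricted to \<open>t\<^sub>k\<^sub>+\<^sub>1\<^sup>n = \<dots> = t\<^sub>n\<^sup>n = 0\<close>, is a function of the monomials of \<open>L\<^sup>k\<close>.  So only monomials of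
  the semigroup \<open>L\<close> occur in it.  Instead of power series, a function of \<open>z\<close> is split into residue classes of
  exponents modulo \<open>M\<close> by a Cauchy integral; a large \<open>M\<close> makes the finitely many monomials needed lie in \<open>L\<close>.
  Applied to a local embedding of \<open>V\<^sub>n\<close>, this gives \<open>\<phi>\<close>.  On a stratum the coordinates of \<open>V\<^sub>k\<^sup>k\<close>, transported by
  the resolution \<open>V\<^sub>k\<^sup>k \<rightarrow> V\<^sub>k\<close> off its divisor, recover all monomials of \<open>L\<^sup>k\<close>, and so invert \<open>\<phi>\<close>.
\<close>

section \<open>Holomorphic functions of several variables\<close>

text \<open>The hypotheses on the functions \<open>t\<close> hold only off nowhere dense sets,
  whereas levels are compared on the thin sets V_j^k. Each \<open>t i\<close> is therefore kept as a
  quotient g_i / h_i of holomorphic functions near the image of \<open>b\<close>, and its monomial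
  form is stated with the denominator and the negative exponents cleared. Such an identity extends
  by continuity and can then be restricted to the plane w_{j+1} = ... = w_k = 0. It keeps its
  content there because the image of a neighbourhood in V_j^k contains an open piece of V_j, where
  h_i is not identically zero. Monomials without unit factors are available because the matrices D^k
  are invertible over the rationals: roots of the units are absorbed into the coordinates. The
  exponents of a transition are then the entries of C^j D^k. They are natural numbers because a
  holomorphic root of a Laurent monomial has nonnegative integral exponents. The modulus
  \<open>M\<close> comes from the triangular shape of C^k, which puts a power of t_l^k into
  L^l.\<close>

definition pdisc :: "nat \<Rightarrow> (nat \<Rightarrow> complex) \<Rightarrow> real \<Rightarrow> (nat \<Rightarrow> complex) set" where
  "pdisc k p r = {w \<in> Cn k. \<forall>i\<in>{1..k}. cmod (w i - p i) < r}"

lemma pdisc_0_iff: "w \<in> pdisc k (\<lambda>_. 0) r \<longleftrightarrow> w \<in> Cn k \<and> (\<forall>i\<in>{1..k}. cmod (w i) < r)"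
  by (simp add: pdisc_def)

lemma pdisc_mono: "r \<le> s \<Longrightarrow> pdisc k p r \<subseteq> pdisc k p s"
  unfolding pdisc_def by force

lemma pdisc_self [simp]: "p \<in> Cn k \<Longrightarrow> r > 0 \<Longrightarrow> p \<in> pdisc k p r"
  unfolding pdisc_def by simp

lemma Cn_upd: "w \<in> Cn k \<Longrightarrow> i \<in> {1..k} \<Longrightarrow> w(i := z) \<in> Cn k"
  unfolding Cn_def by auto

lemma zero_in_Cn [simp]: "(\<lambda>_. 0) \<in> Cn k"
  unfolding Cn_def by auto

lemma Cn_eqI: "w \<in> Cn k \<Longrightarrow> w' \<in> Cn k \<Longrightarrow> (\<And>i. i \<in> {1..k} \<Longrightarrow> w i = w' i) \<Longrightarrow> w = w'"
  by (rule ext) (metis (mono_tags, lifting) Cn_def mem_Collect_eq)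

lemma Cn_mono: "j \<le> k \<Longrightarrow> Cn j \<subseteq> Cn k"
  unfolding Cn_def by auto

lemma continuous_on_coord [continuous_intros]: "continuous_on S (\<lambda>w. w i :: 'b :: topological_space)"
  by (rule continuous_on_subset[OF continuous_on_product_coordinates]) auto

lemma continuous_on_fun_upd [continuous_intros]:
  assumes "continuous_on S f" "continuous_on S g"
  shows "continuous_on S (\<lambda>x. (f x)(i := g x :: 'b :: topological_space))"
proof (rule continuous_on_coordinatewise_then_product)
  fix j show "continuous_on S (\<lambda>x. ((f x)(i := g x)) j)"
    using assms continuous_on_product_then_coordinatewise[OF assms(1), of j] by (cases "j = i") auto
qed

lemma open_coord_disc: "open {w :: nat \<Rightarrow> complex. cmod (w i - a) < r}"
proof -
  have "{w :: nat \<Rightarrow> complex. cmod (w i - a) < r} = (\<lambda>w. w i) -` ball a r"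
    by (auto simp: dist_norm norm_minus_commute)
  then show ?thesis by (simp add: open_vimage continuous_on_coord)
qed

text \<open>Only finitely many radii matter, because every coordinate past \<open>k\<close> is
  frozen at 0; hence a basic open box of the product topology contains a polydisc of equal
  radii.\<close>

lemma openin_Cn_top: "openin (Cn_top k) U \<longleftrightarrow> U \<subseteq> Cn k \<and> (\<forall>p\<in>U. \<exists>e>0. pdisc k p e \<subseteq> U)"
proof (intro iffI conjI ballI)
  assume U: "openin (Cn_top k) U"
  then obtain T where T: "open T" "U = Cn k \<inter> T"
    unfolding Cn_top_def openin_open by auto
  then show "U \<subseteq> Cn k" by auto
  fix p assume p: "p \<in> U"
  have "openin (product_topology (\<lambda>_. euclidean) UNIV) T"
    using T(1) by (simp add: euclidean_product_topology)
  from product_topology_open_contains_basis[OF this, of p] p T(2)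
  obtain X where X: "p \<in> (\<Pi>\<^sub>E i\<in>UNIV. X i)" "\<And>i. open (X i)" "(\<Pi>\<^sub>E i\<in>UNIV. X i) \<subseteq> T" by auto
  have "\<forall>i. \<exists>e>0. ball (p i) e \<subseteq> X i" using X(1,2) by (auto simp: open_contains_ball PiE_def)
  then obtain e where e: "\<And>i. e i > 0" "\<And>i. ball (p i) (e i) \<subseteq> X i" by metis
  define r where "r = Min (insert 1 (e ` {1..k}))"
  have r: "r > 0" using e(1) by (auto simp: r_def)
  have r': "r \<le> e i" if "i \<in> {1..k}" for i unfolding r_def using that by (intro Min_le) auto
  have "pdisc k p r \<subseteq> U"
  proof
    fix w assume w: "w \<in> pdisc k p r"
    have "w i \<in> X i" for i
    proof (cases "i \<in> {1..k}")
      case True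
      then have "cmod (w i - p i) < r" using w by (simp add: pdisc_def)
      then have "cmod (w i - p i) < e i" using r'[OF True] by linarith
      then show ?thesis using e(2)[of i] by (auto simp: dist_norm norm_minus_commute)
    next
      case False
      then have "w i = p i" using w p T(2) by (auto simp: pdisc_def Cn_def)
      then show ?thesis using X(1) by (auto simp: PiE_def)
    qed
    then show "w \<in> U" using X(3) w T(2) by (auto simp: pdisc_def)
  qed
  then show "\<exists>e>0. pdisc k p e \<subseteq> U" using r by auto
next
  assume U: "U \<subseteq> Cn k \<and> (\<forall>p\<in>U. \<exists>e>0. pdisc k p e \<subseteq> U)"
  then obtain e where e: "\<And>p. p \<in> U \<Longrightarrow> e p > 0" "\<And>p. p \<in> U \<Longrightarrow> pdisc k p (e p) \<subseteq> U" by metis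
  define T where "T = (\<Union>p\<in>U. \<Inter>i\<in>{1..k}. {w :: nat \<Rightarrow> complex. cmod (w i - p i) < e p})"
  have "open T" unfolding T_def by (intro open_UN ballI open_INT finite_atLeastAtMost open_coord_disc)
  moreover have "U = Cn k \<inter> T"
  proof
    show "U \<subseteq> Cn k \<inter> T"
    proof
      fix w assume w: "w \<in> U"
      then have "w \<in> (\<Inter>i\<in>{1..k}. {w'. cmod (w' i - w i) < e w})" using e(1) by simp
      then show "w \<in> Cn k \<inter> T" using w U unfolding T_def by blast
    qed
    show "Cn k \<inter> T \<subseteq> U" using e(2) unfolding T_def pdisc_def by blast
  qed
  ultimately show "openin (Cn_top k) U" unfolding Cn_top_def openin_open by auto
qed

lemma topspace_Cn_top [simp]: "topspace (Cn_top k) = Cn k"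
  by (simp add: Cn_top_def)

lemma openin_pdisc [simp]: "openin (Cn_top k) (pdisc k p r)"
proof -
  have "pdisc k p r = Cn k \<inter> (\<Inter>i\<in>{1..k}. {w. cmod (w i - p i) < r})" by (auto simp: pdisc_def)
  moreover have "open (\<Inter>i\<in>{1..k}. {w :: nat \<Rightarrow> complex. cmod (w i - p i) < r})"
    by (intro open_INT ballI finite_atLeastAtMost open_coord_disc)
  ultimately show ?thesis unfolding Cn_top_def openin_open by auto
qed


section \<open>Cauchy integrals depending on parameters\<close>

definition cint :: "real \<Rightarrow> (complex \<Rightarrow> complex) \<Rightarrow> complex" where
  "cint s f = integral (cbox 0 1) (\<lambda>x::real. f (s * exp (2 * pi * \<i> * x)) * (s * exp (2 * pi * \<i> * x)))"

lemma norm_circle_point: "s \<ge> 0 \<Longrightarrow> cmod (of_real s * exp (2 * of_real pi * \<i> * of_real x)) = s"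
  by (simp add: norm_mult)

text \<open>The extra factor in \<open>cint\<close> is d zeta / (2 pi i dx), so the integral is
  normalized as in Cauchy's formula. Written over a real interval, it is within reach of the
  theorems on integrals with parameters.\<close>

lemma cint_contour: "cint s f = contour_integral (circlepath 0 s) f / (2 * pi * \<i>)"
proof -
  have "contour_integral (circlepath 0 s) f =
     integral {0..1} (\<lambda>x::real. (2 * pi * \<i>) * (f (s * exp (2 * pi * \<i> * x)) * (s * exp (2 * pi * \<i> * x))))"
    unfolding contour_integral_integral vector_derivative_circlepath
    by (simp add: circlepath mult_ac)
  also have "\<dots> = 2 * pi * \<i> * cint s f"
    by (simp add: cint_def)
  finally show ?thesis by simp
qed

lemma cint_cong:
  assumes "s \<ge> 0" "\<And>\<zeta>. cmod \<zeta> = s \<Longrightarrow> f \<zeta> = g \<zeta>"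
  shows "cint s f = cint s g"
  unfolding cint_def by (rule integral_cong) (simp add: assms norm_circle_point)

lemma cint_Cauchy:
  assumes "f holomorphic_on ball 0 \<rho>" "cmod w < s" "s < \<rho>"
  shows "cint s (\<lambda>\<zeta>. f \<zeta> / (\<zeta> - w)) = f w"
proof -
  have "((\<lambda>u. f u/(u-w)) has_contour_integral (2 * of_real pi * \<i> * f w)) (circlepath 0 s)"
    using assms by (intro Cauchy_integral_circlepath_simple holomorphic_on_subset[OF assms(1)]) auto
  from contour_integral_unique[OF this] show ?thesis by (simp add: cint_contour)
qed

lemma circle_param_continuous:
  fixes f :: "'a :: topological_space \<Rightarrow> complex \<Rightarrow> complex"
  assumes s: "s \<ge> 0" and c: "continuous_on (U \<times> sphere 0 s) (\<lambda>(x,\<zeta>). f x \<zeta>)"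
  shows "continuous_on (U \<times> cbox 0 1)
           (\<lambda>(x,t::real). f x (s * exp (2 * pi * \<i> * t)) * (s * exp (2 * pi * \<i> * t)))"
proof -
  have "continuous_on (U \<times> cbox 0 (1::real)) (\<lambda>z. (\<lambda>(x,\<zeta>). f x \<zeta>) (fst z, s * exp (2 * pi * \<i> * snd z)))"
    by (rule continuous_on_compose2[OF c]) (auto intro!: continuous_intros simp: norm_circle_point s)
  then have "continuous_on (U \<times> cbox 0 (1::real)) (\<lambda>z. f (fst z) (s * exp (2 * pi * \<i> * snd z)))" by simp
  then have "continuous_on (U \<times> cbox 0 (1::real))
    (\<lambda>z. f (fst z) (s * exp (2 * pi * \<i> * snd z)) * (s * exp (2 * pi * \<i> * snd z)))"
    by (intro continuous_intros)
  then show ?thesis by (simp add: case_prod_beta)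
qed

lemma cint_continuous:
  fixes f :: "'a :: topological_space \<Rightarrow> complex \<Rightarrow> complex"
  assumes "s \<ge> 0" "continuous_on (U \<times> sphere 0 s) (\<lambda>(x,\<zeta>). f x \<zeta>)"
  shows "continuous_on U (\<lambda>x. cint s (f x))"
  unfolding cint_def
  by (rule integral_continuous_on_param[OF circle_param_continuous[OF assms]])

text \<open>By Cauchy's formula the derivative is again a circle integral, now with a squared
  kernel, and such integrals are continuous in all parameters. The circle of radius
  \<open>r'\<close> needs room inside \<open>ball a r\<close>, which is why the radius
  shrinks.\<close>

lemma deriv_param_continuous:
  fixes f :: "complex \<Rightarrow> complex \<Rightarrow> complex"
  assumes c: "continuous_on (ball a r \<times> T) (\<lambda>(x,\<zeta>). f x \<zeta>)"
    and h: "\<And>\<zeta>. \<zeta> \<in> T \<Longrightarrow> (\<lambda>x. f x \<zeta>) holomorphic_on ball a r" and r: "0 < r'" "r' < r"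
  shows "continuous_on (ball a r' \<times> T) (\<lambda>(x,\<zeta>). deriv (\<lambda>x. f x \<zeta>) x)"
proof -
  have eq: "deriv (\<lambda>x. f x \<zeta>) x = cint r' (\<lambda>u. f (a + u) \<zeta> / (a + u - x)^2)"
    if "x \<in> ball a r'" "\<zeta> \<in> T" for x \<zeta>
  proof -
    define g where "g = (\<lambda>u. f (a + u) \<zeta>)"
    have img: "(+) a ` ball 0 r = ball a r" by (simp add: image_add_ball)
    have hg: "g holomorphic_on ball 0 r" unfolding g_def
      using holomorphic_on_compose_gen[of "\<lambda>u. a + u" "ball 0 r" "\<lambda>x. f x \<zeta>" "ball a r", OF _ h[OF that(2)]]
        holomorphic_on_add[OF holomorphic_on_const holomorphic_on_ident, of a "ball 0 r"]
      by (simp add: o_def img)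
    have w: "x - a \<in> ball 0 r'" using that by (auto simp: dist_norm norm_minus_commute)
    have "(g has_field_derivative (1/(2 * of_real pi * \<i>) * contour_integral(circlepath 0 r') (\<lambda>u. g u/(u-(x-a))^2))) (at (x - a))"
      by (rule Cauchy_derivative_integral_circlepath)
         (use w r in \<open>auto intro!: holomorphic_on_imp_continuous_on holomorphic_on_subset[OF hg]\<close>)
    then have "(g has_field_derivative cint r' (\<lambda>u. g u/(u-(x-a))^2)) (at (x - a))"
      by (simp add: cint_contour)
    then have "((\<lambda>y. g (y - a)) has_field_derivative cint r' (\<lambda>u. g u/(u-(x-a))^2)) (at x)"
      using DERIV_shift[of "\<lambda>y. g (y)" _ "x" "-a"] by simp
    then show ?thesis by (simp add: g_def DERIV_imp_deriv algebra_simps)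
  qed
  have "continuous_on (ball a r' \<times> T) (\<lambda>p. cint r' (\<lambda>u. f (a + u) (snd p) / (a + u - fst p)^2))"
  proof (rule cint_continuous)
    have "continuous_on ((ball a r' \<times> T) \<times> sphere 0 r') (\<lambda>z. (\<lambda>(x,\<zeta>). f x \<zeta>) (a + snd z, snd (fst z)))"
      by (rule continuous_on_compose2[OF c]) (use r in \<open>auto intro!: continuous_intros simp: dist_norm\<close>)
    then show "continuous_on ((ball a r' \<times> T) \<times> sphere 0 r')
       (\<lambda>(p, u). f (a + u) (snd p) / (a + u - fst p)\<^sup>2)"
      unfolding case_prod_beta
      by (intro continuous_intros) (auto simp: dist_norm norm_minus_commute add_eq_0_iff algebra_simps)
  qed (use r in auto)
  then show ?thesis
    by (rule continuous_on_eq) (auto simp: eq)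
qed

text \<open>Differentiation under the integral needs a derivative that is jointly continuous in the
  parameter and the circle variable; \<open>deriv_param_continuous\<close> supplies it on a smaller
  disc around each point.\<close>

lemma cint_holomorphic:
  assumes s: "s \<ge> 0" and U: "open U" and c: "continuous_on (U \<times> sphere 0 s) (\<lambda>(x,\<zeta>). f x \<zeta>)"
    and h: "\<And>\<zeta>. \<zeta> \<in> sphere 0 s \<Longrightarrow> (\<lambda>x. f x \<zeta>) holomorphic_on U"
  shows "(\<lambda>x. cint s (f x)) holomorphic_on U"
proof (subst holomorphic_on_open[OF U], intro ballI)
  fix a assume "a \<in> U"
  then obtain r where r: "r > 0" "ball a r \<subseteq> U" using U open_contains_ball by blast
  define r' where "r' = r / 2"
  have r': "0 < r'" "r' < r" "ball a r' \<subseteq> U" using r by (auto simp: r'_def)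
  let ?e = "\<lambda>t::real. s * exp (2 * pi * \<i> * t)"
  have sp: "?e t \<in> sphere 0 s" for t using norm_circle_point[OF s] by simp
  have c': "continuous_on (ball a r' \<times> sphere 0 s) (\<lambda>(x,\<zeta>). deriv (\<lambda>x. f x \<zeta>) x)"
    using r r' by (intro deriv_param_continuous[of a r] continuous_on_subset[OF c] holomorphic_on_subset[OF h]) auto
  have "(\<lambda>x. integral (cbox 0 1) (\<lambda>t. f x (?e t) * ?e t)) holomorphic_on ball a r'"
  proof (rule leibniz_rule_holomorphic)
    fix x and t :: real assume x: "x \<in> ball a r'" "t \<in> cbox 0 1"
    have "((\<lambda>x. f x (?e t)) has_field_derivative deriv (\<lambda>x. f x (?e t)) x) (at x)"
      using holomorphic_derivI[OF h[OF sp] U] x r' by blast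
    then show "((\<lambda>x. f x (?e t) * ?e t) has_field_derivative deriv (\<lambda>x. f x (?e t)) x * ?e t) (at x within ball a r')"
      using DERIV_cmult_right has_field_derivative_at_within by blast
  next
    fix x assume x: "x \<in> ball a r'"
    have "continuous_on (cbox 0 1) (\<lambda>t. (\<lambda>(x,t::real). f x (?e t) * ?e t) (x, t))"
      by (rule continuous_on_compose2[OF circle_param_continuous[OF s c]]) (use x r' in \<open>auto intro!: continuous_intros\<close>)
    then show "(\<lambda>t. f x (?e t) * ?e t) integrable_on cbox 0 1"
      by (intro integrable_continuous) simp
  next
    show "continuous_on (ball a r' \<times> cbox 0 1) (\<lambda>(x, t). deriv (\<lambda>x. f x (?e t)) x * ?e t)"
      using circle_param_continuous[OF s c'] by simp
  qed auto
  then have "(\<lambda>x. cint s (f x)) holomorphic_on ball a r'" by (simp add: cint_def)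
  then show "\<exists>f'. ((\<lambda>x. cint s (f x)) has_field_derivative f') (at a)"
    using r' by (auto simp: holomorphic_on_open)
qed


lemma cint_integrable:
  assumes "s \<ge> 0" "continuous_on (sphere 0 s) f"
  shows "(\<lambda>x::real. f (s * exp (2 * pi * \<i> * x)) * (s * exp (2 * pi * \<i> * x))) integrable_on cbox 0 1"
proof (rule integrable_continuous)
  have "continuous_on (cbox 0 (1::real)) (\<lambda>x. f (s * exp (2 * pi * \<i> * x)))"
    by (rule continuous_on_compose2[OF assms(2)])
       (use assms(1) in \<open>auto intro!: continuous_intros simp: norm_circle_point\<close>)
  then show "continuous_on (cbox 0 (1::real)) (\<lambda>x. f (s * exp (2 * pi * \<i> * x)) * (s * exp (2 * pi * \<i> * x)))"
    by (intro continuous_intros)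
qed

lemma cint_diff:
  assumes "s \<ge> 0" "continuous_on (sphere 0 s) f" "continuous_on (sphere 0 s) g"
  shows "cint s (\<lambda>\<zeta>. f \<zeta> - g \<zeta>) = cint s f - cint s g"
  unfolding cint_def left_diff_distrib
  by (rule integral_diff) (intro cint_integrable assms)+

lemma cint_sum:
  assumes "s \<ge> 0" "finite I" "\<And>i. i \<in> I \<Longrightarrow> continuous_on (sphere 0 s) (f i)"
  shows "cint s (\<lambda>\<zeta>. \<Sum>i\<in>I. f i \<zeta>) = (\<Sum>i\<in>I. cint s (f i))"
  unfolding cint_def sum_distrib_right
  by (rule integral_sum[OF assms(2) cint_integrable[OF assms(1,3)]])

lemma cint_mult: "cint s (\<lambda>\<zeta>. a * f \<zeta>) = a * cint s f"
  unfolding cint_def mult.assoc by simp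

text \<open>Cauchy's formula at \<open>d\<close> minus Cauchy's formula at 0. Unlike the plain
  quotient, the integral makes sense for d = 0 and visibly depends well on further
  parameters.\<close>

lemma divided_difference:
  assumes g: "g holomorphic_on ball 0 \<rho>" and d: "cmod d < s" "s < \<rho>"
  shows "g d - g 0 = d * cint s (\<lambda>\<zeta>. g \<zeta> / ((\<zeta> - d) * \<zeta>))"
proof -
  have s: "s > 0" using d norm_ge_zero[of d] by linarith
  have c: "continuous_on (sphere 0 s) g"
    by (intro holomorphic_on_imp_continuous_on holomorphic_on_subset[OF g]) (use d in auto)
  have "g d - g 0 = cint s (\<lambda>\<zeta>. g \<zeta> / (\<zeta> - d)) - cint s (\<lambda>\<zeta>. g \<zeta> / (\<zeta> - 0))"
    using cint_Cauchy[OF g d] cint_Cauchy[OF g _ d(2), of 0] s by simp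
  also have "\<dots> = cint s (\<lambda>\<zeta>. g \<zeta> / (\<zeta> - d) - g \<zeta> / (\<zeta> - 0))"
    by (rule cint_diff[symmetric]) (use s d in \<open>auto intro!: continuous_intros c\<close>)
  also have "\<dots> = cint s (\<lambda>\<zeta>. d * (g \<zeta> / ((\<zeta> - d) * \<zeta>)))"
  proof (rule cint_cong)
    fix \<zeta> assume "cmod \<zeta> = s"
    then have "\<zeta> \<noteq> 0" "\<zeta> - d \<noteq> 0" using s d by auto
    then show "g \<zeta> / (\<zeta> - d) - g \<zeta> / (\<zeta> - 0) = d * (g \<zeta> / ((\<zeta> - d) * \<zeta>))"
      by (simp add: field_simps)
  qed (use s in auto)
  finally show ?thesis by (simp only: cint_mult)
qed

section \<open>Functions holomorphic in each variable: closure properties\<close>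

lemma hol_on_cont: "hol_on k U f \<Longrightarrow> continuous_on U f"
  by (simp add: hol_on_def)

lemma hol_on_subset: "hol_on k U f \<Longrightarrow> V \<subseteq> U \<Longrightarrow> hol_on k V f"
  unfolding hol_on_def by (auto intro: continuous_on_subset)

lemma hol_on_const: "hol_on k U (\<lambda>_. a)"
  by (auto simp: hol_on_def)

lemma hol_on_coord: "hol_on k U (\<lambda>w. w i)"
proof -
  have "(\<lambda>z. (w(l := z)) i) field_differentiable at (w l)" for w :: "nat \<Rightarrow> complex" and l
    by (cases "l = i") auto
  then show ?thesis by (auto simp: hol_on_def intro!: continuous_intros)
qed

lemma hol_on_add: "hol_on k U f \<Longrightarrow> hol_on k U g \<Longrightarrow> hol_on k U (\<lambda>w. f w + g w)"
  by (auto simp: hol_on_def intro!: continuous_intros field_differentiable_add)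

lemma hol_on_diff: "hol_on k U f \<Longrightarrow> hol_on k U g \<Longrightarrow> hol_on k U (\<lambda>w. f w - g w)"
  by (auto simp: hol_on_def intro!: continuous_intros field_differentiable_diff)

lemma hol_on_mult: "hol_on k U f \<Longrightarrow> hol_on k U g \<Longrightarrow> hol_on k U (\<lambda>w. f w * g w)"
  by (auto simp: hol_on_def intro!: continuous_intros field_differentiable_mult)

lemma hol_on_sum: "(\<And>i. i \<in> I \<Longrightarrow> hol_on k U (f i)) \<Longrightarrow> hol_on k U (\<lambda>w. \<Sum>i\<in>I. f i w)"
  by (induction I rule: infinite_finite_induct) (auto intro: hol_on_add hol_on_const)

lemma hol_on_prod: "(\<And>i. i \<in> I \<Longrightarrow> hol_on k U (f i)) \<Longrightarrow> hol_on k U (\<lambda>w. \<Prod>i\<in>I. f i w)"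
  by (induction I rule: infinite_finite_induct) (auto intro: hol_on_mult hol_on_const)

lemma hol_on_power: "hol_on k U f \<Longrightarrow> hol_on k U (\<lambda>w. f w ^ n)"
  by (induction n) (auto intro: hol_on_mult hol_on_const)

lemma hol_on_compose1:
  assumes "hol_on k U f" "open S" "g holomorphic_on S" "\<And>w. w \<in> U \<Longrightarrow> f w \<in> S"
  shows "hol_on k U (\<lambda>w. g (f w))"
proof -
  have "(\<lambda>z. g (f (w(i := z)))) field_differentiable at (w i)" if "w \<in> U" "i \<in> {1..k}" for w i
  proof -
    have "(\<lambda>z. f (w(i := z))) field_differentiable at (w i)"
      using assms(1) that by (auto simp: hol_on_def)
    moreover have "g field_differentiable at (f (w(i := w i)))"
      using assms(2-4) that by (auto simp: holomorphic_on_imp_differentiable_at)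
    ultimately show ?thesis
      using field_differentiable_compose[of "\<lambda>z. f (w(i := z))" "w i" g] by (simp add: o_def)
  qed
  moreover have "continuous_on U (\<lambda>w. g (f w))"
    by (rule continuous_on_compose2[OF holomorphic_on_imp_continuous_on[OF assms(3)] hol_on_cont[OF assms(1)]])
       (use assms(4) in auto)
  ultimately show ?thesis by (auto simp: hol_on_def)
qed

lemma hol_on_inverse:
  assumes "hol_on k U f" "\<And>w. w \<in> U \<Longrightarrow> f w \<noteq> 0"
  shows "hol_on k U (\<lambda>w. inverse (f w))"
  by (rule hol_on_compose1[OF assms(1), of "-{0}"]) (use assms(2) in \<open>auto intro!: holomorphic_intros\<close>)

lemma hol_on_divide:
  assumes "hol_on k U f" "hol_on k U g" "\<And>w. w \<in> U \<Longrightarrow> g w \<noteq> 0"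
  shows "hol_on k U (\<lambda>w. f w / g w)"
  using hol_on_mult[OF assms(1) hol_on_inverse[OF assms(2,3)]] by (simp add: divide_inverse)

lemma slice_open:
  assumes "openin (Cn_top k) V" "w \<in> Cn k" "i \<in> {1..k}"
  shows "open {z. w(i := z) \<in> V}"
proof (subst open_contains_ball, intro ballI)
  fix z assume "z \<in> {z. w(i := z) \<in> V}"
  then obtain e where e: "e > 0" "pdisc k (w(i := z)) e \<subseteq> V"
    using assms(1) by (auto simp: openin_Cn_top)
  have "ball z e \<subseteq> {z. w(i := z) \<in> V}"
  proof
    fix y assume "y \<in> ball z e"
    then have "w(i := y) \<in> pdisc k (w(i := z)) e"
      using assms(2,3) e(1) by (auto simp: pdisc_def Cn_def dist_norm norm_minus_commute)
    then show "y \<in> {z. w(i := z) \<in> V}" using e by auto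
  qed
  then show "\<exists>e>0. ball z e \<subseteq> {z. w(i := z) \<in> V}" using e by auto
qed

lemma hol_on_slice:
  assumes "openin (Cn_top k) V" "hol_on k V f" "w \<in> Cn k" "i \<in> {1..k}"
  shows "(\<lambda>z. f (w(i := z))) holomorphic_on {z. w(i := z) \<in> V}"
proof -
  have "(\<lambda>z. f (w(i := z))) field_differentiable at a" if "w(i := a) \<in> V" for a
  proof -
    have "(\<lambda>z. f ((w(i := a))(i := z))) field_differentiable at ((w(i := a)) i)"
      using assms(2,4) that unfolding hol_on_def by blast
    then show ?thesis by simp
  qed
  then show ?thesis
    by (auto simp: holomorphic_on_def intro: field_differentiable_at_within)
qed

lemma hol_on_cong:
  assumes "openin (Cn_top k) V" "hol_on k V f" "\<And>w. w \<in> V \<Longrightarrow> f w = g w"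
  shows "hol_on k V g"
proof -
  have "(\<lambda>z. g (w(i := z))) field_differentiable at (w i)" if "w \<in> V" "i \<in> {1..k}" for w i
  proof -
    let ?S = "{z. w(i := z) \<in> V}"
    have w: "w \<in> Cn k" using assms(1) that by (auto simp: openin_Cn_top)
    have "(\<lambda>z. f (w(i := z))) holomorphic_on ?S" by (rule hol_on_slice[OF assms(1,2) w that(2)])
    then have "(\<lambda>z. g (w(i := z))) holomorphic_on ?S"
      by (rule holomorphic_transform) (use assms(3) in auto)
    then show ?thesis
      using slice_open[OF assms(1) w that(2)] that by (auto intro: holomorphic_on_imp_differentiable_at)
  qed
  moreover have "continuous_on V g"
    using continuous_on_eq[OF hol_on_cont[OF assms(2)]] assms(3) by auto
  ultimately show ?thesis by (auto simp: hol_on_def)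
qed

lemma hol_on_local:
  assumes "\<And>p. p \<in> U \<Longrightarrow> \<exists>V. openin (Cn_top k) V \<and> p \<in> V \<and> hol_on k V f" and U: "U \<subseteq> Cn k"
  shows "hol_on k U f"
proof -
  have "continuous_on U f"
    unfolding continuous_on_topological
  proof (intro ballI allI impI)
    fix p B assume p: "p \<in> U" and B: "open B" "f p \<in> B"
    from assms(1)[OF p] obtain V where V: "openin (Cn_top k) V" "p \<in> V" "hol_on k V f" by auto
    from V(1) obtain T where T: "open T" "V = Cn k \<inter> T" unfolding Cn_top_def openin_open by auto
    from hol_on_cont[OF V(3)] B V(2) obtain A where A: "open A" "p \<in> A" "\<forall>y\<in>V. y \<in> A \<longrightarrow> f y \<in> B"
      unfolding continuous_on_topological by metis
    then show "\<exists>A. open A \<and> p \<in> A \<and> (\<forall>y\<in>U. y \<in> A \<longrightarrow> f y \<in> B)"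
      using T V(2) U by (intro exI[of _ "A \<inter> T"]) auto
  qed
  moreover have "(\<lambda>z. f (x(i := z))) field_differentiable at (x i)" if "x \<in> U" "i \<in> {1..k}" for x i
    using assms(1)[OF that(1)] that(2) unfolding hol_on_def by blast
  ultimately show ?thesis by (auto simp: hol_on_def)
qed

lemma hol_on_upd_const:
  assumes "hol_on k U F" "\<And>w. w \<in> V \<Longrightarrow> w(i := a) \<in> U"
  shows "hol_on k V (\<lambda>w. F (w(i := a)))"
proof -
  have "(\<lambda>z. F (w(l := z, i := a))) field_differentiable at (w l)" if "w \<in> V" "l \<in> {1..k}" for w l
  proof (cases "l = i")
    case False
    then have "(\<lambda>z. F (w(i := a, l := z))) field_differentiable at (w l)"
      using assms(1) assms(2)[OF that(1)] that(2) unfolding hol_on_def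
      by (metis fun_upd_other)
    then show ?thesis using False by (simp add: fun_upd_twist)
  qed simp
  moreover have "continuous_on V (\<lambda>w. F (w(i := a)))"
    by (rule continuous_on_compose2[OF hol_on_cont[OF assms(1)]])
       (use assms(2) in \<open>auto intro!: continuous_on_fun_upd continuous_on_id continuous_on_const\<close>)
  ultimately show ?thesis by (auto simp: hol_on_def)
qed

section \<open>Holomorphic dependence of integrals, and composition\<close>

lemma hol_on_cint:
  assumes s: "s \<ge> 0" and V: "openin (Cn_top k) V"
    and c: "continuous_on (V \<times> sphere 0 s) (\<lambda>(w,\<zeta>). \<Phi> w \<zeta>)"
    and h: "\<And>\<zeta>. \<zeta> \<in> sphere 0 s \<Longrightarrow> hol_on k V (\<lambda>w. \<Phi> w \<zeta>)"
  shows "hol_on k V (\<lambda>w. cint s (\<Phi> w))"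
proof -
  have "(\<lambda>z. cint s (\<Phi> (w(i := z)))) field_differentiable at (w i)" if w: "w \<in> V" and i: "i \<in> {1..k}" for w i
  proof -
    have w': "w \<in> Cn k" using V w by (auto simp: openin_Cn_top)
    let ?S = "{z. w(i := z) \<in> V}"
    have "(\<lambda>z. cint s (\<Phi> (w(i := z)))) holomorphic_on ?S"
    proof (rule cint_holomorphic[OF s slice_open[OF V w' i]])
      have "continuous_on (?S \<times> sphere 0 s) (\<lambda>x. (\<lambda>(w,\<zeta>). \<Phi> w \<zeta>) (w(i := fst x), snd x))"
        by (rule continuous_on_compose2[OF c])
           (auto intro!: continuous_on_Pair continuous_on_fun_upd continuous_on_fst continuous_on_snd continuous_on_id continuous_on_const)
      then show "continuous_on (?S \<times> sphere 0 s) (\<lambda>(x, \<zeta>). \<Phi> (w(i := x)) \<zeta>)"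
        by (simp add: case_prod_beta)
      fix \<zeta> :: complex assume "\<zeta> \<in> sphere 0 s"
      then show "(\<lambda>x. \<Phi> (w(i := x)) \<zeta>) holomorphic_on ?S"
        using hol_on_slice[OF V h w' i] by blast
    qed
    then show ?thesis
      using slice_open[OF V w' i] w by (auto intro: holomorphic_on_imp_differentiable_at)
  qed
  then show ?thesis using cint_continuous[OF s c] by (auto simp: hol_on_def)
qed

text \<open>In Caratheodory's form u z = g z * (z - a), the product has difference quotient g Q,
  which only has to be continuous. So the cofactor \<open>Q\<close> need not be differentiable,
  which suits divided differences known only to be continuous.\<close>

lemma field_differentiable_vanishing_mult:
  fixes u Q :: "complex \<Rightarrow> complex"
  assumes "u field_differentiable at a" "u a = 0" "isCont Q a"
  shows "(\<lambda>t. u t * Q t) field_differentiable at a"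
proof -
  obtain u' where "(u has_field_derivative u') (at a)" using assms(1) by (auto simp: field_differentiable_def)
  then obtain g where g: "\<And>z. u z - u a = g z * (z - a)" "isCont g a" unfolding CARAT_DERIV by auto
  have "((\<lambda>t. u t * Q t) has_field_derivative g a * Q a) (at a)"
    unfolding CARAT_DERIV
  proof (intro exI[of _ "\<lambda>t. g t * Q t"] conjI allI)
    fix z
    have "u z = g z * (z - a)" using g(1)[of z] assms(2) by simp
    then show "u z * Q z - u a * Q a = g z * Q z * (z - a)" using assms(2) by simp
  qed (use g(2) assms(3) in \<open>auto intro!: continuous_intros\<close>)
  then show ?thesis by (auto simp: field_differentiable_def)
qed

text \<open>Telescoping one variable at a time; each increment is a divided difference, which is
  continuous in all variables because it is a Cauchy integral.\<close>

lemma holomorphic_compose_curve: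
  assumes B: "openin (Cn_top m) B" and G: "hol_on m B G"
    and S: "open S" and f: "\<And>l. l \<in> {1..m} \<Longrightarrow> (\<lambda>t. f t l) holomorphic_on S"
    and fB: "\<And>t. t \<in> S \<Longrightarrow> f t \<in> B"
  shows "(\<lambda>t. G (f t)) holomorphic_on S"
proof (rule holomorphic_onI)
  fix t0 assume t0: "t0 \<in> S"
  define p where "p = f t0"
  have BC: "B \<subseteq> Cn m" using B by (auto simp: openin_Cn_top)
  obtain \<rho> where \<rho>: "\<rho> > 0" "pdisc m p \<rho> \<subseteq> B" using B fB[OF t0] by (auto simp: openin_Cn_top p_def)
  define s where "s = \<rho> / 2"
  have s: "0 < s" "s < \<rho>" using \<rho> by (auto simp: s_def)
  define S' where "S' = S \<inter> (\<Inter>l\<in>{1..m}. S \<inter> (\<lambda>t. f t l) -` ball (p l) s)"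
  have "open S'" unfolding S'_def
    by (intro open_Int S open_INT ballI finite_atLeastAtMost continuous_open_preimage
        holomorphic_on_imp_continuous_on f open_ball)
  have t0': "t0 \<in> S'" using t0 s by (auto simp: S'_def p_def)
  have S'D: "cmod (f t l - p l) < s" if "t \<in> S'" "l \<in> {1..m}" for t l
    using that by (auto simp: S'_def dist_norm norm_minus_commute)
  have S'S: "S' \<subseteq> S" by (auto simp: S'_def)
  \<comment> \<open>\<open>mix i t\<close> has the coordinates of \<open>f t\<close> up to
    \<open>i\<close> and those of \<open>p\<close> afterwards: consecutive members differ in one
    coordinate, and the chain runs from \<open>p\<close> to \<open>f t\<close>.\<close>
  define mix where "mix i t = (\<lambda>l. if l \<le> i then f t l else p l)" for i t
  have fC: "f t \<in> Cn m" if "t \<in> S" for t using fB that BC by auto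
  have pC: "p \<in> Cn m" using fC t0 by (simp add: p_def)
  have mixC: "mix i t \<in> Cn m" if "t \<in> S" for i t
    using fC[OF that] pC by (auto simp: mix_def Cn_def)
  have mixB: "(mix i t)(i := p i + \<zeta>) \<in> pdisc m p \<rho>" if "t \<in> S'" "i \<in> {1..m}" "cmod \<zeta> < \<rho>" for i t \<zeta>
  proof -
    have "cmod (mix i t l - p l) < \<rho>" if "l \<in> {1..m}" for l
      using S'D[OF \<open>t \<in> S'\<close> that] s \<rho> by (auto simp: mix_def intro: less_trans)
    moreover have "(mix i t)(i := p i + \<zeta>) \<in> Cn m"
      using mixC[of t i] that S'S by (intro Cn_upd) auto
    ultimately show ?thesis using that(3) by (auto simp: pdisc_def)
  qed
  define Q where "Q i t = cint s (\<lambda>\<zeta>. G ((mix i t)(i := p i + \<zeta>)) / ((\<zeta> - (f t i - p i)) * \<zeta>))" for i t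
  have step: "G (mix i t) - G (mix (i - 1) t) = (f t i - p i) * Q i t" if t: "t \<in> S'" and i: "i \<in> {1..m}" for i t
  proof -
    define g where "g \<zeta> = G ((mix i t)(i := p i + \<zeta>))" for \<zeta>
    have "(\<lambda>z. G ((mix i t)(i := z))) holomorphic_on {z. (mix i t)(i := z) \<in> B}"
      using mixC t S'S i by (intro hol_on_slice[OF B G]) auto
    then have "(\<lambda>z. G ((mix i t)(i := z))) holomorphic_on (\<lambda>\<zeta>. p i + \<zeta>) ` ball 0 \<rho>"
    proof (rule holomorphic_on_subset, intro image_subsetI CollectI)
      fix \<zeta> :: complex assume "\<zeta> \<in> ball 0 \<rho>"
      then show "(mix i t)(i := p i + \<zeta>) \<in> B" using mixB[OF t i, of \<zeta>] \<rho>(2) by auto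
    qed
    from holomorphic_on_compose[OF _ this] have "g holomorphic_on ball 0 \<rho>"
      by (simp add: g_def[abs_def] o_def holomorphic_intros)
    from divided_difference[OF this S'D[OF t i] s(2)]
    have "g (f t i - p i) - g 0 = (f t i - p i) * Q i t" by (simp add: Q_def g_def)
    moreover have "(mix i t)(i := p i + (f t i - p i)) = mix i t" by (auto simp: mix_def)
    moreover have "(mix i t)(i := p i + 0) = mix (i - 1) t"
      by (rule ext) (use i in \<open>auto simp: mix_def\<close>)
    ultimately show ?thesis by (simp add: g_def)
  qed
  have contQ: "isCont (Q i) t0" if i: "i \<in> {1..m}" for i
  proof -
    have cf: "continuous_on S' (\<lambda>t. f t l)" for l
    proof (cases "l \<in> {1..m}")
      case True
      then show ?thesis using f S'S by (meson holomorphic_on_imp_continuous_on holomorphic_on_subset)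
    next
      case False
      then have "f t l = 0" if "t \<in> S'" for t using fC that S'S by (auto simp: Cn_def)
      then show ?thesis by (metis (mono_tags, lifting) continuous_on_cong continuous_on_const)
    qed
    have "continuous_on S' (Q i)"
      unfolding Q_def
    proof (rule cint_continuous)
      have "continuous_on (S' \<times> sphere 0 s) (\<lambda>x. mix i (fst x) l)" for l
      proof -
        have "continuous_on (S' \<times> sphere 0 s) (\<lambda>x. f (fst x) l)"
          by (rule continuous_on_compose2[OF cf[of l]]) (auto intro: continuous_on_fst continuous_on_id)
        then show ?thesis by (cases "l \<le> i") (auto simp: mix_def)
      qed
      then have cm: "continuous_on (S' \<times> sphere 0 s) (\<lambda>z. (mix i (fst z))(i := p i + snd z))"
        by (intro continuous_on_fun_upd continuous_on_coordinatewise_then_product)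
           (auto intro!: continuous_intros)
      have "continuous_on (S' \<times> sphere 0 s) (\<lambda>z. G ((mix i (fst z))(i := p i + snd z)))"
        by (rule continuous_on_compose2[OF hol_on_cont[OF G] cm]) (use mixB[OF _ i] s \<rho> in auto)
      moreover have "continuous_on (S' \<times> sphere 0 s) (\<lambda>z. f (fst z) i)"
        by (rule continuous_on_compose2[OF cf]) (auto intro!: continuous_intros)
      ultimately show "continuous_on (S' \<times> sphere 0 s)
          (\<lambda>(t, \<zeta>). G ((mix i t)(i := p i + \<zeta>)) / ((\<zeta> - (f t i - p i)) * \<zeta>))"
        unfolding case_prod_beta
      proof (intro continuous_intros ballI)
        fix x :: "complex \<times> complex" assume x: "x \<in> S' \<times> sphere 0 s"
        then have "cmod (f (fst x) i - p i) < s" "cmod (snd x) = s" using S'D[OF _ i] by auto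
        then show "(snd x - (f (fst x) i - p i)) * snd x \<noteq> 0" using s by auto
      qed
    qed (use s in auto)
    then show ?thesis using \<open>open S'\<close> t0' by (simp add: continuous_on_eq_continuous_at)
  qed
  have eq: "G (f t) = G p + (\<Sum>i=1..m. (f t i - p i) * Q i t)" if t: "t \<in> S'" for t
  proof -
    have "G (mix j t) = G (mix 0 t) + (\<Sum>i=1..j. (f t i - p i) * Q i t)" if "j \<le> m" for j
      using that
    proof (induction j)
      case (Suc j)
      then show ?case using step[OF t, of "Suc j"] by (simp add: algebra_simps)
    qed simp
    moreover have "t \<in> S" using t S'S by auto
    then have "f t l = 0" "p l = 0" if "l \<notin> {1..m}" for l
      using pC fC[of t] that by (auto simp: Cn_def)
    then have "mix 0 t l = p l" "mix m t l = f t l" for l by (force simp: mix_def)+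
    then have "mix 0 t = p" "mix m t = f t" by auto
    ultimately show ?thesis by (metis order_refl)
  qed
  \<comment> \<open>At \<open>t0\<close> every factor f_i(t) - p_i vanishes, because p = f(t0);
    hence continuity of the cofactors is enough.\<close>
  have "(\<lambda>t. \<Sum>i\<in>{1..m}. (f t i - p i) * Q i t) field_differentiable at t0"
  proof (rule field_differentiable_sum, rule field_differentiable_vanishing_mult)
    fix i assume i: "i \<in> {1..m}"
    show "(\<lambda>t. f t i - p i) field_differentiable at t0"
      using f[OF i] S t0 by (intro field_differentiable_diff) (auto simp: holomorphic_on_imp_differentiable_at)
    show "isCont (Q i) t0" by (rule contQ[OF i])
  qed (simp add: p_def)
  then have "(\<lambda>t. G p + (\<Sum>i=1..m. (f t i - p i) * Q i t)) field_differentiable at t0"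
    by (intro field_differentiable_add field_differentiable_const)
  then have "(\<lambda>t. G (f t)) field_differentiable at t0"
    unfolding field_differentiable_def
    using has_field_derivative_transform_within_open[OF _ \<open>open S'\<close> t0'] eq by (metis (no_types, lifting))
  then show "(\<lambda>t. G (f t)) field_differentiable at t0 within S"
    by (rule field_differentiable_at_within)
qed

lemma continuous_on_Cn_map:
  assumes "\<And>l. l \<in> {1..m} \<Longrightarrow> continuous_on V (\<lambda>w. \<Phi> w l)" "\<And>w. w \<in> V \<Longrightarrow> \<Phi> w \<in> Cn m"
  shows "continuous_on V \<Phi>"
proof (rule continuous_on_coordinatewise_then_product)
  fix l show "continuous_on V (\<lambda>w. \<Phi> w l)"
  proof (cases "l \<in> {1..m}")
    case False
    then have "\<Phi> w l = 0" if "w \<in> V" for w using assms(2)[OF that] by (auto simp: Cn_def)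
    then show ?thesis by (metis (mono_tags, lifting) continuous_on_cong continuous_on_const)
  qed (use assms in auto)
qed

lemma hol_on_compose:
  assumes B: "openin (Cn_top m) B" and G: "hol_on m B G" and V: "openin (Cn_top k) V"
    and \<Phi>: "\<And>l. l \<in> {1..m} \<Longrightarrow> hol_on k V (\<lambda>w. \<Phi> w l)" and im: "\<And>w. w \<in> V \<Longrightarrow> \<Phi> w \<in> B"
  shows "hol_on k V (\<lambda>w. G (\<Phi> w))"
proof -
  have "(\<lambda>z. G (\<Phi> (w(i := z)))) field_differentiable at (w i)" if w: "w \<in> V" and i: "i \<in> {1..k}" for w i
  proof -
    have w': "w \<in> Cn k" using V w by (auto simp: openin_Cn_top)
    let ?S = "{z. w(i := z) \<in> V}"
    have "(\<lambda>z. G (\<Phi> (w(i := z)))) holomorphic_on ?S"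
      by (rule holomorphic_compose_curve[OF B G slice_open[OF V w' i]])
         (use im hol_on_slice[OF V \<Phi> w' i] in auto)
    then show ?thesis
      using slice_open[OF V w' i] w by (auto intro: holomorphic_on_imp_differentiable_at)
  qed
  moreover have "continuous_on V (\<lambda>w. G (\<Phi> w))"
  proof (rule continuous_on_compose2[OF hol_on_cont[OF G]])
    show "continuous_on V \<Phi>"
      by (rule continuous_on_Cn_map[of m, OF hol_on_cont[OF \<Phi>]])
         (use im B in \<open>auto simp: openin_Cn_top\<close>)
  qed (use im in auto)
  ultimately show ?thesis by (auto simp: hol_on_def)
qed

lemma openin_Cn_preimage:
  assumes V: "openin (Cn_top k) V" and c: "continuous_on V \<Phi>" and im: "\<And>w. w \<in> V \<Longrightarrow> \<Phi> w \<in> Cn m"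
    and B: "openin (Cn_top m) B"
  shows "openin (Cn_top k) {w \<in> V. \<Phi> w \<in> B}"
proof -
  obtain T where T: "open T" "B = Cn m \<inter> T" using B unfolding Cn_top_def openin_open by auto
  have "openin (top_of_set V) (V \<inter> \<Phi> -` T)" using c T(1) by (rule continuous_openin_preimage_gen)
  then have "openin (Cn_top k) (V \<inter> \<Phi> -` T)"
    using V unfolding Cn_top_def by (rule openin_trans)
  moreover have "V \<inter> \<Phi> -` T = {w \<in> V. \<Phi> w \<in> B}" using im T(2) by auto
  ultimately show ?thesis by simp
qed

lemma openin_Cn_vimage:
  assumes V: "openin (Cn_top k) V" and c: "continuous_on V f" and T: "open T"
  shows "openin (Cn_top k) {w \<in> V. f w \<in> T}"
proof -
  have "openin (top_of_set V) (V \<inter> f -` T)" using c T by (rule continuous_openin_preimage_gen)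
  then have "openin (Cn_top k) (V \<inter> f -` T)"
    using V unfolding Cn_top_def by (rule openin_trans)
  moreover have "V \<inter> f -` T = {w \<in> V. f w \<in> T}" by auto
  ultimately show ?thesis by simp
qed

section \<open>Density and the identity principle\<close>

definition dense_on :: "nat \<Rightarrow> (nat \<Rightarrow> complex) set \<Rightarrow> (nat \<Rightarrow> complex) set \<Rightarrow> bool" where
  "dense_on k P S \<longleftrightarrow> (\<forall>U. openin (Cn_top k) U \<longrightarrow> U \<noteq> {} \<longrightarrow> U \<subseteq> P \<longrightarrow> U \<inter> S \<noteq> {})"

lemma dense_on_mono: "dense_on k P S \<Longrightarrow> P \<inter> S \<subseteq> T \<Longrightarrow> P' \<subseteq> P \<Longrightarrow> dense_on k P' T"
  unfolding dense_on_def by blast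

lemma dense_on_Int:
  assumes "dense_on k P S" "dense_on k P T" "openin (Cn_top k) (P \<inter> T)"
  shows "dense_on k P (S \<inter> T)"
  unfolding dense_on_def
proof (intro allI impI)
  fix U assume U: "openin (Cn_top k) U" "U \<noteq> {}" "U \<subseteq> P"
  have "openin (Cn_top k) (U \<inter> (P \<inter> T))" using U(1) assms(3) by (rule openin_Int)
  moreover have "U \<inter> T \<noteq> {}" using assms(2) U unfolding dense_on_def by simp
  then have "U \<inter> (P \<inter> T) \<noteq> {}" using U(3) by auto
  ultimately have "U \<inter> (P \<inter> T) \<inter> S \<noteq> {}"
    using assms(1) U(3) unfolding dense_on_def by (metis Int_lower1 order_trans)
  then show "U \<inter> (S \<inter> T) \<noteq> {}" by auto
qed

text \<open>This turns generic identities into identities at all points of a polydisc, coordinate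
  hyperplanes included: the set where two continuous functions differ is open.\<close>

lemma eq_on_dense:
  fixes f g :: "(nat \<Rightarrow> complex) \<Rightarrow> complex"
  assumes P: "openin (Cn_top k) P" and d: "dense_on k P S"
    and c: "continuous_on P f" "continuous_on P g"
    and eq: "\<And>w. w \<in> P \<Longrightarrow> w \<in> S \<Longrightarrow> f w = g w" and w: "w \<in> P"
  shows "f w = g w"
proof (rule ccontr)
  assume ne: "f w \<noteq> g w"
  let ?U = "{w \<in> P. f w - g w \<in> -{0}}"
  have "openin (Cn_top k) ?U"
    by (rule openin_Cn_vimage[OF P]) (use c in \<open>auto intro!: continuous_intros\<close>)
  moreover have "w \<in> ?U" using ne w by simp
  then have "?U \<noteq> {}" by auto
  moreover have "?U \<subseteq> P" by auto
  ultimately have "?U \<inter> S \<noteq> {}" using d[unfolded dense_on_def, rule_format, of ?U] by simp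
  then show False using eq by auto
qed

lemma pdisc_line_convex:
  "convex {t :: complex. \<forall>i\<in>{1..k}. cmod (p i + t * c i) < r}"
proof (rule convexI)
  fix x y :: complex and u v :: real
  assume a: "x \<in> {t. \<forall>i\<in>{1..k}. cmod (p i + t * c i) < r}"
    "y \<in> {t. \<forall>i\<in>{1..k}. cmod (p i + t * c i) < r}" "0 \<le> u" "0 \<le> v" "u + v = 1"
  have "cmod (p i + (u *\<^sub>R x + v *\<^sub>R y) * c i) < r" if i: "i \<in> {1..k}" for i
  proof -
    have "p i + (u *\<^sub>R x + v *\<^sub>R y) * c i = u *\<^sub>R (p i + x * c i) + v *\<^sub>R (p i + y * c i)"
    proof -
      have "complex_of_real u * p i + complex_of_real v * p i = p i"
        using a by (simp flip: distrib_right of_real_add)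
      then show ?thesis by (simp add: scaleR_conv_of_real algebra_simps)
    qed
    moreover have "u *\<^sub>R (p i + x * c i) + v *\<^sub>R (p i + y * c i) \<in> ball 0 r"
      by (rule convexD[OF convex_ball]) (use a i in auto)
    ultimately show ?thesis by (auto simp del: scaleR_conv_of_real)
  qed
  then show "u *\<^sub>R x + v *\<^sub>R y \<in> {t. \<forall>i\<in>{1..k}. cmod (p i + t * c i) < r}" by blast
qed

lemma pdisc_line:
  fixes p q :: "nat \<Rightarrow> complex"
  assumes F: "hol_on k (pdisc k (\<lambda>_. 0) r) F" and p: "p \<in> Cn k" and c: "c \<in> Cn k"
  defines "S \<equiv> {t :: complex. \<forall>i\<in>{1..k}. cmod (p i + t * c i) < r}"
  shows "open S" and "(\<lambda>t. F (\<lambda>i. p i + t * c i)) holomorphic_on S"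
    and "\<And>t. t \<in> S \<longleftrightarrow> (\<lambda>i. p i + t * c i) \<in> pdisc k (\<lambda>_. 0) r"
proof -
  show *: "t \<in> S \<longleftrightarrow> (\<lambda>i. p i + t * c i) \<in> pdisc k (\<lambda>_. 0) r" for t
    using p c by (auto simp: S_def pdisc_def Cn_def)
  have "S = (\<Inter>i\<in>{1..k}. (\<lambda>t. p i + t * c i) -` ball 0 r)" by (auto simp: S_def)
  then show "open S"
    by (auto intro!: open_INT open_vimage continuous_intros)
  show "(\<lambda>t. F (\<lambda>i. p i + t * c i)) holomorphic_on S"
    by (rule holomorphic_compose_curve[OF openin_pdisc F \<open>open S\<close>])
       (use * in \<open>auto intro!: holomorphic_intros\<close>)
qed

text \<open>If \<open>F\<close> vanished on an open set, the complex line from one of its points to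
  \<open>w0\<close> would meet the polydisc in a convex open set, and the identity theorem in one
  variable would force F(w0) = 0.\<close>

lemma dense_nonzero:
  assumes F: "hol_on k (pdisc k (\<lambda>_. 0) r) F" and w0: "w0 \<in> pdisc k (\<lambda>_. 0) r" "F w0 \<noteq> 0"
  shows "dense_on k (pdisc k (\<lambda>_. 0) r) {w. F w \<noteq> 0}"
  unfolding dense_on_def
proof (intro allI impI notI)
  let ?P = "pdisc k (\<lambda>_. 0) r"
  fix U assume U: "openin (Cn_top k) U" "U \<noteq> {}" "U \<subseteq> ?P" and 0: "U \<inter> {w. F w \<noteq> 0} = {}"
  obtain p where p: "p \<in> U" using U by auto
  then obtain e where e: "e > 0" "pdisc k p e \<subseteq> U"
    using U(1) unfolding openin_Cn_top by blast
  define c where "c i = w0 i - p i" for i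
  have C: "p \<in> Cn k" "w0 \<in> Cn k" "c \<in> Cn k" using p U(3) w0 by (auto simp: pdisc_def c_def Cn_def)
  define S where "S = {t :: complex. \<forall>i\<in>{1..k}. cmod (p i + t * c i) < r}"
  note L = pdisc_line[OF F C(1,3), folded S_def]
  define g where "g t = F (\<lambda>i. p i + t * c i)" for t
  have "0 \<in> S" using p U(3) by (auto simp: S_def pdisc_def)
  have "1 \<in> S" using w0 by (auto simp: S_def c_def pdisc_def)
  define B where "B = (\<Inter>i\<in>{1..k}. (\<lambda>t. t * c i) -` ball 0 e) \<inter> S"
  have "open B" unfolding B_def
    by (intro open_Int open_INT ballI finite_atLeastAtMost open_vimage open_ball L(1)) (auto intro!: continuous_intros)
  have "0 \<in> B" using e \<open>0 \<in> S\<close> by (auto simp: B_def)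
  have gB: "g t = 0" if "t \<in> B" for t
  proof -
    have "(\<lambda>i. p i + t * c i) \<in> pdisc k p e" using that C by (auto simp: B_def pdisc_def Cn_def)
    then have "(\<lambda>i. p i + t * c i) \<in> U" using e by auto
    then show ?thesis using 0 by (auto simp: g_def)
  qed
  have "g 1 = (\<lambda>_. 0) (1::complex)"
  proof (rule analytic_continuation_open[of B S g "\<lambda>_. 0"])
    show "connected S" unfolding S_def by (intro convex_connected pdisc_line_convex)
    show "g holomorphic_on S" using L(2) by (simp add: g_def[abs_def])
    show "(\<lambda>_. 0) holomorphic_on S" by simp
    show "B \<subseteq> S" by (auto simp: B_def)
  qed (use \<open>open B\<close> L(1) \<open>0 \<in> B\<close> \<open>1 \<in> S\<close> gB in auto)
  moreover have "g 1 = F w0" by (simp add: g_def c_def)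
  ultimately show False using w0 by simp
qed

lemma hol_on_monomial: "hol_on k U (\<lambda>w. \<Prod>i\<in>I. w i ^ e i)"
  by (intro hol_on_prod hol_on_power hol_on_coord)

lemma half_point: "r > 0 \<Longrightarrow> (\<lambda>i. if i \<in> {1..k} then of_real (r/2) else 0) \<in> pdisc k (\<lambda>_. 0) r"
  by (auto simp: pdisc_def Cn_def)

lemma dense_coords_nonzero:
  assumes "r > 0"
  shows "dense_on k (pdisc k (\<lambda>_. 0) r) {w. \<forall>i\<in>{1..k}. w i \<noteq> 0}"
proof -
  have "dense_on k (pdisc k (\<lambda>_. 0) r) {w. (\<Prod>i\<in>{1..k}. w i ^ 1) \<noteq> 0}"
    by (rule dense_nonzero[OF hol_on_monomial half_point]) (use assms in auto)
  then show ?thesis by simp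
qed

section \<open>Division by a coordinate and residue classes of exponents\<close>

lemma continuous_on_fst_coord: "continuous_on S (\<lambda>x. fst x i :: 'b :: topological_space)"
  by (rule continuous_on_product_then_coordinatewise) (intro continuous_on_fst continuous_on_id)

text \<open>The quotient of F - F(z_i = 0) by z_i, taken as a Cauchy integral so that it is
  holomorphic across z_i = 0 at once. The contour of radius \<open>s\<close> costs a smaller
  polydisc.\<close>

lemma divide_coord:
  assumes F: "hol_on k (pdisc k (\<lambda>_. 0) r) F" and k: "i \<in> {1..k}" and s: "0 < s" "s < r"
  obtains K where "hol_on k (pdisc k (\<lambda>_. 0) s) K"
    and "\<And>z. z \<in> pdisc k (\<lambda>_. 0) s \<Longrightarrow> F z = F (z(i := 0)) + z i * K z"
proof -
  let ?P = "pdisc k (\<lambda>_. 0)"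
  have up: "z(i := \<zeta>) \<in> ?P r" if "z \<in> ?P s" "cmod \<zeta> < r" for z \<zeta>
    using that s k by (auto simp: pdisc_0_iff Cn_upd intro: less_trans)
  define K where "K z = cint s (\<lambda>\<zeta>. F (z(i := \<zeta>)) / ((\<zeta> - z i) * \<zeta>))" for z
  have ne: "(\<zeta> - z i) * \<zeta> \<noteq> 0" if "z \<in> ?P s" "cmod \<zeta> = s" for z \<zeta>
    using that s k by (auto simp: pdisc_0_iff)
  have "hol_on k (?P s) K" unfolding K_def
  proof (rule hol_on_cint[OF _ openin_pdisc])
    have "continuous_on (?P s \<times> sphere 0 s) (\<lambda>x. F ((fst x)(i := snd x)))"
      by (rule continuous_on_compose2[OF hol_on_cont[OF F]])
         (use up s in \<open>auto intro!: continuous_on_fun_upd continuous_on_fst continuous_on_snd continuous_on_id\<close>)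
    moreover have "continuous_on (?P s \<times> sphere 0 s) (\<lambda>x. fst x i)"
      by (rule continuous_on_fst_coord)
    ultimately show "continuous_on (?P s \<times> sphere 0 s) (\<lambda>(z, \<zeta>). F (z(i := \<zeta>)) / ((\<zeta> - z i) * \<zeta>))"
      unfolding case_prod_beta by (intro continuous_intros) (use ne in auto)
  next
    fix \<zeta> :: complex assume z: "\<zeta> \<in> sphere 0 s"
    show "hol_on k (?P s) (\<lambda>w. F (w(i := \<zeta>)) / ((\<zeta> - w i) * \<zeta>))"
      by (intro hol_on_divide hol_on_upd_const[OF F] hol_on_mult hol_on_diff hol_on_const hol_on_coord)
         (use z ne up s in auto)
  qed (use s in auto)
  moreover have "F z = F (z(i := 0)) + z i * K z" if z: "z \<in> ?P s" for z
  proof -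
    have zC: "z \<in> Cn k" using z by (simp add: pdisc_def)
    have "(\<lambda>\<zeta>. F (z(i := \<zeta>))) holomorphic_on ball 0 r"
      by (rule holomorphic_on_subset[OF hol_on_slice[OF openin_pdisc F zC k]]) (use up[OF z] in auto)
    from divided_difference[OF this, of "z i" s] z s k show ?thesis
      by (auto simp: K_def pdisc_0_iff algebra_simps)
  qed
  ultimately show ?thesis using that by blast
qed

definition residue_exps :: "nat \<Rightarrow> nat \<Rightarrow> (nat \<Rightarrow> nat) set" where
  "residue_exps M j = {r. \<forall>l. if l \<in> {1..j} then r l < M else r l = 0}"

lemma residue_exps_0: "residue_exps M 0 = {\<lambda>_. 0}"
  by (auto simp: residue_exps_def)

lemma residue_exps_bij:
  "bij_betw (\<lambda>(r, a). r(Suc j := a)) (residue_exps M j \<times> {..<M}) (residue_exps M (Suc j))"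
proof (rule bij_betw_byWitness[where f' = "\<lambda>r. (r(Suc j := 0), r (Suc j))"])
  show "\<forall>x\<in>residue_exps M j \<times> {..<M}.
       (\<lambda>r. (r(Suc j := 0), r (Suc j))) (case x of (r, a) \<Rightarrow> r(Suc j := a)) = x"
  proof (clarify, simp)
    fix r :: "nat \<Rightarrow> nat" assume "r \<in> residue_exps M j"
    then have "r (Suc j) = 0" by (simp add: residue_exps_def)
    then show "r(Suc j := 0) = r" by auto
  qed
qed (auto simp: residue_exps_def split: if_splits)

lemma finite_residue_exps: "finite (residue_exps M j)"
proof (induction j)
  case (Suc j)
  then show ?case using bij_betw_finite[OF residue_exps_bij] by blast
qed (simp add: residue_exps_0)

text \<open>Uses \<open>\<Sum>\<^sub>a \<zeta>^(M-1-a) z^a / (\<zeta>^M - z^M) = 1 / (\<zeta> - z)\<close> under the Cauchy integral.\<close>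

lemma residue_class_step:
  assumes F: "hol_on k (pdisc k (\<lambda>_. 0) r) F" and i: "i \<in> {1..k}" and r: "0 < r" "r \<le> 1" and M: "M > 0"
  defines "s \<equiv> (r / 2) ^ M"
  obtains H where "0 < s" "s \<le> r" "\<And>a. hol_on k (pdisc k (\<lambda>_. 0) s) (H a)"
    "\<And>z. z \<in> pdisc k (\<lambda>_. 0) s \<Longrightarrow> F z = (\<Sum>a<M. z i ^ a * H a (z(i := z i ^ M)))"
proof -
  let ?P = "pdisc k (\<lambda>_. 0)"
  define s0 where "s0 = r / 2"
  have s0: "0 < s0" "s0 < r" "s0 < 1" using r by (auto simp: s0_def)
  note s_def = s_def[folded s0_def]
  have s: "0 < s" "s \<le> s0" "s \<le> r"
    using s0 M power_decreasing[of 1 M s0] by (auto simp: s_def Suc_leI)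
  have up: "z(i := \<zeta>) \<in> ?P r" if "z \<in> ?P s" "cmod \<zeta> < r" for z \<zeta>
    using that s i by (force simp: pdisc_0_iff Cn_upd)
  \<comment> \<open>The contour has radius r / 2, so zeta^M - v stays nonzero as long as |v| < (r /
    2)^M. This is the origin of the radius \<open>s\<close>.\<close>
  have ne: "\<zeta> ^ M - v \<noteq> 0" if "cmod v < s" "cmod \<zeta> = s0" for v \<zeta>
    using that by (auto simp: s_def norm_power)
  \<comment> \<open>\<open>H a\<close> collects the powers of z_i congruent to \<open>a\<close>
    modulo \<open>M\<close>, and its i-th argument stands for z_i^M.\<close>
  define H where "H a z = cint s0 (\<lambda>\<zeta>. F (z(i := \<zeta>)) * (\<zeta> ^ (M - 1 - a) / (\<zeta> ^ M - z i)))" for a z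
  have zi: "cmod (z i) < s" if "z \<in> ?P s" for z using that i by (auto simp: pdisc_0_iff)
  have "hol_on k (?P s) (H a)" for a unfolding H_def
  proof (rule hol_on_cint[OF _ openin_pdisc])
    have "continuous_on (?P s \<times> sphere 0 s0) (\<lambda>x. F ((fst x)(i := snd x)))"
      by (rule continuous_on_compose2[OF hol_on_cont[OF F]])
         (use up s0 in \<open>auto intro!: continuous_on_fun_upd continuous_on_fst continuous_on_snd continuous_on_id\<close>)
    moreover have "continuous_on (?P s \<times> sphere 0 s0) (\<lambda>x. fst x i)"
      by (rule continuous_on_fst_coord)
    ultimately show "continuous_on (?P s \<times> sphere 0 s0)
        (\<lambda>(z, \<zeta>). F (z(i := \<zeta>)) * (\<zeta> ^ (M - 1 - a) / (\<zeta> ^ M - z i)))"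
      unfolding case_prod_beta by (intro continuous_intros) (use ne zi in auto)
  next
    fix \<zeta> :: complex assume z: "\<zeta> \<in> sphere 0 s0"
    show "hol_on k (?P s) (\<lambda>w. F (w(i := \<zeta>)) * (\<zeta> ^ (M - 1 - a) / (\<zeta> ^ M - w i)))"
      by (intro hol_on_divide hol_on_upd_const[OF F] hol_on_mult hol_on_diff hol_on_const hol_on_coord)
         (use z ne up zi s0 in auto)
  qed (use s0 in auto)
  moreover have "F z = (\<Sum>a<M. z i ^ a * H a (z(i := z i ^ M)))" if z: "z \<in> ?P s" for z
  proof -
    have zC: "z \<in> Cn k" using z by (simp add: pdisc_def)
    have zis: "cmod (z i) < s0" using zi[OF z] s by auto
    have ziM: "cmod (z i ^ M) < s" using zis s0 M
      by (auto simp: s_def norm_power intro!: power_strict_mono)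
    define g where "g \<zeta> = F (z(i := \<zeta>))" for \<zeta>
    have g: "g holomorphic_on ball 0 r" unfolding g_def
      by (rule holomorphic_on_subset[OF hol_on_slice[OF openin_pdisc F zC i]]) (use up[OF z] in auto)
    then have cg: "continuous_on (sphere 0 s0) g"
      by (intro holomorphic_on_imp_continuous_on holomorphic_on_subset[OF g]) (use s0 in auto)
    have "(\<Sum>a<M. z i ^ a * H a (z(i := z i ^ M)))
        = (\<Sum>a<M. cint s0 (\<lambda>\<zeta>. z i ^ a * (g \<zeta> * (\<zeta> ^ (M - 1 - a) / (\<zeta> ^ M - z i ^ M)))))"
      by (simp only: H_def cint_mult g_def fun_upd_upd fun_upd_same)
    also have "\<dots> = cint s0 (\<lambda>\<zeta>. \<Sum>a<M. z i ^ a * (g \<zeta> * (\<zeta> ^ (M - 1 - a) / (\<zeta> ^ M - z i ^ M))))"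
      by (rule cint_sum[symmetric]) (use s0 ne[OF ziM] in \<open>auto intro!: continuous_intros cg\<close>)
    also have "\<dots> = cint s0 (\<lambda>\<zeta>. g \<zeta> / (\<zeta> - z i))"
    proof (rule cint_cong)
      fix \<zeta> assume z': "cmod \<zeta> = s0"
      have ne1: "\<zeta> - z i \<noteq> 0" using z' zis by auto
      have "(\<Sum>a<M. z i ^ a * (g \<zeta> * (\<zeta> ^ (M - 1 - a) / (\<zeta> ^ M - z i ^ M))))
          = g \<zeta> / (\<zeta> ^ M - z i ^ M) * (\<Sum>a<M. z i ^ a * \<zeta> ^ (M - 1 - a))"
        by (simp add: sum_distrib_left mult_ac)
      also have "\<dots> = g \<zeta> / (\<zeta> - z i)"
      proof -
        obtain M' where M': "M = Suc M'" using M by (cases M) auto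
        let ?S = "\<Sum>a<M. z i ^ a * \<zeta> ^ (M - 1 - a)"
        have eq: "\<zeta> ^ M - z i ^ M = (\<zeta> - z i) * (\<Sum>a<M. z i ^ a * \<zeta> ^ (M - 1 - a))"
          using diff_power_eq_sum[of "z i" M' \<zeta>] by (simp add: M' algebra_simps)
        then have "?S \<noteq> 0" using ne[OF ziM z'] by auto
        then show ?thesis unfolding eq by simp
      qed
      finally show "(\<Sum>a<M. z i ^ a * (g \<zeta> * (\<zeta> ^ (M - 1 - a) / (\<zeta> ^ M - z i ^ M)))) = g \<zeta> / (\<zeta> - z i)" .
    qed (use s0 in auto)
    also have "\<dots> = g (z i)" by (rule cint_Cauchy[OF g zis]) (use s0 in auto)
    finally show ?thesis by (simp add: g_def)
  qed
  ultimately show ?thesis using that[of H] s by blast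
qed

text \<open>Each step treats one more variable and is applied to every coefficient function of the
  previous step. The bound r \<le> 1 matters: replacing z_l by z_l^M then keeps a point in the
  polydisc, so the earlier coefficient functions can be evaluated there.\<close>

lemma residue_class_decomposition:
  assumes K: "hol_on k (pdisc k (\<lambda>_. 0) r) K" and r: "0 < r" "r \<le> 1" and M: "M > 0" and j: "j \<le> k"
  shows "\<exists>s H. 0 < s \<and> s \<le> r \<and> (\<forall>e. hol_on k (pdisc k (\<lambda>_. 0) s) (H e)) \<and>
    (\<forall>z\<in>pdisc k (\<lambda>_. 0) s. K z =
       (\<Sum>e\<in>residue_exps M j. (\<Prod>l=1..j. z l ^ e l) * H e (\<lambda>l. if l \<in> {1..j} then z l ^ M else z l)))"
  using j
proof (induction j)
  case 0
  show ?case by (rule exI[of _ r], rule exI[of _ "\<lambda>_. K"]) (use r K in \<open>simp add: residue_exps_0\<close>)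
next
  case (Suc j)
  let ?P = "pdisc k (\<lambda>_. 0)"
  let ?z = "\<lambda>j z l. if l \<in> {1..j} then z l ^ M else z l"
  from Suc.IH[OF Suc_leD[OF Suc.prems]]
  obtain s H where s: "0 < s" "s \<le> r" and H': "\<forall>e. hol_on k (?P s) (H e)"
    and eq': "\<forall>z\<in>?P s. K z = (\<Sum>e\<in>residue_exps M j. (\<Prod>l=1..j. z l ^ e l) * H e (?z j z))"
    by (elim exE conjE)
  note H = H'[rule_format] and eq = eq'[rule_format]
  define s' where "s' = (s / 2) ^ M"
  have "\<exists>G. 0 < s' \<and> s' \<le> s \<and> (\<forall>a. hol_on k (?P s') (G a)) \<and>
      (\<forall>z\<in>?P s'. H e z = (\<Sum>a<M. z (Suc j) ^ a * G a (z(Suc j := z (Suc j) ^ M))))" for e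
  proof -
    have "Suc j \<in> {1..k}" "s \<le> 1" using Suc.prems s r by auto
    then obtain G where "0 < s'" "s' \<le> s" "\<And>a. hol_on k (?P s') (G a)"
      "\<And>z. z \<in> ?P s' \<Longrightarrow> H e z = (\<Sum>a<M. z (Suc j) ^ a * G a (z(Suc j := z (Suc j) ^ M)))"
      using residue_class_step[OF H[of e] _ s(1) _ M, folded s'_def] by blast
    then show ?thesis by blast
  qed
  then obtain G where s': "0 < s'" "s' \<le> s" and G: "\<And>e a. hol_on k (?P s') (G e a)"
    and eq': "\<And>e z. z \<in> ?P s' \<Longrightarrow> H e z = (\<Sum>a<M. z (Suc j) ^ a * G e a (z(Suc j := z (Suc j) ^ M)))"
    by metis
  let ?E = "\<lambda>e z. (\<Prod>l=1..Suc j. z l ^ e l) * G (e(Suc j := 0)) (e (Suc j)) (?z (Suc j) z)"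
  have "K z = (\<Sum>e\<in>residue_exps M (Suc j). ?E e z)" if z: "z \<in> ?P s'" for z
  proof -
    have zz: "?z j z \<in> ?P s'"
    proof -
      have "cmod (z l ^ M) < s'" if "l \<in> {1..k}" for l
      proof -
        have "cmod (z l) < s'" "cmod (z l) \<le> 1" using z that s' s r by (force simp: pdisc_0_iff)+
        moreover have "cmod (z l) ^ M \<le> cmod (z l) ^ 1"
          by (rule power_decreasing) (use M calculation in auto)
        ultimately show ?thesis by (simp add: norm_power)
      qed
      then show ?thesis using z Suc.prems by (auto simp: pdisc_0_iff Cn_def)
    qed
    have upd: "(?z j z)(Suc j := z (Suc j) ^ M) = ?z (Suc j) z" by (rule ext) auto
    have "z \<in> ?P s" using z s' pdisc_mono by blast
    from eq[OF this] have "K z = (\<Sum>e\<in>residue_exps M j. (\<Prod>l=1..j. z l ^ e l) * H e (?z j z))" .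
    also have "\<dots> = (\<Sum>e\<in>residue_exps M j. \<Sum>a<M. ?E (e(Suc j := a)) z)"
    proof (rule sum.cong[OF refl])
      fix e assume e: "e \<in> residue_exps M j"
      then have "e (Suc j) = 0" by (simp add: residue_exps_def)
      then have e0: "e(Suc j := 0) = e" by auto
      have "H e (?z j z) = (\<Sum>a<M. z (Suc j) ^ a * G e a (?z (Suc j) z))"
        using eq'[OF zz, of e] upd by simp
      then show "(\<Prod>l=1..j. z l ^ e l) * H e (?z j z) = (\<Sum>a<M. ?E (e(Suc j := a)) z)"
        by (simp add: sum_distrib_left e0 mult_ac)
    qed
    also have "\<dots> = (\<Sum>(e, a)\<in>residue_exps M j \<times> {..<M}. ?E (e(Suc j := a)) z)"
      by (rule sum.cartesian_product)
    also have "\<dots> = (\<Sum>e\<in>residue_exps M (Suc j). ?E e z)"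
      using sum.reindex_bij_betw[OF residue_exps_bij[of j M], of "\<lambda>e. ?E e z"] by (simp only: case_prod_unfold)
    finally show ?thesis .
  qed
  then show ?case using s s' G
    by (intro exI[of _ s'] exI[of _ "\<lambda>e. G (e(Suc j := 0)) (e (Suc j))"]) auto
qed

section \<open>Connectedness off the coordinate hyperplanes, and roots of monomials\<close>

lemma coord_nonzero_path:
  fixes w w' :: "nat \<Rightarrow> complex"
  assumes w: "w \<in> pdisc k (\<lambda>_. 0) r" "\<forall>i\<in>{1..k}. w i \<noteq> 0"
    and w': "w' \<in> pdisc k (\<lambda>_. 0) r" "\<forall>i\<in>{1..k}. w' i \<noteq> 0"
  obtains \<gamma> :: "real \<Rightarrow> nat \<Rightarrow> complex" where "continuous_on {0..1} \<gamma>" "\<gamma> 0 = w" "\<gamma> 1 = w'"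
    "\<And>t. t \<in> {0..1} \<Longrightarrow> \<gamma> t \<in> pdisc k (\<lambda>_. 0) r \<and> (\<forall>i\<in>{1..k}. \<gamma> t i \<noteq> 0)"
proof
  \<comment> \<open>Interpolating logarithms keeps every coordinate nonzero, and the logarithm of
    its modulus moves linearly between two values below \<open>ln r\<close>, so the path never
    leaves the polydisc.\<close>
  define \<gamma> where "\<gamma> t i = (if i \<in> {1..k} then exp (of_real (1 - t) * Ln (w i) + of_real t * Ln (w' i)) else 0)"
    for t :: real and i
  show "continuous_on {0..1} \<gamma>"
  proof (rule continuous_on_coordinatewise_then_product)
    fix i show "continuous_on {0..1} (\<lambda>t. \<gamma> t i)"
      unfolding \<gamma>_def by (cases "i \<in> {1..k}") (auto intro!: continuous_intros)
  qed
  show "\<gamma> 0 = w" "\<gamma> 1 = w'"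
    by (rule Cn_eqI[of _ k]; use w w' in \<open>force simp: \<gamma>_def pdisc_def Cn_def\<close>)+
  show "\<gamma> t \<in> pdisc k (\<lambda>_. 0) r \<and> (\<forall>i\<in>{1..k}. \<gamma> t i \<noteq> 0)" if t: "t \<in> {0..1}" for t
  proof -
    have "cmod (\<gamma> t i) < r" if i: "i \<in> {1..k}" for i
    proof -
      have nz: "w i \<noteq> 0" "w' i \<noteq> 0" "cmod (w i) < r" "cmod (w' i) < r"
        using w w' i by (auto simp: pdisc_def)
      then have "r > 0" by (metis norm_ge_zero le_less_trans)
      have "(1 - t) * ln (cmod (w i)) + t * ln (cmod (w' i)) < ln r"
        by (rule convex_bound_lt) (use nz t \<open>r > 0\<close> in auto)
      then have "exp ((1 - t) * ln (cmod (w i)) + t * ln (cmod (w' i))) < r"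
        using \<open>r > 0\<close> by (metis exp_less_mono exp_ln)
      then show ?thesis using i nz by (simp add: \<gamma>_def)
    qed
    then show ?thesis by (auto simp: pdisc_def Cn_def \<gamma>_def)
  qed
qed

text \<open>Along a path avoiding the hyperplanes, \<open>v\<close> moves continuously inside the
  finite set of M-th roots of \<open>a\<close>.\<close>

lemma root_of_constant_is_constant:
  assumes c: "continuous_on (pdisc k (\<lambda>_. 0) r \<inter> {w. \<forall>i\<in>{1..k}. w i \<noteq> 0}) v"
    and M: "M > 0" and eq: "\<And>w. w \<in> pdisc k (\<lambda>_. 0) r \<Longrightarrow> \<forall>i\<in>{1..k}. w i \<noteq> 0 \<Longrightarrow> v w ^ M = (a :: complex)"
    and w: "w \<in> pdisc k (\<lambda>_. 0) r" "\<forall>i\<in>{1..k}. w i \<noteq> 0"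
    and w': "w' \<in> pdisc k (\<lambda>_. 0) r" "\<forall>i\<in>{1..k}. w' i \<noteq> 0"
  shows "v w = v w'"
proof -
  obtain \<gamma> :: "real \<Rightarrow> nat \<Rightarrow> complex" where \<gamma>: "continuous_on {0..1} \<gamma>" "\<gamma> 0 = w" "\<gamma> 1 = w'"
    "\<And>t. t \<in> {0..1} \<Longrightarrow> \<gamma> t \<in> pdisc k (\<lambda>_. 0) r \<and> (\<forall>i\<in>{1..k}. \<gamma> t i \<noteq> 0)"
    using coord_nonzero_path[OF w w'] by metis
  have "continuous_on {0..1} (\<lambda>t. v (\<gamma> t))"
    by (rule continuous_on_compose2[OF c \<gamma>(1)]) (use \<gamma>(4) in auto)
  moreover have "(\<lambda>t. v (\<gamma> t)) ` {0..1::real} \<subseteq> {z. z ^ M = a}" using \<gamma>(4) eq by auto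
  then have "finite ((\<lambda>t. v (\<gamma> t)) ` {0..1::real})"
    using finite_nth_roots[OF M, of a] by (rule finite_subset)
  ultimately have "(\<lambda>t. v (\<gamma> t)) constant_on {0..1::real}"
    by (rule continuous_finite_range_constant[OF connected_Icc])
  then have "v (\<gamma> 0) = v (\<gamma> 1)" unfolding constant_on_def by auto
  then show ?thesis using \<gamma> by simp
qed

lemma holomorphic_order_at_zero:
  assumes g: "g holomorphic_on ball 0 r" and r: "r > 0" and nz: "z1 \<in> ball 0 r" "g z1 \<noteq> 0"
  obtains e h s where "0 < s" "s \<le> r" "h holomorphic_on ball 0 s" "h 0 \<noteq> 0"
    "\<And>z. z \<in> ball 0 s \<Longrightarrow> g z = z ^ e * h z"
proof (cases "g 0 = 0")
  case False
  then show ?thesis using that[of r g 0] g r by auto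
next
  case True
  have "\<not> g constant_on ball 0 r"
  proof
    assume "g constant_on ball 0 r"
    then have "g z1 = g 0" using nz r unfolding constant_on_def by (metis centre_in_ball)
    then show False using nz True by simp
  qed
  note nc = this
  have zb: "(0::complex) \<in> ball 0 r" using r by simp
  obtain h s n where h: "0 < n" "0 < s" "ball (0::complex) s \<subseteq> ball 0 r" "h holomorphic_on ball 0 s"
    "\<And>w. w \<in> ball 0 s \<Longrightarrow> g w = (w - 0)^n * h w" "\<And>w. w \<in> ball 0 s \<Longrightarrow> h w \<noteq> 0"
    by (rule holomorphic_factor_zero_nonconstant[OF g open_ball connected_ball zb True nc]) (rule that, assumption+)
  moreover have "h holomorphic_on ball 0 (min s r)"
    by (rule holomorphic_on_subset[OF h(4)]) auto
  ultimately show ?thesis using that[of "min s r" h n] r by auto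
qed

text \<open>Cancel the smaller power off the origin and let z tend to 0: the side that keeps a
  positive power tends to 0, the other one to a nonzero value.\<close>

lemma power_balance:
  fixes h1 h2 :: "complex \<Rightarrow> complex"
  assumes s: "s > 0" and c: "continuous_on (ball 0 s) h1" "continuous_on (ball 0 s) h2"
    and nz: "h1 0 \<noteq> 0" "h2 0 \<noteq> 0"
    and eq: "\<And>z. z \<in> ball 0 s \<Longrightarrow> z ^ a * h1 z = z ^ b * h2 z"
  shows "a = b"
proof -
  have *: False if ab: "a < b" and c: "continuous_on (ball 0 s) h1" "continuous_on (ball 0 s) h2"
    and nz: "h1 0 \<noteq> 0" and eq: "\<And>z. z \<in> ball 0 s \<Longrightarrow> z ^ a * h1 z = z ^ b * h2 z"
    for a b and h1 h2 :: "complex \<Rightarrow> complex"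
  proof -
    have e: "h1 z - z ^ (b - a) * h2 z = 0" if "z \<in> ball 0 s - {0}" for z
    proof -
      have "z ^ b = z ^ a * z ^ (b - a)" using ab by (simp flip: power_add)
      then have "z ^ a * h1 z = z ^ a * (z ^ (b - a) * h2 z)" using eq that by (simp add: mult_ac)
      then show ?thesis using that by simp
    qed
    have "isCont (\<lambda>z. h1 z - z ^ (b - a) * h2 z) 0"
      using c s by (intro continuous_intros) (auto simp: continuous_on_eq_continuous_at)
    then have "((\<lambda>z. h1 z - z ^ (b - a) * h2 z) \<longlongrightarrow> h1 0) (at 0)"
      using ab by (simp add: isCont_def zero_power)
    moreover have "((\<lambda>z. h1 z - z ^ (b - a) * h2 z) \<longlongrightarrow> 0) (at 0)"
    proof (rule tendsto_eventually)
      show "\<forall>\<^sub>F z in at 0. h1 z - z ^ (b - a) * h2 z = 0"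
        unfolding eventually_at using s e by (intro exI[of _ s]) auto
    qed
    ultimately show False using nz tendsto_unique[of "at (0::complex)"] by (metis trivial_limit_at)
  qed
  show ?thesis
    using *[of a b h1 h2] *[of b a h2 h1] c nz eq by (metis linorder_neqE_nat)
qed

text \<open>On a coordinate line the order of vanishing of \<open>q\<close> at 0, counted
  \<open>M\<close> times, must be \<open>A i\<close>; so \<open>A i\<close> is a nonnegative
  multiple of \<open>M\<close>. The quotient of \<open>q\<close> by the resulting monomial has a
  constant M-th power off the hyperplanes, hence is constant. Positive and negative exponents stand
  on different sides so that the hypothesis makes sense on the hyperplanes too.\<close>

lemma root_of_monomial:
  fixes A :: "nat \<Rightarrow> int"
  assumes q: "hol_on k (pdisc k (\<lambda>_. 0) r) q" and r: "r > 0" and M: "M > 0" and a: "a \<noteq> 0"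
    and eq: "\<And>w. w \<in> pdisc k (\<lambda>_. 0) r \<Longrightarrow>
      q w ^ M * (\<Prod>i=1..k. w i ^ nat (- A i)) = a * (\<Prod>i=1..k. w i ^ nat (A i))"
  obtains e b where "b \<noteq> 0" "\<And>i. i \<in> {1..k} \<Longrightarrow> A i = int M * int (e i)"
    "\<And>w. w \<in> pdisc k (\<lambda>_. 0) r \<Longrightarrow> q w = b * (\<Prod>i=1..k. w i ^ e i)"
proof -
  let ?P = "pdisc k (\<lambda>_. 0) r"
  let ?N = "{w :: nat \<Rightarrow> complex. \<forall>i\<in>{1..k}. w i \<noteq> 0}"
  define w0 where "w0 = (\<lambda>i. if i \<in> {1..k} then complex_of_real (r/2) else 0)"
  have w0: "w0 \<in> ?P" "w0 \<in> ?N" using half_point[OF r, of k] r by (auto simp: w0_def)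
  have w0C: "w0 \<in> Cn k" using w0 by (simp add: pdisc_def)
  have ex: "\<exists>e. A i = int M * int e" if i: "i \<in> {1..k}" for i
  proof -
    define g where "g z = q (w0(i := z))" for z
    have up: "w0(i := z) \<in> ?P" if "cmod z < r" for z
      using w0 that i by (auto simp: pdisc_0_iff Cn_upd)
    have g: "g holomorphic_on ball 0 r" unfolding g_def
      by (rule holomorphic_on_subset[OF hol_on_slice[OF openin_pdisc q w0C i]]) (use up in auto)
    define c1 where "c1 = (\<Prod>l\<in>{1..k}-{i}. w0 l ^ nat (- A l))"
    define c2 where "c2 = a * (\<Prod>l\<in>{1..k}-{i}. w0 l ^ nat (A l))"
    have c: "c1 \<noteq> 0" "c2 \<noteq> 0" using w0(2) a by (auto simp: c1_def c2_def)
    have pr: "(\<Prod>l=1..k. (w0(i := z)) l ^ f l) = z ^ f i * (\<Prod>l\<in>{1..k}-{i}. w0 l ^ f l)" for z and f :: "nat \<Rightarrow> nat"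
      using i by (subst prod.remove[of _ i]) (auto intro!: prod.cong)
    have geq: "g z ^ M * (z ^ nat (- A i) * c1) = c2 * z ^ nat (A i)" if "cmod z < r" for z
      using eq[OF up[OF that]] by (simp only: pr g_def c1_def c2_def mult_ac)
    have "g (r/2) ^ M * (complex_of_real (r/2) ^ nat (- A i) * c1) \<noteq> 0"
      using geq[of "complex_of_real (r/2)"] r c by simp
    then have g2: "g (complex_of_real (r/2)) \<noteq> 0" using M by (auto simp: zero_power)
    have z2: "complex_of_real (r/2) \<in> ball 0 r" using r by simp
    obtain e h s where h: "0 < s" "s \<le> r" "h holomorphic_on ball 0 s" "h 0 \<noteq> 0"
      "\<And>z. z \<in> ball 0 s \<Longrightarrow> g z = z ^ e * h z"
      by (rule holomorphic_order_at_zero[OF g r z2 g2]) (rule that)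
    have "e * M + nat (- A i) = nat (A i)"
    proof (rule power_balance[OF h(1)])
      show "continuous_on (ball 0 s) (\<lambda>z. h z ^ M * c1)"
        by (intro continuous_intros holomorphic_on_imp_continuous_on h)
      show "continuous_on (ball 0 s) (\<lambda>z. c2)" by simp
      fix z :: complex assume z: "z \<in> ball 0 s"
      then have "(z ^ e * h z) ^ M * (z ^ nat (- A i) * c1) = c2 * z ^ nat (A i)"
        using geq[of z] h(2,5) by auto
      then show "z ^ (e * M + nat (- A i)) * (h z ^ M * c1) = z ^ nat (A i) * c2"
        by (simp add: power_add power_mult_distrib mult_ac flip: power_mult)
    qed (use h c in auto)
    then have "A i = int M * int e" by (cases "A i \<ge> 0") (auto simp: mult.commute simp flip: of_nat_mult)
    then show ?thesis by blast
  qed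
  then obtain e where e: "\<And>i. i \<in> {1..k} \<Longrightarrow> A i = int M * int (e i)" by metis
  let ?m = "\<lambda>w. \<Prod>i=1..k. w i ^ e i"
  have "q w ^ M = a * ?m w ^ M" if "w \<in> ?P" for w
  proof -
    have "(\<Prod>i=1..k. w i ^ nat (- A i)) = 1" by (rule prod.neutral) (auto simp: e)
    moreover have "(\<Prod>i=1..k. w i ^ nat (A i)) = ?m w ^ M"
      unfolding prod_power_distrib power_mult[symmetric]
      by (rule prod.cong) (auto simp: e nat_mult_distrib mult.commute)
    ultimately show ?thesis using eq[OF that] by simp
  qed note pw = this
  define v where "v w = q w / ?m w" for w
  have nzm: "?m w \<noteq> 0" if "w \<in> ?N" for w using that by auto
  have vM: "v w ^ M = a" if "w \<in> ?P" "\<forall>i\<in>{1..k}. w i \<noteq> 0" for w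
    using pw[OF that(1)] nzm that by (simp add: v_def power_divide)
  have cv: "continuous_on (?P \<inter> ?N) v"
    unfolding v_def using hol_on_cont[OF hol_on_subset[OF q, of "?P \<inter> ?N"]] hol_on_cont[OF hol_on_monomial]
    by (intro continuous_on_divide) (use nzm in auto)
  define b where "b = v w0"
  have "b ^ M = a" using vM w0 by (simp add: b_def)
  then have b: "b \<noteq> 0" using a M by (auto simp: zero_power)
  have "q w = b * ?m w" if w: "w \<in> ?P" for w
  proof (rule eq_on_dense[OF openin_pdisc dense_coords_nonzero[OF r] hol_on_cont[OF q] _ _ w])
    show "continuous_on ?P (\<lambda>w. b * ?m w)"
      by (intro hol_on_cont[of k] hol_on_mult hol_on_const hol_on_monomial)
    fix w assume "w \<in> ?P" "w \<in> ?N"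
    then have "v w = b" unfolding b_def
      by (intro root_of_constant_is_constant[OF cv M vM]) (use w0 in auto)
    then show "q w = b * ?m w" using nzm[OF \<open>w \<in> ?N\<close>] by (simp add: v_def field_simps)
  qed
  then show ?thesis using that b e by blast
qed

section \<open>Lipschitz bounds and inversion of unit scalings\<close>

lemma hol_on_lipschitz:
  assumes F: "hol_on k (pdisc k (\<lambda>_. 0) r) F" and B: "\<And>w. w \<in> pdisc k (\<lambda>_. 0) r \<Longrightarrow> cmod (F w) \<le> B"
    and r: "r > 0" and x: "x \<in> pdisc k (\<lambda>_. 0) (r/2)" and y: "y \<in> pdisc k (\<lambda>_. 0) (r/2)"
    and m: "\<And>i. i \<in> {1..k} \<Longrightarrow> cmod (x i - y i) \<le> m" "0 \<le> m"
  shows "cmod (F x - F y) \<le> (2 * B + 1) * (2 * m / r)"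
proof -
  have xP: "x \<in> pdisc k (\<lambda>_. 0) r" and yP: "y \<in> pdisc k (\<lambda>_. 0) r" using x y r by (force simp: pdisc_0_iff)+
  have B0: "B \<ge> 0" using B[OF xP] norm_ge_zero order_trans by blast
  have diff: "cmod (F x' - F y') \<le> 2 * B" if "x' \<in> pdisc k (\<lambda>_. 0) r" "y' \<in> pdisc k (\<lambda>_. 0) r" for x' y'
    using norm_triangle_ineq4[of "F x'" "F y'"] B[OF that(1)] B[OF that(2)] by linarith
  \<comment> \<open>For large \<open>m\<close> the bound follows from 2 B alone; for small positive
    \<open>m\<close> there is room to prolong the line through \<open>x\<close> and
    \<open>y\<close>.\<close>
  consider "m = 0" | "m > 0" "2 * m < r" | "2 * m \<ge> r" using m by linarith
  then show ?thesis
  proof cases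
    case 1
    then have "x = y" using x y m by (intro Cn_eqI[of _ k]) (auto simp: pdisc_def)
    then show ?thesis using B0 m r by simp
  next
    case 3
    have "cmod (F x - F y) \<le> 2 * B + 1" using diff[OF xP yP] by simp
    also have "\<dots> \<le> (2 * B + 1) * (2 * m / r)"
      using mult_left_mono[of r "2 * m" "2 * B + 1"] 3 r B0 by (simp add: pos_le_divide_eq)
    finally show ?thesis .
  next
    case 2
    define c where "c i = x i - y i" for i
    have C: "y \<in> Cn k" "c \<in> Cn k" using x y by (auto simp: pdisc_def Cn_def c_def)
    \<comment> \<open>The line from \<open>y\<close> towards \<open>x\<close> can be prolonged by
      this factor: |y_i| < r / 2 and R m = r / 2 keep it in the polydisc of radius \<open>r\<close>.
      Schwarz's lemma in the prolonged parameter then gives the factor 1 / R.\<close>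
    define R where "R = r / (2 * m)"
    have R: "R > 1" using 2 by (simp add: R_def)
    define S where "S = {t :: complex. \<forall>i\<in>{1..k}. cmod (y i + t * c i) < r}"
    note L = pdisc_line[OF F C, folded S_def]
    \<comment> \<open>Dividing by 2 B + 1 instead of 2 B gives the strict bound of Schwarz's lemma
      and a nonzero divisor when B = 0.\<close>
    define f where "f z = (F (\<lambda>i. y i + (of_real R * z) * c i) - F y) / of_real (2 * B + 1)" for z
    have in_S: "of_real R * z \<in> S" if "cmod z < 1" for z
      unfolding S_def
    proof (intro CollectI ballI)
      fix i assume i: "i \<in> {1..k}"
      have "cmod (y i + of_real R * z * c i) \<le> cmod (y i) + R * cmod z * cmod (c i)"
        using R by (intro order_trans[OF norm_triangle_ineq]) (simp add: norm_mult)
      also have "R * cmod z * cmod (c i) \<le> R * 1 * m"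
        using R that m(1)[OF i] m(2) by (intro mult_mono) (auto simp: c_def)
      also have "R * 1 * m = r / 2" using 2 by (simp add: R_def)
      also have "cmod (y i) < r / 2" using y i by (simp add: pdisc_0_iff)
      finally show "cmod (y i + of_real R * z * c i) < r" by simp
    qed
    have "(\<lambda>z. F (\<lambda>i. y i + (of_real R * z) * c i)) holomorphic_on ball 0 1"
    proof -
      have "(*) (complex_of_real R) ` ball 0 1 \<subseteq> S" using in_S by auto
      moreover have "(*) (complex_of_real R) holomorphic_on ball 0 1" by (intro holomorphic_intros)
      ultimately show ?thesis
        using holomorphic_on_compose_gen[OF _ L(2), of "(*) (complex_of_real R)" "ball 0 1"]
        by (simp add: o_def)
    qed
    then have fh: "f holomorphic_on ball 0 1" unfolding f_def
      using B0 by (intro holomorphic_intros) (auto simp del: of_real_add of_real_mult)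
    have f1: "cmod (f z) < 1" if "cmod z < 1" for z
    proof -
      have "cmod (F (\<lambda>i. y i + (of_real R * z) * c i) - F y) \<le> 2 * B"
        using diff[OF _ yP] L(3) in_S[OF that] by blast
      then show ?thesis using B0 by (simp add: f_def norm_divide del: of_real_add of_real_mult)
    qed
    have f0: "f 0 = 0" by (simp add: f_def)
    have "cmod (1 / of_real R :: complex) < 1" using R by (simp add: norm_divide)
    from Schwarz_Lemma(1)[OF fh f0 f1 this]
    have "cmod (f (1 / of_real R)) \<le> 1 / R" using R by (simp add: norm_divide)
    moreover have "f (1 / of_real R) = (F x - F y) / of_real (2 * B + 1)"
      using R by (simp add: f_def c_def)
    ultimately have "cmod (F x - F y) / (2 * B + 1) \<le> 1 / R"
      using B0 by (simp add: norm_divide del: of_real_add of_real_mult)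
    then show ?thesis using B0 2 r by (simp add: R_def field_simps)
  qed
qed

lemma hol_on_suminf:
  assumes V: "openin (Cn_top k) V" and f: "\<And>n. hol_on k V (f n)"
    and bd: "\<And>n w. w \<in> V \<Longrightarrow> cmod (f n w) \<le> M n" and s: "summable M"
  shows "hol_on k V (\<lambda>w. \<Sum>n. f n w)"
proof -
  have ul: "uniform_limit V (\<lambda>n w. \<Sum>i<n. f i w) (\<lambda>w. \<Sum>n. f n w) sequentially"
    by (rule Weierstrass_m_test[OF bd s])
  have hs: "hol_on k V (\<lambda>w. \<Sum>i<n. f i w)" for n by (intro hol_on_sum f)
  have "continuous_on V (\<lambda>w. \<Sum>n. f n w)"
    by (rule uniform_limit_theorem[OF _ ul]) (use hol_on_cont[OF hs] in \<open>auto intro: always_eventually\<close>)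
  moreover have "(\<lambda>z. \<Sum>n. f n (w(i := z))) field_differentiable at (w i)" if w: "w \<in> V" and i: "i \<in> {1..k}" for w i
  proof -
    have w': "w \<in> Cn k" using V w by (auto simp: openin_Cn_top)
    let ?S = "{z. w(i := z) \<in> V}"
    have "(\<lambda>z. \<Sum>n. f n (w(i := z))) holomorphic_on ?S"
    proof (rule holomorphic_uniform_sequence[OF slice_open[OF V w' i]])
      show "(\<lambda>z. \<Sum>j<n. f j (w(i := z))) holomorphic_on ?S" for n by (rule hol_on_slice[OF V hs w' i])
      fix x assume "x \<in> ?S"
      then obtain d where d: "d > 0" "cball x d \<subseteq> ?S"
        using slice_open[OF V w' i] open_contains_cball by blast
      have "uniform_limit (cball x d) (\<lambda>n z. \<Sum>j<n. f j (w(i := z))) (\<lambda>z. \<Sum>n. f n (w(i := z))) sequentially"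
        by (rule Weierstrass_m_test[OF _ s]) (use d bd in auto)
      then show "\<exists>d>0. cball x d \<subseteq> ?S \<and>
          uniform_limit (cball x d) (\<lambda>n z. \<Sum>j<n. f j (w(i := z))) (\<lambda>z. \<Sum>n. f n (w(i := z))) sequentially"
        using d by blast
    qed
    then show ?thesis
      using slice_open[OF V w' i] w by (auto intro: holomorphic_on_imp_differentiable_at)
  qed
  ultimately show ?thesis by (auto simp: hol_on_def)
qed

lemma hol_on_near_zero:
  assumes F: "hol_on k (pdisc k (\<lambda>_. 0) r) F" and r: "r > 0" and e: "e > 0"
  obtains s where "0 < s" "s \<le> r" "\<And>w. w \<in> pdisc k (\<lambda>_. 0) s \<Longrightarrow> cmod (F w - F (\<lambda>_. 0)) < e"
proof -
  let ?U = "{w \<in> pdisc k (\<lambda>_. 0) r. F w \<in> ball (F (\<lambda>_. 0)) e}"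
  have "openin (Cn_top k) ?U"
    by (rule openin_Cn_vimage[OF openin_pdisc hol_on_cont[OF F] open_ball])
  moreover have "(\<lambda>_. 0) \<in> ?U" using r e by simp
  ultimately obtain s where s: "s > 0" "pdisc k (\<lambda>_. 0) s \<subseteq> ?U" unfolding openin_Cn_top by blast
  have "pdisc k (\<lambda>_. 0) (min s r) \<subseteq> ?U" using s pdisc_mono[of "min s r" s] by auto
  then show ?thesis using that[of "min s r"] s r by (force simp: dist_norm norm_minus_commute)
qed

lemma hol_family_near_zero:
  fixes F :: "nat \<Rightarrow> (nat \<Rightarrow> complex) \<Rightarrow> complex"
  assumes F: "\<And>l. l \<in> {1..k} \<Longrightarrow> hol_on m (pdisc m (\<lambda>_. 0) r) (F l)" and r: "r > 0"
    and e: "\<And>l. l \<in> {1..k} \<Longrightarrow> e l > 0"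
  obtains s where "0 < s" "s \<le> r"
    "\<And>l w. l \<in> {1..k} \<Longrightarrow> w \<in> pdisc m (\<lambda>_. 0) s \<Longrightarrow> cmod (F l w - F l (\<lambda>_. 0)) < e l"
proof -
  have "\<exists>s. 0 < s \<and> s \<le> r \<and> (\<forall>w\<in>pdisc m (\<lambda>_. 0) s. cmod (F l w - F l (\<lambda>_. 0)) < e l)" if "l \<in> {1..k}" for l
    using hol_on_near_zero[OF F[OF that] r e[OF that]] by metis
  then obtain s where s: "\<And>l. l \<in> {1..k} \<Longrightarrow> 0 < s l \<and> s l \<le> r"
    "\<And>l w. l \<in> {1..k} \<Longrightarrow> w \<in> pdisc m (\<lambda>_. 0) (s l) \<Longrightarrow> cmod (F l w - F l (\<lambda>_. 0)) < e l" by metis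
  define t where "t = Min (insert r (s ` {1..k}))"
  have t: "0 < t" "t \<le> r" using s r by (auto simp: t_def)
  have "t \<le> s l" if "l \<in> {1..k}" for l unfolding t_def using that by (intro Min_le) auto
  then show ?thesis using that[OF t] s(2) pdisc_mono by blast
qed

lemma hol_family_bounded:
  assumes F: "\<And>l. l \<in> {1..k} \<Longrightarrow> hol_on k (pdisc k (\<lambda>_. 0) r) (F l)" and r: "r > 0"
  obtains s B where "0 < s" "s \<le> r" "B \<ge> 0"
    "\<And>l w. l \<in> {1..k} \<Longrightarrow> w \<in> pdisc k (\<lambda>_. 0) s \<Longrightarrow> cmod (F l w) \<le> B"
proof -
  obtain t where t: "0 < t" "t \<le> r"
    and near: "\<And>l w. l \<in> {1..k} \<Longrightarrow> w \<in> pdisc k (\<lambda>_. 0) t \<Longrightarrow> cmod (F l w - F l (\<lambda>_. 0)) < 1"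
    by (rule hol_family_near_zero[of k k r F "\<lambda>_. 1", OF F r]) (auto intro: that)
  define B where "B = (\<Sum>l\<in>{1..k}. cmod (F l (\<lambda>_. 0)) + 1)"
  have "cmod (F l w) \<le> B" if l: "l \<in> {1..k}" and w: "w \<in> pdisc k (\<lambda>_. 0) t" for l w
  proof -
    have "cmod (F l w) \<le> cmod (F l (\<lambda>_. 0)) + 1"
      using norm_triangle_sub[of "F l w" "F l (\<lambda>_. 0)"] near[OF l w] by linarith
    also have "\<dots> \<le> B" unfolding B_def using l by (intro member_le_sum) auto
    finally show ?thesis .
  qed
  moreover have "B \<ge> 0" unfolding B_def by (intro sum_nonneg) auto
  ultimately show ?thesis using that t by blast
qed

text \<open>The equation \<open>x\<^sub>l v\<^sub>l(x) = y\<^sub>l\<close> is solved by iterating the contraction \<open>x\<^sub>l \<mapsto> y\<^sub>l / v\<^sub>l(x)\<close>.\<close>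

lemma inverse_of_unit_scaling:
  assumes v: "\<And>l. l \<in> {1..k} \<Longrightarrow> hol_on k (pdisc k (\<lambda>_. 0) \<rho>) (v l)"
    and nz: "\<And>l w. l \<in> {1..k} \<Longrightarrow> w \<in> pdisc k (\<lambda>_. 0) \<rho> \<Longrightarrow> v l w \<noteq> 0" and \<rho>: "\<rho> > 0"
  obtains r s \<Psi> where "0 < r" "0 < s" "s \<le> \<rho>"
    "\<And>y. y \<in> pdisc k (\<lambda>_. 0) r \<Longrightarrow> \<Psi> y \<in> pdisc k (\<lambda>_. 0) s"
    "\<And>y l. y \<in> pdisc k (\<lambda>_. 0) r \<Longrightarrow> l \<in> {1..k} \<Longrightarrow> \<Psi> y l * v l (\<Psi> y) = y l"
    "\<And>l. hol_on k (pdisc k (\<lambda>_. 0) r) (\<lambda>y. \<Psi> y l)"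
    "\<And>x y. x \<in> pdisc k (\<lambda>_. 0) s \<Longrightarrow> y \<in> pdisc k (\<lambda>_. 0) r \<Longrightarrow>
       (\<And>l. l \<in> {1..k} \<Longrightarrow> x l * v l x = y l) \<Longrightarrow> \<Psi> y = x"
proof -
  let ?P = "pdisc k (\<lambda>_. 0)"
  define u where "u l w = inverse (v l w)" for l w
  have u: "hol_on k (?P \<rho>) (u l)" if "l \<in> {1..k}" for l
    unfolding u_def using v nz that by (intro hol_on_inverse) auto
  obtain s0 B where s0: "0 < s0" "s0 \<le> \<rho>" "B \<ge> 0"
    and B: "\<And>l w. l \<in> {1..k} \<Longrightarrow> w \<in> ?P s0 \<Longrightarrow> cmod (u l w) \<le> B"
    using hol_family_bounded[of k \<rho> u, OF u \<rho>] by metis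
  have us: "hol_on k (?P s0) (u l)" if "l \<in> {1..k}" for l
    using hol_on_subset[OF u[OF that]] pdisc_mono[OF s0(2)] by blast
  define s where "s = s0 / 2"
  define C where "C = (2 * B + 1) * (2 / s0)"
  have s: "0 < s" "s < s0" "s \<le> \<rho>" using s0 by (auto simp: s_def)
  have C: "C > 0" using s0 by (simp add: C_def)
  have Ps: "?P s \<subseteq> ?P s0" using s by (intro pdisc_mono) auto
  have lip: "cmod (u l x - u l x') \<le> C * m"
    if "l \<in> {1..k}" "x \<in> ?P s" "x' \<in> ?P s" "\<And>i. i \<in> {1..k} \<Longrightarrow> cmod (x i - x' i) \<le> m" "0 \<le> m" for l x x' m
    using hol_on_lipschitz[OF us[OF that(1)] B[OF that(1)] s0(1), of x x' m] that unfolding s_def C_def by (simp add: algebra_simps add_divide_distrib)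
  \<comment> \<open>The first bound keeps the iterates in the polydisc of radius \<open>s\<close>,
    the second makes the iteration contract by the factor 1/2.\<close>
  define r where "r = min (s / (2 * (B + 1))) (1 / (2 * C))"
  have r: "r > 0" using s s0 C by (simp add: r_def)
  have rB: "r * B < s"
  proof -
    have "r * B \<le> s / (2 * (B + 1)) * (B + 1)" using r s0 by (intro mult_mono) (auto simp: r_def)
    also have "\<dots> = s / 2" using s0 by (simp add: field_simps)
    finally show ?thesis using s by simp
  qed
  have rC: "r * C \<le> 1 / 2"
  proof -
    have "r * C \<le> 1 / (2 * C) * C" using C by (intro mult_right_mono) (auto simp: r_def)
    then show ?thesis using C by simp
  qed
  define X where "X = rec_nat (\<lambda>y. \<lambda>_. 0) (\<lambda>_ Z y l. if l \<in> {1..k} then y l * u l (Z y) else 0)"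
  have X0: "X 0 y = (\<lambda>_. 0)" and XS: "X (Suc n) y = (\<lambda>l. if l \<in> {1..k} then y l * u l (X n y) else 0)" for n y
    by (simp_all only: X_def nat.rec)
  have yu: "cmod (y l * z) \<le> r * b" if "y \<in> ?P r" "l \<in> {1..k}" "cmod z \<le> b" for y l z b
    using that by (auto simp: norm_mult pdisc_0_iff intro!: mult_mono less_imp_le[of _ r] order_trans[OF norm_ge_zero])
  have XB: "X n y \<in> ?P s \<and> (\<forall>l\<in>{1..k}. cmod (X n y l) \<le> r * B)" if y: "y \<in> ?P r" for n y
  proof (induction n)
    case 0
    then show ?case using s r s0 by (simp add: X0)
  next
    case (Suc n)
    have "cmod (X (Suc n) y l) \<le> r * B" if "l \<in> {1..k}" for l
      using yu[OF y that B[OF that]] Suc Ps that by (auto simp: XS)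
    then show ?case using rB by (force simp: pdisc_0_iff XS Cn_def)
  qed
  have Xh: "hol_on k (?P r) (\<lambda>y. X n y l)" for n l
  proof (induction n arbitrary: l)
    case (Suc n)
    have "hol_on k (?P r) (\<lambda>y. y l * u l (X n y))" if "l \<in> {1..k}"
      using XB Ps by (intro hol_on_mult hol_on_coord hol_on_compose[OF openin_pdisc us[OF that] openin_pdisc] Suc) auto
    then show ?case by (cases "l \<in> {1..k}") (auto simp: XS hol_on_const)
  qed (simp add: X0 hol_on_const)
  have inc: "cmod (X (Suc n) y l - X n y l) \<le> s * (1/2) ^ n" if y: "y \<in> ?P r" for n y l
  proof (induction n arbitrary: l)
    case 0
    show ?case using XB[OF y, of "Suc 0"] s by (cases "l \<in> {1..k}") (auto simp: X0 pdisc_0_iff XS less_imp_le)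
  next
    case (Suc n)
    show ?case
    proof (cases "l \<in> {1..k}")
      case True
      have "cmod (u l (X (Suc n) y) - u l (X n y)) \<le> C * (s * (1/2) ^ n)"
        using XB[OF y] Suc s by (intro lip[OF True]) auto
      then have "cmod (y l * (u l (X (Suc n) y) - u l (X n y))) \<le> r * (C * (s * (1/2) ^ n))"
        by (rule yu[OF y True])
      also have "\<dots> = (r * C) * (s * (1/2) ^ n)" by simp
      also have "\<dots> \<le> 1/2 * (s * (1/2) ^ n)" using rC s by (intro mult_right_mono) auto
      finally show ?thesis using True by (simp add: XS[of "Suc n"] XS[of n] right_diff_distrib)
    next
      case False
      then have "X j y l = 0" for j by (cases j) (auto simp: X0 XS)
      then show ?thesis using s by simp
    qed
  qed
  \<comment> \<open>The limit is written as the series of its increments, so that the Weierstrass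
    test yields holomorphy along with convergence.\<close>
  define \<Psi> where "\<Psi> y l = (\<Sum>n. X (Suc n) y l - X n y l)" for y l
  have sm: "summable (\<lambda>n. s * (1/2::real) ^ n)" by (intro summable_mult summable_geometric) auto
  have \<Psi>h: "hol_on k (?P r) (\<lambda>y. \<Psi> y l)" for l
    unfolding \<Psi>_def by (rule hol_on_suminf[OF openin_pdisc _ inc sm]) (intro hol_on_diff Xh)
  have lim: "(\<lambda>n. X n y l) \<longlonglongrightarrow> \<Psi> y l" if y: "y \<in> ?P r" for y l
  proof -
    have "summable (\<lambda>n. X (Suc n) y l - X n y l)"
      by (rule summable_comparison_test[OF _ sm]) (use inc[OF y] in blast)
    from summable_LIMSEQ[OF this] show ?thesis
      by (simp add: \<Psi>_def sum_lessThan_telescope[of "\<lambda>n. X n y l"] X0)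
  qed
  have \<Psi>s: "\<Psi> y \<in> ?P s" if y: "y \<in> ?P r" for y
  proof -
    have "cmod (\<Psi> y l) \<le> r * B" if "l \<in> {1..k}" for l
      by (rule Lim_bounded[OF tendsto_norm[OF lim[OF y, of l]], of 0]) (use XB[OF y] that in auto)
    moreover have "\<Psi> y l = 0" if "l \<notin> {1..k}" for l
    proof -
      have "X n y l = 0" for n using XB[OF y, of n] that by (auto simp: pdisc_0_iff Cn_def)
      then show ?thesis by (simp add: \<Psi>_def)
    qed
    ultimately show ?thesis using rB by (force simp: pdisc_0_iff Cn_def)
  qed
  have fixpt: "\<Psi> y l = y l * u l (\<Psi> y)" if y: "y \<in> ?P r" and l: "l \<in> {1..k}" for y l
  proof -
    define m where "m n = (\<Sum>i\<in>{1..k}. cmod (X n y i - \<Psi> y i))" for n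
    have "m \<longlonglongrightarrow> (\<Sum>i\<in>{1..k}. cmod (\<Psi> y i - \<Psi> y i))"
      unfolding m_def by (intro tendsto_intros lim[OF y])
    then have m0: "(\<lambda>n. C * m n) \<longlonglongrightarrow> 0" using tendsto_mult_right_zero[of m sequentially C] by simp
    have "(\<lambda>n. u l (X n y) - u l (\<Psi> y)) \<longlonglongrightarrow> 0"
    proof (rule Lim_null_comparison[OF always_eventually m0], intro allI)
      fix n show "cmod (u l (X n y) - u l (\<Psi> y)) \<le> C * m n"
        using XB[OF y] \<Psi>s[OF y]
        by (intro lip[OF l]) (auto simp: m_def sum_nonneg intro!: member_le_sum[of _ _ "\<lambda>i. cmod (X n y i - \<Psi> y i)"])
    qed
    then have "(\<lambda>n. y l * u l (X n y)) \<longlonglongrightarrow> y l * u l (\<Psi> y)"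
      by (intro tendsto_mult tendsto_const) (simp add: LIM_zero_iff)
    then have "(\<lambda>n. X (Suc n) y l) \<longlonglongrightarrow> y l * u l (\<Psi> y)" using l by (simp add: XS)
    moreover have "(\<lambda>n. X (Suc n) y l) \<longlonglongrightarrow> \<Psi> y l" using lim[OF y] by (rule LIMSEQ_Suc)
    ultimately show ?thesis by (metis LIMSEQ_unique)
  qed
  \<comment> \<open>For two solutions, the largest coordinate difference is at most half of
    itself.\<close>
  have uniq: "\<Psi> y = x" if x: "x \<in> ?P s" and y: "y \<in> ?P r" and eq: "\<And>l. l \<in> {1..k} \<Longrightarrow> x l = y l * u l x" for x y
  proof (rule Cn_eqI[of _ k])
    fix i assume i: "i \<in> {1..k}"
    let ?D = "(\<lambda>i. cmod (\<Psi> y i - x i)) ` {1..k}"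
    define m where "m = Max ?D"
    have m: "cmod (\<Psi> y l - x l) \<le> m" if "l \<in> {1..k}" for l unfolding m_def using that by (intro Max_ge) auto
    then have m0: "m \<ge> 0" using i norm_ge_zero order_trans by blast
    have "m \<in> ?D" unfolding m_def using i by (intro Max_in) auto
    then obtain l where l: "l \<in> {1..k}" "m = cmod (\<Psi> y l - x l)" by auto
    have "cmod (u l (\<Psi> y) - u l x) \<le> C * m" by (rule lip[OF l(1) \<Psi>s[OF y] x m m0])
    then have "cmod (y l * (u l (\<Psi> y) - u l x)) \<le> r * (C * m)" by (rule yu[OF y l(1)])
    moreover have "\<Psi> y l - x l = y l * (u l (\<Psi> y) - u l x)"
      using fixpt[OF y l(1)] eq[OF l(1)] by (simp add: right_diff_distrib)
    then have "m = cmod (y l * (u l (\<Psi> y) - u l x))" using l(2) by simp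
    moreover have "r * (C * m) \<le> 1/2 * m"
      using mult_right_mono[OF rC m0] by (simp add: mult.assoc)
    ultimately have "m \<le> 1/2 * m" by linarith
    then have "m = 0" using m0 by simp
    then show "\<Psi> y i = x i" using m[OF i] by simp
  qed (use \<Psi>s[OF y] x in \<open>auto simp: pdisc_def\<close>)
  have nzs: "v l x \<noteq> 0" if "l \<in> {1..k}" "x \<in> ?P s" for l x
    using nz that Ps pdisc_mono[OF s0(2)] by blast
  show ?thesis
  proof (rule that[of r s \<Psi>])
    show "\<Psi> y l * v l (\<Psi> y) = y l" if "y \<in> ?P r" "l \<in> {1..k}" for y l
      using fixpt[OF that] nzs[OF that(2) \<Psi>s[OF that(1)]] by (simp add: u_def field_simps)
    show "\<Psi> y = x" if "x \<in> ?P s" "y \<in> ?P r" "\<And>l. l \<in> {1..k} \<Longrightarrow> x l * v l x = y l" for x y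
    proof (rule uniq[OF that(1,2)])
      fix l assume l: "l \<in> {1..k}"
      have "x l * v l x = y l" by (rule that(3)[OF l])
      then show "x l = y l * u l x"
        using nzs[OF l that(1)] by (simp add: u_def field_simps)
    qed
  qed (use r s \<Psi>s \<Psi>h in auto)
qed

section \<open>Complex spaces\<close>

lemma ctop_csub [simp]: "ctop (csub X A) = subtopology (ctop X) A"
  by (simp add: csub_def)

lemma chol_csub: "chol (csub X A) p f \<longleftrightarrow>
    (\<exists>U g. openin (ctop X) U \<and> p \<in> U \<and> chol X p g \<and> (\<forall>q\<in>U \<inter> A. f q = g q))"
  by (simp add: csub_def)

lemma ctop_affine [simp]: "ctop (affine_space k) = Cn_top k"
  by (simp add: affine_space_def)

lemma chol_affine: "chol (affine_space k) p f \<longleftrightarrow> (\<exists>U. openin (Cn_top k) U \<and> p \<in> U \<and> hol_on k U f)"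
  by (simp add: affine_space_def)

lemma chol_csubI: "chol X p f \<Longrightarrow> p \<in> points X \<Longrightarrow> chol (csub X A) p f"
  unfolding chol_csub by blast

lemma germ_closedD:
  "germ_closed X \<Longrightarrow> chol X p f \<Longrightarrow> openin (ctop X) U \<Longrightarrow> p \<in> U \<Longrightarrow> (\<And>q. q \<in> U \<Longrightarrow> f q = g q) \<Longrightarrow> chol X p g"
  unfolding germ_closed_def by blast

lemma germ_closed_csub [simp]: "germ_closed (csub X A)"
  unfolding germ_closed_def
proof (intro allI impI)
  fix p f g U
  assume U: "openin (ctop (csub X A)) U" "p \<in> U" and f: "chol (csub X A) p f" and eq: "\<forall>q\<in>U. f q = g q"
  obtain V h where V: "openin (ctop X) V" "p \<in> V" "chol X p h" "\<forall>q\<in>V \<inter> A. f q = h q"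
    using f unfolding chol_csub by blast
  obtain T where T: "openin (ctop X) T" "U = T \<inter> A" using U(1) by (auto simp: openin_subtopology)
  have "g q = h q" if "q \<in> (V \<inter> T) \<inter> A" for q
    using bspec[OF eq, of q] bspec[OF V(4), of q] that T(2) by simp
  moreover have "openin (ctop X) (V \<inter> T)" "p \<in> V \<inter> T" using V T U by auto
  ultimately have "openin (ctop X) (V \<inter> T)" "p \<in> V \<inter> T" "\<forall>q\<in>(V \<inter> T) \<inter> A. g q = h q" by auto
  then show "chol (csub X A) p g" using V(3) unfolding chol_csub by blast
qed

lemma germ_closed_affine [simp]: "germ_closed (affine_space k)"
  unfolding germ_closed_def chol_affine
proof (intro allI impI)
  fix p f g U assume U: "openin (ctop (affine_space k)) U" "p \<in> U" "\<forall>q\<in>U. f q = g q"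
    and "\<exists>U. openin (Cn_top k) U \<and> p \<in> U \<and> hol_on k U f"
  then obtain V where V: "openin (Cn_top k) V" "p \<in> V" "hol_on k V f" by blast
  have "openin (Cn_top k) (U \<inter> V)" using U V by auto
  moreover have "hol_on k (U \<inter> V) g"
    by (rule hol_on_cong[OF calculation hol_on_subset[OF V(3)]]) (use U in auto)
  ultimately show "\<exists>U. openin (Cn_top k) U \<and> p \<in> U \<and> hol_on k U g" using U V by blast
qed

lemma chol_csub_open:
  assumes "germ_closed X" "openin (ctop X) U" "p \<in> U"
  shows "chol (csub X U) p f \<longleftrightarrow> chol X p f"
proof
  assume "chol (csub X U) p f"
  then obtain V g where "openin (ctop X) V" "p \<in> V" "chol X p g" "\<forall>q\<in>V \<inter> U. f q = g q"
    unfolding chol_csub by blast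
  then show "chol X p f" using germ_closedD[OF assms(1), of p g "V \<inter> U" f] assms by auto
next
  assume "chol X p f"
  then show "chol (csub X U) p f"
    by (rule chol_csubI) (use assms openin_subset in blast)
qed

lemma morphism_cont: "morphism X Y f \<Longrightarrow> continuous_map (ctop X) (ctop Y) f"
  by (simp add: morphism_def)

lemma morphism_chol: "morphism X Y f \<Longrightarrow> p \<in> points X \<Longrightarrow> chol Y (f p) g \<Longrightarrow> chol X p (\<lambda>q. g (f q))"
  unfolding morphism_def o_def by blast

lemma morphism_in: "morphism X Y f \<Longrightarrow> p \<in> points X \<Longrightarrow> f p \<in> points Y"
  unfolding morphism_def continuous_map_def by auto

lemma morphismI:
  "continuous_map (ctop X) (ctop Y) f \<Longrightarrow>
   (\<And>p g. p \<in> points X \<Longrightarrow> chol Y (f p) g \<Longrightarrow> chol X p (\<lambda>q. g (f q))) \<Longrightarrow> morphism X Y f"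
  unfolding morphism_def o_def by blast

lemma morphism_id [simp]: "morphism X X id"
  by (rule morphismI) auto

lemma morphism_compose: "morphism X Y f \<Longrightarrow> morphism Y Z g \<Longrightarrow> morphism X Z (g \<circ> f)"
proof (rule morphismI)
  assume a: "morphism X Y f" "morphism Y Z g"
  then show "continuous_map (ctop X) (ctop Z) (g \<circ> f)"
    by (meson continuous_map_compose morphism_cont)
  fix p h assume p: "p \<in> points X" and h: "chol Z ((g \<circ> f) p) h"
  have "chol Y (f p) (\<lambda>q. h (g q))"
    using morphism_chol[OF a(2), OF morphism_in[OF a(1) p]] h by simp
  from morphism_chol[OF a(1), OF p this] show "chol X p (\<lambda>q. h ((g \<circ> f) q))" by simp
qed

lemma morphism_cong:
  assumes X: "germ_closed X" and f: "morphism X Y f" and eq: "\<And>p. p \<in> points X \<Longrightarrow> f p = g p"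
  shows "morphism X Y g"
proof (rule morphismI)
  show "continuous_map (ctop X) (ctop Y) g"
    using morphism_cont[OF f] eq by (metis (no_types, lifting) continuous_map_eq)
  fix p h assume p: "p \<in> points X" and h: "chol Y (g p) h"
  have "chol Y (f p) h" using h eq[OF p] by simp
  from morphism_chol[OF f, OF p this] have "chol X p (\<lambda>q. h (f q))" .
  then show "chol X p (\<lambda>q. h (g q))"
    by (rule germ_closedD[OF X, of _ _ "points X"]) (use p eq in auto)
qed

lemma morphism_csub_target: "morphism X (csub Y A) f \<Longrightarrow> morphism X Y f"
proof (rule morphismI)
  assume f: "morphism X (csub Y A) f"
  then show "continuous_map (ctop X) (ctop Y) f"
    using morphism_cont[OF f] by (simp add: continuous_map_in_subtopology)
  fix p h assume p: "p \<in> points X" and h: "chol Y (f p) h"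
  have "f p \<in> points Y" using morphism_in[OF f p] by simp
  then have "chol (csub Y A) (f p) h" using h by (intro chol_csubI) auto
  then show "chol X p (\<lambda>q. h (f q))" by (rule morphism_chol[OF f, OF p])
qed

text \<open>A germ on the subspace agrees with an ambient germ only on \<open>A\<close>; since all
  values lie in \<open>A\<close>, the two pullbacks agree on a neighbourhood, and
  \<open>germ_closed\<close> lets one replace the other.\<close>

lemma morphism_into_csub:
  assumes g: "germ_closed X" and f: "morphism X Y f" and A: "\<And>p. p \<in> points X \<Longrightarrow> f p \<in> A"
  shows "morphism X (csub Y A) f"
proof (rule morphismI)
  show "continuous_map (ctop X) (ctop (csub Y A)) f"
    using morphism_cont[OF f] A by (auto simp: continuous_map_in_subtopology)
  fix p h assume p: "p \<in> points X" and h: "chol (csub Y A) (f p) h"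
  then obtain U k where U: "openin (ctop Y) U" "f p \<in> U" "chol Y (f p) k" "\<forall>q\<in>U \<inter> A. h q = k q"
    unfolding chol_csub by blast
  have "chol X p (\<lambda>q. k (f q))" by (rule morphism_chol[OF f, OF p U(3)])
  moreover have "openin (ctop X) {q \<in> points X. f q \<in> U}"
    by (rule openin_continuous_map_preimage[OF morphism_cont[OF f] U(1)])
  ultimately show "chol X p (\<lambda>q. h (f q))"
    by (rule germ_closedD[OF g]) (use p U A in auto)
qed

lemma morphism_csub_source: "morphism X Y f \<Longrightarrow> morphism (csub X A) Y f"
proof (rule morphismI)
  assume f: "morphism X Y f"
  then show "continuous_map (ctop (csub X A)) (ctop Y) f"
    by (simp add: continuous_map_from_subtopology morphism_cont)
  fix p h assume p: "p \<in> points (csub X A)" and h: "chol Y (f p) h"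
  then have p': "p \<in> points X" by simp
  show "chol (csub X A) p (\<lambda>q. h (f q))" by (rule chol_csubI[OF morphism_chol[OF f, OF p' h] p'])
qed

lemma morphism_csub: "morphism X Y f \<Longrightarrow> (\<And>p. p \<in> points X \<Longrightarrow> p \<in> A \<Longrightarrow> f p \<in> B) \<Longrightarrow> morphism (csub X A) (csub Y B) f"
  by (rule morphism_into_csub[OF germ_closed_csub morphism_csub_source]) auto

lemma isomorphism_inverse:
  assumes "isomorphism X Y f"
  obtains g where "morphism X Y f" "morphism Y X g" "\<And>x. x \<in> points X \<Longrightarrow> g (f x) = x"
    "\<And>y. y \<in> points Y \<Longrightarrow> f (g y) = y"
  using assms unfolding isomorphism_def by blast

text \<open>The bridge from stalks to \<open>hol_on\<close>: each point of \<open>V\<close> brings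
  its own neighbourhood, and \<open>hol_on_local\<close> glues them.\<close>

lemma morphism_affine_hol_on:
  assumes f: "morphism (csub (affine_space k) V) X f" and V: "openin (Cn_top k) V"
    and g: "\<And>w. w \<in> V \<Longrightarrow> chol X (f w) g"
  shows "hol_on k V (\<lambda>w. g (f w))"
proof (rule hol_on_local)
  show VC: "V \<subseteq> Cn k" using V by (simp add: openin_Cn_top)
  fix p assume p: "p \<in> V"
  then have "p \<in> points (csub (affine_space k) V)" using VC by auto
  from morphism_chol[OF f, OF this g[OF p]] have "chol (affine_space k) p (\<lambda>q. g (f q))"
    using chol_csub_open[OF germ_closed_affine, of k V p] V p by simp
  then show "\<exists>V. openin (Cn_top k) V \<and> p \<in> V \<and> hol_on k V (\<lambda>w. g (f w))" by (simp add: chol_affine)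
qed

lemma chol_affine_coord: "p \<in> Cn k \<Longrightarrow> chol (affine_space k) p (\<lambda>w. w l)"
  unfolding chol_affine by (rule exI[of _ "Cn k"]) (auto simp: hol_on_coord simp flip: topspace_Cn_top)

lemma morphism_affine_coord:
  "morphism X (affine_space k) y \<Longrightarrow> p \<in> points X \<Longrightarrow> chol X p (\<lambda>q. y q l)"
  using morphism_chol[of X "affine_space k" y p "\<lambda>w. w l"] chol_affine_coord morphism_in[of X "affine_space k" y p] by simp

text \<open>The local model as a two-way dictionary: functions of the ambient coordinates are
  holomorphic on \<open>X\<close>, and holomorphic germs on \<open>X\<close> extend to the ambient
  space. Of the inverse \<open>y\<close> only continuity is kept; the extension property carries the
  rest.\<close>

lemma complex_space_embedding:
  assumes X: "complex_space X" and p: "p \<in> points X"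
  obtains U m x y where "openin (ctop X) U" "p \<in> U"
    "continuous_map (subtopology (ctop X) U) (Cn_top m) x"
    "continuous_map (subtopology (Cn_top m) (x ` U)) (ctop X) y"
    "\<And>q. q \<in> U \<Longrightarrow> y (x q) = q"
    "\<And>q G B. q \<in> U \<Longrightarrow> openin (Cn_top m) B \<Longrightarrow> x q \<in> B \<Longrightarrow> hol_on m B G \<Longrightarrow> chol X q (\<lambda>q. G (x q))"
    "\<And>q g. q \<in> U \<Longrightarrow> chol X q g \<Longrightarrow>
       \<exists>B G. openin (Cn_top m) B \<and> x q \<in> B \<and> hol_on m B G \<and> (\<forall>q'\<in>U. x q' \<in> B \<longrightarrow> g q' = G (x q'))"
proof -
  have gc: "germ_closed X" using X by (simp add: complex_space_def)
  obtain U m B Z x where U: "openin (ctop X) U" "p \<in> U" and B: "openin (Cn_top m) B"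
    and Z: "analytic_in (csub (affine_space m) B) Z"
    and x: "isomorphism (csub X U) (csub (affine_space m) Z) x"
    using X p unfolding complex_space_def by blast
  have US: "U \<subseteq> points X" using U openin_subset by blast
  have ZC: "Z \<subseteq> Cn m" using Z by (auto simp: analytic_in_def)
  obtain y where xm: "morphism (csub X U) (csub (affine_space m) Z) x"
    and ym: "morphism (csub (affine_space m) Z) (csub X U) y"
    and yx: "\<And>q. q \<in> U \<Longrightarrow> y (x q) = q" and xy: "\<And>z. z \<in> Z \<Longrightarrow> x (y z) = z"
    using isomorphism_inverse[OF x] US ZC by (auto simp: inf_absorb2)
  have xZ: "x q \<in> Z" if "q \<in> U" for q using morphism_in[OF xm, of q] that US by auto
  have yU: "y z \<in> U" if "z \<in> Z" for z using morphism_in[OF ym, of z] that ZC by auto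
  have img: "x ` U = Z" using xZ yU xy by (metis image_eqI image_subset_iff subsetI subset_antisym)
  have xm': "morphism (csub X U) (affine_space m) x" by (rule morphism_csub_target[OF xm])
  show ?thesis
  proof (rule that[OF U])
    show "continuous_map (subtopology (ctop X) U) (Cn_top m) x" using morphism_cont[OF xm'] by simp
    show "continuous_map (subtopology (Cn_top m) (x ` U)) (ctop X) y"
      using morphism_cont[OF morphism_csub_target[OF ym]] by (simp add: img)
    show "y (x q) = q" if "q \<in> U" for q using yx that .
  next
    fix q G B' assume q: "q \<in> U" and B': "openin (Cn_top m) B'" "x q \<in> B'" "hol_on m B' G"
    then have "chol (affine_space m) (x q) G" unfolding chol_affine by blast
    from morphism_chol[OF xm', OF _ this] show "chol X q (\<lambda>q. G (x q))"
      using chol_csub_open[OF gc U(1) q] q US by auto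
  next
    fix q g assume q: "q \<in> U" and g: "chol X q g"
    have "chol (csub X U) (y (x q)) g" using g chol_csub_open[OF gc U(1) q] yx[OF q] by simp
    from morphism_chol[OF ym, OF _ this] xZ[OF q] ZC
    have "chol (csub (affine_space m) Z) (x q) (\<lambda>z. g (y z))" by auto
    then obtain V G where V: "openin (Cn_top m) V" "x q \<in> V" "chol (affine_space m) (x q) G"
      "\<forall>z\<in>V \<inter> Z. g (y z) = G z" unfolding chol_csub by auto
    then obtain V' where V': "openin (Cn_top m) V'" "x q \<in> V'" "hol_on m V' G" unfolding chol_affine by blast
    have "g q' = G (x q')" if "q' \<in> U" "x q' \<in> V \<inter> V'" for q'
      using V(4) that xZ[OF that(1)] yx[OF that(1)] by force
    then show "\<exists>B G. openin (Cn_top m) B \<and> x q \<in> B \<and> hol_on m B G \<and> (\<forall>q'\<in>U. x q' \<in> B \<longrightarrow> g q' = G (x q'))"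
      using V V' by (intro exI[of _ "V \<inter> V'"] exI[of _ G]) (auto intro: hol_on_subset)
  qed
qed

definition tuple :: "nat \<Rightarrow> (nat \<Rightarrow> 'a \<Rightarrow> complex) \<Rightarrow> 'a \<Rightarrow> nat \<Rightarrow> complex" where
  "tuple m f q = (\<lambda>l. if l \<in> {1..m} then f l q else 0)"

lemma tuple_in_Cn [simp]: "tuple m f q \<in> Cn m"
  by (auto simp: tuple_def Cn_def)

lemma continuous_on_tuple:
  "(\<And>l. l \<in> {1..m} \<Longrightarrow> continuous_on V (f l)) \<Longrightarrow> continuous_on V (tuple m f)"
  by (rule continuous_on_Cn_map[of m]) (auto simp: tuple_def Cn_def)

lemma hol_on_tuple:
  assumes B: "openin (Cn_top m) B" and G: "hol_on m B G" and V: "openin (Cn_top k) V"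
    and f: "\<And>l. l \<in> {1..m} \<Longrightarrow> hol_on k V (f l)"
  shows "openin (Cn_top k) {w \<in> V. tuple m f w \<in> B}" and "hol_on k {w \<in> V. tuple m f w \<in> B} (\<lambda>w. G (tuple m f w))"
proof -
  show op: "openin (Cn_top k) {w \<in> V. tuple m f w \<in> B}"
    by (rule openin_Cn_preimage[OF V continuous_on_tuple tuple_in_Cn B]) (use f hol_on_cont in auto)
  show "hol_on k {w \<in> V. tuple m f w \<in> B} (\<lambda>w. G (tuple m f w))"
  proof (rule hol_on_compose[OF B G op])
    fix l assume "l \<in> {1..m}"
    then show "hol_on k {w \<in> V. tuple m f w \<in> B} (\<lambda>w. tuple m f w l)"
      using hol_on_subset[OF f] by (auto simp: tuple_def)
  qed auto
qed

section \<open>Monomial coordinates\<close>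

lemma morphism_csub_mono: "morphism (csub X N) Y f \<Longrightarrow> M \<subseteq> N \<Longrightarrow> morphism (csub X M) Y f"
  using morphism_compose[OF morphism_csub[OF morphism_id, of X M N], of Y f] by (auto simp: o_def id_def)

lemma morphism_tuple:
  assumes V: "openin (Cn_top k) V" and F: "\<And>l. l \<in> {1..m} \<Longrightarrow> hol_on k V (F l)"
  shows "morphism (csub (affine_space k) V) (affine_space m) (tuple m F)"
proof (rule morphismI)
  have VC: "V \<subseteq> Cn k" using V by (simp add: openin_Cn_top)
  have "continuous_on V (tuple m F)" by (intro continuous_on_tuple hol_on_cont[of k] F)
  then show "continuous_map (ctop (csub (affine_space k) V)) (ctop (affine_space m)) (tuple m F)"
    using VC by (simp add: Cn_top_def subtopology_subtopology inf_absorb2 continuous_map_in_subtopology image_subset_iff)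
  fix p g assume p: "p \<in> points (csub (affine_space k) V)" and "chol (affine_space m) (tuple m F p) g"
  then obtain B where B: "openin (Cn_top m) B" "tuple m F p \<in> B" "hol_on m B g" unfolding chol_affine by blast
  note H = hol_on_tuple[OF B(1,3) V F]
  have "chol (affine_space k) p (\<lambda>w. g (tuple m F w))"
    unfolding chol_affine using H p B(2) by (intro exI[of _ "{w \<in> V. tuple m F w \<in> B}"]) auto
  then show "chol (csub (affine_space k) V) p (\<lambda>w. g (tuple m F w))"
    using p by (intro chol_csubI) auto
qed

text \<open>Both directions of a chart are kept: \<open>E\<close> pulls functions back to the
  polydisc, \<open>y\<close> reads off the coordinates of a given point. \<open>E\<close> is a
  morphism into all of \<open>K\<close>, ready to be composed with the maps of the tower.\<close>

definition coord_disc ::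
  "'a cspace \<Rightarrow> nat \<Rightarrow> real \<Rightarrow> ((nat \<Rightarrow> complex) \<Rightarrow> 'a) \<Rightarrow> ('a \<Rightarrow> nat \<Rightarrow> complex) \<Rightarrow> 'a set \<Rightarrow> bool" where
  "coord_disc K k r E y Q \<longleftrightarrow> 0 < r \<and> openin (ctop K) Q \<and>
     morphism (csub (affine_space k) (pdisc k (\<lambda>_. 0) r)) K E \<and> morphism (csub K Q) (affine_space k) y \<and>
     (\<forall>w\<in>pdisc k (\<lambda>_. 0) r. E w \<in> Q \<and> y (E w) = w) \<and> (\<forall>q\<in>Q. y q \<in> pdisc k (\<lambda>_. 0) r \<and> E (y q) = q)"

lemma powi_times_power_neg: "z \<noteq> 0 \<Longrightarrow> z powi d * z ^ nat (- d) = (z :: complex) ^ nat d"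
  by (cases "d \<ge> 0") (auto simp: power_int_def simp flip: power_mult_distrib)

lemma of_int_nat_diff: "of_nat (nat d) - of_nat (nat (- d)) = (of_int d :: 'a :: ring_1)"
  by (cases "d \<ge> 0") auto

text \<open>With u_i = exp (L i), the v_l are the products of rational powers u_j^(c l j), with
  branches fixed by \<open>L\<close>. As \<open>c\<close> inverts \<open>d\<close>, the product of
  the v_l^(d i l) is u_i again; negative exponents are moved to the other side.\<close>

lemma unit_root_identity:
  fixes L :: "nat \<Rightarrow> complex"
  assumes inv: "mutually_inverse k c d" and i: "i \<in> {1..k}"
  defines "v \<equiv> \<lambda>l. exp (\<Sum>j=1..k. of_rat (c l j) * L j)"
  shows "exp (L i) * (\<Prod>l=1..k. v l ^ nat (- d i l)) = (\<Prod>l=1..k. v l ^ nat (d i l))"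
proof -
  define S where "S l = (\<Sum>j=1..k. of_rat (c l j) * L j)" for l
  have pe: "(\<Prod>l=1..k. v l ^ n l) = exp (\<Sum>l=1..k. of_nat (n l) * S l)" for n
    by (simp add: exp_sum exp_of_nat_mult v_def S_def)
  have "(\<Sum>l=1..k. of_int (d i l) * S l) = (\<Sum>j=1..k. \<Sum>l=1..k. of_rat (of_int (d i l) * c l j) * L j)"
    unfolding S_def sum_distrib_left by (subst sum.swap) (simp add: of_rat_mult mult_ac)
  also have "\<dots> = (\<Sum>j=1..k. of_rat (\<Sum>l=1..k. of_int (d i l) * c l j) * L j)"
    by (simp add: of_rat_sum sum_distrib_right)
  also have "\<dots> = (\<Sum>j=1..k. (if i = j then L j else 0))"
    using inv i by (intro sum.cong) (auto simp: mutually_inverse_def)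
  also have "\<dots> = L i" using i by simp
  finally have "L i = (\<Sum>l=1..k. (of_nat (nat (d i l)) - of_nat (nat (- d i l))) * S l)"
    by (simp add: of_int_nat_diff)
  then have "L i + (\<Sum>l=1..k. of_nat (nat (- d i l)) * S l) = (\<Sum>l=1..k. of_nat (nat (d i l)) * S l)"
    by (simp add: left_diff_distrib sum_subtractf)
  then show ?thesis unfolding pe by (simp flip: exp_add)
qed

lemma chart_inverse:
  assumes K: "germ_closed K" and ch: "chart K k p N x"
  obtains B e where "openin (Cn_top k) B" "(\<lambda>_. 0) \<in> B" "e (\<lambda>_. 0) = p"
    "morphism (csub K N) (affine_space k) x" "morphism (csub (affine_space k) B) K e"
    "\<And>w. w \<in> B \<Longrightarrow> e w \<in> N \<and> x (e w) = w" "\<And>q. q \<in> N \<Longrightarrow> x q \<in> B \<and> e (x q) = q"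
proof -
  obtain B where N: "openin (ctop K) N" "p \<in> N" "x p = (\<lambda>_. 0)" and B: "openin (Cn_top k) B"
    and iso: "isomorphism (csub K N) (csub (affine_space k) B) x" using ch unfolding chart_def by blast
  have NS: "N \<subseteq> points K" and BC: "B \<subseteq> Cn k" using N(1) B openin_subset by (auto simp: openin_Cn_top)
  obtain e where xm: "morphism (csub K N) (csub (affine_space k) B) x"
    and em: "morphism (csub (affine_space k) B) (csub K N) e"
    and ex: "\<And>q. q \<in> N \<Longrightarrow> e (x q) = q" and xe: "\<And>w. w \<in> B \<Longrightarrow> x (e w) = w"
    using isomorphism_inverse[OF iso] NS BC by (auto simp: inf_absorb2)
  have "x q \<in> B" if "q \<in> N" for q using morphism_in[OF xm, of q] that NS by auto
  moreover have "e w \<in> N" if "w \<in> B" for w using morphism_in[OF em, of w] that BC by auto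
  ultimately show ?thesis
    using that[OF B _ _ morphism_csub_target[OF xm] morphism_csub_target[OF em]] ex xe N by metis
qed

text \<open>In the good coordinates t_i is x^(d_i) times a unit. Setting w_l = x_l v_l, with v_l the
  rational powers of the normalized units, turns this into a constant times w^(d_i). As the v_l
  never vanish, the hyperplanes x_l = 0 and w_l = 0 coincide, so the flag and the divisor keep their
  position relative to the coordinates.\<close>

lemma monomial_coordinates:
  assumes K: "germ_closed K" and good: "good_coordinates K k W D b N x"
    and T: "morphism K X T" and inv: "mutually_inverse k c d"
    and am: "\<And>i. i \<in> {1..k} \<Longrightarrow> almost_monomial K N x k (d i) (\<lambda>q. f i (T q))"
    and Ua: "openin (ctop X) Ua" "T b \<in> Ua"
    and gh: "\<And>i q. i \<in> {1..k} \<Longrightarrow> q \<in> Ua \<Longrightarrow> chol X q (g i) \<and> chol X q (h i)"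
    and fgh: "\<And>i q. i \<in> {1..k} \<Longrightarrow> q \<in> Ua \<Longrightarrow> h i q \<noteq> 0 \<Longrightarrow> f i q = g i q / h i q"
    and nv: "\<And>i Q. i \<in> {1..k} \<Longrightarrow> openin (ctop K) Q \<Longrightarrow> b \<in> Q \<Longrightarrow> \<exists>q\<in>Q. h i (T q) \<noteq> 0"
  obtains r E y Q \<gamma> where "coord_disc K k r E y Q" "b \<in> Q" "E (\<lambda>_. 0) = b"
    "\<And>w j. w \<in> pdisc k (\<lambda>_. 0) r \<Longrightarrow> j \<le> k \<Longrightarrow> E w \<in> W j \<longleftrightarrow> (\<forall>i\<in>{Suc j..k}. w i = 0)"
    "\<And>w. w \<in> pdisc k (\<lambda>_. 0) r \<Longrightarrow> E w \<in> \<Union>D \<Longrightarrow> \<exists>l\<in>{1..k}. w l = 0"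
    "\<And>w. w \<in> pdisc k (\<lambda>_. 0) r \<Longrightarrow> T (E w) \<in> Ua" "\<And>i. \<gamma> i \<noteq> 0"
    "\<And>i w. i \<in> {1..k} \<Longrightarrow> w \<in> pdisc k (\<lambda>_. 0) r \<Longrightarrow>
       g i (T (E w)) * (\<Prod>l=1..k. w l ^ nat (- d i l)) = \<gamma> i * h i (T (E w)) * (\<Prod>l=1..k. w l ^ nat (d i l))"
proof -
  let ?P = "pdisc k (\<lambda>_. 0)"
  have ch: "chart K k b N x" using good by (simp add: good_coordinates_def)
  have N: "openin (ctop K) N" "b \<in> N" "x b = (\<lambda>_. 0)" using ch by (auto simp: chart_def)
  have NS: "N \<subseteq> points K" using N(1) openin_subset by blast
  obtain B e where B: "openin (Cn_top k) B" "(\<lambda>_. 0) \<in> B" and e0: "e (\<lambda>_. 0) = b"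
    and xm: "morphism (csub K N) (affine_space k) x" and em: "morphism (csub (affine_space k) B) K e"
    and eB: "\<And>w. w \<in> B \<Longrightarrow> e w \<in> N \<and> x (e w) = w" and xN: "\<And>q. q \<in> N \<Longrightarrow> x q \<in> B \<and> e (x q) = q"
    by (rule chart_inverse[OF K ch]) (rule that, assumption+)
  have BC: "B \<subseteq> Cn k" using B by (simp add: openin_Cn_top)
  define R where "R i u \<longleftrightarrow> (\<forall>q\<in>N. chol K q u \<and> u q \<noteq> 0) \<and>
      generically (csub K N) (\<lambda>q. f i (T q) = (\<Prod>l=1..k. x q l powi d i l) * u q)" for i u
  have "\<forall>i\<in>{1..k}. \<exists>u. R i u" using am unfolding almost_monomial_def R_def by blast
  from bchoice[OF this] obtain u where uR: "\<And>i. i \<in> {1..k} \<Longrightarrow> R i (u i)" by blast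
  have u: "chol K q (u i) \<and> u i q \<noteq> 0" if "i \<in> {1..k}" "q \<in> N" for i q
    using uR[OF that(1)] that(2) by (simp add: R_def)
  have gen: "generically (csub K N) (\<lambda>q. f i (T q) = (\<Prod>l=1..k. x q l powi d i l) * u i q)"
    if "i \<in> {1..k}" for i using uR[OF that] by (simp add: R_def)
  define U where "U i w = u i (e w)" for i w
  have Uh: "hol_on k B (U i)" if "i \<in> {1..k}" for i
    unfolding U_def by (rule morphism_affine_hol_on[OF em B(1)]) (use u that eB in auto)
  have Unz: "U i w \<noteq> 0" if "i \<in> {1..k}" "w \<in> B" for i w using u eB that by (simp add: U_def)
  have Tem: "morphism (csub (affine_space k) B) X (T \<circ> e)" by (rule morphism_compose[OF em T])
  let ?B' = "{w \<in> points (csub (affine_space k) B). (T \<circ> e) w \<in> Ua}"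
  have "openin (ctop (csub (affine_space k) B)) ?B'"
    by (rule openin_continuous_map_preimage[OF morphism_cont[OF Tem] Ua(1)])
  then have "openin (Cn_top k) ?B'" using B(1) by (simp add: openin_open_subtopology)
  moreover have "(\<lambda>_. 0) \<in> ?B'" using B Ua e0 by simp
  ultimately obtain \<rho>0 where \<rho>0: "\<rho>0 > 0" "?P \<rho>0 \<subseteq> ?B'" unfolding openin_Cn_top by blast
  have Uh0: "hol_on k (?P \<rho>0) (U i)" if "i \<in> {1..k}" for i
    by (rule hol_on_subset[OF Uh[OF that]]) (use \<rho>0 in auto)
  have Upos: "cmod (U i (\<lambda>_. 0)) > 0" if "i \<in> {1..k}" for i using Unz[OF that B(2)] by simp
  \<comment> \<open>On this polydisc U_i / U_i(0) stays in the right half-plane, where the principal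
    logarithm is holomorphic.\<close>
  obtain \<rho> where \<rho>: "0 < \<rho>" "\<rho> \<le> \<rho>0"
    and Un: "\<And>i w. i \<in> {1..k} \<Longrightarrow> w \<in> ?P \<rho> \<Longrightarrow> cmod (U i w - U i (\<lambda>_. 0)) < cmod (U i (\<lambda>_. 0))"
    by (rule hol_family_near_zero[of k k \<rho>0 U "\<lambda>i. cmod (U i (\<lambda>_. 0))", OF Uh0 \<rho>0(1) Upos]) (assumption | rule that)+
  have \<rho>B: "?P \<rho> \<subseteq> ?B'" using \<rho>0 \<rho> pdisc_mono by blast
  then have \<rho>B': "?P \<rho> \<subseteq> B" by auto
  define L where "L w i = Ln (U i w / U i (\<lambda>_. 0))" for i w
  have Lh: "hol_on k (?P \<rho>) (\<lambda>w. L w i)" if i: "i \<in> {1..k}" for i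
  proof -
    have "hol_on k (?P \<rho>) (\<lambda>w. U i w / U i (\<lambda>_. 0))"
      by (intro hol_on_divide hol_on_const hol_on_subset[OF Uh[OF i] \<rho>B']) (use Unz[OF i B(2)] in simp)
    then show ?thesis unfolding L_def
    proof (rule hol_on_compose1[of _ _ _ "{z. Re z > 0}"])
      show "open {z. Re z > 0}" by (rule open_halfspace_Re_gt)
      show "Ln holomorphic_on {z. Re z > 0}"
        by (intro holomorphic_intros) (auto simp: complex_nonpos_Reals_iff)
      fix w assume w: "w \<in> ?P \<rho>"
      have U0: "U i (\<lambda>_. 0) \<noteq> 0" by (rule Unz[OF i B(2)])
      have "cmod (U i w / U i (\<lambda>_. 0) - 1) = cmod (U i w - U i (\<lambda>_. 0)) / cmod (U i (\<lambda>_. 0))"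
        using U0 by (simp add: diff_divide_distrib flip: norm_divide)
      also have "\<dots> < 1" using Un[OF i w] U0 by simp
      finally have "\<bar>Re (U i w / U i (\<lambda>_. 0) - 1)\<bar> < 1" using abs_Re_le_cmod le_less_trans by blast
      then show "U i w / U i (\<lambda>_. 0) \<in> {z. Re z > 0}" by simp
    qed
  qed
  have expL: "exp (L w i) = U i w / U i (\<lambda>_. 0)" if "i \<in> {1..k}" "w \<in> ?P \<rho>" for i w
    using Unz[OF that(1)] that(2) \<rho>B' B(2) by (auto simp: L_def)
  define v where "v l w = exp (\<Sum>j=1..k. of_rat (c l j) * L w j)" for l w
  have vh: "hol_on k (?P \<rho>) (v l)" for l
    unfolding v_def
    by (rule hol_on_compose1[where S=UNIV]) (auto intro!: hol_on_sum hol_on_mult hol_on_const Lh holomorphic_intros)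
  have vid: "U i w * (\<Prod>l=1..k. v l w ^ nat (- d i l)) = U i (\<lambda>_. 0) * (\<Prod>l=1..k. v l w ^ nat (d i l))"
    if i: "i \<in> {1..k}" and w: "w \<in> ?P \<rho>" for i w
    using unit_root_identity[OF inv i, of "L w", folded v_def] expL[OF i w] Unz[OF i B(2)]
    by (simp add: field_simps)
  obtain r s \<Psi> where r: "0 < r" "0 < s" "s \<le> \<rho>"
    and \<Psi>s: "\<And>y. y \<in> ?P r \<Longrightarrow> \<Psi> y \<in> ?P s"
    and \<Psi>v: "\<And>y l. y \<in> ?P r \<Longrightarrow> l \<in> {1..k} \<Longrightarrow> \<Psi> y l * v l (\<Psi> y) = y l"
    and \<Psi>h: "\<And>l. hol_on k (?P r) (\<lambda>y. \<Psi> y l)"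
    and \<Psi>u: "\<And>x y. x \<in> ?P s \<Longrightarrow> y \<in> ?P r \<Longrightarrow> (\<And>l. l \<in> {1..k} \<Longrightarrow> x l * v l x = y l) \<Longrightarrow> \<Psi> y = x"
    by (rule inverse_of_unit_scaling[of k \<rho> v]) (use vh \<rho> in \<open>auto simp: v_def\<close>)
  have sB: "?P s \<subseteq> B" using r pdisc_mono \<rho>B' by blast
  define F where "F l w = w l * v l w" for l and w :: "nat \<Rightarrow> complex"
  have Fh: "hol_on k (?P s) (F l)" for l
    unfolding F_def using hol_on_subset[OF vh pdisc_mono[OF r(3)]] by (intro hol_on_mult hol_on_coord)
  define y where "y = tuple k F \<circ> x"
  define E where "E = e \<circ> \<Psi>"
  define N1 where "N1 = {q \<in> N. x q \<in> ?P s}"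
  define Q where "Q = {q \<in> N1. y q \<in> ?P r}"
  have opN1: "openin (ctop K) N1"
    using openin_continuous_map_preimage[OF morphism_cont[OF xm], of "?P s"] NS N(1)
    by (simp add: openin_open_subtopology N1_def inf_absorb2)
  have ym: "morphism (csub K N1) (affine_space k) y"
    unfolding y_def
  proof (rule morphism_compose[OF _ morphism_tuple[OF openin_pdisc Fh]])
    show "morphism (csub K N1) (csub (affine_space k) (?P s)) x"
      by (rule morphism_into_csub[OF germ_closed_csub morphism_csub_mono[OF xm]]) (auto simp: N1_def)
  qed
  have opQ: "openin (ctop K) Q"
    using openin_continuous_map_preimage[OF morphism_cont[OF ym], of "?P r"] opN1 openin_subset[OF opN1]
    by (simp add: openin_open_subtopology Q_def inf_absorb2)
  have \<Psi>t: "\<Psi> w = tuple k (\<lambda>l w. \<Psi> w l) w" if "w \<in> ?P r" for w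
    by (rule Cn_eqI[of _ k]) (use \<Psi>s[OF that] in \<open>auto simp: pdisc_def tuple_def Cn_def\<close>)
  have "morphism (csub (affine_space k) (?P r)) (affine_space k) (tuple k (\<lambda>l w. \<Psi> w l))"
    by (rule morphism_tuple[OF openin_pdisc \<Psi>h])
  then have "morphism (csub (affine_space k) (?P r)) (csub (affine_space k) (?P s)) (tuple k (\<lambda>l w. \<Psi> w l))"
    by (rule morphism_into_csub[OF germ_closed_csub]) (use \<Psi>t \<Psi>s in auto)
  from morphism_compose[OF this morphism_csub_mono[OF em sB]]
  have Em': "morphism (csub (affine_space k) (?P r)) K (e \<circ> tuple k (\<lambda>l w. \<Psi> w l))" .
  have Em: "morphism (csub (affine_space k) (?P r)) K E"
    by (rule morphism_cong[OF germ_closed_csub Em']) (use \<Psi>t in \<open>auto simp: E_def\<close>)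
  have EN: "E w \<in> N" "x (E w) = \<Psi> w" if "w \<in> ?P r" for w
    using eB \<Psi>s[OF that] sB by (auto simp: E_def)
  have yE: "y (E w) = w" if w: "w \<in> ?P r" for w
    by (rule Cn_eqI[of _ k]) (use w EN[OF w] \<Psi>v[OF w] in \<open>auto simp: y_def tuple_def F_def pdisc_def Cn_def\<close>)
  have EQ: "E w \<in> Q" if w: "w \<in> ?P r" for w
    using EN[OF w] \<Psi>s[OF w] yE[OF w] w by (auto simp: Q_def N1_def)
  have Ey: "E (y q) = q" if q: "q \<in> Q" for q
  proof -
    have "\<Psi> (y q) = x q"
      by (rule \<Psi>u) (use q in \<open>auto simp: Q_def N1_def y_def tuple_def F_def\<close>)
    then show ?thesis using q xN by (auto simp: E_def Q_def N1_def)
  qed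
  have cd: "coord_disc K k r E y Q"
    unfolding coord_disc_def
    using r opQ Em EQ yE Ey morphism_csub_mono[OF ym, of Q] by (auto simp: Q_def)
  have 0: "\<Psi> (\<lambda>_. 0) = (\<lambda>_. 0)" by (rule \<Psi>u) (use r in auto)
  have E0: "E (\<lambda>_. 0) = b" using 0 e0 by (simp add: E_def)
  have bQ: "b \<in> Q" using EQ[of "\<lambda>_. 0"] E0 r by simp
  have \<Psi>z: "\<Psi> w l = 0 \<longleftrightarrow> w l = 0" if "w \<in> ?P r" "l \<in> {1..k}" for w l
    using \<Psi>v[OF that] by (metis exp_not_eq_zero mult_eq_0_iff v_def)
  have EW: "E w \<in> W j \<longleftrightarrow> (\<forall>i\<in>{Suc j..k}. w i = 0)" if w: "w \<in> ?P r" and j: "j \<le> k" for w j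
  proof -
    have "W j \<inter> N = {q \<in> N. \<forall>i\<in>{Suc j..k}. x q i = 0}"
      using good j by (simp add: good_coordinates_def)
    then have "E w \<in> W j \<inter> N \<longleftrightarrow> E w \<in> {q \<in> N. \<forall>i\<in>{Suc j..k}. x q i = 0}" by simp
    then have "E w \<in> W j \<longleftrightarrow> (\<forall>i\<in>{Suc j..k}. x (E w) i = 0)" using EN[OF w] by simp
    also have "\<dots> \<longleftrightarrow> (\<forall>i\<in>{Suc j..k}. w i = 0)" using \<Psi>z[OF w] EN(2)[OF w] by auto
    finally show ?thesis .
  qed
  have ED: "\<exists>l\<in>{1..k}. w l = 0" if w: "w \<in> ?P r" and "E w \<in> \<Union>D" for w
  proof -
    have "\<Union>D \<inter> N \<subseteq> {q \<in> N. (\<Prod>i=1..k. x q i) = 0}" using good by (simp add: good_coordinates_def)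
    moreover have "E w \<in> \<Union>D \<inter> N" using EN[OF w] that by blast
    ultimately have "E w \<in> {q \<in> N. (\<Prod>i=1..k. x q i) = 0}" by (rule subsetD)
    then have "(\<Prod>i=1..k. \<Psi> w i) = 0" using EN[OF w] by simp
    then show ?thesis using \<Psi>z[OF w] by (auto simp: prod_zero_iff)
  qed
  have EU: "T (E w) \<in> Ua" if w: "w \<in> ?P r" for w
    using \<Psi>s[OF w] pdisc_mono[OF r(3)] \<rho>B by (auto simp: E_def)
  \<comment> \<open>The monomial form holds off a nowhere dense set, the quotient formula where h_i
    is nonzero, and Laurent powers are cleared at nonzero coordinates. All three conditions hold
    together on a dense set, and both sides are continuous.\<close>
  have xid: "g i (T (e z)) * (\<Prod>l=1..k. z l ^ nat (- d i l)) = h i (T (e z)) * (\<Prod>l=1..k. z l ^ nat (d i l)) * U i z"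
    if i: "i \<in> {1..k}" and z: "z \<in> ?P \<rho>" for i z
  proof -
    have Teh: "hol_on k (?P \<rho>) (\<lambda>z. G (T (e z)))" if "\<And>q. q \<in> Ua \<Longrightarrow> chol X q G" for G
    proof -
      have "hol_on k (?P \<rho>) (\<lambda>z. G ((T \<circ> e) z))"
        by (rule morphism_affine_hol_on[OF morphism_csub_mono[OF Tem \<rho>B'] openin_pdisc]) (use \<rho>B that in auto)
      then show ?thesis by simp
    qed
    have gH: "hol_on k (?P \<rho>) (\<lambda>z. g i (T (e z)))" "hol_on k (?P \<rho>) (\<lambda>z. h i (T (e z)))"
      using gh[OF i] by (auto intro: Teh)
    obtain A where A: "nowhere_dense_analytic (csub K N) A"
      and gA: "\<And>q. q \<in> points (csub K N) - A \<Longrightarrow> f i (T q) = (\<Prod>l=1..k. x q l powi d i l) * u i q"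
      using gen[OF i] unfolding generically_def by blast
    have d1: "dense_on k (?P \<rho>) {z. e z \<notin> A}"
      unfolding dense_on_def
    proof (intro allI impI notI)
      fix V assume V: "openin (Cn_top k) V" "V \<noteq> {}" "V \<subseteq> ?P \<rho>" "V \<inter> {z. e z \<notin> A} = {}"
      let ?S = "{q \<in> N. x q \<in> V}"
      have "openin (ctop (csub K N)) ?S"
        using openin_continuous_map_preimage[OF morphism_cont[OF xm], of V] V(1) NS by (simp add: inf_absorb2)
      moreover have "?S \<subseteq> A" using V(4) xN by force
      ultimately have "?S \<subseteq> ctop (csub K N) interior_of A" by (rule interior_of_maximal[rotated])
      moreover obtain z where "z \<in> V" using V(2) by auto
      then have "e z \<in> ?S" using eB V(3) \<rho>B' by auto
      ultimately show False using A by (auto simp: nowhere_dense_analytic_def)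
    qed
    have "openin (ctop K) {q \<in> N. x q \<in> ?P \<rho>}"
      using openin_continuous_map_preimage[OF morphism_cont[OF xm], of "?P \<rho>"] NS N(1)
      by (simp add: openin_open_subtopology inf_absorb2)
    from nv[OF i this] N \<rho> obtain q where q: "q \<in> N" "x q \<in> ?P \<rho>" "h i (T q) \<noteq> 0" by auto
    have d2: "dense_on k (?P \<rho>) {z. h i (T (e z)) \<noteq> 0}"
      by (rule dense_nonzero[OF gH(2) q(2)]) (use xN q in auto)
    have "openin (Cn_top k) {z \<in> ?P \<rho>. h i (T (e z)) \<in> -{0}}"
      by (rule openin_Cn_vimage[OF openin_pdisc hol_on_cont[OF gH(2)]]) auto
    moreover have "{z \<in> ?P \<rho>. h i (T (e z)) \<in> -{0}} = ?P \<rho> \<inter> {z. h i (T (e z)) \<noteq> 0}" by auto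
    ultimately have d12: "dense_on k (?P \<rho>) ({z. e z \<notin> A} \<inter> {z. h i (T (e z)) \<noteq> 0})"
      by (intro dense_on_Int[OF d1 d2]) simp
    have "openin (Cn_top k) {z \<in> ?P \<rho>. (\<Prod>l=1..k. z l ^ 1) \<in> -{0}}"
      by (rule openin_Cn_vimage[OF openin_pdisc hol_on_cont[OF hol_on_monomial]]) auto
    moreover have "{z \<in> ?P \<rho>. (\<Prod>l=1..k. z l ^ 1) \<in> -{0}} = ?P \<rho> \<inter> {z. \<forall>l\<in>{1..k}. z l \<noteq> 0}" by auto
    ultimately have d: "dense_on k (?P \<rho>) ({z. e z \<notin> A} \<inter> {z. h i (T (e z)) \<noteq> 0} \<inter> {z. \<forall>l\<in>{1..k}. z l \<noteq> 0})"
      by (intro dense_on_Int[OF d12 dense_coords_nonzero[OF \<rho>(1)]]) simp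
    show ?thesis
    proof (rule eq_on_dense[OF openin_pdisc d _ _ _ z])
      show "continuous_on (?P \<rho>) (\<lambda>z. g i (T (e z)) * (\<Prod>l=1..k. z l ^ nat (- d i l)))"
        by (intro hol_on_cont[of k] hol_on_mult gH hol_on_monomial)
      show "continuous_on (?P \<rho>) (\<lambda>z. h i (T (e z)) * (\<Prod>l=1..k. z l ^ nat (d i l)) * U i z)"
        by (intro hol_on_cont[of k] hol_on_mult gH hol_on_monomial hol_on_subset[OF Uh[OF i] \<rho>B'])
      fix z assume z: "z \<in> ?P \<rho>" and
        zS: "z \<in> {z. e z \<notin> A} \<inter> {z. h i (T (e z)) \<noteq> 0} \<inter> {z. \<forall>l\<in>{1..k}. z l \<noteq> 0}"
      have zB: "z \<in> B" using z \<rho>B' by auto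
      then have "e z \<in> points (csub K N) - A" using eB NS zS by auto
      from gA[OF this] have "f i (T (e z)) = (\<Prod>l=1..k. z l powi d i l) * U i z" using eB[OF zB] by (simp add: U_def)
      moreover have "T (e z) \<in> Ua" using z \<rho>B by auto
      ultimately have "g i (T (e z)) = h i (T (e z)) * ((\<Prod>l=1..k. z l powi d i l) * U i z)"
        using fgh[OF i, of "T (e z)"] zS by (simp add: field_simps)
      moreover have "(\<Prod>l=1..k. z l powi d i l) * (\<Prod>l=1..k. z l ^ nat (- d i l)) = (\<Prod>l=1..k. z l ^ nat (d i l))"
        unfolding prod.distrib[symmetric] by (rule prod.cong) (use zS powi_times_power_neg in auto)
      ultimately show "g i (T (e z)) * (\<Prod>l=1..k. z l ^ nat (- d i l)) = h i (T (e z)) * (\<Prod>l=1..k. z l ^ nat (d i l)) * U i z"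
        by (simp add: mult_ac)
    qed
  qed
  have id: "g i (T (E w)) * (\<Prod>l=1..k. w l ^ nat (- d i l)) = U i (\<lambda>_. 0) * h i (T (E w)) * (\<Prod>l=1..k. w l ^ nat (d i l))"
    if i: "i \<in> {1..k}" and w: "w \<in> ?P r" for i w
  proof -
    define z where "z = \<Psi> w"
    have z: "z \<in> ?P \<rho>" using \<Psi>s[OF w] pdisc_mono[OF r(3)] by (auto simp: z_def)
    have pw: "(\<Prod>l=1..k. w l ^ n l) = (\<Prod>l=1..k. z l ^ n l) * (\<Prod>l=1..k. v l z ^ n l)" for n :: "nat \<Rightarrow> nat"
      unfolding prod.distrib[symmetric]
      by (rule prod.cong) (use \<Psi>v[OF w] in \<open>auto simp: z_def simp flip: power_mult_distrib\<close>)
    have "g i (T (e z)) * (\<Prod>l=1..k. w l ^ nat (- d i l))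
        = (g i (T (e z)) * (\<Prod>l=1..k. z l ^ nat (- d i l))) * (\<Prod>l=1..k. v l z ^ nat (- d i l))"
      by (simp only: pw mult.assoc)
    also have "\<dots> = h i (T (e z)) * (\<Prod>l=1..k. z l ^ nat (d i l)) * (U i z * (\<Prod>l=1..k. v l z ^ nat (- d i l)))"
      by (simp only: xid[OF i z] mult.assoc)
    also have "\<dots> = U i (\<lambda>_. 0) * h i (T (e z)) * ((\<Prod>l=1..k. z l ^ nat (d i l)) * (\<Prod>l=1..k. v l z ^ nat (d i l)))"
      by (simp only: vid[OF i z] mult_ac)
    finally show ?thesis by (simp only: pw z_def E_def o_apply mult.assoc)
  qed
  define \<gamma> where "\<gamma> i = (if i \<in> {1..k} then U i (\<lambda>_. 0) else 1)" for i
  have "\<gamma> i \<noteq> 0" for i using Unz[of i] B(2) by (simp add: \<gamma>_def)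
  then show ?thesis
    by (intro that[OF cd bQ E0 EW ED EU, of \<gamma>]) (use id in \<open>auto simp: \<gamma>_def\<close>)
qed

section \<open>Laurent monomials and transitions between monomial coordinates\<close>

lemma power_int_sum: "z \<noteq> 0 \<Longrightarrow> (z :: complex) powi (\<Sum>i\<in>I. a i) = (\<Prod>i\<in>I. z powi a i)"
  by (induction I rule: infinite_finite_induct) (auto simp: power_int_add)

lemma power_int_prod: "(\<Prod>i\<in>I. f i :: complex) powi a = (\<Prod>i\<in>I. f i powi a)"
  by (induction I rule: infinite_finite_induct) (auto simp: power_int_mult_distrib)

lemma monomial_substitution:
  fixes w :: "nat \<Rightarrow> complex"
  assumes w: "\<And>m. m \<in> J \<Longrightarrow> w m \<noteq> 0"
  shows "(\<Prod>i\<in>I. (\<delta> i * (\<Prod>m\<in>J. w m powi D i m)) powi C i) =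
    (\<Prod>i\<in>I. \<delta> i powi C i) * (\<Prod>m\<in>J. w m powi (\<Sum>i\<in>I. C i * D i m))"
proof -
  have "(\<Prod>i\<in>I. \<Prod>m\<in>J. w m powi (D i m * C i)) = (\<Prod>m\<in>J. \<Prod>i\<in>I. w m powi (D i m * C i))"
    by (rule prod.swap)
  also have "\<dots> = (\<Prod>m\<in>J. w m powi (\<Sum>i\<in>I. C i * D i m))"
    using w by (intro prod.cong) (auto simp: power_int_sum mult.commute)
  finally show ?thesis
    by (simp add: power_int_mult_distrib power_int_prod prod.distrib power_int_mult)
qed

lemma common_denominator:
  fixes c :: "nat \<Rightarrow> nat \<Rightarrow> rat"
  obtains M :: nat where "M > 0" "\<And>i j. i \<le> k \<Longrightarrow> j \<le> k \<Longrightarrow> of_nat M * c i j \<in> \<int>"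
proof -
  define den where "den i j = nat (snd (quotient_of (c i j)))" for i j
  define M where "M = (\<Prod>i\<le>k. \<Prod>j\<le>k. den i j)"
  have den: "den i j > 0" for i j by (simp add: den_def quotient_of_denom_pos')
  have int: "of_nat (den i j) * c i j \<in> \<int>" for i j
  proof -
    obtain p q where pq: "quotient_of (c i j) = (p, q)" by (cases "quotient_of (c i j)") auto
    then have q: "q > 0" "c i j = of_int p / of_int q" by (auto simp: quotient_of_denom_pos quotient_of_div)
    have "of_nat (den i j) = (of_int q :: rat)" using q(1) by (simp add: den_def pq)
    then have "of_nat (den i j) * c i j = of_int p" using q by simp
    then show ?thesis by simp
  qed
  show ?thesis
  proof (rule that[of M])
    show "M > 0" using den by (auto simp: M_def intro!: prod_pos)
    fix i j assume ij: "i \<le> k" "j \<le> k"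
    have "den i j dvd (\<Prod>j\<le>k. den i j)" using ij by (intro dvd_prodI) auto
    also have "(\<Prod>j\<le>k. den i j) dvd M" unfolding M_def using ij by (intro dvd_prodI) auto
    finally obtain a where "M = den i j * a" by (elim dvdE)
    then have "of_nat M * c i j = of_nat a * (of_nat (den i j) * c i j)" by simp
    then show "of_nat M * c i j \<in> \<int>" using int[of i j] by (metis Ints_mult Ints_of_nat)
  qed
qed

text \<open>The cleared form makes sense on the hyperplanes, the Laurent form can be raised to
  integer powers. This lemma and \<open>prod_powi_to_power\<close> pass between them where no
  coordinate vanishes.\<close>

lemma prod_power_to_powi:
  assumes "\<And>l. l \<in> I \<Longrightarrow> w l \<noteq> (0 :: complex)" "G * (\<Prod>l\<in>I. w l ^ nat (- D l)) = a * (\<Prod>l\<in>I. w l ^ nat (D l))"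
  shows "G = a * (\<Prod>l\<in>I. w l powi D l)"
proof -
  have "(\<Prod>l\<in>I. w l powi D l) * (\<Prod>l\<in>I. w l ^ nat (- D l)) = (\<Prod>l\<in>I. w l ^ nat (D l))"
    unfolding prod.distrib[symmetric] by (rule prod.cong) (use assms powi_times_power_neg in auto)
  then have "(G - a * (\<Prod>l\<in>I. w l powi D l)) * (\<Prod>l\<in>I. w l ^ nat (- D l)) = 0"
    using assms(2) by (simp add: left_diff_distrib mult.assoc)
  moreover have "(\<Prod>l\<in>I. w l ^ nat (- D l)) \<noteq> 0" using assms(1) by (cases "finite I") auto
  ultimately show ?thesis by simp
qed

lemma prod_powi_to_power:
  assumes "\<And>l. l \<in> I \<Longrightarrow> w l \<noteq> (0 :: complex)" "G = a * (\<Prod>l\<in>I. w l powi D l)"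
  shows "G * (\<Prod>l\<in>I. w l ^ nat (- D l)) = a * (\<Prod>l\<in>I. w l ^ nat (D l))"
proof -
  have "(\<Prod>l\<in>I. w l powi D l) * (\<Prod>l\<in>I. w l ^ nat (- D l)) = (\<Prod>l\<in>I. w l ^ nat (D l))"
    unfolding prod.distrib[symmetric] by (rule prod.cong) (use assms powi_times_power_neg in auto)
  then show ?thesis by (simp add: assms(2) mult.assoc)
qed

lemma dense_all_nonzero:
  assumes r: "r > 0" and H: "\<And>i. i \<in> I \<Longrightarrow> hol_on j (pdisc j (\<lambda>_. 0) r) (H i)" and I: "finite I"
    and nz: "\<And>i. i \<in> I \<Longrightarrow> \<exists>w\<in>pdisc j (\<lambda>_. 0) r. H i w \<noteq> 0"
  shows "dense_on j (pdisc j (\<lambda>_. 0) r) {w. (\<forall>m\<in>{1..j}. w m \<noteq> 0) \<and> (\<forall>i\<in>I. H i w \<noteq> 0)}"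
  using I H nz
proof (induction I rule: finite_induct)
  case empty
  then show ?case using dense_coords_nonzero[OF r, of j] by simp
next
  case (insert i I)
  let ?P = "pdisc j (\<lambda>_. 0) r"
  have d: "dense_on j ?P {w. H i w \<noteq> 0}" using dense_nonzero insert.prems by blast
  have "openin (Cn_top j) {w \<in> ?P. H i w \<in> -{0}}"
    by (rule openin_Cn_vimage[OF openin_pdisc hol_on_cont]) (use insert.prems in auto)
  moreover have "{w \<in> ?P. H i w \<in> -{0}} = ?P \<inter> {w. H i w \<noteq> 0}" by auto
  ultimately have "dense_on j ?P ({w. (\<forall>m\<in>{1..j}. w m \<noteq> 0) \<and> (\<forall>i\<in>I. H i w \<noteq> 0)} \<inter> {w. H i w \<noteq> 0})"
    by (intro dense_on_Int[OF _ d] insert) (use insert.prems in auto)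
  then show ?case by (rule dense_on_mono) auto
qed

text \<open>Comparing, on a dense set, the two expressions of \<open>G\<^sub>i / H\<^sub>i\<close> as Laurent monomials in \<open>q\<close> and in
  \<open>w\<close> shows that a power of each \<open>q\<^sub>l\<close> is a Laurent monomial in \<open>w\<close>.\<close>

lemma monomial_transition:
  fixes D D' :: "nat \<Rightarrow> nat \<Rightarrow> int"
  assumes r: "r > 0" and q: "\<And>l. l \<in> {1..j} \<Longrightarrow> hol_on j (pdisc j (\<lambda>_. 0) r) (q l)"
    and H: "\<And>i. i \<in> {1..j} \<Longrightarrow> hol_on j (pdisc j (\<lambda>_. 0) r) (H i)"
    and nz: "\<And>i. i \<in> {1..j} \<Longrightarrow> \<exists>w\<in>pdisc j (\<lambda>_. 0) r. H i w \<noteq> 0"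
    and inv: "mutually_inverse j c D"
    and tri: "\<And>i l. i \<in> {1..j} \<Longrightarrow> l \<in> {Suc i..j} \<Longrightarrow> D i l = 0" and diag: "\<And>i. i \<in> {1..j} \<Longrightarrow> D i i \<noteq> 0"
    and \<gamma>: "\<And>i. \<gamma> i \<noteq> 0" "\<And>i. \<gamma>' i \<noteq> 0"
    and eq: "\<And>i w. i \<in> {1..j} \<Longrightarrow> w \<in> pdisc j (\<lambda>_. 0) r \<Longrightarrow>
       G i w * (\<Prod>l=1..j. q l w ^ nat (- D i l)) = \<gamma> i * H i w * (\<Prod>l=1..j. q l w ^ nat (D i l))"
    and eq': "\<And>i w. i \<in> {1..j} \<Longrightarrow> w \<in> pdisc j (\<lambda>_. 0) r \<Longrightarrow>
       G i w * (\<Prod>l=1..j. w l ^ nat (- D' i l)) = \<gamma>' i * H i w * (\<Prod>l=1..j. w l ^ nat (D' i l))"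
    and l: "l \<in> {1..j}"
  obtains e b where "b \<noteq> 0" "\<And>w. w \<in> pdisc j (\<lambda>_. 0) r \<Longrightarrow> q l w = b * (\<Prod>m=1..j. w m ^ e m)"
    "\<And>m. m \<in> {1..j} \<Longrightarrow> of_nat (e m) = (\<Sum>i=1..j. c l i * of_int (D' i m))"
proof -
  let ?P = "pdisc j (\<lambda>_. 0) r"
  let ?S = "{w. (\<forall>m\<in>{1..j}. w m \<noteq> 0) \<and> (\<forall>i\<in>{1..j}. H i w \<noteq> 0)}"
  obtain M :: nat where M: "M > 0" "\<And>a b. a \<le> j \<Longrightarrow> b \<le> j \<Longrightarrow> of_nat M * c a b \<in> \<int>"
    by (rule common_denominator[of j c]) (rule that, assumption+)
  \<comment> \<open>An integral multiple of row \<open>l\<close> of the inverse matrix, so that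
    powers with these exponents need no branches.\<close>
  define C where "C i = \<lfloor>of_nat M * c l i\<rfloor>" for i
  have C: "of_int (C i) = of_nat M * c l i" if "i \<in> {1..j}" for i
    using M(2)[of l i] that l by (auto simp: C_def elim: Ints_cases)
  define \<kappa> where "\<kappa> = (\<Prod>i=1..j. (\<gamma>' i / \<gamma> i) powi C i)"
  have \<kappa>: "\<kappa> \<noteq> 0" using \<gamma> by (auto simp: \<kappa>_def)
  define A where "A m = (\<Sum>i=1..j. C i * D' i m)" for m
  have ev: "q l w ^ M = \<kappa> * (\<Prod>m=1..j. w m powi A m)" if w: "w \<in> ?P" "w \<in> ?S" for w
  proof -
    have Gw: "G i w = (\<gamma>' i * H i w) * (\<Prod>m=1..j. w m powi D' i m)" if "i \<in> {1..j}" for i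
      by (rule prod_power_to_powi) (use w eq'[OF that w(1)] in auto)
    have Gnz: "G i w \<noteq> 0" if "i \<in> {1..j}" for i
      using Gw[OF that] that w(2) \<gamma> by (auto simp: prod_zero_iff power_int_eq_0_iff)
    \<comment> \<open>By triangularity, relation \<open>p\<close> involves q_1, ..., q_p only, and
      q_p with nonzero exponent. If q_p vanished, one side of the cleared relation would be 0 and
      the other would not.\<close>
    have qnz: "q p w \<noteq> 0" if "p \<in> {1..j}" for p
      using that
    proof (induction p rule: less_induct)
      case (less p)
      \<comment> \<open>The parameter \<open>a\<close> is 1 or -1, so that one computation covers
        the products on both sides.\<close>
      define R where "R a = (\<Prod>m\<in>{1..<p}. q m w ^ nat (a * D p m))" for a
      have pr: "(\<Prod>m=1..j. q m w ^ nat (a * D p m)) = R a * q p w ^ nat (a * D p p)" for a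
      proof -
        have "(\<Prod>m=1..j. q m w ^ nat (a * D p m)) = (\<Prod>m\<in>{1..p}. q m w ^ nat (a * D p m))"
          using less.prems tri[OF less.prems] by (intro prod.mono_neutral_right) auto
        also have "{1..p} = insert p {1..<p}" using less.prems by auto
        finally show ?thesis by (simp add: R_def mult.commute)
      qed
      have "R a \<noteq> 0" for a
        unfolding R_def using less by (auto simp: prod_zero_iff)
      moreover have "G p w * (\<Prod>m=1..j. q m w ^ nat (-1 * D p m)) = \<gamma> p * H p w * (\<Prod>m=1..j. q m w ^ nat (1 * D p m))"
        using eq[OF less.prems w(1)] by simp
      moreover have "\<gamma> p * H p w \<noteq> 0" using w less.prems \<gamma> by auto
      ultimately show ?case unfolding pr
        using Gnz[OF less.prems] diag[OF less.prems] by (cases "D p p > 0") (auto simp: zero_power)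
    qed
    have "G i w = (\<gamma> i * H i w) * (\<Prod>m=1..j. q m w powi D i m)" if "i \<in> {1..j}" for i
      by (rule prod_power_to_powi) (use qnz eq[OF that w(1)] in auto)
    then have rel: "1 * (\<Prod>m=1..j. q m w powi D i m) = (\<gamma>' i / \<gamma> i) * (\<Prod>m=1..j. w m powi D' i m)" if "i \<in> {1..j}" for i
      using Gw[OF that] that w(2) \<gamma>[of i] by (simp add: field_simps)
    have "(\<Prod>i=1..j. (1 * (\<Prod>m=1..j. q m w powi D i m)) powi C i) = \<kappa> * (\<Prod>m=1..j. w m powi A m)"
      unfolding \<kappa>_def A_def using rel w(2)
      by (subst monomial_substitution[symmetric]) (auto intro!: prod.cong)
    also have "(\<Prod>i=1..j. (1 * (\<Prod>m=1..j. q m w powi D i m)) powi C i)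
        = (\<Prod>m=1..j. q m w powi (\<Sum>i=1..j. C i * D i m))"
      by (subst monomial_substitution) (use qnz in auto)
    \<comment> \<open>\<open>C\<close> times the matrix \<open>D\<close> is \<open>M\<close> times
      the l-th unit vector, which leaves the single power q_l^M.\<close>
    also have "\<dots> = (\<Prod>m=1..j. if m = l then q m w ^ M else 1)"
    proof (rule prod.cong[OF refl])
      fix m assume m: "m \<in> {1..j}"
      have "(\<Sum>i=1..j. of_int (C i * D i m)) = (\<Sum>i=1..j. of_nat M * (c l i * of_int (D i m)))"
        by (rule sum.cong) (auto simp: C)
      also have "\<dots> = of_nat M * (if l = m then 1 else 0 :: rat)"
        using inv l m by (simp add: mutually_inverse_def flip: sum_distrib_left)
      finally have "of_int (\<Sum>i=1..j. C i * D i m) = (of_int (if l = m then int M else 0) :: rat)"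
        unfolding of_int_sum by (cases "l = m") simp_all
      then have "(\<Sum>i=1..j. C i * D i m) = (if l = m then int M else 0)"
        by (simp only: of_int_eq_iff)
      then show "q m w powi (\<Sum>i=1..j. C i * D i m) = (if m = l then q m w ^ M else 1)" by auto
    qed
    also have "\<dots> = q l w ^ M" using l by simp
    finally show ?thesis .
  qed
  have d: "dense_on j ?P ?S" by (rule dense_all_nonzero[OF r H _ nz]) auto
  have "q l w ^ M * (\<Prod>m=1..j. w m ^ nat (- A m)) = \<kappa> * (\<Prod>m=1..j. w m ^ nat (A m))" if w: "w \<in> ?P" for w
  proof (rule eq_on_dense[OF openin_pdisc d _ _ _ w])
    show "continuous_on ?P (\<lambda>w. q l w ^ M * (\<Prod>m=1..j. w m ^ nat (- A m)))"
      by (intro hol_on_cont[of j] hol_on_mult hol_on_power q l hol_on_monomial)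
    show "continuous_on ?P (\<lambda>w. \<kappa> * (\<Prod>m=1..j. w m ^ nat (A m)))"
      by (intro hol_on_cont[of j] hol_on_mult hol_on_const hol_on_monomial)
    fix w assume w: "w \<in> ?P" "w \<in> ?S"
    show "q l w ^ M * (\<Prod>m=1..j. w m ^ nat (- A m)) = \<kappa> * (\<Prod>m=1..j. w m ^ nat (A m))"
      by (rule prod_powi_to_power[OF _ ev[OF w]]) (use w in auto)
  qed
  then obtain e b where e: "b \<noteq> 0" "\<And>i. i \<in> {1..j} \<Longrightarrow> A i = int M * int (e i)"
    "\<And>w. w \<in> ?P \<Longrightarrow> q l w = b * (\<Prod>i=1..j. w i ^ e i)"
    by (rule root_of_monomial[OF q[OF l] r M(1) \<kappa>]) (assumption | rule that)+
  have "of_nat (e m) = (\<Sum>i=1..j. c l i * of_int (D' i m))" if m: "m \<in> {1..j}" for m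
  proof -
    have "of_nat M * of_nat (e m) = (of_int (A m) :: rat)" using e(2)[OF m] by simp
    also have "\<dots> = (\<Sum>i=1..j. of_nat M * (c l i * of_int (D' i m)))"
      unfolding A_def of_int_sum by (rule sum.cong) (auto simp: C)
    also have "\<dots> = of_nat M * (\<Sum>i=1..j. c l i * of_int (D' i m))" by (simp add: sum_distrib_left)
    finally show ?thesis using M(1) by simp
  qed
  with e(1,3) show ?thesis by (rule that)
qed

section \<open>The tower of resolutions\<close>

lemma coord_disc_image_open:
  assumes cd: "coord_disc K k r E y Q" and U: "openin (Cn_top k) U" "U \<subseteq> pdisc k (\<lambda>_. 0) r"
  shows "openin (ctop K) (E ` U)" "E ` U \<subseteq> Q"
proof -
  have Q: "openin (ctop K) Q" "Q \<subseteq> points K" using cd openin_subset unfolding coord_disc_def by blast+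
  have y: "morphism (csub K Q) (affine_space k) y"
    and Ey: "\<And>w. w \<in> pdisc k (\<lambda>_. 0) r \<Longrightarrow> E w \<in> Q \<and> y (E w) = w" "\<And>q. q \<in> Q \<Longrightarrow> E (y q) = q"
    using cd by (auto simp: coord_disc_def)
  show "E ` U \<subseteq> Q" using Ey U by blast
  have "E ` U = {q \<in> Q. y q \<in> U}"
  proof (intro equalityI subsetI)
    fix q assume "q \<in> {q \<in> Q. y q \<in> U}"
    then show "q \<in> E ` U" using Ey(2)[of q] by (metis (mono_tags, lifting) imageI mem_Collect_eq)
  qed (use Ey U in auto)
  moreover have "openin (ctop K) {q \<in> Q. y q \<in> U}"
    using openin_continuous_map_preimage[OF morphism_cont[OF y], of U] U Q
    by (simp add: openin_open_subtopology inf_absorb2)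
  ultimately show "openin (ctop K) (E ` U)" by simp
qed

lemma tower_map_add: "tower_map \<pi> k (a + b) q = tower_map \<pi> k a (tower_map \<pi> (k + a) b q)"
  by (induction b arbitrary: q) (auto simp: add.assoc)

text \<open>A nonempty open set contains a point at which the map is a local isomorphism, and near
  such a point the map is open.\<close>

lemma local_iso_image:
  assumes gen: "generically A (local_iso_at A B f)" and Q: "openin (ctop A) Q" "Q \<noteq> {}"
  obtains S where "S \<noteq> {}" "openin (ctop B) S" "S \<subseteq> f ` Q"
proof -
  obtain A0 where A0: "ctop A interior_of A0 = {}" and li: "\<And>p. p \<in> points A - A0 \<Longrightarrow> local_iso_at A B f p"
    using gen unfolding generically_def nowhere_dense_analytic_def by blast
  have "\<not> Q \<subseteq> A0" using interior_of_maximal[OF _ Q(1), of A0] A0 Q(2) by blast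
  then obtain p where p: "p \<in> Q" "p \<in> points A - A0" using openin_subset[OF Q(1)] by blast
  obtain U U' where U: "openin (ctop A) U" "p \<in> U" "openin (ctop B) U'"
    and iso: "isomorphism (csub A U) (csub B U') f" using li[OF p(2)] unfolding local_iso_at_def by blast
  have sub: "U \<subseteq> points A" "U' \<subseteq> points B" using U openin_subset by blast+
  obtain g where fm: "morphism (csub A U) (csub B U') f" and gm: "morphism (csub B U') (csub A U) g"
    and gf: "\<And>u. u \<in> U \<Longrightarrow> g (f u) = u" and fg: "\<And>u. u \<in> U' \<Longrightarrow> f (g u) = u"
    using isomorphism_inverse[OF iso] sub by (auto simp: inf_absorb2)
  let ?S = "{s \<in> U'. g s \<in> Q}"
  have oS: "openin (ctop B) ?S"
    using openin_continuous_map_preimage[OF morphism_cont[OF morphism_csub_target[OF gm]] Q(1)] U(3) sub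
    by (simp add: openin_open_subtopology inf_absorb2)
  have "f p \<in> U'" using morphism_in[OF fm, of p] U(2) sub by auto
  then have "f p \<in> ?S" using gf[OF U(2)] p(1) by simp
  then have "?S \<noteq> {}" by auto
  moreover have "?S \<subseteq> f ` Q"
  proof
    fix u assume "u \<in> ?S"
    then show "u \<in> f ` Q" using fg[of u] by (intro image_eqI[of _ _ "g u"]) auto
  qed
  ultimately show ?thesis using oS by (intro that[of ?S])
qed

lemma pdisc_Cn_mono: "j \<le> k \<Longrightarrow> 0 < r \<Longrightarrow> pdisc j (\<lambda>_. 0) r \<subseteq> pdisc k (\<lambda>_. 0) r"
  using Cn_mono[of j k] by (force simp: pdisc_0_iff Cn_def)

text \<open>Since \<open>Cn j\<close> is literally a subset of \<open>Cn k\<close>, a function is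
  restricted to a coordinate plane without being changed: \<open>hol_on j\<close> merely asks about
  fewer variables.\<close>

lemma hol_on_restrict:
  assumes "hol_on k U f" "V \<subseteq> U" "j \<le> k"
  shows "hol_on j V f"
  using assms unfolding hol_on_def by (auto intro: continuous_on_subset)

locale flag_tower =
  fixes n :: nat and X :: "'a cspace" and V :: "nat \<Rightarrow> 'a set" and t :: "nat \<Rightarrow> 'a \<Rightarrow> complex"
    and Y :: "nat \<Rightarrow> 'a cspace" and VV :: "nat \<Rightarrow> nat \<Rightarrow> 'a set" and \<pi> :: "nat \<Rightarrow> 'a \<Rightarrow> 'a"
    and \<D> :: "nat \<Rightarrow> 'a set set" and b :: 'a and bb :: "nat \<Rightarrow> 'a"
    and N :: "nat \<Rightarrow> 'a set" and x :: "nat \<Rightarrow> 'a \<Rightarrow> nat \<Rightarrow> complex"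
    and d :: "nat \<Rightarrow> nat \<Rightarrow> nat \<Rightarrow> int" and c :: "nat \<Rightarrow> nat \<Rightarrow> nat \<Rightarrow> rat"
  assumes flag: "variety_flag X n V"
    and mero: "\<forall>k\<in>{1..n}. meromorphic_along X (V ` {k..n}) (t k)"
    and Y0: "Y 0 = X" and VV0: "\<forall>j\<le>n. VV 0 j = V j"
    and flags: "\<forall>k\<le>n. variety_flag (Y k) n (VV k)"
    and cover: "\<forall>k\<in>{1..n}. branched_covering n (Y k) (Y (k - 1)) (\<pi> k) \<and>
           degree_one (Y k) (Y (k - 1)) (\<pi> k) \<and> (\<forall>j\<le>n. \<pi> k ` VV k j \<subseteq> VV (k - 1) j)"
    and resol: "\<forall>k\<le>n. flag_resolution (csub X (V k)) k V (t ` {1..k})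
           (csub (Y k) (VV k k)) (tower_map \<pi> 0 k) (\<D> k)"
    and resol_flag: "\<forall>k\<le>n. resolution_flag (csub X (V k)) k V
           (csub (Y k) (VV k k)) (tower_map \<pi> 0 k) (VV k)"
    and b: "b \<in> VV n 0" and bb: "\<forall>k\<le>n. bb k = tower_map \<pi> k (n - k) b"
    and good: "\<forall>k\<le>n. good_coordinates (csub (Y k) (VV k k)) k (VV k) (\<D> k) (bb k) (N k) (x k)"
    and almost: "\<forall>k\<le>n. \<forall>i\<in>{1..k}. almost_monomial (csub (Y k) (VV k k)) (N k) (x k) k (d k i)
           (t i \<circ> tower_map \<pi> 0 k)"
    and tri: "\<forall>k\<in>{1..n}. d k k k = 1 \<and>
           (\<forall>i\<in>{1..k}. d k i i \<noteq> 0 \<and> (\<forall>j\<in>{Suc i..k}. d k i j = 0))"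
    and inv: "\<forall>k\<in>{1..n}. mutually_inverse k (c k) (d k)"
begin

abbreviation "T k \<equiv> tower_map \<pi> 0 k"
abbreviation "K k \<equiv> csub (Y k) (VV k k)"

section \<open>Incidences and maps in the tower\<close>

lemma inv_le: "k \<le> n \<Longrightarrow> mutually_inverse k (c k) (d k)"
  using inv by (cases "k = 0") (auto simp: mutually_inverse_def)

lemma Y_complex: "k \<le> n \<Longrightarrow> complex_space (Y k)"
  using flags by (auto simp: variety_flag_def variety_def)

lemma X_complex: "complex_space X"
  using Y_complex[of 0] Y0 by simp

lemma VV_top: "k \<le> n \<Longrightarrow> VV k n = points (Y k)"
  using flags by (auto simp: variety_flag_def)

lemma VV_mono:
  assumes "k \<le> n" "i \<le> j" "j \<le> n"
  shows "VV k i \<subseteq> VV k j"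
  using assms(2,3)
proof (induction rule: dec_induct)
  case (step m)
  then show ?case using flags assms(1) unfolding variety_flag_def by (meson Suc_le_lessD less_or_eq_imp_le order_trans)
qed auto

lemma VV_points: "k \<le> n \<Longrightarrow> j \<le> n \<Longrightarrow> VV k j \<subseteq> points (Y k)"
  using VV_mono[of k j n] VV_top by simp

lemma V_mono: "i \<le> j \<Longrightarrow> j \<le> n \<Longrightarrow> V i \<subseteq> V j"
  using VV_mono[of 0 i j] VV0 by simp

lemma V_points: "j \<le> n \<Longrightarrow> V j \<subseteq> points X"
  using VV_points[of 0 j] VV0 Y0 by simp

lemma tower_morphism: "k + m \<le> n \<Longrightarrow> morphism (Y (k + m)) (Y k) (tower_map \<pi> k m)"
proof (induction m)
  case (Suc m)
  have "branched_covering n (Y (k + Suc m)) (Y (k + Suc m - 1)) (\<pi> (k + Suc m))"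
    using cover Suc.prems by (metis add_gr_0 atLeastAtMost_iff One_nat_def Suc_leI zero_less_Suc)
  then have "morphism (Y (k + Suc m)) (Y (k + m)) (\<pi> (k + Suc m))" by (simp add: branched_covering_def)
  from morphism_compose[OF this Suc.IH] Suc.prems show ?case by (simp add: o_def)
qed simp

lemma tower_VV: "k + m \<le> n \<Longrightarrow> j \<le> n \<Longrightarrow> q \<in> VV (k + m) j \<Longrightarrow> tower_map \<pi> k m q \<in> VV k j"
proof (induction m arbitrary: q)
  case (Suc m)
  have "\<pi> (k + Suc m) ` VV (k + Suc m) j \<subseteq> VV (k + Suc m - 1) j"
    using cover Suc.prems by (metis add_gr_0 atLeastAtMost_iff One_nat_def Suc_leI zero_less_Suc)
  then have "\<pi> (k + Suc m) q \<in> VV (k + m) j" using Suc.prems by auto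
  then show ?case using Suc by simp
qed simp

lemma T_morphism: "k \<le> n \<Longrightarrow> morphism (Y k) X (T k)"
  using tower_morphism[of 0 k] Y0 by simp

lemma T_VV: "k \<le> n \<Longrightarrow> j \<le> n \<Longrightarrow> q \<in> VV k j \<Longrightarrow> T k q \<in> V j"
  using tower_VV[of 0 k j q] VV0 by simp

lemma T_theta: "j \<le> k \<Longrightarrow> T j (tower_map \<pi> j (k - j) q) = T k q"
  using tower_map_add[of \<pi> 0 j "k - j" q] by simp

lemma bb_n: "bb n = b"
  using bb by simp

lemma bb_in: "k \<le> n \<Longrightarrow> j \<le> n \<Longrightarrow> bb k \<in> VV k j"
  using tower_VV[of k "n - k" 0 b] b bb VV_mono[of k 0 j] by auto

lemma theta_bb:
  assumes "j \<le> k" "k \<le> n"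
  shows "tower_map \<pi> j (k - j) (bb k) = bb j"
proof -
  have "tower_map \<pi> j (k - j) (tower_map \<pi> (j + (k - j)) (n - k) b) = tower_map \<pi> j ((k - j) + (n - k)) b"
    by (rule tower_map_add[symmetric])
  then show ?thesis using assms bb by simp
qed

lemma T_bb: "k \<le> n \<Longrightarrow> T k (bb k) = T n b"
  using theta_bb[of 0 k] theta_bb[of 0 n] bb_n by simp

text \<open>For j < k the set V_j^k is a generic preimage, so some component through
  \<open>bb k\<close> maps to V_j as a local isomorphism at a generic point; for j = k the
  resolution itself does. As \<open>Q\<close> may be small, a function that vanishes on no open
  piece of V_j is nonzero somewhere near \<open>bb k\<close>.\<close>

lemma resolution_image_open:
  assumes jk: "j \<le> k" "k \<le> n" and Q: "openin (ctop (Y k)) Q" "bb k \<in> Q"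
  obtains S where "S \<noteq> {}" "openin (subtopology (ctop X) (V j)) S" "S \<subseteq> T k ` (Q \<inter> VV k j)"
proof (cases "j = k")
  case True
  have gen: "generically (K k) (local_iso_at (K k) (csub X (V k)) (T k))"
    using resol jk by (auto simp: flag_resolution_def branched_covering_def)
  have op: "openin (ctop (K k)) (Q \<inter> VV k k)" using Q(1) by (auto simp: openin_subtopology)
  have ne: "Q \<inter> VV k k \<noteq> {}" using bb_in[of k k] Q(2) jk by auto
  obtain S where "S \<noteq> {}" "openin (ctop (csub X (V k))) S" "S \<subseteq> T k ` (Q \<inter> VV k k)"
    by (rule local_iso_image[OF gen op ne]) (rule that, assumption+)
  then show ?thesis using that True by simp
next
  case False
  let ?A = "csub (K k) (VV k (Suc j))"
  let ?B = "csub (csub X (V k)) (V (Suc j))"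
  have "VV k j = generic_preimage ?A ?B (T k) (V j)"
    using resol_flag jk False by (auto simp: resolution_flag_def)
  moreover have "bb k \<in> VV k j" using bb_in jk by auto
  ultimately have "bb k \<in> generic_preimage ?A ?B (T k) (V j)" "generic_preimage ?A ?B (T k) (V j) = VV k j" by auto
  then obtain C where C: "bb k \<in> C" "C \<subseteq> VV k j"
    and gen: "generically (csub ?A C) (local_iso_at (csub ?A C) (csub ?B (V j)) (T k))"
    unfolding generic_preimage_def by blast
  have sub: "C \<subseteq> VV k k" "C \<subseteq> VV k (Suc j)"
    using C(2) VV_mono[of k j k] VV_mono[of k j "Suc j"] jk False by auto
  have subV: "V j \<subseteq> V k" "V j \<subseteq> V (Suc j)" using V_mono jk False by auto
  have tA: "ctop (csub ?A C) = subtopology (ctop (Y k)) C"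
    using sub by (simp add: subtopology_subtopology Int_absorb1 inf_absorb2 Int_assoc)
  have tB: "ctop (csub ?B (V j)) = subtopology (ctop X) (V j)"
    using subV by (simp add: subtopology_subtopology Int_absorb1 inf_absorb2 Int_assoc)
  have op: "openin (ctop (csub ?A C)) (Q \<inter> C)" unfolding tA using Q(1) by (auto simp: openin_subtopology)
  have ne: "Q \<inter> C \<noteq> {}" using Q(2) C by auto
  obtain S where S: "S \<noteq> {}" "openin (ctop (csub ?B (V j))) S" "S \<subseteq> T k ` (Q \<inter> C)"
    by (rule local_iso_image[OF gen op ne]) (rule that, assumption+)
  moreover have "T k ` (Q \<inter> C) \<subseteq> T k ` (Q \<inter> VV k j)" using C(2) by (intro image_mono) auto
  ultimately show ?thesis unfolding tB by (intro that[of S]) auto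
qed

text \<open>One neighbourhood and one numerator and denominator for each \<open>t i\<close>, shared
  by all levels, because comparing two levels requires the same g_i and h_i on both sides. The last
  clause is what lets the quotient be restricted to V_j.\<close>

definition quotients :: "'a set \<Rightarrow> (nat \<Rightarrow> 'a \<Rightarrow> complex) \<Rightarrow> (nat \<Rightarrow> 'a \<Rightarrow> complex) \<Rightarrow> bool" where
  "quotients U g h \<longleftrightarrow> openin (ctop X) U \<and> T n b \<in> U \<and>
     (\<forall>i\<in>{1..n}. (\<forall>q\<in>U. chol X q (g i) \<and> chol X q (h i) \<and> (h i q \<noteq> 0 \<longrightarrow> t i q = g i q / h i q)) \<and>
       (\<forall>j\<in>{i..n}. subtopology (ctop X) (V j) interior_of {q \<in> U \<inter> V j. h i q = 0} = {}))"

lemma ex_quotients: "\<exists>U g h. quotients U g h"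
proof -
  have a: "T n b \<in> points X"
    using morphism_in[OF T_morphism[of n]] VV_points[of n 0] b by auto
  define R where "R i U g h \<longleftrightarrow> openin (ctop X) U \<and> T n b \<in> U \<and>
     (\<forall>q\<in>U. chol X q g \<and> chol X q h) \<and>
     (\<forall>Z\<in>insert (points X) (V ` {i..n}). ctop (csub X Z) interior_of {q\<in>U \<inter> Z. h q = 0} = {}) \<and>
     (\<forall>q\<in>U. h q \<noteq> 0 \<longrightarrow> t i q = g q / h q)" for i U g h
  have "\<exists>U g h. R i U g h" if "i \<in> {1..n}" for i
    unfolding R_def using mero that a unfolding meromorphic_along_def by blast
  then obtain U g h where R: "\<And>i. i \<in> {1..n} \<Longrightarrow> R i (U i) (g i) (h i)" by metis
  \<comment> \<open>Intersecting with all points covers n = 0, where the family of neighbourhoods is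
    empty.\<close>
  define W where "W = points X \<inter> (\<Inter>i\<in>{1..n}. U i)"
  have W: "openin (ctop X) W"
  proof (cases "{1..n} = {}")
    case False
    have "openin (ctop X) (\<Inter>i\<in>{1..n}. U i)" using False R by (intro openin_INT2) (auto simp: R_def)
    then show ?thesis unfolding W_def by (metis openin_Int openin_topspace)
  qed (simp add: W_def)
  have "quotients W g h"
    unfolding quotients_def
  proof (intro conjI ballI impI)
    show "T n b \<in> W" using a R by (auto simp: W_def R_def)
    fix i j assume i: "i \<in> {1..n}" and j: "j \<in> {i..n}"
    have "subtopology (ctop X) (V j) interior_of {q \<in> U i \<inter> V j. h i q = 0} = {}"
      using R[OF i] j by (auto simp: R_def)
    moreover have "{q \<in> W \<inter> V j. h i q = 0} \<subseteq> {q \<in> U i \<inter> V j. h i q = 0}" using i by (auto simp: W_def)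
    ultimately show "subtopology (ctop X) (V j) interior_of {q \<in> W \<inter> V j. h i q = 0} = {}"
      using interior_of_mono by blast
  qed (use W R in \<open>auto simp: W_def R_def\<close>)
  then show ?thesis by blast
qed

text \<open>Otherwise \<open>h i\<close> would vanish on the open piece of V_j inside the image of
  \<open>Q\<close>, against the choice of the quotients.\<close>

lemma denominator_nonvanishing:
  assumes qt: "quotients U g h" and jk: "j \<le> k" "k \<le> n" and i: "i \<in> {1..j}"
    and Q: "openin (ctop (Y k)) Q" "bb k \<in> Q"
  shows "\<exists>q\<in>Q \<inter> VV k j. h i (T k q) \<noteq> 0"
proof (rule ccontr)
  assume neg: "\<not> (\<exists>q\<in>Q \<inter> VV k j. h i (T k q) \<noteq> 0)"
  have U: "openin (ctop X) U" "T n b \<in> U" using qt by (auto simp: quotients_def)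
  let ?Q = "Q \<inter> {q \<in> points (Y k). T k q \<in> U}"
  have "openin (ctop (Y k)) ?Q"
    using Q(1) openin_continuous_map_preimage[OF morphism_cont[OF T_morphism[OF jk(2)]] U(1)] by blast
  moreover have "bb k \<in> ?Q" using Q(2) U(2) T_bb[OF jk(2)] openin_subset[OF Q(1)] by auto
  ultimately obtain S where S: "S \<noteq> {}" "openin (subtopology (ctop X) (V j)) S" "S \<subseteq> T k ` (?Q \<inter> VV k j)"
    by (rule resolution_image_open[OF jk]) (rule that, assumption+)
  have "S \<subseteq> {q \<in> U \<inter> V j. h i q = 0}" using S(3) neg T_VV[OF jk(2), of j] jk by auto
  then have "S \<subseteq> subtopology (ctop X) (V j) interior_of {q \<in> U \<inter> V j. h i q = 0}"
    using S(2) by (rule interior_of_maximal)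
  moreover have "i \<in> {1..n}" "j \<in> {i..n}" using i jk by auto
  then have "subtopology (ctop X) (V j) interior_of {q \<in> U \<inter> V j. h i q = 0} = {}"
    using qt unfolding quotients_def by blast
  ultimately show False using S(1) by blast
qed

text \<open>The outcome of \<open>monomial_coordinates\<close> on V_k^k for the shared data
  \<open>U\<close>, \<open>g\<close>, \<open>h\<close>. The constants \<open>\<gamma>\<close> are
  all that is left of the unit factors.\<close>

definition adapted where
  "adapted U g h k r E y Q \<gamma> \<longleftrightarrow> coord_disc (K k) k r E y Q \<and> bb k \<in> Q \<and> E (\<lambda>_. 0) = bb k \<and> (\<forall>i. \<gamma> i \<noteq> (0::complex)) \<and>
     (\<forall>w\<in>pdisc k (\<lambda>_. 0) r. (\<forall>j\<le>k. E w \<in> VV k j \<longleftrightarrow> (\<forall>i\<in>{Suc j..k}. w i = 0)) \<and>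
       (E w \<in> \<Union>(\<D> k) \<longrightarrow> (\<exists>l\<in>{1..k}. w l = 0)) \<and> T k (E w) \<in> U \<and>
       (\<forall>i\<in>{1..k}. g i (T k (E w)) * (\<Prod>l=1..k. w l ^ nat (- d k i l)) =
          \<gamma> i * h i (T k (E w)) * (\<Prod>l=1..k. w l ^ nat (d k i l))))"

lemma
  assumes "adapted U g h k r E y Q \<gamma>"
  shows adapted_coord_disc: "coord_disc (K k) k r E y Q"
    and adapted_base: "bb k \<in> Q" "E (\<lambda>_. 0) = bb k"
    and adapted_nonzero: "\<gamma> i \<noteq> 0"
    and adapted_VV: "w \<in> pdisc k (\<lambda>_. 0) r \<Longrightarrow> j \<le> k \<Longrightarrow> E w \<in> VV k j \<longleftrightarrow> (\<forall>i\<in>{Suc j..k}. w i = 0)"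
    and adapted_D: "w \<in> pdisc k (\<lambda>_. 0) r \<Longrightarrow> E w \<in> \<Union>(\<D> k) \<Longrightarrow> \<exists>l\<in>{1..k}. w l = 0"
    and adapted_U: "w \<in> pdisc k (\<lambda>_. 0) r \<Longrightarrow> T k (E w) \<in> U"
    and adapted_eq: "w \<in> pdisc k (\<lambda>_. 0) r \<Longrightarrow> l \<in> {1..k} \<Longrightarrow>
       g l (T k (E w)) * (\<Prod>m=1..k. w m ^ nat (- d k l m)) = \<gamma> l * h l (T k (E w)) * (\<Prod>m=1..k. w m ^ nat (d k l m))"
  using assms unfolding adapted_def by simp_all

lemma ex_adapted:
  assumes qt: "quotients U g h" and k: "k \<le> n"
  shows "\<exists>r E y Q \<gamma>. adapted U g h k r E y Q \<gamma>"
proof -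
  have U: "openin (ctop X) U" "T k (bb k) \<in> U" using qt T_bb[OF k] by (auto simp: quotients_def)
  have gd: "good_coordinates (K k) k (VV k) (\<D> k) (bb k) (N k) (x k)" using good k by auto
  have Tm: "morphism (K k) X (T k)" by (rule morphism_csub_source[OF T_morphism[OF k]])
  have am: "almost_monomial (K k) (N k) (x k) k (d k i) (\<lambda>q. t i (T k q))" if "i \<in> {1..k}" for i
    using almost k that by (simp add: o_def)
  have gh: "chol X q (g i) \<and> chol X q (h i)" and fgh: "h i q \<noteq> 0 \<Longrightarrow> t i q = g i q / h i q"
    if "i \<in> {1..k}" "q \<in> U" for i q
    using qt that k by (auto simp: quotients_def)
  have nv: "\<exists>q\<in>Q. h i (T k q) \<noteq> 0" if i: "i \<in> {1..k}" and Q: "openin (ctop (K k)) Q" "bb k \<in> Q" for i Q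
  proof -
    obtain Q' where Q': "openin (ctop (Y k)) Q'" "Q = Q' \<inter> VV k k" using Q(1) by (auto simp: openin_subtopology)
    then show ?thesis using denominator_nonvanishing[OF qt order_refl k i Q'(1)] Q(2) by auto
  qed
  obtain r E y Q \<gamma> where R: "coord_disc (K k) k r E y Q" "bb k \<in> Q" "E (\<lambda>_. 0) = bb k"
    "\<And>w j. w \<in> pdisc k (\<lambda>_. 0) r \<Longrightarrow> j \<le> k \<Longrightarrow> E w \<in> VV k j \<longleftrightarrow> (\<forall>i\<in>{Suc j..k}. w i = 0)"
    "\<And>w. w \<in> pdisc k (\<lambda>_. 0) r \<Longrightarrow> E w \<in> \<Union>(\<D> k) \<Longrightarrow> \<exists>l\<in>{1..k}. w l = 0"
    "\<And>w. w \<in> pdisc k (\<lambda>_. 0) r \<Longrightarrow> T k (E w) \<in> U" "\<And>i. \<gamma> i \<noteq> 0"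
    "\<And>i w. i \<in> {1..k} \<Longrightarrow> w \<in> pdisc k (\<lambda>_. 0) r \<Longrightarrow>
       g i (T k (E w)) * (\<Prod>l=1..k. w l ^ nat (- d k i l)) =
       \<gamma> i * h i (T k (E w)) * (\<Prod>l=1..k. w l ^ nat (d k i l))"
    by (rule monomial_coordinates[OF germ_closed_csub gd Tm inv_le[OF k] am U gh fgh nv]) (assumption | rule that)+
  have "adapted U g h k r E y Q \<gamma>"
    unfolding adapted_def using R by (intro conjI allI ballI impI) simp_all
  then show ?thesis by blast
qed

lemma adapted_hol:
  assumes ad: "adapted U g h k r E y Q \<gamma>" and k: "k \<le> n" and f: "\<And>q. q \<in> U \<Longrightarrow> chol X q f"
  shows "hol_on k (pdisc k (\<lambda>_. 0) r) (\<lambda>w. f (T k (E w)))"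
proof -
  have "morphism (csub (affine_space k) (pdisc k (\<lambda>_. 0) r)) (K k) E" using adapted_coord_disc[OF ad] by (simp add: coord_disc_def)
  from morphism_compose[OF this morphism_csub_source[OF T_morphism[OF k]]]
  have m: "morphism (csub (affine_space k) (pdisc k (\<lambda>_. 0) r)) X (T k \<circ> E)" .
  have "hol_on k (pdisc k (\<lambda>_. 0) r) (\<lambda>w. f ((T k \<circ> E) w))"
    by (rule morphism_affine_hol_on[OF m openin_pdisc]) (use adapted_U[OF ad] f in auto)
  then show ?thesis by simp
qed

lemma adapted_nonvanishing:
  assumes qt: "quotients U g h" and ad: "adapted U g h k r E y Q \<gamma>" and jk: "j \<le> k" "k \<le> n"
    and i: "i \<in> {1..j}" and s: "0 < s" "s \<le> r"
  shows "\<exists>w\<in>pdisc j (\<lambda>_. 0) s. h i (T k (E w)) \<noteq> 0"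
proof -
  have cd: "coord_disc (K k) k r E y Q" by (rule adapted_coord_disc[OF ad])
  have "openin (ctop (K k)) (E ` pdisc k (\<lambda>_. 0) s)"
    by (rule coord_disc_image_open(1)[OF cd openin_pdisc pdisc_mono[OF s(2)]])
  then obtain Q' where Q': "openin (ctop (Y k)) Q'" "E ` pdisc k (\<lambda>_. 0) s = Q' \<inter> VV k k"
    by (auto simp: openin_subtopology)
  have "E (\<lambda>_. 0) = bb k" "(\<lambda>_. 0) \<in> pdisc k (\<lambda>_. 0) s" using adapted_base[OF ad] s(1) by auto
  then have "bb k \<in> E ` pdisc k (\<lambda>_. 0) s" by (metis imageI)
  then have "bb k \<in> Q'" using Q' by auto
  from denominator_nonvanishing[OF qt jk i Q'(1) this]
  obtain q where q: "q \<in> Q'" "q \<in> VV k j" "h i (T k q) \<noteq> 0" by auto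
  then have "q \<in> E ` pdisc k (\<lambda>_. 0) s" using Q' VV_mono[of k j k] jk by auto
  then obtain w where w: "w \<in> pdisc k (\<lambda>_. 0) s" "q = E w" by auto
  then have "w \<in> pdisc k (\<lambda>_. 0) r" using pdisc_mono[OF s(2)] by auto
  then have "\<forall>i\<in>{Suc j..k}. w i = 0" using adapted_VV[OF ad _ jk(1)] q(2) w(2) by blast
  then have "w \<in> pdisc j (\<lambda>_. 0) s" using w(1) jk by (force simp: pdisc_0_iff Cn_def)
  then show ?thesis using q w by auto
qed

text \<open>On the plane w_{j+1} = ... = w_k = 0 the same functions g_i / h_i are expressed twice:
  directly through \<open>d k\<close>, and through \<open>d j\<close> after the map V_j^k -> V_j^j,
  since both ways lead to the same point of \<open>X\<close>. Then
  \<open>monomial_transition\<close> applies, and the exponents form the matrix C^j D^k.\<close>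

lemma adapted_transition:
  assumes qt: "quotients U g h" and ad: "adapted U g h k r E y Q \<gamma>" and ad': "adapted U g h j r' E' y' Q' \<gamma>'"
    and jk: "j \<le> k" "k \<le> n"
  obtains s e \<kappa> where "0 < s" "s \<le> r" "\<And>l. \<kappa> l \<noteq> 0"
    "\<And>l m. l \<in> {1..j} \<Longrightarrow> m \<in> {1..j} \<Longrightarrow> of_nat (e l m) = (\<Sum>i=1..j. c j l i * of_int (d k i m))"
    "\<And>w. w \<in> pdisc j (\<lambda>_. 0) s \<Longrightarrow> tower_map \<pi> j (k - j) (E w) \<in> Q'"
    "\<And>w l. w \<in> pdisc j (\<lambda>_. 0) s \<Longrightarrow> l \<in> {1..j} \<Longrightarrow>
       y' (tower_map \<pi> j (k - j) (E w)) l = \<kappa> l * (\<Prod>m=1..j. w m ^ e l m)"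
proof -
  let ?\<theta> = "tower_map \<pi> j (k - j)"
  let ?P = "pdisc j (\<lambda>_. 0)"
  have cd: "coord_disc (K k) k r E y Q" and cd': "coord_disc (K j) j r' E' y' Q'"
    using adapted_coord_disc[OF ad] adapted_coord_disc[OF ad'] by auto
  have r: "r > 0" using cd by (simp add: coord_disc_def)
  have jn: "j \<le> n" using jk by simp
  have EVV: "E w \<in> VV k j" if "w \<in> ?P r" for w
  proof -
    have "w \<in> pdisc k (\<lambda>_. 0) r" using that pdisc_Cn_mono[OF jk(1) r] by auto
    moreover have "\<forall>i\<in>{Suc j..k}. w i = 0" using that by (auto simp: pdisc_0_iff Cn_def)
    ultimately show ?thesis using adapted_VV[OF ad _ jk(1)] by blast
  qed
  have idm: "morphism (csub (affine_space j) (?P r)) (csub (affine_space k) (pdisc k (\<lambda>_. 0) r)) id"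
  proof -
    have "morphism (csub (affine_space j) (?P r)) (affine_space k) (tuple k (\<lambda>l w. w l))"
      by (rule morphism_tuple[OF openin_pdisc hol_on_coord])
    moreover have "tuple k (\<lambda>l w. w l) w = id w" if "w \<in> ?P r" for w
      by (rule Cn_eqI[of _ k]) (use that jk Cn_mono[OF jk(1)] in \<open>auto simp: tuple_def pdisc_def Cn_def\<close>)
    ultimately have "morphism (csub (affine_space j) (?P r)) (affine_space k) id"
      by (rule morphism_cong[OF germ_closed_csub]) auto
    then show ?thesis
      by (rule morphism_into_csub[OF germ_closed_csub]) (use pdisc_Cn_mono[OF jk(1) r] in auto)
  qed
  have Em: "morphism (csub (affine_space k) (pdisc k (\<lambda>_. 0) r)) (Y k) E"
    using cd morphism_csub_target unfolding coord_disc_def by blast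
  have \<theta>m: "morphism (Y k) (Y j) ?\<theta>" using tower_morphism[of j "k - j"] jk by simp
  have "morphism (csub (affine_space j) (?P r)) (Y j) (?\<theta> \<circ> (E \<circ> id))"
    by (rule morphism_compose[OF morphism_compose[OF idm Em] \<theta>m])
  then have \<theta>Em: "morphism (csub (affine_space j) (?P r)) (K j) (?\<theta> \<circ> E)"
    by (intro morphism_into_csub) (use EVV tower_VV[of j "k - j" j] jk in auto)
  let ?S = "{w \<in> points (csub (affine_space j) (?P r)). (?\<theta> \<circ> E) w \<in> Q'}"
  have Q'o: "openin (ctop (K j)) Q'" using cd' by (simp add: coord_disc_def)
  have "openin (Cn_top j) ?S"
    using openin_continuous_map_preimage[OF morphism_cont[OF \<theta>Em] Q'o] by (simp add: openin_open_subtopology)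
  moreover have "(\<lambda>_. 0) \<in> ?S"
    using adapted_base[OF ad] adapted_base[OF ad'] theta_bb[OF jk] r by auto
  ultimately obtain s0 where s0: "s0 > 0" "?P s0 \<subseteq> ?S" unfolding openin_Cn_top by blast
  define s where "s = min s0 r"
  have s: "0 < s" "s \<le> r" "?P s \<subseteq> ?S" using s0 r pdisc_mono[of s s0] by (auto simp: s_def)
  have inQ': "?\<theta> (E w) \<in> Q'" if "w \<in> ?P s" for w using s that by auto
  have Psr: "?P s \<subseteq> pdisc k (\<lambda>_. 0) r" using pdisc_mono[OF s(2)] pdisc_Cn_mono[OF jk(1) r] by blast
  define q where "q l w = y' (?\<theta> (E w)) l" for l w
  have y'm: "morphism (csub (K j) Q') (affine_space j) y'" using cd' by (simp add: coord_disc_def)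
  have Q'p: "Q' \<subseteq> points (K j)" by (rule openin_subset[OF Q'o])
  have "chol (K j) p (\<lambda>q. y' q l)" if "p \<in> Q'" for p l
    using morphism_affine_coord[OF y'm, of p l] chol_csub_open[OF germ_closed_csub Q'o that] that Q'p by auto
  then have qh: "hol_on j (?P s) (q l)" for l
    using morphism_affine_hol_on[OF morphism_csub_mono[OF \<theta>Em pdisc_mono[OF s(2)]] openin_pdisc, of "\<lambda>q. y' q l"] inQ'
    by (simp add: q_def[abs_def])
  have gq: "chol X p (g i)" "chol X p (h i)" if "p \<in> U" "i \<in> {1..n}" for i p
    using qt that by (auto simp: quotients_def)
  define H where "H i w = h i (T k (E w))" for i w
  define G where "G i w = g i (T k (E w))" for i w
  have Hh: "hol_on j (?P s) (H i)" if "i \<in> {1..j}" for i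
    unfolding H_def
    by (rule hol_on_restrict[OF adapted_hol[OF ad jk(2)] Psr jk(1)]) (use gq that jk in auto)
  have nz: "\<exists>w\<in>?P s. H i w \<noteq> 0" if "i \<in> {1..j}" for i
    unfolding H_def by (rule adapted_nonvanishing[OF qt ad jk that s(1,2)])
  have eq': "G i w * (\<Prod>l=1..j. w l ^ nat (- d k i l)) = \<gamma> i * H i w * (\<Prod>l=1..j. w l ^ nat (d k i l))"
    if i: "i \<in> {1..j}" and w: "w \<in> ?P s" for i w
  proof -
    have ik: "i \<in> {1..k}" "k \<in> {1..n}" using i jk by auto
    \<comment> \<open>Row i \<le> j of a lower triangular matrix has no entries past
      \<open>j\<close>, so the coordinates that vanish on the plane enter with exponent 0 and
      contribute the factor 1.\<close>
    have z: "d k i l = 0" if "l \<in> {Suc j..k}" for l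
      using tri ik that i by auto
    have "(\<Prod>l=1..k. w l ^ nat (a * d k i l)) = (\<Prod>l=1..j. w l ^ nat (a * d k i l))" for a
      by (rule prod.mono_neutral_right) (use jk z in auto)
    from this[of "-1"] this[of 1]
    have "(\<Prod>l=1..k. w l ^ nat (- d k i l)) = (\<Prod>l=1..j. w l ^ nat (- d k i l))"
      "(\<Prod>l=1..k. w l ^ nat (d k i l)) = (\<Prod>l=1..j. w l ^ nat (d k i l))" by simp_all
    moreover have "G i w * (\<Prod>l=1..k. w l ^ nat (- d k i l)) = \<gamma> i * H i w * (\<Prod>l=1..k. w l ^ nat (d k i l))"
      unfolding G_def H_def by (rule adapted_eq[OF ad _ ik(1)]) (use w Psr in auto)
    ultimately show ?thesis by simp
  qed
  have eq: "G i w * (\<Prod>l=1..j. q l w ^ nat (- d j i l)) = \<gamma>' i * H i w * (\<Prod>l=1..j. q l w ^ nat (d j i l))"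
    if i: "i \<in> {1..j}" and w: "w \<in> ?P s" for i w
  proof -
    let ?v = "y' (?\<theta> (E w))"
    have v: "?v \<in> ?P r'" "E' ?v = ?\<theta> (E w)" using cd' inQ'[OF w] by (auto simp: coord_disc_def)
    have "g i (T j (E' ?v)) * (\<Prod>l=1..j. ?v l ^ nat (- d j i l)) =
        \<gamma>' i * h i (T j (E' ?v)) * (\<Prod>l=1..j. ?v l ^ nat (d j i l))"
      by (rule adapted_eq[OF ad' v(1) i])
    then show ?thesis unfolding v(2) T_theta[OF jk(1)] by (simp add: G_def H_def q_def)
  qed
  have \<gamma>: "\<gamma> i \<noteq> 0" "\<gamma>' i \<noteq> 0" for i using adapted_nonzero[OF ad] adapted_nonzero[OF ad'] by auto
  have tr: "d j i l = 0" if "i \<in> {1..j}" "l \<in> {Suc i..j}" for i l using tri that jn by auto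
  have dg: "d j i i \<noteq> 0" if "i \<in> {1..j}" for i using tri that jn by auto
  define R where "R l e \<kappa> \<longleftrightarrow> \<kappa> \<noteq> 0 \<and> (\<forall>w\<in>?P s. q l w = \<kappa> * (\<Prod>m=1..j. w m ^ e m)) \<and>
    (\<forall>m\<in>{1..j}. of_nat (e m) = (\<Sum>i=1..j. c j l i * of_int (d k i m)))" for l e \<kappa>
  have "\<exists>e \<kappa>. R l e \<kappa>" if l: "l \<in> {1..j}" for l
    by (rule monomial_transition[OF s(1) qh Hh nz inv_le[OF jn] tr dg \<gamma>(2,1) eq eq' l])
       (assumption | unfold R_def, blast)+
  then obtain e \<kappa> where e: "\<And>l. l \<in> {1..j} \<Longrightarrow> R l (e l) (\<kappa> l)" by metis
  show ?thesis
    by (rule that[of s "\<lambda>l. if l \<in> {1..j} then \<kappa> l else 1" e])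
       (use s e inQ' in \<open>auto simp: R_def q_def\<close>)
qed

text \<open>A power of \<open>\<tau>\<close> is a Laurent monomial in the t_j with exponents from
  row \<open>i\<close> of C^n; as C^n D^n is the identity, it is a constant times w_i^M. Hence
  \<open>\<tau>\<close> is a constant times w_i, and the choice of a branch amounts to rescaling the
  chart.\<close>

lemma branch_linear:
  assumes qt: "quotients U g h" and ad: "adapted U g h n r E y Q \<gamma>"
    and N0: "openin (ctop (Y n)) N0" "b \<in> N0" and i: "i \<in> {1..n}"
    and br: "monomial_branch (Y n) N0 n (\<lambda>j. t j \<circ> T n) (tmon c n i) \<tau>"
  obtains s a where "0 < s" "s \<le> r" "a \<noteq> 0"
    "\<And>w. w \<in> pdisc n (\<lambda>_. 0) s \<Longrightarrow> E w \<in> N0 \<and> \<tau> (E w) = a * w i"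
proof -
  let ?P = "pdisc n (\<lambda>_. 0)"
  have cd: "coord_disc (K n) n r E y Q" by (rule adapted_coord_disc[OF ad])
  have r: "r > 0" using cd by (simp add: coord_disc_def)
  have Em: "morphism (csub (affine_space n) (?P r)) (Y n) E"
    using cd morphism_csub_target unfolding coord_disc_def by blast
  have KY: "ctop (K n) = ctop (Y n)" using VV_top[of n] by simp
  let ?S = "{w \<in> points (csub (affine_space n) (?P r)). E w \<in> N0}"
  have "openin (Cn_top n) ?S"
    using openin_continuous_map_preimage[OF morphism_cont[OF Em] N0(1)] by (simp add: openin_open_subtopology)
  moreover have "(\<lambda>_. 0) \<in> ?S" using adapted_base[OF ad] N0(2) bb_n r by auto
  ultimately obtain s0 where s0: "s0 > 0" "?P s0 \<subseteq> ?S" unfolding openin_Cn_top by blast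
  define s where "s = min s0 r"
  have s: "0 < s" "s \<le> r" "?P s \<subseteq> ?S" using s0 r pdisc_mono[of s s0] by (auto simp: s_def)
  have Psr: "?P s \<subseteq> ?P r" by (rule pdisc_mono[OF s(2)])
  have EN0: "E w \<in> N0" if "w \<in> ?P s" for w using s that by auto
  define q where "q w = \<tau> (E w)" for w
  have qh: "hol_on n (?P s) q"
    unfolding q_def
    by (rule morphism_affine_hol_on[OF morphism_csub_mono[OF Em Psr] openin_pdisc])
       (use br EN0 in \<open>auto simp: monomial_branch_def\<close>)
  define H where "H j w = h j (T n (E w))" for j w
  define G where "G j w = g j (T n (E w))" for j w
  have gq: "chol X p (h j)" if "p \<in> U" "j \<in> {1..n}" for j p
    using qt that by (auto simp: quotients_def)
  have Hh: "hol_on n (?P s) (H j)" if "j \<in> {1..n}" for j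
    unfolding H_def by (rule hol_on_subset[OF adapted_hol[OF ad order_refl] Psr]) (use gq that in auto)
  have nz: "\<exists>w\<in>?P s. H j w \<noteq> 0" if "j \<in> {1..n}" for j
    unfolding H_def by (rule adapted_nonvanishing[OF qt ad order_refl order_refl that s(1,2)])
  let ?Z = "{w. (\<forall>m\<in>{1..n}. w m \<noteq> 0) \<and> (\<forall>j\<in>{1..n}. H j w \<noteq> 0)}"
  have dZ: "dense_on n (?P s) ?Z" by (rule dense_all_nonzero[OF s(1) Hh _ nz]) auto
  have oZ: "openin (Cn_top n) (?P s \<inter> ?Z)"
  proof -
    have "hol_on n (?P s) (\<lambda>w. (\<Prod>m=1..n. w m ^ 1) * (\<Prod>j=1..n. H j w))"
      by (intro hol_on_mult hol_on_monomial hol_on_prod Hh) auto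
    then have "openin (Cn_top n) {w \<in> ?P s. (\<Prod>m=1..n. w m ^ 1) * (\<Prod>j=1..n. H j w) \<in> -{0}}"
      by (intro openin_Cn_vimage hol_on_cont) auto
    moreover have "{w \<in> ?P s. (\<Prod>m=1..n. w m ^ 1) * (\<Prod>j=1..n. H j w) \<in> -{0}} = ?P s \<inter> ?Z" by auto
    ultimately show ?thesis by simp
  qed
  obtain M :: nat where M: "M > 0" "\<And>a b. a \<le> n \<Longrightarrow> b \<le> n \<Longrightarrow> of_nat M * c n a b \<in> \<int>"
    by (rule common_denominator[of n "c n"]) (rule that, assumption+)
  define C where "C j = \<lfloor>of_nat M * tmon c n i j\<rfloor>" for j
  have C: "of_int (C j) = of_nat M * c n i j" if "j \<in> {1..n}" for j
    using M(2)[of i j] that i by (auto simp: C_def tmon_def elim: Ints_cases)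
  have "\<forall>j\<in>{1..n}. of_nat M * tmon c n i j \<in> \<int>" using M(2) i by (auto simp: tmon_def)
  then obtain A where A: "nowhere_dense_analytic (csub (Y n) N0) A"
    and gA: "\<And>q. q \<in> points (csub (Y n) N0) - A \<Longrightarrow> \<tau> q ^ M = (\<Prod>j=1..n. (t j \<circ> T n) q powi C j)"
    using br M(1) unfolding monomial_branch_def generically_def C_def by blast
  \<comment> \<open>\<open>E\<close> maps open sets to open sets, so an exceptional set without
    interior cannot contain such an image.\<close>
  have dA: "dense_on n (?P s) {w. E w \<notin> A}"
    unfolding dense_on_def
  proof (intro allI impI notI)
    fix B assume B: "openin (Cn_top n) B" "B \<noteq> {}" "B \<subseteq> ?P s" "B \<inter> {w. E w \<notin> A} = {}"
    have "openin (ctop (Y n)) (E ` B)"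
      using coord_disc_image_open(1)[OF cd B(1)] B(3) Psr KY by auto
    moreover have "E ` B \<subseteq> N0" using B(3) EN0 by auto
    ultimately have "openin (ctop (csub (Y n) N0)) (E ` B)" by (auto simp: openin_subtopology)
    moreover have "E ` B \<subseteq> A" using B(4) by auto
    ultimately have "E ` B \<subseteq> ctop (csub (Y n) N0) interior_of A" by (intro interior_of_maximal)
    then show False using A B(2) by (auto simp: nowhere_dense_analytic_def)
  qed
  have dn: "dense_on n (?P s) ({w. E w \<notin> A} \<inter> ?Z)" by (rule dense_on_Int[OF dA dZ oZ])
  define \<kappa> where "\<kappa> = (\<Prod>j=1..n. \<gamma> j powi C j)"
  have \<kappa>: "\<kappa> \<noteq> 0" using adapted_nonzero[OF ad] by (auto simp: \<kappa>_def)
  define B where "B m = (if m = i then int M else 0)" for m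
  have CB: "(\<Sum>j=1..n. C j * d n j m) = B m" if m: "m \<in> {1..n}" for m
  proof -
    have "(\<Sum>j=1..n. of_int (C j * d n j m)) = (\<Sum>j=1..n. of_nat M * (c n i j * of_int (d n j m)))"
      by (rule sum.cong) (auto simp: C)
    also have "\<dots> = of_nat M * (if i = m then 1 else 0 :: rat)"
      using inv_le[of n] i m by (simp add: mutually_inverse_def flip: sum_distrib_left)
    finally have "of_int (\<Sum>j=1..n. C j * d n j m) = (of_int (B m) :: rat)"
      unfolding of_int_sum B_def by (cases "m = i") simp_all
    then show ?thesis by (simp only: of_int_eq_iff)
  qed
  have ev: "q w ^ M = \<kappa> * (\<Prod>m=1..n. w m powi B m)" if w: "w \<in> ?P s" "w \<in> {w. E w \<notin> A} \<inter> ?Z" for w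
  proof -
    have wr: "w \<in> ?P r" using w Psr by auto
    have tj: "t j (T n (E w)) = \<gamma> j * (\<Prod>m=1..n. w m powi d n j m)" if j: "j \<in> {1..n}" for j
    proof -
      have "G j w * (\<Prod>l=1..n. w l ^ nat (- d n j l)) = (\<gamma> j * H j w) * (\<Prod>l=1..n. w l ^ nat (d n j l))"
        unfolding G_def H_def by (rule adapted_eq[OF ad wr j])
      then have "G j w = (\<gamma> j * H j w) * (\<Prod>l=1..n. w l powi d n j l)"
        by (rule prod_power_to_powi[rotated]) (use w in auto)
      moreover have "T n (E w) \<in> U" by (rule adapted_U[OF ad wr])
      then have "t j (T n (E w)) = G j w / H j w"
        using qt j w(2) unfolding quotients_def G_def H_def by auto
      ultimately show ?thesis using w(2) j by simp
    qed
    have "E w \<in> points (csub (Y n) N0) - A" using EN0[OF w(1)] w(2) openin_subset[OF N0(1)] by auto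
    from gA[OF this] have "q w ^ M = (\<Prod>j=1..n. (\<gamma> j * (\<Prod>m=1..n. w m powi d n j m)) powi C j)"
      unfolding q_def o_apply using tj by (auto intro!: prod.cong)
    also have "\<dots> = \<kappa> * (\<Prod>m=1..n. w m powi (\<Sum>j=1..n. C j * d n j m))"
      unfolding \<kappa>_def by (rule monomial_substitution) (use w in auto)
    also have "(\<Prod>m=1..n. w m powi (\<Sum>j=1..n. C j * d n j m)) = (\<Prod>m=1..n. w m powi B m)"
      by (rule prod.cong) (simp_all only: CB)
    finally show ?thesis .
  qed
  have "q w ^ M * (\<Prod>m=1..n. w m ^ nat (- B m)) = \<kappa> * (\<Prod>m=1..n. w m ^ nat (B m))" if w: "w \<in> ?P s" for w
  proof (rule eq_on_dense[OF openin_pdisc dn _ _ _ w])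
    show "continuous_on (?P s) (\<lambda>w. q w ^ M * (\<Prod>m=1..n. w m ^ nat (- B m)))"
      by (intro hol_on_cont[of n] hol_on_mult hol_on_power qh hol_on_monomial)
    show "continuous_on (?P s) (\<lambda>w. \<kappa> * (\<Prod>m=1..n. w m ^ nat (B m)))"
      by (intro hol_on_cont[of n] hol_on_mult hol_on_const hol_on_monomial)
    fix w assume w: "w \<in> ?P s" "w \<in> {w. E w \<notin> A} \<inter> ?Z"
    show "q w ^ M * (\<Prod>m=1..n. w m ^ nat (- B m)) = \<kappa> * (\<Prod>m=1..n. w m ^ nat (B m))"
      by (rule prod_powi_to_power[OF _ ev[OF w]]) (use w in auto)
  qed
  then obtain e a where e: "a \<noteq> 0" "\<And>m. m \<in> {1..n} \<Longrightarrow> B m = int M * int (e m)"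
    "\<And>w. w \<in> ?P s \<Longrightarrow> q w = a * (\<Prod>m=1..n. w m ^ e m)"
    by (rule root_of_monomial[OF qh s(1) M(1) \<kappa>]) (assumption | rule that)+
  have "e m = (if m = i then 1 else 0)" if "m \<in> {1..n}" for m
    using e(2)[OF that] M(1) by (auto simp: B_def split: if_splits)
  then have "(\<Prod>m=1..n. w m ^ e m) = (\<Prod>m=1..n. if m = i then w m else 1)" for w :: "nat \<Rightarrow> complex"
    by (intro prod.cong) auto
  then have "(\<Prod>m=1..n. w m ^ e m) = w i" for w :: "nat \<Rightarrow> complex" using i by simp
  then show ?thesis using that[OF s(1,2) e(1)] EN0 e(3) by (simp add: q_def)
qed

end

section \<open>Lattices and points of the toric variety\<close>

text \<open>Forward substitution: by induction the rows of \<open>C\<close> above \<open>i\<close>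
  vanish in column \<open>j\<close>, so only the diagonal term survives in row \<open>i\<close> of
  the product. One statement gives the diagonal entries and the zeros to their right.\<close>

lemma inverse_triangular:
  fixes C :: "nat \<Rightarrow> nat \<Rightarrow> rat"
  assumes inv: "mutually_inverse k C D"
    and tri: "\<And>i l. i \<in> {1..k} \<Longrightarrow> l \<in> {Suc i..k} \<Longrightarrow> D i l = 0" and diag: "\<And>i. i \<in> {1..k} \<Longrightarrow> D i i \<noteq> 0"
    and ij: "i \<in> {1..k}" "j \<in> {i..k}"
  shows "of_int (D i i) * C i j = (if i = j then 1 else 0)"
  using ij
proof (induction i arbitrary: j rule: less_induct)
  case (less i)
  have "(\<Sum>l=1..k. of_int (D i l) * C l j) = (\<Sum>l=1..i. of_int (D i l) * C l j)"
    using less.prems tri[of i] by (intro sum.mono_neutral_right) auto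
  also have "{1..i} = insert i {1..<i}" using less.prems by auto
  also have "(\<Sum>l\<in>insert i {1..<i}. of_int (D i l) * C l j) = of_int (D i i) * C i j"
  proof -
    have "C l j = 0" if "l \<in> {1..<i}" for l
      using less.IH[of l j] diag[of l] that less.prems by auto
    then show ?thesis by simp
  qed
  finally show ?case using inv less.prems by (simp add: mutually_inverse_def)
qed

context flag_tower
begin

section \<open>Transition exponents between the levels\<close>

lemma c_tri: "k \<le> n \<Longrightarrow> i \<in> {1..k} \<Longrightarrow> j \<in> {Suc i..k} \<Longrightarrow> c k i j = 0"
  using inverse_triangular[OF inv_le, of k i j] tri by fastforce

lemma c_diag: "k \<le> n \<Longrightarrow> i \<in> {1..k} \<Longrightarrow> of_int (d k i i) * c k i i = 1"
  using inverse_triangular[OF inv_le, of k i i] tri by fastforce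

text \<open>The exponents of \<open>t\<^sub>l\<^sup>j\<close> in \<open>t\<^sub>1\<^sup>k, \<dots>, t\<^sub>j\<^sup>k\<close>.\<close>

definition transition :: "nat \<Rightarrow> nat \<Rightarrow> nat \<Rightarrow> nat \<Rightarrow> nat" where
  "transition j k l m = nat \<lfloor>\<Sum>i=1..j. c j l i * of_int (d k i m)\<rfloor>"

lemma adapted_transition':
  assumes qt: "quotients U g h" and ad: "adapted U g h k r E y Q \<gamma>" and ad': "adapted U g h j r' E' y' Q' \<gamma>'"
    and jk: "j \<le> k" "k \<le> n"
  obtains s \<kappa> where "0 < s" "s \<le> r" "\<And>l. \<kappa> l \<noteq> 0"
    "\<And>w. w \<in> pdisc j (\<lambda>_. 0) s \<Longrightarrow> tower_map \<pi> j (k - j) (E w) \<in> Q'"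
    "\<And>w l. w \<in> pdisc j (\<lambda>_. 0) s \<Longrightarrow> l \<in> {1..j} \<Longrightarrow>
       y' (tower_map \<pi> j (k - j) (E w)) l = \<kappa> l * (\<Prod>m=1..j. w m ^ transition j k l m)"
proof -
  obtain s e \<kappa> where *: "0 < s" "s \<le> r" "\<And>l. \<kappa> l \<noteq> 0"
    and e: "\<And>l m. l \<in> {1..j} \<Longrightarrow> m \<in> {1..j} \<Longrightarrow> of_nat (e l m) = (\<Sum>i=1..j. c j l i * of_int (d k i m))"
    and **: "\<And>w. w \<in> pdisc j (\<lambda>_. 0) s \<Longrightarrow> tower_map \<pi> j (k - j) (E w) \<in> Q'"
    "\<And>w l. w \<in> pdisc j (\<lambda>_. 0) s \<Longrightarrow> l \<in> {1..j} \<Longrightarrow>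
       y' (tower_map \<pi> j (k - j) (E w)) l = \<kappa> l * (\<Prod>m=1..j. w m ^ e l m)"
    by (rule adapted_transition[OF qt ad ad' jk]) (rule that, assumption+)
  have "transition j k l m = e l m" if "l \<in> {1..j}" "m \<in> {1..j}" for l m
    unfolding transition_def e[OF that, symmetric] by simp
  then have "(\<Prod>m=1..j. w m ^ e l m) = (\<Prod>m=1..j. w m ^ transition j k l m)" if "l \<in> {1..j}" for l and w :: "nat \<Rightarrow> complex"
    using that by (intro prod.cong) auto
  then show ?thesis using that * ** by auto
qed

text \<open>The content is that the entries of C^j D^k are integral and nonnegative. This comes from
  geometry: they are exponents of holomorphic coordinate functions, so charts at both levels are
  chosen to obtain it.\<close>

lemma transition_eq:
  assumes jk: "j \<le> k" "k \<le> n" and lm: "l \<in> {1..j}" "m \<in> {1..j}"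
  shows "of_nat (transition j k l m) = (\<Sum>i=1..j. c j l i * of_int (d k i m))"
proof -
  obtain U g h where qt: "quotients U g h" using ex_quotients by blast
  obtain r E y Q \<gamma> where ad: "adapted U g h k r E y Q \<gamma>" using ex_adapted[OF qt jk(2)] by blast
  obtain r' E' y' Q' \<gamma>' where ad': "adapted U g h j r' E' y' Q' \<gamma>'" using ex_adapted[OF qt, of j] jk by auto
  obtain e where e: "\<And>l m. l \<in> {1..j} \<Longrightarrow> m \<in> {1..j} \<Longrightarrow>
      of_nat (e l m :: nat) = (\<Sum>i=1..j. c j l i * of_int (d k i m))"
    by (rule adapted_transition[OF qt ad ad' jk]) (rule that, assumption)
  show ?thesis unfolding transition_def e[OF lm, symmetric] by simp
qed

text \<open>A product of two lower triangular matrices with nonzero diagonals, C^j being lower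
  triangular by \<open>c_tri\<close>.\<close>

lemma transition_tri:
  assumes jk: "j \<le> k" "k \<le> n" and l: "l \<in> {1..j}"
  shows "m \<in> {Suc l..j} \<Longrightarrow> transition j k l m = 0" and "transition j k l l > 0"
proof -
  have z: "c j l i * of_int (d k i m) = 0" if "i \<in> {1..j}" "m \<in> {l..j}" "\<not> (i = l \<and> m = l)" for i m
  proof (cases "i > l")
    case True
    then show ?thesis using c_tri[of j l i] jk l that by auto
  next
    case False
    then have "k \<in> {1..n}" "i \<in> {1..k}" "m \<in> {Suc i..k}" using that jk l by auto
    then have "d k i m = 0" using tri by blast
    then show ?thesis by simp
  qed
  { assume m: "m \<in> {Suc l..j}"
    then have "of_nat (transition j k l m) = (\<Sum>i=1..j. (0 :: rat))"
      unfolding transition_eq[OF jk l, of m] using l by (intro trans[OF transition_eq[OF jk l]] sum.cong z) auto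
    then show "transition j k l m = 0" by simp }
  have "of_nat (transition j k l l) = (\<Sum>i=1..j. if i = l then c j l l * of_int (d k l l) else 0)"
    unfolding transition_eq[OF jk l l] using z[of _ l] l by (intro sum.cong) auto
  then have "of_nat (transition j k l l) = c j l l * of_int (d k l l)" using l by simp
  moreover have "c j l l \<noteq> 0" using c_diag[of j l] jk l by auto
  moreover have "d k l l \<noteq> 0" using tri jk l by auto
  ultimately show "transition j k l l > 0" by (metis gr0I mult_eq_0_iff of_int_eq_0_iff of_nat_0)
qed

text \<open>Express t_l^j through the t_p by C^j and these through the t_m^k by D^k. The sum over m
  may stop at \<open>j\<close>, because rows p \<le> j of D^k end there.\<close>

lemma tmon_transition:
  assumes jk: "j \<le> k" "k \<le> n" and l: "l \<in> {1..j}"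
  shows "tmon c j l i = (\<Sum>m=1..j. of_nat (transition j k l m) * tmon c k m i)"
proof (cases "i \<in> {1..k}")
  case i: True
  have "(\<Sum>m=1..j. of_nat (transition j k l m) * tmon c k m i)
      = (\<Sum>m=1..j. \<Sum>p=1..j. c j l p * (of_int (d k p m) * c k m i))"
    using i by (intro sum.cong) (auto simp: transition_eq[OF jk l] tmon_def sum_distrib_right mult.assoc)
  also have "\<dots> = (\<Sum>p=1..j. c j l p * (\<Sum>m=1..j. of_int (d k p m) * c k m i))"
    by (subst sum.swap) (simp add: sum_distrib_left)
  also have "\<dots> = (\<Sum>p=1..j. c j l p * (if p = i then 1 else 0))"
  proof (rule sum.cong[OF refl])
    fix p assume p: "p \<in> {1..j}"
    have pk: "p \<in> {1..k}" "k \<in> {1..n}" using p jk by auto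
    have "(\<Sum>m=1..j. of_int (d k p m) * c k m i) = (\<Sum>m=1..k. of_int (d k p m) * c k m i)"
    proof (rule sum.mono_neutral_left)
      show "\<forall>m\<in>{1..k} - {1..j}. of_int (d k p m) * c k m i = 0"
      proof
        fix m assume "m \<in> {1..k} - {1..j}"
        then have "m \<in> {Suc p..k}" using p by auto
        then have "d k p m = 0" using tri pk by blast
        then show "of_int (d k p m) * c k m i = 0" by simp
      qed
    qed (use jk in auto)
    also have "\<dots> = (if p = i then 1 else 0)" using inv_le[OF jk(2)] pk i by (simp add: mutually_inverse_def)
    finally show "c j l p * (\<Sum>m=1..j. of_int (d k p m) * c k m i) = c j l p * (if p = i then 1 else 0)" by simp
  qed
  also have "\<dots> = tmon c j l i" by (simp add: tmon_def if_distrib cong: if_cong)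
  finally show ?thesis by simp
qed (use jk in \<open>auto simp: tmon_def\<close>)

lemma tcomb_transition:
  assumes jk: "j \<le> k" "k \<le> n"
  shows "tcomb c j j p = tcomb c k k (\<lambda>m. if m \<in> {1..j} then \<Sum>l=1..j. p l * int (transition j k l m) else 0)"
proof
  fix i
  have "tcomb c j j p i = (\<Sum>l=1..j. \<Sum>m=1..j. of_int (p l * int (transition j k l m)) * tmon c k m i)"
    unfolding tcomb_def using tmon_transition[OF jk] by (intro sum.cong) (auto simp: sum_distrib_left mult.assoc)
  also have "\<dots> = (\<Sum>m=1..j. of_int (\<Sum>l=1..j. p l * int (transition j k l m)) * tmon c k m i)"
    by (subst sum.swap) (simp add: sum_distrib_right)
  also have "\<dots> = (\<Sum>m=1..k. of_int (if m \<in> {1..j} then \<Sum>l=1..j. p l * int (transition j k l m) else 0) * tmon c k m i)"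
    by (rule sum.mono_neutral_cong_left) (use jk in auto)
  finally show "tcomb c j j p i = tcomb c k k (\<lambda>m. if m \<in> {1..j} then \<Sum>l=1..j. p l * int (transition j k l m) else 0) i"
    by (simp only: tcomb_def)
qed

lemma mon_lattice_mono: "j \<le> k \<Longrightarrow> k \<le> n \<Longrightarrow> mon_lattice c j \<subseteq> mon_lattice c k"
  unfolding mon_lattice_def using tcomb_transition by (metis (no_types, lifting) image_subsetI rangeI)

text \<open>Multiplication by D^n undoes C^n, so a monomial determines its exponents in t_1^n, ...,
  t_n^n.\<close>

lemma tcomb_coord:
  assumes "m \<in> {1..n}"
  shows "(\<Sum>j=1..n. tcomb c n n a j * of_int (d n j m)) = of_int (a m)"
proof -
  have "(\<Sum>j=1..n. tcomb c n n a j * of_int (d n j m)) = (\<Sum>j=1..n. \<Sum>i=1..n. of_int (a i) * (c n i j * of_int (d n j m)))"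
    by (rule sum.cong) (auto simp: tcomb_def tmon_def sum_distrib_right mult.assoc)
  also have "\<dots> = (\<Sum>i=1..n. of_int (a i) * (\<Sum>j=1..n. c n i j * of_int (d n j m)))"
    by (subst sum.swap) (simp add: sum_distrib_left)
  also have "\<dots> = (\<Sum>i=1..n. of_int (a i) * (if i = m then 1 else 0))"
    using inv_le[of n] assms by (intro sum.cong) (auto simp: mutually_inverse_def)
  finally show ?thesis using assms by (simp add: if_distrib cong: if_cong)
qed

text \<open>The exponent of \<open>t\<^sub>m\<^sup>n\<close> in \<open>s\<close>; meaningful on the cone only.\<close>

definition expo :: "monomial \<Rightarrow> nat \<Rightarrow> nat" where
  "expo s m = nat \<lfloor>\<Sum>j=1..n. s j * of_int (d n j m)\<rfloor>"

lemma expo_tcomb: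
  assumes "m \<in> {1..n}"
  shows "expo (tcomb c n n a) m = nat (a m)"
  unfolding expo_def tcomb_coord[OF assms] by simp

lemma tcomb_inject: "tcomb c n n a = tcomb c n n a' \<Longrightarrow> m \<in> {1..n} \<Longrightarrow> a m = a' m"
  using tcomb_coord[of m a] tcomb_coord[of m a'] by simp

lemma tcomb_cong: "(\<And>i. i \<in> {1..l} \<Longrightarrow> a i = a' i) \<Longrightarrow> tcomb c k l a = tcomb c k l a'"
  by (simp add: tcomb_def)

lemma tcomb_add: "(\<lambda>j. tcomb c k l a j + tcomb c k l a' j) = tcomb c k l (\<lambda>i. a i + a' i)"
  by (simp add: tcomb_def sum.distrib distrib_right)

lemma tcomb_zero: "tcomb c k l (\<lambda>_. 0) = (\<lambda>_. 0)"
  by (simp add: tcomb_def)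

lemma tcomb_single: "i \<in> {1..l} \<Longrightarrow> tcomb c k l (\<lambda>m. if m = i then 1 else 0) = tmon c k i"
proof
  fix j assume i: "i \<in> {1..l}"
  have "(\<Sum>m=1..l. of_int (if m = i then 1 else 0) * tmon c k m j) = (\<Sum>m=1..l. if m = i then tmon c k m j else 0)"
    by (rule sum.cong) auto
  then show "tcomb c k l (\<lambda>m. if m = i then 1 else 0) j = tmon c k i j" using i by (simp add: tcomb_def)
qed

lemma tcomb_hat: "l \<le> k \<Longrightarrow> tcomb c k l a = tcomb c k k (\<lambda>i. if i \<in> {1..l} then a i else 0)"
  unfolding tcomb_def by (rule ext, rule sum.mono_neutral_cong_left) auto

section \<open>The semigroup and leading indices\<close>

abbreviation "tcone \<equiv> cone_semigroup c n"
abbreviation "semi \<equiv> tcone \<inter> flag_semigroup c n"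

lemma coneE:
  assumes "s \<in> tcone"
  shows "s = tcomb c n n (\<lambda>m. int (expo s m))"
proof -
  obtain a where a: "s = tcomb c n n a" "\<forall>i\<in>{1..n}. a i \<ge> 0" using assms by (auto simp: cone_semigroup_def)
  then show ?thesis unfolding a(1) by (intro tcomb_cong) (auto simp: expo_tcomb)
qed

lemma coneI: "(\<And>i. i \<in> {1..n} \<Longrightarrow> a i \<ge> 0) \<Longrightarrow> tcomb c n n a \<in> tcone"
  unfolding cone_semigroup_def by auto

text \<open>The index \<open>k\<close> of the last exponent that occurs witnesses everything at
  once: a positive exponent there makes \<open>s\<close> greater than 1 in the lexicographic order
  and keeps it out of the group generated by t_1^n, ..., t_{k-1}^n.\<close>

lemma semiI:
  assumes k: "k \<in> {1..n}" and s: "s = tcomb c n n (\<lambda>m. int (a m))" "s \<in> mon_lattice c k"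
    and a: "a k > 0" "\<And>m. m \<in> {Suc k..n} \<Longrightarrow> a m = 0"
  shows "s \<in> semi"
proof -
  have "lex_pos c n s" unfolding lex_pos_def using k s(1) a by (intro exI[of _ "\<lambda>m. int (a m)"]) auto
  moreover have "s \<notin> mon_lattice_hat c n (k - 1)"
  proof
    assume "s \<in> mon_lattice_hat c n (k - 1)"
    then obtain a' where a': "s = tcomb c n (k - 1) a'" by (auto simp: mon_lattice_hat_def)
    have le: "k - 1 \<le> n" using k by auto
    have "tcomb c n n (\<lambda>m. int (a m)) = tcomb c n n (\<lambda>i. if i \<in> {1..k - 1} then a' i else 0)"
      by (rule trans[OF trans[OF s(1)[symmetric] a'] tcomb_hat[OF le]])
    from tcomb_inject[OF this k] have "int (a k) = (if k \<in> {1..k - 1} then a' k else 0)" .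
    moreover have "k \<notin> {1..k - 1}" using k by auto
    ultimately have "int (a k) = 0" by (simp only: if_False)
    then show False using a(1) by simp
  qed
  moreover have "s \<in> tcone" unfolding s(1) by (rule coneI) simp
  ultimately show ?thesis using k s(2) unfolding flag_semigroup_def by blast
qed

lemma zero_semi: "(\<lambda>_. 0) \<in> semi"
  using coneI[of "\<lambda>_. 0"] by (auto simp: flag_semigroup_def tcomb_zero)

text \<open>Converse of \<open>semiI\<close>. An element of L^k has no exponents past
  \<open>k\<close>, by \<open>tcomb_transition\<close>; if the k-th exponent were 0 too, it would
  lie in the group that the definition excludes.\<close>

lemma semiE:
  assumes s: "s \<in> semi" "s \<noteq> (\<lambda>_. 0)"
  obtains k where "k \<in> {1..n}" "s \<in> mon_lattice c k" "expo s k > 0" "\<And>m. m \<in> {Suc k..n} \<Longrightarrow> expo s m = 0"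
proof -
  obtain k where k: "k \<in> {1..n}" "s \<in> mon_lattice c k" "s \<notin> mon_lattice_hat c n (k - 1)"
    using s by (auto simp: flag_semigroup_def)
  have sc: "s = tcomb c n n (\<lambda>m. int (expo s m))" using s coneE by auto
  obtain p where p: "s = tcomb c k k p" using k(2) by (auto simp: mon_lattice_def)
  have z: "expo s m = 0" if "m \<in> {Suc k..n}" for m
  proof -
    have "s = tcomb c n n (\<lambda>m. if m \<in> {1..k} then \<Sum>l=1..k. p l * int (transition k n l m) else 0)"
      using p tcomb_transition[of k n p] k(1) by simp
    then have "expo s m = nat (if m \<in> {1..k} then \<Sum>l=1..k. p l * int (transition k n l m) else 0)"
      using expo_tcomb[of m] that by (metis (no_types, lifting) atLeastAtMost_iff le_trans One_nat_def Suc_le_mono le0)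
    then show ?thesis using that by simp
  qed
  have "expo s k > 0"
  proof (rule ccontr)
    assume "\<not> expo s k > 0"
    then have z': "expo s m = 0" if "m \<in> {k..n}" for m using that z[of m] by (cases "m = k") auto
    have "tcomb c n n (\<lambda>m. int (expo s m)) = tcomb c n n (\<lambda>i. if i \<in> {1..k - 1} then int (expo s i) else 0)"
      by (rule tcomb_cong) (use z' in auto)
    also have "\<dots> = tcomb c n (k - 1) (\<lambda>m. int (expo s m))"
      using k(1) by (intro tcomb_hat[symmetric]) auto
    finally show False using k(3) sc by (auto simp: mon_lattice_hat_def)
  qed
  then show ?thesis using that k z by blast
qed

text \<open>The sum has the larger of the two leading indices, and the lattice of that index
  contains both summands.\<close>

lemma semi_add:
  assumes "s \<in> semi" "s' \<in> semi"
  shows "(\<lambda>j. s j + s' j) \<in> semi"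
proof (cases "s = (\<lambda>_. 0) \<or> s' = (\<lambda>_. 0)")
  case True
  then show ?thesis using assms by auto
next
  case False
  have *: "(\<lambda>j. s j + s' j) \<in> semi"
    if s: "s \<in> semi" "s' \<in> semi" and k: "k \<in> {1..n}" "s \<in> mon_lattice c k" "expo s k > 0" "\<And>m. m \<in> {Suc k..n} \<Longrightarrow> expo s m = 0"
      and k': "k' \<in> {1..n}" "s' \<in> mon_lattice c k'" "\<And>m. m \<in> {Suc k'..n} \<Longrightarrow> expo s' m = 0" and le: "k' \<le> k"
    for s s' k k'
  proof (rule semiI[OF k(1), of _ "\<lambda>m. expo s m + expo s' m"])
    have "s \<in> tcone" "s' \<in> tcone" using s by auto
    from this[THEN coneE] show "(\<lambda>j. s j + s' j) = tcomb c n n (\<lambda>m. int (expo s m + expo s' m))"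
      by (simp only: of_nat_add tcomb_add[symmetric])
    have "s' \<in> mon_lattice c k" using k'(2) mon_lattice_mono[OF le] k(1) by auto
    then show "(\<lambda>j. s j + s' j) \<in> mon_lattice c k" using k(2) by (auto simp: mon_lattice_def tcomb_add)
  qed (use k k' le in auto)
  obtain k where k: "k \<in> {1..n}" "s \<in> mon_lattice c k" "expo s k > 0" "\<And>m. m \<in> {Suc k..n} \<Longrightarrow> expo s m = 0"
    by (rule semiE[OF assms(1)]) (use False in simp, rule that)
  obtain k' where k': "k' \<in> {1..n}" "s' \<in> mon_lattice c k'" "expo s' k' > 0" "\<And>m. m \<in> {Suc k'..n} \<Longrightarrow> expo s' m = 0"
    by (rule semiE[OF assms(2)]) (use False in simp, rule that)
  show ?thesis
  proof (cases "k' \<le> k")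
    case True
    then show ?thesis using *[OF assms k k'(1,2,4)] by blast
  next
    case False
    then have "(\<lambda>j. s' j + s j) \<in> semi" using *[OF assms(2,1) k' k(1,2,4)] by simp
    then show ?thesis by (simp add: add.commute)
  qed
qed

section \<open>Points of the toric varieties\<close>

lemma expo_add:
  assumes "s \<in> tcone" "s' \<in> tcone" "m \<in> {1..n}"
  shows "expo (\<lambda>j. s j + s' j) m = expo s m + expo s' m"
proof -
  have "(\<lambda>j. s j + s' j) = tcomb c n n (\<lambda>m. int (expo s m) + int (expo s' m))"
    by (simp only: tcomb_add[symmetric] coneE[OF assms(1), symmetric] coneE[OF assms(2), symmetric])
  then show ?thesis using assms(3) by (simp add: expo_tcomb nat_add_distrib)
qed

lemma cone_add: "s \<in> tcone \<Longrightarrow> s' \<in> tcone \<Longrightarrow> (\<lambda>j. s j + s' j) \<in> tcone"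
  unfolding cone_semigroup_def by (force simp: tcomb_add)

text \<open>Evaluation of monomials at \<open>w\<close>: the identification of C^n with the points
  of \<open>T_hat\<close>, inverse to \<open>coords\<close>.\<close>

definition toric_pt :: "(nat \<Rightarrow> complex) \<Rightarrow> monomial \<Rightarrow> complex" where
  "toric_pt w s = (if s \<in> tcone then \<Prod>m=1..n. w m ^ expo s m else 0)"

definition coords :: "(monomial \<Rightarrow> complex) \<Rightarrow> nat \<Rightarrow> complex" where
  "coords u m = (if m \<in> {1..n} then u (tmon c n m) else 0)"

lemma coords_Cn [simp]: "coords u \<in> Cn n"
  by (auto simp: coords_def Cn_def)

lemma tmon_cone: "i \<in> {1..n} \<Longrightarrow> tmon c n i \<in> tcone"
  using coneI[of "\<lambda>m. if m = i then 1 else 0"] tcomb_single[of i n n] by auto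

lemma toric_pt_point: "toric_pt w \<in> points (T_hat c n)"
proof -
  have "(\<lambda>_. 0) \<in> tcone" using coneI[of "\<lambda>_. 0"] by (auto simp: tcomb_zero)
  moreover have "expo (\<lambda>_. 0) m = 0" for m by (simp add: expo_def)
  ultimately have "toric_pt w (\<lambda>_. 0) = 1" by (simp add: toric_pt_def)
  moreover have "toric_pt w (\<lambda>j. s j + s' j) = toric_pt w s * toric_pt w s'" if "s \<in> tcone" "s' \<in> tcone" for s s'
    using that cone_add[OF that] by (simp add: toric_pt_def expo_add power_add prod.distrib)
  ultimately show ?thesis by (auto simp: T_hat_def toric_space_def toric_points_def toric_pt_def)
qed

lemma coords_toric_pt: "w \<in> Cn n \<Longrightarrow> coords (toric_pt w) = w"
proof (rule Cn_eqI[of _ n])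
  fix i assume i: "i \<in> {1..n}"
  have "(\<Prod>m=1..n. w m ^ expo (tmon c n i) m) = (\<Prod>m=1..n. if m = i then w m else 1)"
    using expo_tcomb[of _ "\<lambda>m. if m = i then 1 else 0"] tcomb_single[OF i, of n]
    by (intro prod.cong) auto
  then show "coords (toric_pt w) i = w i"
    using i by (simp add: coords_def toric_pt_def tmon_cone)
qed auto

text \<open>A homomorphism is determined by its values on the t_i^n: induct on the exponent of one
  generator, then on the number of generators.\<close>

lemma toric_pt_coords:
  assumes u: "u \<in> points (T_hat c n)"
  shows "toric_pt (coords u) = u"
proof
  fix s
  have u0: "u (\<lambda>_. 0) = 1" and add: "\<And>s s'. s \<in> tcone \<Longrightarrow> s' \<in> tcone \<Longrightarrow> u (\<lambda>j. s j + s' j) = u s * u s'"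
    and out: "\<And>s. s \<notin> tcone \<Longrightarrow> u s = 0"
    using u by (auto simp: T_hat_def toric_space_def toric_points_def)
  have single: "u (tcomb c n n (\<lambda>m. if m = i then int p else 0)) = u (tmon c n i) ^ p" if i: "i \<in> {1..n}" for i p
  proof (induction p)
    case 0
    have "tcomb c n n (\<lambda>m. if m = i then int 0 else 0) = tcomb c n n (\<lambda>_. 0)" by (rule tcomb_cong) auto
    then show ?case using u0 by (simp add: tcomb_zero)
  next
    case (Suc p)
    have "tcomb c n n (\<lambda>m. if m = i then int (Suc p) else 0)
        = tcomb c n n (\<lambda>m. (if m = i then 1 else 0) + (if m = i then int p else 0))"
      by (rule tcomb_cong) auto
    also have "\<dots> = (\<lambda>j. tmon c n i j + tcomb c n n (\<lambda>m. if m = i then int p else 0) j)"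
      using tcomb_add[of n n "\<lambda>m. if m = i then 1 else 0" "\<lambda>m. if m = i then int p else 0"] tcomb_single[OF i, of n] by simp
    finally show ?case using add[OF tmon_cone[OF i] coneI, of "\<lambda>m. if m = i then int p else 0"] Suc by simp
  qed
  have multi: "u (tcomb c n n (\<lambda>m. if m \<le> j then int (a m) else 0)) = (\<Prod>m=1..j. u (tmon c n m) ^ a m)" if "j \<le> n" for j a
    using that
  proof (induction j)
    case 0
    have "tcomb c n n (\<lambda>m. if m \<le> 0 then int (a m) else 0) = tcomb c n n (\<lambda>_. 0)" by (rule tcomb_cong) auto
    then show ?case using u0 by (simp add: tcomb_zero)
  next
    case (Suc j)
    have "tcomb c n n (\<lambda>m. if m \<le> Suc j then int (a m) else 0)
        = tcomb c n n (\<lambda>m. (if m \<le> j then int (a m) else 0) + (if m = Suc j then int (a (Suc j)) else 0))"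
      by (rule tcomb_cong) auto
    then show ?case
      using Suc single[of "Suc j" "a (Suc j)"] add[OF coneI coneI, of "\<lambda>m. if m \<le> j then int (a m) else 0" "\<lambda>m. if m = Suc j then int (a (Suc j)) else 0"]
      by (simp flip: tcomb_add)
  qed
  show "toric_pt (coords u) s = u s"
  proof (cases "s \<in> tcone")
    case True
    have "s = tcomb c n n (\<lambda>m. if m \<le> n then int (expo s m) else 0)"
      by (subst coneE[OF True]) (rule tcomb_cong, auto)
    then have "u s = (\<Prod>m=1..n. u (tmon c n m) ^ expo s m)" using multi[OF order_refl, of "expo s"] by metis
    then show ?thesis using True by (simp add: toric_pt_def coords_def)
  qed (simp add: toric_pt_def out)
qed

lemma nu_in_toric: "u \<in> points (T_hat c n) \<Longrightarrow> nu c n u \<in> toric_points semi"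
  using semi_add zero_semi unfolding toric_points_def nu_def T_hat_def toric_space_def by auto

lemma continuous_toric_pt: "continuous_on S f \<Longrightarrow> continuous_on S (\<lambda>x. toric_pt (f x))"
proof (rule continuous_on_coordinatewise_then_product)
  fix s assume "continuous_on S f"
  then have "continuous_on S (\<lambda>x. f x m)" for m by (rule continuous_on_product_then_coordinatewise)
  then show "continuous_on S (\<lambda>x. toric_pt (f x) s)"
    unfolding toric_pt_def by (cases "s \<in> tcone") (auto intro!: continuous_intros)
qed

end

section \<open>Holomorphic functions on the toric variety\<close>

lemma openin_Cn_full [simp]: "openin (Cn_top k) (Cn k)"
  by (metis openin_topspace topspace_Cn_top)

lemma eval_at_Cn [simp]: "eval_at M s u \<in> Cn M"
  by (auto simp: eval_at_def Cn_def)

context flag_tower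
begin

text \<open>\<open>w\<close> is a coordinate system with \<open>t\<^sub>i\<^sup>n = \<alpha>\<^sub>i w\<^sub>i\<close>.\<close>

definition rep :: "(nat \<Rightarrow> complex) \<Rightarrow> real \<Rightarrow> ((nat \<Rightarrow> complex) \<Rightarrow> complex) \<Rightarrow> bool" where
  "rep \<alpha> \<rho> f \<longleftrightarrow> (\<exists>M s B G. (\<forall>i\<in>{1..M}. s i \<in> semi) \<and> openin (Cn_top M) B \<and> hol_on M B G \<and>
     (\<forall>w\<in>pdisc n (\<lambda>_. 0) \<rho>. eval_at M s (toric_pt (\<lambda>m. \<alpha> m * w m)) \<in> B \<and>
        f w = G (eval_at M s (toric_pt (\<lambda>m. \<alpha> m * w m)))))"

lemma rep_cong:
  assumes f: "rep \<alpha> \<rho> f" and \<rho>': "\<rho>' \<le> \<rho>" and eq: "\<And>w. w \<in> pdisc n (\<lambda>_. 0) \<rho>' \<Longrightarrow> f w = g w"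
  shows "rep \<alpha> \<rho>' g"
proof -
  let ?p = "\<lambda>w. toric_pt (\<lambda>m. \<alpha> m * w m)"
  obtain M s B G where *: "\<forall>i\<in>{1..M}. s i \<in> semi" "openin (Cn_top M) B" "hol_on M B G"
    "\<forall>w\<in>pdisc n (\<lambda>_. 0) \<rho>. eval_at M s (?p w) \<in> B \<and> f w = G (eval_at M s (?p w))"
    using f unfolding rep_def by (elim exE conjE)
  have "eval_at M s (?p w) \<in> B \<and> g w = G (eval_at M s (?p w))" if w: "w \<in> pdisc n (\<lambda>_. 0) \<rho>'" for w
  proof -
    have "w \<in> pdisc n (\<lambda>_. 0) \<rho>" using w pdisc_mono[OF \<rho>'] by auto
    from bspec[OF *(4) this] eq[OF w] show ?thesis by simp
  qed
  with *(1-3) show ?thesis unfolding rep_def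
    by (intro exI[of _ M] exI[of _ s] exI[of _ B] exI[of _ G] conjI ballI) auto
qed

lemma rep_mono: "rep \<alpha> \<rho> f \<Longrightarrow> \<rho>' \<le> \<rho> \<Longrightarrow> rep \<alpha> \<rho>' f"
  by (rule rep_cong) auto

text \<open>Finitely many functions are brought to one common list of monomials by concatenation.
  Composition needs this, and so does the factored map, whose components are evaluated on one
  tuple.\<close>

lemma rep_family:
  fixes m :: nat
  assumes "\<And>l. l \<in> {1..m} \<Longrightarrow> rep \<alpha> \<rho> (f l)"
  shows "\<exists>M s B G. (\<forall>i\<in>{1..M}. s i \<in> semi) \<and> openin (Cn_top M) B \<and> (\<forall>l\<in>{1..m}. hol_on M B (G l)) \<and>
     (\<forall>w\<in>pdisc n (\<lambda>_. 0) \<rho>. eval_at M s (toric_pt (\<lambda>m. \<alpha> m * w m)) \<in> B \<and>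
        (\<forall>l\<in>{1..m}. f l w = G l (eval_at M s (toric_pt (\<lambda>m. \<alpha> m * w m)))))"
  using assms
proof (induction m)
  case 0
  show ?case
    by (rule exI[of _ 0], rule exI[of _ "\<lambda>_ _. 0"], rule exI[of _ "Cn 0"]) auto
next
  case (Suc m)
  let ?p = "\<lambda>w. toric_pt (\<lambda>m. \<alpha> m * w m)"
  have "\<exists>M s B G. (\<forall>i\<in>{1..M}. s i \<in> semi) \<and> openin (Cn_top M) B \<and> (\<forall>l\<in>{1..m}. hol_on M B (G l)) \<and>
     (\<forall>w\<in>pdisc n (\<lambda>_. 0) \<rho>. eval_at M s (?p w) \<in> B \<and> (\<forall>l\<in>{1..m}. f l w = G l (eval_at M s (?p w))))"
    by (rule Suc.IH) (use Suc.prems in auto)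
  then obtain M s B G where s: "\<forall>i\<in>{1..M}. s i \<in> semi" and B: "openin (Cn_top M) B"
    and G: "\<forall>l\<in>{1..m}. hol_on M B (G l)"
    and eq: "\<forall>w\<in>pdisc n (\<lambda>_. 0) \<rho>. eval_at M s (?p w) \<in> B \<and> (\<forall>l\<in>{1..m}. f l w = G l (eval_at M s (?p w)))"
    by (elim exE conjE)
  have "rep \<alpha> \<rho> (f (Suc m))" by (rule Suc.prems) auto
  then obtain M' s' B' G' where s': "\<forall>i\<in>{1..M'}. s' i \<in> semi" and B': "openin (Cn_top M') B'"
    and G': "hol_on M' B' G'"
    and eq': "\<forall>w\<in>pdisc n (\<lambda>_. 0) \<rho>. eval_at M' s' (?p w) \<in> B' \<and> f (Suc m) w = G' (eval_at M' s' (?p w))"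
    unfolding rep_def by (elim exE conjE)
  \<comment> \<open>Entries past \<open>M\<close> come from the second list, shifted by
    \<open>M\<close>; \<open>pL\<close> and \<open>pR\<close> cut a tuple back into the two
    parts.\<close>
  define s2 where "s2 i = (if i \<le> M then s i else s' (i - M))" for i
  define pL where "pL = tuple M (\<lambda>l v. v l :: complex)"
  define pR where "pR = tuple M' (\<lambda>l v. v (l + M) :: complex)"
  define BL where "BL = {v \<in> Cn (M + M'). pL v \<in> B}"
  define BR where "BR = {v \<in> Cn (M + M'). pR v \<in> B'}"
  have L: "openin (Cn_top (M + M')) BL" "hol_on (M + M') BL (\<lambda>v. H (pL v))" if "hol_on M B H" for H
    using hol_on_tuple[OF B that openin_Cn_full[of "M + M'"], of "\<lambda>l v. v l"] hol_on_coord
    by (auto simp: BL_def pL_def)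
  have BLo: "openin (Cn_top (M + M')) BL" by (rule L(1)[OF hol_on_const])
  have R: "openin (Cn_top (M + M')) BR" "hol_on (M + M') BR (\<lambda>v. G' (pR v))"
    using hol_on_tuple[OF B' G' openin_Cn_full[of "M + M'"], of "\<lambda>l v. v (l + M)"] hol_on_coord
    by (auto simp: BR_def pR_def)
  define G2 where "G2 l v = (if l \<le> m then G l (pL v) else G' (pR v))" for l v
  have ev: "pL (eval_at (M + M') s2 u) = eval_at M s u" "pR (eval_at (M + M') s2 u) = eval_at M' s' u" for u
    by (rule ext, simp add: pL_def pR_def tuple_def eval_at_def s2_def)+
  have G2h: "hol_on (M + M') (BL \<inter> BR) (G2 l)" if "l \<in> {1..Suc m}" for l
  proof (cases "l \<le> m")
    case True
    then have "hol_on (M + M') BL (\<lambda>v. G l (pL v))" using L(2) G that by auto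
    from hol_on_subset[OF this, of "BL \<inter> BR"] show ?thesis using True by (simp add: G2_def[abs_def])
  next
    case False
    from hol_on_subset[OF R(2), of "BL \<inter> BR"] show ?thesis using False by (simp add: G2_def[abs_def])
  qed
  have "\<forall>i\<in>{1..M + M'}. s2 i \<in> semi"
  proof
    fix i assume i: "i \<in> {1..M + M'}"
    show "s2 i \<in> semi"
    proof (cases "i \<le> M")
      case True
      then have "i \<in> {1..M}" using i by auto
      then show ?thesis using s True by (simp only: s2_def if_True)
    next
      case False
      then have "i - M \<in> {1..M'}" using i by auto
      then show ?thesis using s' False by (simp only: s2_def if_False)
    qed
  qed
  moreover have "openin (Cn_top (M + M')) (BL \<inter> BR)" using BLo R(1) by auto
  moreover have "eval_at (M + M') s2 (?p w) \<in> BL \<inter> BR \<and> (\<forall>l\<in>{1..Suc m}. f l w = G2 l (eval_at (M + M') s2 (?p w)))"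
    if "w \<in> pdisc n (\<lambda>_. 0) \<rho>" for w
  proof -
    have e: "eval_at M s (?p w) \<in> B" "\<And>l. l \<in> {1..m} \<Longrightarrow> f l w = G l (eval_at M s (?p w))"
      "eval_at M' s' (?p w) \<in> B'" "f (Suc m) w = G' (eval_at M' s' (?p w))" using eq eq' that by auto
    have "f l w = G2 l (eval_at (M + M') s2 (?p w))" if "l \<in> {1..Suc m}" for l
      using e(2)[of l] e(4) that by (cases "l \<le> m") (auto simp: G2_def ev le_Suc_eq)
    then show ?thesis using e(1,3) by (auto simp: BL_def BR_def ev)
  qed
  ultimately show ?case using G2h by (intro exI[of _ "M + M'"] exI[of _ s2] exI[of _ "BL \<inter> BR"] exI[of _ G2]) blast
qed

text \<open>Closure under holomorphic functions of several variables; constants (with m = 0), sums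
  and products are instances.\<close>

lemma rep_compose:
  assumes f: "\<And>l. l \<in> {1..m} \<Longrightarrow> rep \<alpha> \<rho> (f l)" and B: "openin (Cn_top m) B" and G: "hol_on m B G"
    and im: "\<And>w. w \<in> pdisc n (\<lambda>_. 0) \<rho> \<Longrightarrow> tuple m f w \<in> B"
  shows "rep \<alpha> \<rho> (\<lambda>w. G (tuple m f w))"
proof -
  let ?p = "\<lambda>w. toric_pt (\<lambda>m. \<alpha> m * w m)"
  have "\<exists>M s B G. (\<forall>i\<in>{1..M}. s i \<in> semi) \<and> openin (Cn_top M) B \<and> (\<forall>l\<in>{1..m}. hol_on M B (G l)) \<and>
     (\<forall>w\<in>pdisc n (\<lambda>_. 0) \<rho>. eval_at M s (?p w) \<in> B \<and> (\<forall>l\<in>{1..m}. f l w = G l (eval_at M s (?p w))))"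
    by (rule rep_family[OF f])
  then obtain M s A F where s: "\<forall>i\<in>{1..M}. s i \<in> semi" and A: "openin (Cn_top M) A"
    and F: "\<forall>l\<in>{1..m}. hol_on M A (F l)"
    and eq: "\<forall>w\<in>pdisc n (\<lambda>_. 0) \<rho>. eval_at M s (?p w) \<in> A \<and> (\<forall>l\<in>{1..m}. f l w = F l (eval_at M s (?p w)))"
    by (elim exE conjE)
  note H = hol_on_tuple[OF B G A F[rule_format]]
  have "eval_at M s (?p w) \<in> {v \<in> A. tuple m F v \<in> B} \<and> G (tuple m f w) = G (tuple m F (eval_at M s (?p w)))"
    if w: "w \<in> pdisc n (\<lambda>_. 0) \<rho>" for w
  proof -
    have "tuple m F (eval_at M s (?p w)) = tuple m f w" using eq w by (auto simp: tuple_def)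
    then show ?thesis using eq w im[OF w] by auto
  qed
  with s H show ?thesis unfolding rep_def
    by (intro exI[of _ M] exI[of _ s] exI[of _ "{v \<in> A. tuple m F v \<in> B}"] exI[of _ "\<lambda>v. G (tuple m F v)"] conjI ballI)
       (simp_all only: simp_thms)
qed

lemma rep_const: "rep \<alpha> \<rho> (\<lambda>_. a)"
  using rep_compose[of 0 \<alpha> \<rho> "\<lambda>_ _. 0" "Cn 0" "\<lambda>_. a"] hol_on_const by auto

lemma rep_add:
  assumes "rep \<alpha> \<rho> f" "rep \<alpha> \<rho> g"
  shows "rep \<alpha> \<rho> (\<lambda>w. f w + g w)"
proof -
  have "rep \<alpha> \<rho> (\<lambda>w. (\<lambda>v. v 1 + v 2) (tuple 2 (\<lambda>l. if l = 1 then f else g) w))"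
    by (rule rep_compose[OF _ openin_Cn_full]) (use assms in \<open>auto intro: hol_on_add hol_on_coord simp del: One_nat_def\<close>)
  then show ?thesis by (simp add: tuple_def)
qed

lemma rep_mult:
  assumes "rep \<alpha> \<rho> f" "rep \<alpha> \<rho> g"
  shows "rep \<alpha> \<rho> (\<lambda>w. f w * g w)"
proof -
  have "rep \<alpha> \<rho> (\<lambda>w. (\<lambda>v. v 1 * v 2) (tuple 2 (\<lambda>l. if l = 1 then f else g) w))"
    by (rule rep_compose[OF _ openin_Cn_full]) (use assms in \<open>auto intro: hol_on_mult hol_on_coord simp del: One_nat_def\<close>)
  then show ?thesis by (simp add: tuple_def)
qed

lemma rep_sum: "finite I \<Longrightarrow> (\<And>i. i \<in> I \<Longrightarrow> rep \<alpha> \<rho> (f i)) \<Longrightarrow> rep \<alpha> \<rho> (\<lambda>w. \<Sum>i\<in>I. f i w)"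
  by (induction I rule: finite_induct) (auto intro: rep_add rep_const)

lemma rep_monomial:
  assumes \<alpha>: "\<And>m. \<alpha> m \<noteq> 0" and s: "s \<in> semi"
  shows "rep \<alpha> \<rho> (\<lambda>w. a * (\<Prod>m=1..n. w m ^ expo s m))"
proof -
  define \<beta> where "\<beta> = (\<Prod>m=1..n. \<alpha> m ^ expo s m)"
  have \<beta>: "\<beta> \<noteq> 0" using \<alpha> by (auto simp: \<beta>_def)
  have "toric_pt (\<lambda>m. \<alpha> m * w m) s = \<beta> * (\<Prod>m=1..n. w m ^ expo s m)" for w
    using s by (simp add: toric_pt_def power_mult_distrib prod.distrib \<beta>_def)
  then have eq: "a / \<beta> * toric_pt (\<lambda>m. \<alpha> m * w m) s = a * (\<Prod>m=1..n. w m ^ expo s m)" for w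
    using \<beta> by simp
  have ev: "eval_at 1 (\<lambda>_. s) u 1 = u s" for u by (simp add: eval_at_def)
  have "rep \<alpha> \<rho> (\<lambda>w. toric_pt (\<lambda>m. \<alpha> m * w m) s)"
    unfolding rep_def
    by (intro exI[of _ 1] exI[of _ "\<lambda>_. s"] exI[of _ "Cn 1"] exI[of _ "\<lambda>v. v 1"] conjI ballI)
       (simp_all only: s ev openin_Cn_full hol_on_coord eval_at_Cn)
  from rep_mult[OF rep_const[of _ _ "a / \<beta>"] this] show ?thesis by (simp only: eq)
qed

text \<open>By triangularity t_l^k involves t_1, ..., t_l only, and these are integral monomials in
  t_1^l, ..., t_l^l through D^l. So clearing the denominators of the matrices C^k suffices, and one
  \<open>M\<close> serves every k and l.\<close>

lemma uniform_denominator: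
  obtains M :: nat where "M > 0" "\<And>k l. k \<le> n \<Longrightarrow> l \<in> {1..k} \<Longrightarrow>
    tcomb c k k (\<lambda>m. if m = l then int M else 0) \<in> mon_lattice c l"
proof -
  have "\<exists>M>0. \<forall>i\<le>k. \<forall>j\<le>k. of_nat M * c k i j \<in> \<int>" for k
    using common_denominator[of k "c k"] by metis
  then obtain M where M: "\<And>k. M k > (0::nat)" "\<And>k i j. i \<le> k \<Longrightarrow> j \<le> k \<Longrightarrow> of_nat (M k) * c k i j \<in> \<int>" by metis
  define P where "P = (\<Prod>k\<le>n. M k)"
  have int: "of_nat P * c k i j \<in> \<int>" if "k \<le> n" "i \<le> k" "j \<le> k" for k i j
  proof -
    have "M k dvd P" unfolding P_def using that by (intro dvd_prodI) auto
    then obtain a where "P = M k * a" by (elim dvdE)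
    then have "of_nat P * c k i j = of_nat a * (of_nat (M k) * c k i j)" by simp
    then show ?thesis using M(2)[OF that(2,3)] by (metis Ints_mult Ints_of_nat)
  qed
  show ?thesis
  proof (rule that[of P])
    show "P > 0" using M(1) by (auto simp: P_def)
    fix k l assume k: "k \<le> n" and l: "l \<in> {1..k}"
    have ln: "l \<le> n" using k l by auto
    define p where "p m = \<lfloor>\<Sum>j=1..l. of_nat P * c k l j * of_int (d l j m)\<rfloor>" for m
    have p: "of_int (p m) = (\<Sum>j=1..l. of_nat P * c k l j * of_int (d l j m))" for m
    proof -
      have "(\<Sum>j=1..l. of_nat P * c k l j * of_int (d l j m)) \<in> \<int>"
        using l by (intro Ints_sum Ints_mult[OF int[OF k]] Ints_of_int) auto
      then show ?thesis by (auto simp: p_def elim: Ints_cases)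
    qed
    have "tcomb c k k (\<lambda>m. if m = l then int P else 0) = tcomb c l l p"
    proof
      fix i
      have "tcomb c k k (\<lambda>m. if m = l then int P else 0) i = (\<Sum>m=1..k. if m = l then of_nat P * tmon c k m i else 0)"
        unfolding tcomb_def by (rule sum.cong) auto
      also have "\<dots> = of_nat P * tmon c k l i" using l by simp
      also have "\<dots> = tcomb c l l p i"
      proof (cases "i \<in> {1..l}")
        case True
        have "tcomb c l l p i = (\<Sum>m=1..l. \<Sum>j=1..l. of_nat P * c k l j * (of_int (d l j m) * c l m i))"
          using True by (simp add: tcomb_def p tmon_def sum_distrib_right mult.assoc)
        also have "\<dots> = (\<Sum>j=1..l. of_nat P * c k l j * (\<Sum>m=1..l. of_int (d l j m) * c l m i))"
          by (subst sum.swap) (simp add: sum_distrib_left)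
        also have "\<dots> = (\<Sum>j=1..l. if j = i then of_nat P * c k l j else 0)"
          using inv_le[OF ln] True by (intro sum.cong) (auto simp: mutually_inverse_def)
        also have "\<dots> = of_nat P * tmon c k l i" using True l by (simp add: tmon_def)
        finally show ?thesis by simp
      next
        case False
        then have "tmon c k l i = 0" using c_tri[OF k l, of i] by (auto simp: tmon_def)
        moreover have "tcomb c l l p i = 0" using False by (auto simp: tcomb_def tmon_def)
        ultimately show ?thesis by simp
      qed
      finally show "tcomb c k k (\<lambda>m. if m = l then int P else 0) i = tcomb c l l p i" .
    qed
    then show "tcomb c k k (\<lambda>m. if m = l then int P else 0) \<in> mon_lattice c l" by (auto simp: mon_lattice_def)
  qed
qed

text \<open>The l-th coordinate on V_k^k as a function of the chart of V_n^n on its k-plane;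
  \<open>\<kappa>\<close> holds the constants of the transition.\<close>

definition zmon :: "(nat \<Rightarrow> complex) \<Rightarrow> nat \<Rightarrow> nat \<Rightarrow> (nat \<Rightarrow> complex) \<Rightarrow> complex" where
  "zmon \<kappa> k l w = \<kappa> l * (\<Prod>m=1..k. w m ^ transition k n l m)"

lemma zmon_hol: "hol_on j U (zmon \<kappa> k l)"
  unfolding zmon_def by (intro hol_on_mult hol_on_const hol_on_monomial)

text \<open>Exponents, in the t_m^n, of the product of the powers (t_l^k)^(p l).\<close>

definition zexp :: "nat \<Rightarrow> (nat \<Rightarrow> nat) \<Rightarrow> nat \<Rightarrow> nat" where
  "zexp k p m = (if m \<in> {1..k} then \<Sum>l=1..k. p l * transition k n l m else 0)"

lemma tcomb_zexp:
  assumes k: "k \<le> n"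
  shows "tcomb c k k (\<lambda>l. int (p l)) = tcomb c n n (\<lambda>m. int (zexp k p m))"
proof (rule trans[OF tcomb_transition[OF k order_refl]], rule tcomb_cong)
  fix m
  show "(if m \<in> {1..k} then \<Sum>l=1..k. int (p l) * int (transition k n l m) else 0) = int (zexp k p m)"
    by (simp add: zexp_def)
qed

lemma rep_zmon:
  assumes \<alpha>: "\<And>m. \<alpha> m \<noteq> 0" and k: "k \<le> n" and s: "tcomb c k k (\<lambda>l. int (p l)) \<in> semi"
  shows "rep \<alpha> \<rho> (\<lambda>w. \<Prod>l=1..k. zmon \<kappa> k l w ^ p l)"
proof -
  let ?s = "tcomb c k k (\<lambda>l. int (p l))"
  have ex: "expo ?s m = zexp k p m" if "m \<in> {1..n}" for m
    unfolding tcomb_zexp[OF k] expo_tcomb[OF that] by simp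
  have "(\<Prod>l=1..k. zmon \<kappa> k l w ^ p l) = (\<Prod>l=1..k. \<kappa> l ^ p l) * (\<Prod>m=1..n. w m ^ expo ?s m)" for w
  proof -
    have "(\<Prod>l=1..k. \<Prod>m=1..k. w m ^ (transition k n l m * p l)) = (\<Prod>m=1..k. w m ^ zexp k p m)"
      by (subst prod.swap) (auto simp: zexp_def power_sum mult.commute intro!: prod.cong)
    also have "\<dots> = (\<Prod>m=1..n. w m ^ expo ?s m)"
      by (rule prod.mono_neutral_cong_left) (use k ex in \<open>auto simp: zexp_def\<close>)
    finally show ?thesis
      by (simp add: zmon_def power_mult_distrib prod.distrib prod_power_distrib power_mult)
  qed
  then show ?thesis using rep_monomial[OF \<alpha> s] by simp
qed

text \<open>Division by z_k gives z_k K(z). Only z_1, ..., z_{k-1} are split into residue classes: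
  z_k has leading index \<open>k\<close>, so z_k and each z_k z^e belong to the semigroup. The
  arguments z_l^M of the coefficient functions belong to it with leading index
  \<open>l\<close>.\<close>

lemma rep_step:
  assumes \<alpha>: "\<And>m. \<alpha> m \<noteq> 0" and k: "k \<in> {1..n}" and F: "hol_on k (pdisc k (\<lambda>_. 0) R) F" and R: "R > 0"
  shows "\<exists>\<rho>>0. rep \<alpha> \<rho> (\<lambda>w. F (tuple k (zmon \<kappa> k) w) - F ((tuple k (zmon \<kappa> k) w)(k := 0)))"
proof -
  let ?z = "zmon \<kappa> k"
  have kn: "k \<le> n" and k1: "k \<in> {1..k}" using k by auto
  obtain M where M: "M > 0" and MLat: "\<And>k l. k \<le> n \<Longrightarrow> l \<in> {1..k} \<Longrightarrow>
    tcomb c k k (\<lambda>m. if m = l then int M else 0) \<in> mon_lattice c l"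
    by (rule uniform_denominator) (rule that, assumption+)
  define s where "s = min (R / 2) 1"
  have s: "0 < s" "s < R" "s \<le> 1" using R by (auto simp: s_def)
  obtain K where K: "hol_on k (pdisc k (\<lambda>_. 0) s) K"
    and FK: "\<And>z. z \<in> pdisc k (\<lambda>_. 0) s \<Longrightarrow> F z = F (z(k := 0)) + z k * K z"
    by (rule divide_coord[OF F k1 s(1,2)]) (rule that, assumption+)
  obtain s1 H where s1: "0 < s1" "s1 \<le> s" and H: "\<forall>e. hol_on k (pdisc k (\<lambda>_. 0) s1) (H e)"
    and KH: "\<forall>z\<in>pdisc k (\<lambda>_. 0) s1. K z = (\<Sum>e\<in>residue_exps M (k - 1).
      (\<Prod>l=1..k - 1. z l ^ e l) * H e (\<lambda>l. if l \<in> {1..k - 1} then z l ^ M else z l))"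
    using residue_class_decomposition[OF K s(1,3) M diff_le_self[of k 1]] by (elim exE conjE)
  have z0: "?z l (\<lambda>_. 0) = 0" if "l \<in> {1..k}" for l
    using transition_tri(2)[OF kn order_refl that] that by (auto simp: zmon_def zero_power)
  obtain \<rho> where \<rho>: "0 < \<rho>"
    and zs': "\<And>l w. l \<in> {1..k} \<Longrightarrow> w \<in> pdisc n (\<lambda>_. 0) \<rho> \<Longrightarrow> cmod (?z l w - ?z l (\<lambda>_. 0)) < s1"
    by (rule hol_family_near_zero[of k n 1 ?z "\<lambda>_. s1", OF zmon_hol]) (use s1 in \<open>auto intro: that\<close>)
  have zs: "cmod (?z l w) < s1" if "l \<in> {1..k}" "w \<in> pdisc n (\<lambda>_. 0) \<rho>" for l w
    using zs'[OF that] z0[OF that(1)] by simp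
  have repA: "rep \<alpha> \<rho> (\<lambda>w. ?z k w * (\<Prod>l=1..k - 1. ?z l w ^ e l))" for e
  proof -
    define p where "p = e(k := 1)"
    have pr: "(\<Prod>l=1..k. ?z l w ^ p l) = ?z k w * (\<Prod>l=1..k - 1. ?z l w ^ e l)" for w
    proof -
      have "{1..k} = insert k {1..k - 1}" "k \<notin> {1..k - 1}" using k by auto
      then have "(\<Prod>l=1..k. ?z l w ^ p l) = ?z k w ^ p k * (\<Prod>l=1..k - 1. ?z l w ^ p l)" by simp
      also have "(\<Prod>l=1..k - 1. ?z l w ^ p l) = (\<Prod>l=1..k - 1. ?z l w ^ e l)"
        using k by (intro prod.cong) (auto simp: p_def)
      finally show ?thesis by (simp add: p_def)
    qed
    have mem: "tcomb c k k (\<lambda>l. int (p l)) \<in> semi"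
    proof (rule semiI[OF k tcomb_zexp[OF kn]])
      have "p k * transition k n k k \<le> (\<Sum>l=1..k. p l * transition k n l k)"
        using k1 by (intro member_le_sum) auto
      moreover have "transition k n k k > 0" by (rule transition_tri(2)[OF kn order_refl k1])
      ultimately show "zexp k p k > 0" using k1 by (simp add: zexp_def p_def)
    qed (auto simp: zexp_def mon_lattice_def)
    from rep_zmon[where \<alpha> = \<alpha> and \<kappa> = \<kappa>, OF \<alpha> kn mem] show ?thesis by (simp only: pr)
  qed
  have repk: "rep \<alpha> \<rho> (?z k)" using repA[of "\<lambda>_. 0"] by simp
  have repM: "rep \<alpha> \<rho> (\<lambda>w. ?z l w ^ M)" if l: "l \<in> {1..k}" for l
  proof -
    define p where "p m = (if m = l then M else 0)" for m
    have "(\<Prod>m=1..k. ?z m w ^ p m) = (\<Prod>m=1..k. if m = l then ?z m w ^ M else 1)" for w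
      by (rule prod.cong) (auto simp: p_def)
    then have pr: "(\<Prod>m=1..k. ?z m w ^ p m) = ?z l w ^ M" for w using l by simp
    \<comment> \<open>The leading index is \<open>l\<close>, possibly smaller than \<open>k\<close>,
      so membership in L^l is needed; \<open>M\<close> was chosen for this.\<close>
    have mem: "tcomb c k k (\<lambda>m. int (p m)) \<in> semi"
    proof (rule semiI[OF _ tcomb_zexp[OF kn]])
      have ze: "zexp k p m = (if m \<in> {1..k} then M * transition k n l m else 0)" for m
      proof -
        have "(\<Sum>i=1..k. p i * transition k n i m) = (\<Sum>i=1..k. if i = l then M * transition k n i m else 0)"
          by (rule sum.cong) (auto simp: p_def)
        then show ?thesis using l by (simp add: zexp_def)
      qed
      show "zexp k p l > 0" using ze l M transition_tri(2)[OF kn order_refl l] by simp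
      show "zexp k p m = 0" if "m \<in> {Suc l..n}" for m
        using ze transition_tri(1)[OF kn order_refl l, of m] that by auto
      show "l \<in> {1..n}" using l kn by auto
      show "tcomb c k k (\<lambda>m. int (p m)) \<in> mon_lattice c l"
        using MLat[OF kn l] by (simp add: p_def if_distrib cong: if_cong)
    qed
    from rep_zmon[where \<alpha> = \<alpha> and \<kappa> = \<kappa>, OF \<alpha> kn mem] show ?thesis by (simp only: pr)
  qed
  define f where "f l = (if l \<in> {1..k - 1} then (\<lambda>w. ?z l w ^ M) else ?z l)" for l
  have repH: "rep \<alpha> \<rho> (\<lambda>w. H e (tuple k f w))" for e
  proof (rule rep_compose[OF _ openin_pdisc H[rule_format]])
    show "rep \<alpha> \<rho> (f l)" if "l \<in> {1..k}" for l
    proof (cases "l = k")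
      case True
      then show ?thesis using repk k by (auto simp: f_def)
    next
      case False
      then show ?thesis using repM[OF that] that by (auto simp: f_def)
    qed
    show "tuple k f w \<in> pdisc k (\<lambda>_. 0) s1" if w: "w \<in> pdisc n (\<lambda>_. 0) \<rho>" for w
    proof -
      have "cmod (f l w) < s1" if l: "l \<in> {1..k}" for l
      proof -
        have "cmod (?z l w) < s1" "cmod (?z l w) \<le> 1" using zs[OF l w] s1 s by auto
        moreover have "cmod (?z l w) ^ M \<le> cmod (?z l w) ^ 1"
          by (rule power_decreasing) (use M calculation in auto)
        ultimately show ?thesis by (auto simp: f_def norm_power)
      qed
      then show ?thesis by (auto simp: pdisc_0_iff tuple_def Cn_def)
    qed
  qed
  have "rep \<alpha> \<rho> (\<lambda>w. \<Sum>e\<in>residue_exps M (k - 1). (?z k w * (\<Prod>l=1..k - 1. ?z l w ^ e l)) * H e (tuple k f w))"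
    by (intro rep_sum finite_residue_exps rep_mult repA repH)
  then have "rep \<alpha> \<rho> (\<lambda>w. F (tuple k ?z w) - F ((tuple k ?z w)(k := 0)))"
  proof (rule rep_cong[OF _ order_refl])
    fix w assume w: "w \<in> pdisc n (\<lambda>_. 0) \<rho>"
    let ?v = "tuple k ?z w"
    have v1: "?v \<in> pdisc k (\<lambda>_. 0) s1" using zs[OF _ w] by (auto simp: pdisc_0_iff tuple_def Cn_def)
    then have v: "?v \<in> pdisc k (\<lambda>_. 0) s" using pdisc_mono[OF s1(2)] by auto
    have t: "(\<lambda>l. if l \<in> {1..k - 1} then ?v l ^ M else ?v l) = tuple k f w"
      by (rule ext) (auto simp: tuple_def f_def)
    have "F ?v - F (?v(k := 0)) = ?z k w * K ?v" using FK[OF v] k1 by (simp add: tuple_def)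
    also have "K ?v = (\<Sum>e\<in>residue_exps M (k - 1). (\<Prod>l=1..k - 1. ?v l ^ e l) * H e (tuple k f w))"
      using KH v1 t by simp
    also have "\<dots> = (\<Sum>e\<in>residue_exps M (k - 1). (\<Prod>l=1..k - 1. ?z l w ^ e l) * H e (tuple k f w))"
      by (intro sum.cong arg_cong2[of _ _ _ _ "(*)"] prod.cong) (auto simp: tuple_def)
    finally show "(\<Sum>e\<in>residue_exps M (k - 1). (?z k w * (\<Prod>l=1..k - 1. ?z l w ^ e l)) * H e (tuple k f w))
        = F ?v - F (?v(k := 0))"
      by (simp only: sum_distrib_left mult.assoc)
  qed
  then show ?thesis using \<rho> by blast
qed

definition trunc :: "nat \<Rightarrow> (nat \<Rightarrow> complex) \<Rightarrow> nat \<Rightarrow> complex" where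
  "trunc j w m = (if m \<in> {1..j} then w m else 0)"

text \<open>Telescope along the coordinate planes \<open>w\<^sub>k\<^sub>+\<^sub>1 = \<dots> = w\<^sub>n = 0\<close>: each difference vanishes at \<open>w\<^sub>k = 0\<close>, so
  all its monomials lie in \<open>L\<^sup>k\<close> and outside the group generated by \<open>t\<^sub>1\<^sup>n, \<dots>, t\<^sub>k\<^sub>-\<^sub>1\<^sup>n\<close>.\<close>

lemma rep_function:
  assumes \<alpha>: "\<And>m. \<alpha> m \<noteq> 0"
    and F: "\<And>k. k \<le> n \<Longrightarrow> hol_on k (pdisc k (\<lambda>_. 0) (R k)) (F k)" and R: "\<And>k. k \<le> n \<Longrightarrow> R k > 0"
    and S: "\<And>k. k \<le> n \<Longrightarrow> S k > 0"
    and f: "\<And>k w. k \<le> n \<Longrightarrow> w \<in> pdisc k (\<lambda>_. 0) (S k) \<Longrightarrow> f w = F k (tuple k (zmon (\<kappa> k) k) w)"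
  shows "\<exists>\<rho>>0. rep \<alpha> \<rho> f"
proof -
  have "\<exists>\<rho>>0. rep \<alpha> \<rho> (\<lambda>w. f (trunc j w))" if "j \<le> n" for j
    using that
  proof (induction j)
    case 0
    \<comment> \<open>On the 0-plane only the constant value at the origin is left.\<close>
    have "trunc 0 w = (\<lambda>_. 0)" for w by (rule ext) (simp add: trunc_def)
    then show ?case using rep_const by (intro exI[of _ 1]) simp
  next
    case (Suc j)
    define k where "k = Suc j"
    have k: "k \<in> {1..n}" "k \<le> n" using Suc.prems by (auto simp: k_def)
    obtain \<rho>1 where r1: "\<rho>1 > 0" "rep \<alpha> \<rho>1 (\<lambda>w. f (trunc j w))"
      using Suc.IH[OF Suc_leD[OF Suc.prems]] by (elim exE conjE)
    obtain \<rho>2 where r2: "\<rho>2 > 0" "rep \<alpha> \<rho>2 (\<lambda>w. F k (tuple k (zmon (\<kappa> k) k) w) - F k ((tuple k (zmon (\<kappa> k) k) w)(k := 0)))"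
      using rep_step[where \<alpha> = \<alpha> and \<kappa> = "\<kappa> k", OF \<alpha> k(1) F[OF k(2)] R[OF k(2)]] by (elim exE conjE)
    define \<rho> where "\<rho> = min (S k) (min \<rho>1 \<rho>2)"
    have \<rho>: "\<rho> > 0" "\<rho> \<le> \<rho>1" "\<rho> \<le> \<rho>2" "\<rho> \<le> S k" using r1 r2 S[OF k(2)] by (auto simp: \<rho>_def)
    have "rep \<alpha> \<rho> (\<lambda>w. f (trunc j w) + (F k (tuple k (zmon (\<kappa> k) k) w) - F k ((tuple k (zmon (\<kappa> k) k) w)(k := 0))))"
      by (rule rep_add[OF rep_mono[OF r1(2) \<rho>(2)] rep_mono[OF r2(2) \<rho>(3)]])
    then have "rep \<alpha> \<rho> (\<lambda>w. f (trunc k w))"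
    proof (rule rep_cong[OF _ order_refl])
      fix w assume w: "w \<in> pdisc n (\<lambda>_. 0) \<rho>"
      have tr: "trunc i w \<in> pdisc k (\<lambda>_. 0) (S k)" if "i \<le> k" for i
        using w k \<rho> S[OF k(2)] that by (force simp: pdisc_0_iff trunc_def Cn_def)
      have "tuple k (zmon (\<kappa> k) k) (trunc k w) = tuple k (zmon (\<kappa> k) k) w"
        by (auto simp: tuple_def zmon_def trunc_def)
      then have 1: "f (trunc k w) = F k (tuple k (zmon (\<kappa> k) k) w)" using f[OF k(2) tr] by simp
      \<comment> \<open>Dropping w_k makes z_k vanish, as w_k occurs in it, and leaves z_l for l < k
        alone, as w_k does not occur there: the exponents are lower triangular with positive
        diagonal. So the smaller plane corresponds to z_k = 0.\<close>
      have "tuple k (zmon (\<kappa> k) k) (trunc j w) = (tuple k (zmon (\<kappa> k) k) w)(k := 0)"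
      proof
        fix l
        show "tuple k (zmon (\<kappa> k) k) (trunc j w) l = ((tuple k (zmon (\<kappa> k) k) w)(k := 0)) l"
        proof (cases "l = k")
          case True
          have kk: "k \<in> {1..k}" using k by auto
          have "trunc j w k ^ transition k n k k = 0"
            using transition_tri(2)[OF k(2) order_refl kk] by (simp add: trunc_def k_def zero_power)
          then have "(\<Prod>m=1..k. trunc j w m ^ transition k n k m) = 0" using kk by (auto simp: prod_zero_iff)
          then show ?thesis using True by (simp add: tuple_def zmon_def)
        next
          case False
          have "(\<Prod>m=1..k. trunc j w m ^ transition k n l m) = (\<Prod>m=1..k. w m ^ transition k n l m)" if l: "l \<in> {1..k}"
          proof (rule prod.cong[OF refl])
            fix m assume m: "m \<in> {1..k}"
            show "trunc j w m ^ transition k n l m = w m ^ transition k n l m"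
            proof (cases "m = k")
              case True
              then have "m \<in> {Suc l..k}" using l False by auto
              then show ?thesis using transition_tri(1)[OF k(2) order_refl l] by simp
            qed (use m in \<open>auto simp: trunc_def k_def\<close>)
          qed
          then show ?thesis using False by (simp add: tuple_def zmon_def)
        qed
      qed
      then have 2: "f (trunc j w) = F k ((tuple k (zmon (\<kappa> k) k) w)(k := 0))"
        using f[OF k(2) tr, of j] by (simp add: k_def)
      show "f (trunc j w) + (F k (tuple k (zmon (\<kappa> k) k) w) - F k ((tuple k (zmon (\<kappa> k) k) w)(k := 0))) = f (trunc k w)"
        using 1 2 by simp
    qed
    then show ?case using \<rho>(1) by (auto simp: k_def)
  qed
  then obtain \<rho> where \<rho>: "\<rho> > 0" "rep \<alpha> \<rho> (\<lambda>w. f (trunc n w))" by auto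
  have "rep \<alpha> \<rho> f"
  proof (rule rep_cong[OF \<rho>(2) order_refl])
    fix w assume "w \<in> pdisc n (\<lambda>_. 0) \<rho>"
    then have "trunc n w = w" by (intro Cn_eqI[of _ n]) (auto simp: pdisc_0_iff trunc_def Cn_def)
    then show "f (trunc n w) = f w" by simp
  qed
  then show ?thesis using \<rho>(1) by blast
qed

end

section \<open>The factorization\<close>

lemma finite_common_bound:
  fixes f :: "'i \<Rightarrow> real"
  assumes "finite I" "\<And>i. i \<in> I \<Longrightarrow> f i > 0"
  obtains e where "e > 0" "\<And>i. i \<in> I \<Longrightarrow> e \<le> f i"
proof
  show "Min (insert 1 (f ` I)) > 0" using assms by auto
  show "Min (insert 1 (f ` I)) \<le> f i" if "i \<in> I" for i using assms that by (intro Min_le) auto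
qed

lemma continuous_on_eval_at: "continuous_on A (eval_at M s)"
proof (rule continuous_on_coordinatewise_then_product)
  fix i show "continuous_on A (\<lambda>u. eval_at M s u i)"
    unfolding eval_at_def by (cases "i \<in> {1..M}") (auto intro: continuous_on_coord)
qed

context flag_tower
begin

lemma quotients_subset:
  assumes "quotients U g h" "openin (ctop X) U'" "T n b \<in> U'" "U' \<subseteq> U"
  shows "quotients U' g h"
  unfolding quotients_def
proof (intro conjI ballI impI)
  fix i j assume i: "i \<in> {1..n}" and j: "j \<in> {i..n}"
  have "subtopology (ctop X) (V j) interior_of {q \<in> U \<inter> V j. h i q = 0} = {}"
    using assms(1) i j unfolding quotients_def by blast
  moreover have "{q \<in> U' \<inter> V j. h i q = 0} \<subseteq> {q \<in> U \<inter> V j. h i q = 0}" using assms(4) by auto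
  ultimately show "subtopology (ctop X) (V j) interior_of {q \<in> U' \<inter> V j. h i q = 0} = {}"
    using interior_of_mono by blast
qed (use assms in \<open>auto simp: quotients_def\<close>)

lemma ctop_T_flag: "ctop (T_flag c n) = top_of_set (toric_points semi)"
  by (simp add: T_flag_def toric_space_def)

lemma ctop_T_hat: "ctop (T_hat c n) = top_of_set (points (T_hat c n))"
  by (simp add: T_hat_def toric_space_def)

lemma chol_T_flag: "chol (T_flag c n) v f \<longleftrightarrow> (\<exists>M s B G. (\<forall>i\<in>{1..M}. s i \<in> semi) \<and> openin (Cn_top M) B \<and>
    hol_on M B G \<and> eval_at M s v \<in> B \<and> (\<forall>u\<in>toric_points semi. eval_at M s u \<in> B \<longrightarrow> f u = G (eval_at M s u)))"
  by (simp add: T_flag_def toric_space_def)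

lemma eval_at_nu: "\<forall>i\<in>{1..M}. s i \<in> semi \<Longrightarrow> eval_at M s (nu c n u) = eval_at M s u"
  by (rule ext) (auto simp: eval_at_def nu_def)

end

text \<open>All choices near \<open>b\<close>, frozen together. \<open>\<kappa>\<close> holds the
  constants between levels, \<open>\<alpha>\<close> those between the chosen branches and the chart
  of V_n^n, and \<open>\<rho>\<close> is one radius at which everything holds.\<close>

locale toric_chart = flag_tower n X V t Y VV \<pi> \<D> b bb N x d c
  for n :: nat and X :: "'a cspace" and V t Y VV \<pi> \<D> b bb N x d c +
  fixes U :: "'a set" and g h :: "nat \<Rightarrow> 'a \<Rightarrow> complex" and r S :: "nat \<Rightarrow> real"
    and E :: "nat \<Rightarrow> (nat \<Rightarrow> complex) \<Rightarrow> 'a" and y :: "nat \<Rightarrow> 'a \<Rightarrow> nat \<Rightarrow> complex" and Q :: "nat \<Rightarrow> 'a set"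
    and \<gamma> \<kappa> :: "nat \<Rightarrow> nat \<Rightarrow> complex" and \<alpha> :: "nat \<Rightarrow> complex" and \<rho> :: real
    and \<tau> :: "nat \<Rightarrow> 'a \<Rightarrow> complex"
  assumes ad: "\<And>k. k \<le> n \<Longrightarrow> adapted U g h k (r k) (E k) (y k) (Q k) (\<gamma> k)"
    and \<kappa>: "\<And>k l. \<kappa> k l \<noteq> 0"
    and theta_Q: "\<And>k w. k \<le> n \<Longrightarrow> w \<in> pdisc k (\<lambda>_. 0) (S k) \<Longrightarrow> tower_map \<pi> k (n - k) (E n w) \<in> Q k"
    and theta_y: "\<And>k w l. k \<le> n \<Longrightarrow> w \<in> pdisc k (\<lambda>_. 0) (S k) \<Longrightarrow> l \<in> {1..k} \<Longrightarrow>
       y k (tower_map \<pi> k (n - k) (E n w)) l = zmon (\<kappa> k) k l w"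
    and \<alpha>: "\<And>m. \<alpha> m \<noteq> 0" and \<rho>: "0 < \<rho>" "\<rho> \<le> r n" "\<And>k. k \<le> n \<Longrightarrow> \<rho> \<le> S k"
    and branch: "\<And>i w. i \<in> {1..n} \<Longrightarrow> w \<in> pdisc n (\<lambda>_. 0) \<rho> \<Longrightarrow> \<tau> i (E n w) = \<alpha> i * w i"
begin

text \<open>The chart point belonging to \<open>u\<close>, because t_m^n is
  \<open>\<alpha> m\<close> times w_m.\<close>

definition unscale :: "(monomial \<Rightarrow> complex) \<Rightarrow> nat \<Rightarrow> complex" where
  "unscale u m = coords u m / \<alpha> m"

lemma scale_unscale: "u \<in> points (T_hat c n) \<Longrightarrow> toric_pt (\<lambda>m. \<alpha> m * unscale u m) = u"
  using toric_pt_coords[of u] \<alpha> by (simp add: unscale_def)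

lemma unscale_pdisc:
  assumes u: "u \<in> polydisk c n R" and R: "\<And>i. i \<in> {1..n} \<Longrightarrow> R i \<le> \<rho> * cmod (\<alpha> i)"
  shows "unscale u \<in> pdisc n (\<lambda>_. 0) \<rho>"
proof -
  have "cmod (unscale u i) < \<rho>" if i: "i \<in> {1..n}" for i
  proof -
    have "cmod (u (tmon c n i)) < \<rho> * cmod (\<alpha> i)" using u R[OF i] i by (force simp: polydisk_def)
    then show ?thesis using i \<alpha>[of i] by (simp add: unscale_def coords_def norm_divide divide_less_eq)
  qed
  then show ?thesis using coords_Cn[of u] by (auto simp: pdisc_0_iff unscale_def Cn_def)
qed

text \<open>The coordinates \<open>\<tau>\<close> determine \<open>\<psi>\<close>: along the segment from the origin to \<open>u\<close>, the set where \<open>\<psi>\<close> agrees with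
  the chart \<open>E n\<close> is open and closed.\<close>

lemma psi_eq:
  assumes R: "\<And>i. i \<in> {1..n} \<Longrightarrow> R i \<le> \<rho> * cmod (\<alpha> i)"
    and W: "openin (ctop (Y n)) W" "b \<in> W"
    and iso: "isomorphism (csub (T_hat c n) (polydisk c n R)) (csub (Y n) W) \<psi>"
    and \<tau>: "\<forall>u\<in>polydisk c n R. \<forall>i\<in>{1..n}. \<tau> i (\<psi> u) = u (tmon c n i)"
    and u: "u \<in> polydisk c n R"
  shows "\<psi> u = E n (unscale u)"
proof -
  let ?P = "polydisk c n R"
  have Pp: "?P \<subseteq> points (T_hat c n)" by (auto simp: polydisk_def)
  have Wp: "W \<subseteq> points (Y n)" by (rule openin_subset[OF W(1)])
  obtain \<psi>' where \<psi>m: "morphism (csub (T_hat c n) ?P) (csub (Y n) W) \<psi>"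
    and \<psi>'m: "morphism (csub (Y n) W) (csub (T_hat c n) ?P) \<psi>'"
    and "\<And>u. u \<in> ?P \<Longrightarrow> \<psi>' (\<psi> u) = u" and \<psi>\<psi>': "\<And>q. q \<in> W \<Longrightarrow> \<psi> (\<psi>' q) = q"
    using isomorphism_inverse[OF iso] Pp Wp by (auto simp: inf_absorb2)
  note adn = ad[OF order_refl]
  have cd: "coord_disc (K n) n (r n) (E n) (y n) (Q n)" by (rule adapted_coord_disc[OF adn])
  define u0 where "u0 = \<psi>' b"
  have u0: "u0 \<in> ?P" "\<psi> u0 = b" using morphism_in[OF \<psi>'m, of b] W Wp \<psi>\<psi>' by (auto simp: u0_def)
  \<comment> \<open>All branches vanish at \<open>b\<close>, the origin of the chart, so the point
    that \<open>\<psi>\<close> sends to \<open>b\<close> is the origin of \<open>T_hat\<close>. This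
    is where the agreement starts.\<close>
  have "coords u0 = (\<lambda>_. 0)"
  proof
    fix i
    have "E n (\<lambda>_. 0) = b" using adapted_base(2)[OF adn] bb_n by simp
    then have "\<tau> i b = 0" if "i \<in> {1..n}" using branch[OF that, of "\<lambda>_. 0"] \<rho>(1) by simp
    then show "coords u0 i = 0" using \<tau> u0 by (force simp: coords_def)
  qed
  then have pt0: "toric_pt (\<lambda>_. 0) = u0" using toric_pt_coords[of u0] u0 Pp by auto
  define pth where "pth s = toric_pt (\<lambda>m. of_real s * coords u m)" for s :: real
  have cpth: "coords (pth s) = (\<lambda>m. of_real s * coords u m)" for s
    unfolding pth_def by (rule coords_toric_pt) (use coords_Cn[of u] in \<open>auto simp: Cn_def\<close>)
  have pthP: "pth s \<in> ?P" if s: "s \<in> {0..1}" for s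
  proof -
    have "cmod (pth s (tmon c n i)) < R i" if i: "i \<in> {1..n}" for i
    proof -
      have "pth s (tmon c n i) = of_real s * u (tmon c n i)"
        using fun_cong[OF cpth[of s], of i] i by (simp add: coords_def)
      moreover have "cmod (of_real s * u (tmon c n i)) \<le> 1 * cmod (u (tmon c n i))"
        unfolding norm_mult using s by (intro mult_right_mono) auto
      ultimately show ?thesis using u i by (force simp: polydisk_def)
    qed
    then show ?thesis using toric_pt_point by (auto simp: polydisk_def pth_def)
  qed
  let ?I = "top_of_set {0..1::real}"
  have "continuous_on {0..1} pth" unfolding pth_def
    by (rule continuous_toric_pt, rule continuous_on_coordinatewise_then_product) (intro continuous_intros)
  then have "continuous_map ?I (ctop (csub (T_hat c n) ?P)) pth"
    using pthP Pp by (subst ctop_csub, subst ctop_T_hat) (auto simp: subtopology_subtopology inf_absorb2)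
  from continuous_map_compose[OF this morphism_cont[OF morphism_csub_target[OF \<psi>m]]]
  have f1: "continuous_map ?I (ctop (Y n)) (\<psi> \<circ> pth)" .
  define seg where "seg s = (\<lambda>m. complex_of_real s * unscale u m)" for s
  have uns: "unscale u \<in> pdisc n (\<lambda>_. 0) \<rho>" by (rule unscale_pdisc[OF u R])
  have segP: "seg s \<in> pdisc n (\<lambda>_. 0) \<rho>" if s: "s \<in> {0..1}" for s
  proof -
    have "cmod (complex_of_real s * unscale u i) < \<rho>" if i: "i \<in> {1..n}" for i
    proof -
      have "cmod (of_real s * unscale u i) \<le> 1 * cmod (unscale u i)"
        unfolding norm_mult using s by (intro mult_right_mono) auto
      then show ?thesis using uns i by (force simp: pdisc_0_iff)
    qed
    then show ?thesis using uns by (auto simp: pdisc_0_iff seg_def Cn_def)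
  qed
  have segr: "seg s \<in> pdisc n (\<lambda>_. 0) (r n)" if "s \<in> {0..1}" for s using segP[OF that] pdisc_mono[OF \<rho>(2)] by auto
  have "continuous_on {0..1} seg" unfolding seg_def
    by (rule continuous_on_coordinatewise_then_product) (intro continuous_intros)
  then have "continuous_map ?I (ctop (csub (affine_space n) (pdisc n (\<lambda>_. 0) (r n)))) seg"
    using segr by (auto simp: Cn_top_def subtopology_subtopology pdisc_def)
  moreover have Em: "morphism (csub (affine_space n) (pdisc n (\<lambda>_. 0) (r n))) (Y n) (E n)"
    using cd morphism_csub_target unfolding coord_disc_def by blast
  ultimately have f2: "continuous_map ?I (ctop (Y n)) (E n \<circ> seg)"
    by (intro continuous_map_compose[OF _ morphism_cont])
  let ?A = "{s \<in> topspace ?I. (\<psi> \<circ> pth) s = (E n \<circ> seg) s}"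
  let ?O = "E n ` pdisc n (\<lambda>_. 0) \<rho>"
  have "Hausdorff_space (ctop (Y n))" using Y_complex[of n] by (simp add: complex_space_def)
  from closedin_continuous_maps_eq[OF this f1 f2] have cl: "closedin ?I ?A" .
  have "openin (ctop (K n)) ?O" by (rule coord_disc_image_open(1)[OF cd openin_pdisc pdisc_mono[OF \<rho>(2)]])
  then have "openin (ctop (Y n)) ?O" using VV_top[of n] by simp
  from openin_continuous_map_preimage[OF f1 this] have "openin ?I {s \<in> topspace ?I. (\<psi> \<circ> pth) s \<in> ?O}" .
  \<comment> \<open>Once \<open>\<psi> (pth s)\<close> lies in the image of the chart, the branches
    pin down its chart coordinates. So the agreement set is the preimage of an open set.\<close>
  moreover have "{s \<in> topspace ?I. (\<psi> \<circ> pth) s \<in> ?O} = ?A"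
  proof (intro equalityI subsetI)
    fix s assume "s \<in> {s \<in> topspace ?I. (\<psi> \<circ> pth) s \<in> ?O}"
    then obtain w where s: "s \<in> {0..1}" and w: "w \<in> pdisc n (\<lambda>_. 0) \<rho>" "\<psi> (pth s) = E n w" by auto
    have "w = seg s"
    proof (rule Cn_eqI[of _ n])
      fix i assume i: "i \<in> {1..n}"
      have "\<alpha> i * w i = \<tau> i (\<psi> (pth s))" using branch[OF i w(1)] w(2) by simp
      also have "\<dots> = coords (pth s) i" using \<tau> pthP[OF s] i by (simp add: coords_def)
      also have "\<dots> = of_real s * coords u i" by (simp add: cpth)
      finally show "w i = seg s i" using \<alpha>[of i] by (simp add: seg_def unscale_def field_simps)
    qed (use w segP[OF s] in \<open>auto simp: pdisc_def\<close>)
    then show "s \<in> ?A" using s w by simp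
  next
    fix s assume "s \<in> ?A"
    then show "s \<in> {s \<in> topspace ?I. (\<psi> \<circ> pth) s \<in> ?O}" using segP[of s] by auto
  qed
  ultimately have op: "openin ?I ?A" by simp
  have "connected_space ?I" using connected_Icc[of "0::real" 1] by (simp add: connected_space_subtopology connectedin)
  then have "?A = {} \<or> ?A = topspace ?I" using op cl unfolding connected_space_clopen_in by blast
  moreover have "0 \<in> ?A" using pt0 u0(2) adapted_base(2)[OF adn] bb_n by (simp add: pth_def seg_def)
  then have "?A \<noteq> {}" by (metis (no_types, lifting) empty_iff)
  ultimately have "?A = topspace ?I" by (simp only: simp_thms)
  moreover have "1 \<in> topspace ?I" by simp
  ultimately have "1 \<in> ?A" by (simp only:)
  moreover have "pth 1 = u" using toric_pt_coords[of u] u Pp by (auto simp: pth_def)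
  moreover have "seg 1 = unscale u" by (simp add: seg_def)
  ultimately show ?thesis by simp
qed

text \<open>The ambient coordinates of the image are functions of finitely many monomials of the
  semigroup, so they depend on \<open>nu c n u\<close> only. Continuity comes from the inverse
  \<open>ye\<close> of the embedding, and a germ on \<open>X\<close> is pulled back after extending
  it to the ambient space.\<close>

lemma phi_factors:
  assumes P: "P \<subseteq> points (T_hat c n)" "\<And>u. u \<in> P \<Longrightarrow> unscale u \<in> pdisc n (\<lambda>_. 0) \<rho>"
    and xe: "continuous_map (subtopology (ctop X) Ue) (Cn_top mm) xe"
    and ye: "continuous_map (subtopology (Cn_top mm) (xe ` Ue)) (ctop X) ye" "\<And>q. q \<in> Ue \<Longrightarrow> ye (xe q) = q"
    and ext: "\<And>q f. q \<in> Ue \<Longrightarrow> chol X q f \<Longrightarrow>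
       \<exists>B G. openin (Cn_top mm) B \<and> xe q \<in> B \<and> hol_on mm B G \<and> (\<forall>q'\<in>Ue. xe q' \<in> B \<longrightarrow> f q' = G (xe q'))"
    and Ue: "U \<subseteq> Ue" "Ue \<subseteq> points X"
    and rp: "\<And>l. l \<in> {1..mm} \<Longrightarrow> rep \<alpha> \<rho> (\<lambda>w. xe (T n (E n w)) l)"
  shows "\<exists>\<phi>. morphism (csub (T_flag c n) (nu c n ` P)) X \<phi> \<and> (\<forall>u\<in>P. \<phi> (nu c n u) = T n (E n (unscale u)))"
proof -
  let ?p = "\<lambda>w. toric_pt (\<lambda>m. \<alpha> m * w m)"
  have "\<exists>M s B G. (\<forall>i\<in>{1..M}. s i \<in> semi) \<and> openin (Cn_top M) B \<and> (\<forall>l\<in>{1..mm}. hol_on M B (G l)) \<and>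
     (\<forall>w\<in>pdisc n (\<lambda>_. 0) \<rho>. eval_at M s (?p w) \<in> B \<and>
        (\<forall>l\<in>{1..mm}. xe (T n (E n w)) l = G l (eval_at M s (?p w))))"
    by (rule rep_family[OF rp])
  then obtain M s B G where s: "\<forall>i\<in>{1..M}. s i \<in> semi" and B: "openin (Cn_top M) B"
    and G: "\<forall>l\<in>{1..mm}. hol_on M B (G l)"
    and eq: "\<forall>w\<in>pdisc n (\<lambda>_. 0) \<rho>. eval_at M s (?p w) \<in> B \<and>
        (\<forall>l\<in>{1..mm}. xe (T n (E n w)) l = G l (eval_at M s (?p w)))"
    by (elim exE conjE)
  let ?\<nu> = "nu c n"
  let ?P = "?\<nu> ` P"
  define H where "H v = tuple mm G (eval_at M s v)" for v
  define \<phi> where "\<phi> v = ye (H v)" for v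
  have inU: "T n (E n (unscale u)) \<in> Ue" if "u \<in> P" for u
    using adapted_U[OF ad[OF order_refl], of "unscale u"] P(2)[OF that] pdisc_mono[OF \<rho>(2)] Ue(1) by blast
  have xeC: "xe q \<in> Cn mm" if "q \<in> Ue" for q using xe that Ue(2) by (auto simp: continuous_map_def)
  have ev: "eval_at M s (?\<nu> u) \<in> B" and Hx: "H (?\<nu> u) = xe (T n (E n (unscale u)))" if u: "u \<in> P" for u
  proof -
    have e: "eval_at M s (?\<nu> u) = eval_at M s (?p (unscale u))"
      using eval_at_nu[OF s] scale_unscale[of u] u P(1) by auto
    show "eval_at M s (?\<nu> u) \<in> B" using eq P(2)[OF u] e by auto
    show "H (?\<nu> u) = xe (T n (E n (unscale u)))"
      by (rule Cn_eqI[of _ mm]) (use eq P(2)[OF u] e xeC[OF inU[OF u]] in \<open>auto simp: H_def tuple_def[of mm G] Cn_def\<close>)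
  qed
  have \<phi>\<nu>: "\<phi> (?\<nu> u) = T n (E n (unscale u))" if "u \<in> P" for u
    using Hx[OF that] ye(2)[OF inU[OF that]] by (simp add: \<phi>_def)
  have \<nu>t: "?P \<subseteq> toric_points semi" using nu_in_toric P(1) by auto
  have ctP: "ctop (csub (T_flag c n) ?P) = top_of_set ?P"
    using \<nu>t by (simp add: ctop_T_flag subtopology_subtopology inf_absorb2)
  have cH: "continuous_on ?P H"
    unfolding H_def
  proof (rule continuous_on_Cn_map[OF _ tuple_in_Cn])
    fix l assume l: "l \<in> {1..mm}"
    have "continuous_on ?P (\<lambda>v. G l (eval_at M s v))"
      by (rule continuous_on_compose2[OF hol_on_cont continuous_on_eval_at]) (use G l ev in auto)
    then show "continuous_on ?P (\<lambda>v. tuple mm G (eval_at M s v) l)" using l by (simp add: tuple_def)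
  qed
  have HU: "H v \<in> xe ` Ue" if "v \<in> ?P" for v using that Hx inU by auto
  have "morphism (csub (T_flag c n) ?P) X \<phi>"
  proof (rule morphismI)
    have "continuous_map (top_of_set ?P) (subtopology (Cn_top mm) (xe ` Ue)) H"
      using cH HU by (auto simp: continuous_map_in_subtopology Cn_top_def H_def)
    from continuous_map_compose[OF this ye(1)]
    show "continuous_map (ctop (csub (T_flag c n) ?P)) (ctop X) \<phi>" unfolding ctP by (simp add: \<phi>_def[abs_def] o_def)
  next
    fix v f assume v: "v \<in> points (csub (T_flag c n) ?P)" and f: "chol X (\<phi> v) f"
    then have vP: "v \<in> ?P" by simp
    then obtain u where u: "u \<in> P" "v = ?\<nu> u" by auto
    have \<phi>v: "\<phi> v \<in> Ue" "xe (\<phi> v) = H v" using \<phi>\<nu> Hx inU u by auto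
    from ext[OF \<phi>v(1) f] obtain B' F where B': "openin (Cn_top mm) B'" "xe (\<phi> v) \<in> B'" "hol_on mm B' F"
      and fF: "\<forall>q'\<in>Ue. xe q' \<in> B' \<longrightarrow> f q' = F (xe q')" by (elim exE conjE)
    note HT = hol_on_tuple[OF B'(1,3) B G[rule_format]]
    let ?B = "{z \<in> B. tuple mm G z \<in> B'}"
    define f' where "f' v' = F (H v')" for v'
    have evB: "eval_at M s v \<in> ?B" using ev u B'(2) \<phi>v by (auto simp: H_def)
    have "chol (T_flag c n) v f'"
      unfolding chol_T_flag
      by (intro exI[of _ M] exI[of _ s] exI[of _ ?B] exI[of _ "\<lambda>z. F (tuple mm G z)"] conjI ballI impI)
         (use s HT evB in \<open>simp_all add: f'_def H_def\<close>)
    moreover have "openin (ctop (T_flag c n)) {v' \<in> toric_points semi. eval_at M s v' \<in> ?B}"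
    proof -
      have "continuous_map (ctop (T_flag c n)) (Cn_top M) (eval_at M s)"
        unfolding ctop_T_flag Cn_top_def using continuous_on_eval_at by (simp add: continuous_map_in_subtopology image_subset_iff)
      from openin_continuous_map_preimage[OF this HT(1)] show ?thesis by (simp add: ctop_T_flag)
    qed
    moreover have "f (\<phi> v') = f' v'" if v': "v' \<in> {v' \<in> toric_points semi. eval_at M s v' \<in> ?B} \<inter> ?P" for v'
    proof -
      obtain u' where u': "u' \<in> P" "v' = ?\<nu> u'" using v' by blast
      have "\<phi> v' \<in> Ue" "xe (\<phi> v') = H v'" using \<phi>\<nu> Hx inU u' by auto
      then show ?thesis using fF v' by (auto simp: f'_def H_def)
    qed
    moreover have "v \<in> {v' \<in> toric_points semi. eval_at M s v' \<in> ?B}" using evB vP \<nu>t by auto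
    ultimately show "chol (csub (T_flag c n) ?P) v (\<lambda>v. f (\<phi> v))" unfolding chol_csub by blast
  qed
  then show ?thesis using \<phi>\<nu> by blast
qed

text \<open>On a stratum, the inverse of \<open>\<phi>\<close> expresses the monomials of \<open>L\<^sup>k\<close> as Laurent monomials in the coordinates
  of \<open>V\<^sub>k\<^sup>k\<close>, which the resolution identifies with functions on the image.\<close>

lemma stratum_isomorphism:
  assumes R: "\<And>i. i \<in> {1..n} \<Longrightarrow> R i \<le> \<rho> * cmod (\<alpha> i)" and k: "k \<le> n"
    and \<phi>m: "morphism (csub (T_flag c n) (nu c n ` polydisk c n R)) X \<phi>"
    and \<phi>\<nu>: "\<And>u. u \<in> polydisk c n R \<Longrightarrow> \<phi> (nu c n u) = T n (E n (unscale u))"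
  defines "Uk \<equiv> nu c n ` stratum c n R k"
  shows "\<phi> ` Uk \<subseteq> V k" and "isomorphism (csub (T_flag c n) Uk) (csub X (\<phi> ` Uk)) \<phi>"
proof -
  let ?\<theta> = "tower_map \<pi> k (n - k)"
  let ?\<nu> = "nu c n"
  define A where "A = \<phi> ` Uk"
  have Pp: "polydisk c n R \<subseteq> points (T_hat c n)" by (auto simp: polydisk_def)
  have sP: "stratum c n R k \<subseteq> polydisk c n R" by (auto simp: stratum_def)
  have Ukt: "Uk \<subseteq> toric_points semi" using nu_in_toric Pp sP by (auto simp: Uk_def)
  have adk: "adapted U g h k (r k) (E k) (y k) (Q k) (\<gamma> k)" by (rule ad[OF k])
  have cd: "coord_disc (K k) k (r k) (E k) (y k) (Q k)" by (rule adapted_coord_disc[OF adk])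
  have w: "unscale u \<in> pdisc n (\<lambda>_. 0) \<rho>" "unscale u \<in> pdisc k (\<lambda>_. 0) (S k)"
    "\<forall>i\<in>{Suc k..n}. unscale u i = 0" "\<forall>i\<in>{1..k}. unscale u i \<noteq> 0" if u: "u \<in> stratum c n R k" for u
  proof -
    show 1: "unscale u \<in> pdisc n (\<lambda>_. 0) \<rho>" using unscale_pdisc[OF _ R] u sP by blast
    show 2: "\<forall>i\<in>{Suc k..n}. unscale u i = 0" "\<forall>i\<in>{1..k}. unscale u i \<noteq> 0"
      using u k \<alpha> by (auto simp: stratum_def unscale_def coords_def)
    have "unscale u \<in> Cn k"
      unfolding Cn_def
    proof (intro CollectI allI impI)
      fix i assume "i \<notin> {1..k}"
      then show "unscale u i = 0" using 2(1) by (cases "i \<in> {1..n}") (auto simp: unscale_def coords_def)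
    qed
    then show "unscale u \<in> pdisc k (\<lambda>_. 0) (S k)"
      using 1 \<rho>(3)[OF k] k by (force simp: pdisc_0_iff)
  qed
  define pt where "pt u = ?\<theta> (E n (unscale u))" for u
  have ptQ: "pt u \<in> Q k" if "u \<in> stratum c n R k" for u unfolding pt_def by (rule theta_Q[OF k w(2)[OF that]])
  have pty: "y k (pt u) l = zmon (\<kappa> k) k l (unscale u)" if "u \<in> stratum c n R k" "l \<in> {1..k}" for u l
    unfolding pt_def by (rule theta_y[OF k w(2)[OF that(1)] that(2)])
  have ptnz: "y k (pt u) l \<noteq> 0" if "u \<in> stratum c n R k" "l \<in> {1..k}" for u l
    unfolding pty[OF that] zmon_def using w(4)[OF that(1)] \<kappa>[of k l] by (auto simp: prod_zero_iff)
  have Tpt: "T k (pt u) = \<phi> (?\<nu> u)" if "u \<in> stratum c n R k" for u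
    using T_theta[OF k] \<phi>\<nu> that sP by (auto simp: pt_def)
  have QK: "Q k \<subseteq> points (K k)" using cd openin_subset unfolding coord_disc_def by blast
  define D0 where "D0 = points (K k) - \<Union>(\<D> k)"
  \<comment> \<open>No coordinate on V_k^k vanishes at this point, whereas the divisor lies in the
    union of the coordinate hyperplanes. So the resolution is invertible there.\<close>
  have ptD: "pt u \<in> D0" if u: "u \<in> stratum c n R k" for u
  proof -
    have yr: "y k (pt u) \<in> pdisc k (\<lambda>_. 0) (r k)" "E k (y k (pt u)) = pt u"
      using cd ptQ[OF u] by (auto simp: coord_disc_def)
    have "pt u \<notin> \<Union>(\<D> k)" using adapted_D[OF adk yr(1)] yr(2) ptnz[OF u] by auto
    then show ?thesis using ptQ[OF u] QK by (auto simp: D0_def)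
  qed
  have AV: "A \<subseteq> V k"
  proof
    fix q assume "q \<in> A"
    then obtain u where u: "u \<in> stratum c n R k" "q = \<phi> (?\<nu> u)" by (auto simp: A_def Uk_def)
    have "unscale u \<in> pdisc n (\<lambda>_. 0) (r n)" using w(1)[OF u(1)] pdisc_mono[OF \<rho>(2)] by auto
    then have "E n (unscale u) \<in> VV n k" using adapted_VV[OF ad[OF order_refl] _ k] w(3)[OF u(1)] by blast
    then show "q \<in> V k" using T_VV[OF order_refl k] \<phi>\<nu> u sP by auto
  qed
  then show "\<phi> ` Uk \<subseteq> V k" by (simp add: A_def)
  have Ap: "A \<subseteq> points X" using AV V_points[OF k] by auto
  obtain Rk where "isomorphism (csub (K k) D0) (csub (csub X (V k)) Rk) (T k)"
    using resol k unfolding flag_resolution_def D0_def by blast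
  then obtain \<iota> where Tm: "morphism (csub (K k) D0) (csub (csub X (V k)) Rk) (T k)"
    and \<iota>m: "morphism (csub (csub X (V k)) Rk) (csub (K k) D0) \<iota>"
    and \<iota>T: "\<And>p. p \<in> points (csub (K k) D0) \<Longrightarrow> \<iota> (T k p) = p"
    by (rule isomorphism_inverse) (rule that)
  have D0p: "points (csub (K k) D0) = D0" by (auto simp: D0_def)
  have \<iota>pt: "\<iota> (\<phi> (?\<nu> u)) = pt u" if "u \<in> stratum c n R k" for u
    using \<iota>T[unfolded D0p, OF ptD[OF that]] Tpt[OF that] by simp
  have ARk: "A \<subseteq> Rk"
  proof
    fix q assume "q \<in> A"
    then obtain u where u: "u \<in> stratum c n R k" "q = \<phi> (?\<nu> u)" by (auto simp: A_def Uk_def)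
    show "q \<in> Rk" using morphism_in[OF Tm, unfolded D0p, OF ptD[OF u(1)]] Tpt[OF u(1)] u(2) by simp
  qed
  \<comment> \<open>The coordinates of V_k^k transported to the image; they form a morphism because
    the inverse of the resolution is one off the divisor.\<close>
  define \<zeta> where "\<zeta> = y k \<circ> \<iota>"
  have \<zeta>\<phi>: "\<zeta> (\<phi> (?\<nu> u)) = y k (pt u)" if "u \<in> stratum c n R k" for u using \<iota>pt[OF that] by (simp add: \<zeta>_def)
  have \<zeta>m: "morphism (csub X A) (affine_space k) \<zeta>"
  proof -
    have "morphism (csub X A) (csub X (V k)) id"
      by (rule morphism_into_csub[OF germ_closed_csub morphism_csub_source[OF morphism_id]]) (use AV in auto)
    then have i: "morphism (csub X A) (csub (csub X (V k)) A) id"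
      by (rule morphism_into_csub[OF germ_closed_csub]) auto
    have "morphism (csub (csub X (V k)) A) (K k) \<iota>"
      by (rule morphism_csub_target[OF morphism_csub_mono[OF \<iota>m ARk]])
    then have "morphism (csub (csub X (V k)) A) (csub (K k) (Q k)) \<iota>"
      by (rule morphism_into_csub[OF germ_closed_csub]) (use \<iota>pt ptQ in \<open>auto simp: A_def Uk_def\<close>)
    from morphism_compose[OF morphism_compose[OF i this], of "affine_space k" "y k"] cd
    show ?thesis by (simp add: coord_disc_def \<zeta>_def o_assoc)
  qed
  define Z where "Z = {z \<in> Cn k. \<forall>l\<in>{1..k}. z l \<noteq> 0}"
  have Zo: "openin (Cn_top k) Z"
  proof -
    have "openin (Cn_top k) {z \<in> Cn k. (\<Prod>l=1..k. z l ^ 1) \<in> -{0}}"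
      by (rule openin_Cn_vimage[OF openin_Cn_full hol_on_cont[OF hol_on_monomial]]) auto
    moreover have "{z \<in> Cn k. (\<Prod>l=1..k. z l ^ 1) \<in> -{0}} = Z" by (auto simp: Z_def)
    ultimately show ?thesis by simp
  qed
  have \<zeta>Z: "\<zeta> q \<in> Z" if q: "q \<in> A" for q
  proof -
    obtain u where u: "u \<in> stratum c n R k" "q = \<phi> (?\<nu> u)" using q by (auto simp: A_def Uk_def)
    have "\<zeta> q \<in> Cn k" using morphism_in[OF \<zeta>m, of q] q Ap by auto
    then show ?thesis using \<zeta>\<phi>[OF u(1)] u(2) ptnz[OF u(1)] by (simp add: Z_def)
  qed
  \<comment> \<open>The monomials that do not vanish on the stratum: no t_m^n with m > k occurs in
    them.\<close>
  define face where "face s \<longleftrightarrow> (\<forall>m\<in>{Suc k..n}. expo s m = 0)" for s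
  \<comment> \<open>A monomial of the semigroup on the face is 1 or has leading index at most
    \<open>k\<close>, so it lies in L^k. In terms of the t_l^k it may have negative exponents, hence
    the Laurent monomials.\<close>
  have "\<exists>p. s = tcomb c k k p" if s: "s \<in> semi" "face s" for s
  proof (cases "s = (\<lambda>_. 0)")
    case True
    then show ?thesis using tcomb_zero[of k k] by metis
  next
    case False
    obtain k' where k': "k' \<in> {1..n}" "s \<in> mon_lattice c k'" "expo s k' > 0"
      by (rule semiE[OF s(1) False]) (rule that)
    have "k' \<le> k"
    proof (rule ccontr)
      assume "\<not> k' \<le> k"
      then have "k' \<in> {Suc k..n}" using k' by auto
      then have "expo s k' = 0" using s(2) by (simp only: face_def)
      then show False using k'(3) by simp
    qed
    then have "s \<in> mon_lattice c k" using k'(2) mon_lattice_mono[OF _ k] by blast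
    then show ?thesis by (auto simp: mon_lattice_def)
  qed
  then obtain pp where pp: "\<And>s. s \<in> semi \<Longrightarrow> face s \<Longrightarrow> s = tcomb c k k (pp s)" by metis
  \<comment> \<open>Chosen so that t_l^k, evaluated at a point of the stratum, is
    \<open>\<mu> l\<close> times the l-th coordinate on V_k^k.\<close>
  define \<mu> where "\<mu> l = (\<Prod>m=1..k. \<alpha> m ^ transition k n l m) / \<kappa> k l" for l
  have \<mu>: "\<mu> l \<noteq> 0" for l using \<alpha> \<kappa> by (auto simp: \<mu>_def)
  define Lau where "Lau s z = (if face s then \<Prod>l=1..k. (\<mu> l * z l) powi pp s l else 0)" for s and z :: "nat \<Rightarrow> complex"
  have Lauh: "hol_on k Z (Lau s)" for s
  proof (cases "face s")
    case True
    have "hol_on k Z (\<lambda>z. (\<mu> l * z l) powi pp s l)" if "l \<in> {1..k}" for l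
      by (rule hol_on_compose1[OF hol_on_mult[OF hol_on_const hol_on_coord], of "-{0}" "\<lambda>x. x powi pp s l"])
         (use that \<mu> in \<open>auto simp: Z_def intro!: holomorphic_intros\<close>)
    then show ?thesis using True by (auto simp: Lau_def[abs_def] intro: hol_on_prod)
  next
    case False
    then show ?thesis by (simp add: Lau_def[abs_def] hol_on_const)
  qed
  have uLau: "u s = Lau s (y k (pt u))" if u: "u \<in> stratum c n R k" and s: "s \<in> semi" for u s
  proof -
    have up: "u \<in> points (T_hat c n)" using u sP Pp by auto
    have us: "u s = (\<Prod>m=1..n. coords u m ^ expo s m)"
      using fun_cong[OF toric_pt_coords[OF up], of s] s by (simp add: toric_pt_def)
    have cu: "coords u m = \<alpha> m * unscale u m" for m using \<alpha>[of m] by (simp add: unscale_def)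
    show ?thesis
    proof (cases "face s")
      case False
      then obtain m where "m \<in> {Suc k..n}" "expo s m \<noteq> 0" by (auto simp: face_def)
      then have "coords u m ^ expo s m = 0" "m \<in> {1..n}" using w(3)[OF u] cu by auto
      then show ?thesis using False us by (auto simp: Lau_def prod_zero_iff)
    next
      case True
      have ex: "int (expo s m) = (\<Sum>l=1..k. pp s l * int (transition k n l m))" if m: "m \<in> {1..k}" for m
      proof -
        have "tcomb c n n (\<lambda>m. int (expo s m)) = s" using coneE[of s] s by simp
        also have "s = tcomb c k k (pp s)" by (rule pp[OF s True])
        also have "\<dots> = tcomb c n n (\<lambda>m. if m \<in> {1..k} then \<Sum>l=1..k. pp s l * int (transition k n l m) else 0)"
          by (rule tcomb_transition[OF k order_refl])
        finally have "tcomb c n n (\<lambda>m. int (expo s m)) =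
          tcomb c n n (\<lambda>m. if m \<in> {1..k} then \<Sum>l=1..k. pp s l * int (transition k n l m) else 0)" .
        moreover have "m \<in> {1..n}" using m k by auto
        ultimately have "int (expo s m) = (if m \<in> {1..k} then \<Sum>l=1..k. pp s l * int (transition k n l m) else 0)"
          by (rule tcomb_inject)
        then show ?thesis using m by (simp only: if_True)
      qed
      have cnz: "coords u m \<noteq> 0" if "m \<in> {1..k}" for m using cu w(4)[OF u] \<alpha> that by simp
      have "u s = (\<Prod>m=1..k. coords u m ^ expo s m)"
        unfolding us by (rule prod.mono_neutral_right) (use k True in \<open>auto simp: face_def\<close>)
      also have "\<dots> = (\<Prod>m=1..k. coords u m powi (\<Sum>l=1..k. pp s l * int (transition k n l m)))"
        by (rule prod.cong[OF refl]) (metis ex power_int_of_nat)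
      also have "\<dots> = (\<Prod>l=1..k. (1 * (\<Prod>m=1..k. coords u m powi int (transition k n l m))) powi pp s l)"
        by (subst monomial_substitution) (use cnz in auto)
      also have "\<dots> = (\<Prod>l=1..k. (\<mu> l * y k (pt u) l) powi pp s l)"
      proof (rule prod.cong[OF refl])
        fix l assume l: "l \<in> {1..k}"
        have "(\<Prod>m=1..k. coords u m ^ transition k n l m) = \<mu> l * zmon (\<kappa> k) k l (unscale u)"
          using \<kappa>[of k l] by (simp add: \<mu>_def zmon_def cu power_mult_distrib prod.distrib)
        then show "(1 * (\<Prod>m=1..k. coords u m powi int (transition k n l m))) powi pp s l = (\<mu> l * y k (pt u) l) powi pp s l"
          using pty[OF u l] by simp
      qed
      finally show ?thesis using True by (simp add: Lau_def)
    qed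
  qed
  \<comment> \<open>A point of the stratum is rebuilt from the values of all its monomials, which
    are 0 off the face; the value 0 outside the semigroup is the convention of
    \<open>toric_points\<close>.\<close>
  define \<xi> where "\<xi> q s = (if s \<in> semi then Lau s (\<zeta> q) else 0)" for q s
  have \<xi>\<phi>: "\<xi> (\<phi> v) = v" if v: "v \<in> Uk" for v
  proof -
    obtain u where u: "u \<in> stratum c n R k" "v = ?\<nu> u" using v by (auto simp: Uk_def)
    show ?thesis
      by (rule ext) (use u uLau[OF u(1)] \<zeta>\<phi>[OF u(1)] in \<open>simp add: \<xi>_def nu_def\<close>)
  qed
  then have \<xi>A: "\<xi> q \<in> Uk \<and> \<phi> (\<xi> q) = q" if "q \<in> A" for q using that by (auto simp: A_def)
  have ctA: "topspace (ctop (csub X A)) = A" using Ap by auto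
  have ctU: "ctop (csub (T_flag c n) Uk) = top_of_set Uk"
    using Ukt by (simp add: ctop_T_flag subtopology_subtopology inf_absorb2)
  have \<zeta>c: "continuous_map (ctop (csub X A)) (top_of_set Z) \<zeta>"
    using morphism_cont[OF \<zeta>m] \<zeta>Z Ap by (auto simp: Cn_top_def continuous_map_in_subtopology)
  have \<xi>c: "continuous_map (ctop (csub X A)) (top_of_set Uk) \<xi>"
  proof -
    have "continuous_map (ctop (csub X A)) euclidean (\<lambda>q. \<xi> q s)" for s
    proof (cases "s \<in> semi")
      case True
      have "continuous_map (top_of_set Z) euclidean (Lau s)" using hol_on_cont[OF Lauh] by simp
      from continuous_map_compose[OF \<zeta>c this] show ?thesis using True by (simp add: \<xi>_def o_def)
    next
      case False
      then have "\<xi> q s = 0" for q by (simp only: \<xi>_def if_False)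
      then show ?thesis by simp
    qed
    then have "continuous_map (ctop (csub X A)) (product_topology (\<lambda>_. euclidean) UNIV) \<xi>"
      by (simp add: continuous_map_componentwise_UNIV)
    then show ?thesis using \<xi>A ctA by (auto simp: euclidean_product_topology continuous_map_in_subtopology)
  qed
  have \<xi>m: "morphism (csub X A) (csub (T_flag c n) Uk) \<xi>"
  proof (rule morphismI)
    show "continuous_map (ctop (csub X A)) (ctop (csub (T_flag c n) Uk)) \<xi>" unfolding ctU by (rule \<xi>c)
    fix q f assume "q \<in> points (csub X A)" and f: "chol (csub (T_flag c n) Uk) (\<xi> q) f"
    then have q: "q \<in> A" by simp
    obtain O1 f1 where O1: "openin (ctop (T_flag c n)) O1" "\<xi> q \<in> O1" "chol (T_flag c n) (\<xi> q) f1"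
      and ff1: "\<forall>v\<in>O1 \<inter> Uk. f v = f1 v" using f unfolding chol_csub by (elim exE conjE)
    obtain M s B G where s: "\<forall>i\<in>{1..M}. s i \<in> semi" and B: "openin (Cn_top M) B" "hol_on M B G"
      and qB: "eval_at M s (\<xi> q) \<in> B"
      and f1G: "\<forall>u\<in>toric_points semi. eval_at M s u \<in> B \<longrightarrow> f1 u = G (eval_at M s u)"
      using O1(3) unfolding chol_T_flag by (elim exE conjE)
    \<comment> \<open>A germ on the toric variety depends on finitely many monomials, so its
      pullback is a holomorphic function of \<open>\<zeta>\<close>.\<close>
    define F where "F i = Lau (s i)" for i
    note HT = hol_on_tuple[OF B Zo, of F, unfolded F_def, OF Lauh]
    let ?Z = "{z \<in> Z. tuple M (\<lambda>i. Lau (s i)) z \<in> B}"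
    have ev: "eval_at M s (\<xi> q') = tuple M (\<lambda>i. Lau (s i)) (\<zeta> q')" for q'
      by (rule ext) (use s in \<open>auto simp: eval_at_def tuple_def \<xi>_def\<close>)
    have \<zeta>q: "\<zeta> q \<in> ?Z" using qB \<zeta>Z[OF q] by (simp add: ev)
    have "chol (affine_space k) (\<zeta> q) (\<lambda>z. G (tuple M (\<lambda>i. Lau (s i)) z))"
      unfolding chol_affine using HT \<zeta>q by blast
    from morphism_chol[OF \<zeta>m, OF _ this] q ctA
    have c1: "chol (csub X A) q (\<lambda>q. G (tuple M (\<lambda>i. Lau (s i)) (\<zeta> q)))" by auto
    let ?O = "{q' \<in> topspace (ctop (csub X A)). \<xi> q' \<in> O1 \<inter> Uk} \<inter> {q' \<in> topspace (ctop (csub X A)). \<zeta> q' \<in> ?Z}"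
    have "openin (top_of_set Uk) (O1 \<inter> Uk)"
      using O1(1) unfolding ctU[symmetric] ctop_csub by (auto simp: openin_subtopology)
    from openin_continuous_map_preimage[OF \<xi>c this]
      openin_continuous_map_preimage[OF morphism_cont[OF \<zeta>m], of ?Z] HT(1)
    have op: "openin (ctop (csub X A)) ?O" by (intro openin_Int) auto
    show "chol (csub X A) q (\<lambda>q. f (\<xi> q))"
    proof (rule germ_closedD[OF germ_closed_csub c1 op])
      show "q \<in> ?O" using q ctA \<xi>A O1(2) \<zeta>q by auto
      fix q' assume q': "q' \<in> ?O"
      have "f (\<xi> q') = f1 (\<xi> q')" using ff1 q' by blast
      also have "\<dots> = G (eval_at M s (\<xi> q'))" using f1G q' Ukt by (auto simp: ev)
      finally show "G (tuple M (\<lambda>i. Lau (s i)) (\<zeta> q')) = f (\<xi> q')" by (simp add: ev)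
    qed
  qed
  have "Uk \<subseteq> ?\<nu> ` polydisk c n R" using sP by (auto simp: Uk_def)
  then have "morphism (csub (T_flag c n) Uk) (csub X A) \<phi>"
    by (intro morphism_into_csub[OF germ_closed_csub morphism_csub_mono[OF \<phi>m]]) (auto simp: A_def)
  then have "isomorphism (csub (T_flag c n) Uk) (csub X A) \<phi>"
    unfolding isomorphism_def using \<xi>m \<xi>\<phi> \<xi>A by (intro conjI exI[of _ \<xi>]) auto
  then show "isomorphism (csub (T_flag c n) Uk) (csub X (\<phi> ` Uk)) \<phi>" by (simp add: A_def)
qed

end

context flag_tower
begin

lemma factorization:
  assumes N0: "openin (ctop (Y n)) N0" "b \<in> N0"
    and br: "\<forall>i\<in>{1..n}. monomial_branch (Y n) N0 n (\<lambda>j. t j \<circ> T n) (tmon c n i) (\<tau> i)"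
  shows "\<exists>\<delta>>0. \<forall>R W \<psi>.
           (\<forall>i\<in>{1..n}. 0 < R i \<and> R i < \<delta>) \<longrightarrow>
           openin (ctop (Y n)) W \<longrightarrow> b \<in> W \<longrightarrow> W \<subseteq> N0 \<longrightarrow>
           isomorphism (csub (T_hat c n) (polydisk c n R)) (csub (Y n) W) \<psi> \<longrightarrow>
           (\<forall>u\<in>polydisk c n R. \<forall>i\<in>{1..n}. \<tau> i (\<psi> u) = u (tmon c n i)) \<longrightarrow>
           (\<exists>\<phi>. morphism (csub (T_flag c n) (nu c n ` polydisk c n R)) X \<phi> \<and>
              (\<forall>u\<in>polydisk c n R. T n (\<psi> u) = \<phi> (nu c n u)) \<and>
              (\<forall>k\<le>n. let Uk = nu c n ` stratum c n R k in
                 \<phi> ` Uk \<subseteq> V k \<and> isomorphism (csub (T_flag c n) Uk) (csub X (\<phi> ` Uk)) \<phi>))"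
proof -
  have a: "T n b \<in> points X"
    using morphism_in[OF T_morphism[of n]] VV_points[of n 0] b by auto
  obtain Ue mm xe ye where Ue: "openin (ctop X) Ue" "T n b \<in> Ue"
    and xe: "continuous_map (subtopology (ctop X) Ue) (Cn_top mm) xe"
    and ye: "continuous_map (subtopology (Cn_top mm) (xe ` Ue)) (ctop X) ye" "\<And>q. q \<in> Ue \<Longrightarrow> ye (xe q) = q"
    and bwd: "\<And>q G B. q \<in> Ue \<Longrightarrow> openin (Cn_top mm) B \<Longrightarrow> xe q \<in> B \<Longrightarrow> hol_on mm B G \<Longrightarrow> chol X q (\<lambda>q. G (xe q))"
    and ext: "\<And>q f. q \<in> Ue \<Longrightarrow> chol X q f \<Longrightarrow>
       \<exists>B G. openin (Cn_top mm) B \<and> xe q \<in> B \<and> hol_on mm B G \<and> (\<forall>q'\<in>Ue. xe q' \<in> B \<longrightarrow> f q' = G (xe q'))"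
    by (rule complex_space_embedding[OF X_complex a]) (rule that, assumption+)
  have UeX: "Ue \<subseteq> points X" by (rule openin_subset[OF Ue(1)])
  have xeC: "xe q \<in> Cn mm" if "q \<in> Ue" for q using xe that UeX by (auto simp: continuous_map_def)
  have xeh: "chol X q (\<lambda>q. xe q l)" if "q \<in> Ue" for q l
    using bwd[OF that openin_Cn_full xeC[OF that] hol_on_coord] .
  obtain U0 g h where qt0: "quotients U0 g h" using ex_quotients by blast
  \<comment> \<open>Shrunk so that the images of all charts lie in the domain of the embedding,
    where its coordinates are holomorphic.\<close>
  define U where "U = U0 \<inter> Ue"
  have qt: "quotients U g h"
    by (rule quotients_subset[OF qt0]) (use qt0 Ue in \<open>auto simp: U_def quotients_def\<close>)
  have "\<exists>r E y Q \<gamma>. k \<le> n \<longrightarrow> adapted U g h k r E y Q \<gamma>" for k using ex_adapted[OF qt] by blast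
  then obtain r E y Q \<gamma> where ad: "\<And>k. k \<le> n \<Longrightarrow> adapted U g h k (r k) (E k) (y k) (Q k) (\<gamma> k)" by metis
  note adn = ad[OF order_refl]
  have r: "r k > 0" if "k \<le> n" for k using adapted_coord_disc[OF ad[OF that]] by (simp add: coord_disc_def)
  define tr where "tr k S \<kappa> \<longleftrightarrow> 0 < S \<and> (\<forall>l. \<kappa> l \<noteq> 0) \<and> (\<forall>w\<in>pdisc k (\<lambda>_. 0) S.
      tower_map \<pi> k (n - k) (E n w) \<in> Q k \<and>
      (\<forall>l\<in>{1..k}. y k (tower_map \<pi> k (n - k) (E n w)) l = zmon \<kappa> k l w))" for k and S :: real and \<kappa>
  \<comment> \<open>The nonvanishing of \<open>\<kappa>\<close> stays outside the implication, so
    that after the choice it holds for every k, as the locale demands.\<close>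
  have ex_tr: "\<exists>S \<kappa>. (\<forall>l. \<kappa> l \<noteq> 0) \<and> (k \<le> n \<longrightarrow> tr k S \<kappa>)" for k
  proof (cases "k \<le> n")
    case True
    obtain S \<kappa> where "0 < S" "S \<le> r n" "\<And>l. \<kappa> l \<noteq> 0"
      "\<And>w. w \<in> pdisc k (\<lambda>_. 0) S \<Longrightarrow> tower_map \<pi> k (n - k) (E n w) \<in> Q k"
      "\<And>w l. w \<in> pdisc k (\<lambda>_. 0) S \<Longrightarrow> l \<in> {1..k} \<Longrightarrow>
         y k (tower_map \<pi> k (n - k) (E n w)) l = \<kappa> l * (\<Prod>m=1..k. w m ^ transition k n l m)"
      by (rule adapted_transition'[OF qt adn ad[OF True] True order_refl]) (rule that, assumption+)
    then show ?thesis by (intro exI[of _ S] exI[of _ \<kappa>]) (simp add: tr_def zmon_def)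
  next
    case False
    then show ?thesis by (intro exI[of _ 1] exI[of _ "\<lambda>_. 1"]) simp
  qed
  then obtain S \<kappa> where \<kappa>: "\<And>k l. \<kappa> k l \<noteq> 0" and trk: "\<And>k. k \<le> n \<Longrightarrow> tr k (S k) (\<kappa> k)" by metis
  have S: "S k > 0" if "k \<le> n" for k using trk[OF that] by (simp add: tr_def)
  define lin where "lin i s a \<longleftrightarrow> 0 < s \<and> (\<forall>w\<in>pdisc n (\<lambda>_. 0) s. \<tau> i (E n w) = a * w i)" for i s a
  have "\<exists>s a. a \<noteq> 0 \<and> (i \<in> {1..n} \<longrightarrow> lin i s a)" for i
  proof (cases "i \<in> {1..n}")
    case True
    obtain s a where "0 < s" "s \<le> r n" "a \<noteq> 0"
      "\<And>w. w \<in> pdisc n (\<lambda>_. 0) s \<Longrightarrow> E n w \<in> N0 \<and> \<tau> i (E n w) = a * w i"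
      by (rule branch_linear[OF qt adn N0 True br[rule_format, OF True]]) (rule that, assumption+)
    then show ?thesis by (intro exI[of _ s] exI[of _ a]) (simp add: lin_def)
  next
    case False
    then show ?thesis by (intro exI[of _ 1] exI[of _ 1]) auto
  qed
  then obtain s \<alpha> where \<alpha>: "\<And>i. \<alpha> i \<noteq> 0" and lin: "\<And>i. i \<in> {1..n} \<Longrightarrow> lin i (s i) (\<alpha> i)" by metis
  \<comment> \<open>The function on V_k^k is an ambient coordinate composed with the map to
    \<open>X\<close>. Passing through V_k^k or going directly from V_n^n leads to the same point,
    which is the compatibility that \<open>rep_function\<close> asks for.\<close>
  have "\<exists>\<rho>>0. rep \<alpha> \<rho> (\<lambda>w. xe (T n (E n w)) l)" for l
  proof (rule rep_function[where F = "\<lambda>k v. xe (T k (E k v)) l" and R = r and S = S and \<kappa> = \<kappa>])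
    show "\<alpha> m \<noteq> 0" for m by (rule \<alpha>)
    fix k assume k: "k \<le> n"
    show "hol_on k (pdisc k (\<lambda>_. 0) (r k)) (\<lambda>v. xe (T k (E k v)) l)"
      by (rule adapted_hol[OF ad[OF k] k]) (use xeh in \<open>auto simp: U_def\<close>)
    show "r k > 0" "S k > 0" by (rule r[OF k], rule S[OF k])
    fix w assume w: "w \<in> pdisc k (\<lambda>_. 0) (S k)"
    let ?p = "tower_map \<pi> k (n - k) (E n w)"
    have p: "?p \<in> Q k" "\<And>l. l \<in> {1..k} \<Longrightarrow> y k ?p l = zmon (\<kappa> k) k l w" using trk[OF k] w by (auto simp: tr_def)
    have yp: "y k ?p \<in> pdisc k (\<lambda>_. 0) (r k)" "E k (y k ?p) = ?p"
      using adapted_coord_disc[OF ad[OF k]] p(1) by (auto simp: coord_disc_def)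
    have "y k ?p = tuple k (zmon (\<kappa> k) k) w"
      by (rule Cn_eqI[of _ k]) (use yp(1) p(2) in \<open>auto simp: pdisc_def tuple_def Cn_def\<close>)
    then have "T k (E k (tuple k (zmon (\<kappa> k) k) w)) = T n (E n w)" using yp(2) T_theta[OF k] by simp
    then show "xe (T n (E n w)) l = xe (T k (E k (tuple k (zmon (\<kappa> k) k) w))) l" by simp
  qed
  then obtain p where p: "\<And>l. p l > 0" "\<And>l. rep \<alpha> (p l) (\<lambda>w. xe (T n (E n w)) l)" by metis
  obtain e1 where e1: "e1 > 0" "\<And>k. k \<in> {0..n} \<Longrightarrow> e1 \<le> S k"
    by (rule finite_common_bound[of "{0..n}" S]) (use S in \<open>auto intro: that\<close>)
  obtain e2 where e2: "e2 > 0" "\<And>i. i \<in> {1..n} \<Longrightarrow> e2 \<le> s i"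
    by (rule finite_common_bound[of "{1..n}" s]) (use lin in \<open>auto simp: lin_def intro: that\<close>)
  obtain e3 where e3: "e3 > 0" "\<And>l. l \<in> {1..mm} \<Longrightarrow> e3 \<le> p l"
    by (rule finite_common_bound[of "{1..mm}" p]) (use p(1) in \<open>auto intro: that\<close>)
  obtain e4 where e4: "e4 > 0" "\<And>i. i \<in> {1..n} \<Longrightarrow> e4 \<le> cmod (\<alpha> i)"
    by (rule finite_common_bound[of "{1..n}" "\<lambda>i. cmod (\<alpha> i)"]) (use \<alpha> in \<open>auto intro: that\<close>)
  define \<rho> where "\<rho> = min (min (r n) e1) (min e2 e3)"
  have rho: "0 < \<rho>" "\<rho> \<le> r n" "\<rho> \<le> e1" "\<rho> \<le> e2" "\<rho> \<le> e3"
    using r[of n] e1(1) e2(1) e3(1) by (auto simp: \<rho>_def)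
  interpret toric_chart n X V t Y VV \<pi> \<D> b bb N x d c U g h r S E y Q \<gamma> \<kappa> \<alpha> \<rho> \<tau>
  proof (unfold_locales, goal_cases)
    case (1 k) then show ?case by (rule ad)
  next
    case (2 k l) then show ?case by (rule \<kappa>)
  next
    case (3 k w) then show ?case using trk[of k] by (simp add: tr_def)
  next
    case (4 k w l) then show ?case using trk[of k] by (simp add: tr_def)
  next
    case (5 m) then show ?case by (rule \<alpha>)
  next
    case 6 then show ?case by (rule rho(1))
  next
    case 7 then show ?case by (rule rho(2))
  next
    case (8 k) then show ?case using e1(2)[of k] rho(3) by auto
  next
    case (9 i w)
    then have "w \<in> pdisc n (\<lambda>_. 0) (s i)" using e2(2)[of i] rho(4) pdisc_mono[of \<rho> "s i"] by auto
    then show ?case using lin[OF 9(1)] by (simp add: lin_def)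
  qed
  have rp: "rep \<alpha> \<rho> (\<lambda>w. xe (T n (E n w)) l)" if "l \<in> {1..mm}" for l
    by (rule rep_mono[OF p(2)]) (use e3(2)[OF that] rho(5) in simp)
  \<comment> \<open>Radii of the polydisk are measured in t_i^n, which is \<open>\<alpha> i\<close>
    times w_i; the lower bound \<open>e4\<close> of the moduli of the \<open>\<alpha> i\<close>
    converts them to radii in w.\<close>
  show ?thesis
  proof (intro exI[of _ "\<rho> * e4"] conjI allI impI)
    show "\<rho> * e4 > 0" using rho(1) e4(1) by simp
    fix R W \<psi>
    assume Rd: "\<forall>i\<in>{1..n}. 0 < R i \<and> R i < \<rho> * e4" and W: "openin (ctop (Y n)) W" "b \<in> W"
      and iso: "isomorphism (csub (T_hat c n) (polydisk c n R)) (csub (Y n) W) \<psi>"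
      and \<tau>: "\<forall>u\<in>polydisk c n R. \<forall>i\<in>{1..n}. \<tau> i (\<psi> u) = u (tmon c n i)"
    have R: "R i \<le> \<rho> * cmod (\<alpha> i)" if "i \<in> {1..n}" for i
    proof -
      have "R i \<le> \<rho> * e4" using Rd that by (simp add: less_imp_le)
      also have "\<dots> \<le> \<rho> * cmod (\<alpha> i)" using e4(2)[OF that] rho(1) by simp
      finally show ?thesis .
    qed
    have \<psi>: "\<psi> u = E n (unscale u)" if "u \<in> polydisk c n R" for u
      by (rule psi_eq[OF R W iso \<tau> that])
    have Pp: "polydisk c n R \<subseteq> points (T_hat c n)" by (auto simp: polydisk_def)
    have "\<exists>\<phi>. morphism (csub (T_flag c n) (nu c n ` polydisk c n R)) X \<phi> \<and>
        (\<forall>u\<in>polydisk c n R. \<phi> (nu c n u) = T n (E n (unscale u)))"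
      by (rule phi_factors[OF Pp unscale_pdisc[OF _ R] xe ye ext _ UeX rp]) (auto simp: U_def)
    then obtain \<phi> where \<phi>m: "morphism (csub (T_flag c n) (nu c n ` polydisk c n R)) X \<phi>"
      and \<phi>\<nu>: "\<And>u. u \<in> polydisk c n R \<Longrightarrow> \<phi> (nu c n u) = T n (E n (unscale u))" by blast
    show "\<exists>\<phi>. morphism (csub (T_flag c n) (nu c n ` polydisk c n R)) X \<phi> \<and>
        (\<forall>u\<in>polydisk c n R. T n (\<psi> u) = \<phi> (nu c n u)) \<and>
        (\<forall>k\<le>n. let Uk = nu c n ` stratum c n R k in
           \<phi> ` Uk \<subseteq> V k \<and> isomorphism (csub (T_flag c n) Uk) (csub X (\<phi> ` Uk)) \<phi>)"
      unfolding Let_def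
    proof (intro exI[of _ \<phi>] conjI allI impI ballI)
      show "T n (\<psi> u) = \<phi> (nu c n u)" if "u \<in> polydisk c n R" for u using \<psi>[OF that] \<phi>\<nu>[OF that] by simp
      fix k assume k: "k \<le> n"
      show "\<phi> ` nu c n ` stratum c n R k \<subseteq> V k"
        by (rule stratum_isomorphism(1)[OF R k \<phi>m \<phi>\<nu>])
      show "isomorphism (csub (T_flag c n) (nu c n ` stratum c n R k)) (csub X (\<phi> ` nu c n ` stratum c n R k)) \<phi>"
        by (rule stratum_isomorphism(2)[OF R k \<phi>m \<phi>\<nu>])
    qed (rule \<phi>m)
  qed
qed

end

theorem theorem2p4p2:
  fixes n :: nat
    and X :: "'a cspace" and V :: "nat \<Rightarrow> 'a set"
    and Vt :: "nat \<Rightarrow> 'b cspace" and \<rho> :: "nat \<Rightarrow> 'b \<Rightarrow> 'a"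
    and t :: "nat \<Rightarrow> 'a \<Rightarrow> complex"
    and Y :: "nat \<Rightarrow> 'a cspace" and VV :: "nat \<Rightarrow> nat \<Rightarrow> 'a set" and \<pi> :: "nat \<Rightarrow> 'a \<Rightarrow> 'a"
    and \<D> :: "nat \<Rightarrow> 'a set set"
    and b :: 'a and bb :: "nat \<Rightarrow> 'a"
    and N :: "nat \<Rightarrow> 'a set" and x :: "nat \<Rightarrow> 'a \<Rightarrow> nat \<Rightarrow> complex"
    and d :: "nat \<Rightarrow> nat \<Rightarrow> nat \<Rightarrow> int" and c :: "nat \<Rightarrow> nat \<Rightarrow> nat \<Rightarrow> rat"
    and N0 :: "'a set" and \<tau> :: "nat \<Rightarrow> 'a \<Rightarrow> complex"
  \<comment> \<open>the flag, the normalizations and the functions \<open>t k\<close>\<close>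
  assumes "variety_flag X n V"
    and "\<forall>k\<in>{1..n}. normalization (Vt k) (csub X (V k)) (\<rho> k)"
    and "\<forall>k\<in>{1..n}. meromorphic_along X (V ` {k..n}) (t k)"
    and "\<forall>k\<in>{1..n}.
           let H = generic_preimage (Vt k) (csub X (V k)) (\<rho> k) (V (k - 1))
           in generically (csub (Vt k) H) (order_along (Vt k) k H 1 (t k \<circ> \<rho> k))"
  \<comment> \<open>the tower of resolutions\<close>
    and "Y 0 = X" and "\<forall>j\<le>n. VV 0 j = V j"
    and "\<forall>k\<le>n. variety_flag (Y k) n (VV k)"
    and "\<forall>k\<in>{1..n}. branched_covering n (Y k) (Y (k - 1)) (\<pi> k) \<and>
           degree_one (Y k) (Y (k - 1)) (\<pi> k) \<and> (\<forall>j\<le>n. \<pi> k ` VV k j \<subseteq> VV (k - 1) j)"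
    and "\<forall>k\<le>n. flag_resolution (csub X (V k)) k V (t ` {1..k})
           (csub (Y k) (VV k k)) (tower_map \<pi> 0 k) (\<D> k)"
    and "\<forall>k\<le>n. resolution_flag (csub X (V k)) k V
           (csub (Y k) (VV k k)) (tower_map \<pi> 0 k) (VV k)"
  \<comment> \<open>the point, good coordinates and the matrices of exponents\<close>
    and "b \<in> VV n 0" and "\<forall>k\<le>n. bb k = tower_map \<pi> k (n - k) b"
    and "\<forall>k\<le>n. good_coordinates (csub (Y k) (VV k k)) k (VV k) (\<D> k) (bb k) (N k) (x k)"
    and "\<forall>k\<le>n. \<forall>i\<in>{1..k}. almost_monomial (csub (Y k) (VV k k)) (N k) (x k) k (d k i)
           (t i \<circ> tower_map \<pi> 0 k)"
    and "\<forall>k\<in>{1..n}. d k k k = 1 \<and>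
           (\<forall>i\<in>{1..k}. d k i i \<noteq> 0 \<and> (\<forall>j\<in>{Suc i..k}. d k i j = 0))"
    and "\<forall>k\<in>{1..n}. mutually_inverse k (c k) (d k)"
  \<comment> \<open>branches of \<open>t_1^n, \<dots>, t_n^n\<close> near the point\<close>
    and "openin (ctop (Y n)) N0" and "b \<in> N0"
    and "\<forall>i\<in>{1..n}. monomial_branch (Y n) N0 n (\<lambda>j. t j \<circ> tower_map \<pi> 0 n) (tmon c n i) (\<tau> i)"
  shows "\<exists>\<delta>>0. \<forall>r W \<psi>.
           (\<forall>i\<in>{1..n}. 0 < r i \<and> r i < \<delta>) \<longrightarrow>
           openin (ctop (Y n)) W \<longrightarrow> b \<in> W \<longrightarrow> W \<subseteq> N0 \<longrightarrow>
           isomorphism (csub (T_hat c n) (polydisk c n r)) (csub (Y n) W) \<psi> \<longrightarrow>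
           (\<forall>u\<in>polydisk c n r. \<forall>i\<in>{1..n}. \<tau> i (\<psi> u) = u (tmon c n i)) \<longrightarrow>
           (\<exists>\<phi>. morphism (csub (T_flag c n) (nu c n ` polydisk c n r)) X \<phi> \<and>
              (\<forall>u\<in>polydisk c n r. tower_map \<pi> 0 n (\<psi> u) = \<phi> (nu c n u)) \<and>
              (\<forall>k\<le>n. let Uk = nu c n ` stratum c n r k in
                 \<phi> ` Uk \<subseteq> V k \<and> isomorphism (csub (T_flag c n) Uk) (csub X (\<phi> ` Uk)) \<phi>))"
proof -
  interpret flag_tower n X V t Y VV \<pi> \<D> b bb N x d c
    by (rule flag_tower.intro[OF assms(1,3,5-16)])
  show ?thesis by (rule factorization[OF assms(17-19)])
qed

end
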